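(* Let $m\ge3$ and $k\ge1$ be integers, let $V=\mathbb{R}^k$, let $A:V\to V$ be a non-singular linear map, and let $f:\mathbb{R}\times V\to V$ be a continuous function such that for all $t\in\mathbb{R}$, $x\in V$: $f(t+2\pi,x)=f(t,x)$, $f(-t,x)=f(t,x)$, $f(t,-x)=-f(t,x)$, and $\lim_{x\to0}\frac{f(t,x)}{|x|}=0$ uniformly with respect to $t$. Consider the problem $$\ddot u(t)=\big(-\alpha\,\mathrm{Id}+A\big)u(t)+f(t,u(t)),\qquad u(t)=u(t+2\pi m),\quad \dot u(t)=\dot u(t+2\pi m),$$ with parameter $\alpha\in\mathbb{R}$, and let $\Lambda=\{\alpha_{j,\mu}:=\frac{j^2+m^2\mu}{m^2}: j=0,1,2,\dots,\ \mu\in\sigma(A)\}$ be its set of critical points. Assume that $\alpha_{j,\mu}\ne\alpha_{j',\mu'}$ whenever $\alpha_{j,\mu},\alpha_{j',\mu'}\in\Lambda$ and $(j,\mu)\neq(j',\mu')$. Then for every $\alpha_{j_o,\mu_o}\in\Lambda$ such that the algebraic multiplicity $m(\mu_o)$ of the eigenvalue $\mu_o$ of $A$ is odd, we have $\omega_G(\alpha_{j_o,\mu_o})\neq0$, where $G=D_m\times\mathbb{Z}_2$, and $(\alpha_{j_o,\mu_o},0)$ is a bifurcation point of non-trivial $2\pi m$-periodic solutions of the problem.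
   Context: $\sigma(A)$ is the set of real eigenvalues of $A$. $\mathbb{E}=C^2_{2\pi m}(\mathbb{R},V)$ is the Banach space of $2\pi m$-periodic $C^2$ functions with norm $\max\{\|u\|_\infty,\|\dot u\|_\infty,\|\ddot u\|_\infty\}$, $\mathbb{F}=C_{2\pi m}(\mathbb{R},V)$ with the sup-norm, $\mathfrak{j}:\mathbb{E}\to\mathbb{F}$ is the (compact) inclusion, and $L:\mathbb{E}\to\mathbb{F}$, $Lu=\ddot u-u$, is an isomorphism. For $\alpha\in\mathbb{R}$ let $$\mathscr{A}(\alpha)=\mathrm{Id}-L^{-1}\big(A\circ\mathfrak{j}-(\alpha+1)\mathfrak{j}\big):\mathbb{E}\to\mathbb{E},$$ the linearization at $u=0$ of the operator form of the problem. A real number $\alpha$ is a critical point if $\mathscr{A}(\alpha)$ is not an isomorphism; the set of critical points is $\Lambda$, which is discrete. $D_m$ is the dihedral group of order $2m$ generated by $\gamma$ (rotation of order $m$) and $\kappa$ (reflection). $G=D_m\times\mathbb{Z}_2$ acts on $\mathbb{E}$ by $((\gamma^j,\pm1)u)(t)=\pm u(t+2\pi j)$, $((\kappa,\pm1)u)(t)=\pm u(-t)$; $\mathscr{A}(\alpha)$ is $G$-equivariant. $A(G)$ denotes the Burnside ring of $G$: as a group it is the free abelian group on the set of conjugacy classes $(H)$ of subgroups $H\le G$. For a $G$-equivariant linear isomorphism $T=\mathrm{Id}-K:\mathbb{E}\to\mathbb{E}$ with $K$ compact, and $B(\mathbb{E})$ the open unit ball, $G\text{-}\deg(T,B(\mathbb{E}))=\sum_{(H)}n_H(H)\in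 A(G)$ is defined recursively by $$n_H=\frac{\deg\big(T|_{\mathbb{E}^H},B(\mathbb{E})^H\big)-\sum_{(K)>(H)}n_K\,n(H,K)\,|W(K)|}{|W(H)|},$$ where $\deg$ is the Leray–Schauder degree, $\mathbb{E}^H$ the $H$-fixed subspace, $W(H)=N(H)/H$, $(H)\le(K)$ means that $H$ is conjugate to a subgroup of $K$, and $n(H,K)$ is the number of subgroups conjugate to $K$ that contain $H$. The local bifurcation invariant at $\alpha_o\in\Lambda$ is $$\omega_G(\alpha_o)=G\text{-}\deg(\mathscr{A}(\alpha_-),B(\mathbb{E}))-G\text{-}\deg(\mathscr{A}(\alpha_+),B(\mathbb{E}))\in A(G),$$ where $\alpha_-<\alpha_o<\alpha_+$ and $[\alpha_-,\alpha_+]\cap\Lambda=\{\alpha_o\}$. Since $f(t,0)=0$, $(\alpha,0)$ is a (trivial) solution for each $\alpha\in\mathbb{R}$. The point $(\alpha_o,0)$ is a bifurcation point of non-trivial $2\pi m$-periodic solutions if every neighbourhood of $(\alpha_o,0)$ in $\mathbb{R}\times\mathbb{E}$ contains a solution $(\alpha,u)$ of the problem with $u\ne0$. *)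

theory Defs
  imports
    "HOL-Analysis.Analysis"
    "HOL-Algebra.Group_Action"
    "HOL-Homology.Homology"
    "HOL-Computational_Algebra.Polynomial"
begin

section \<open>Brouwer and Leray--Schauder degree on the unit ball\<close>

definition lin_comb :: "(nat \<Rightarrow> 'a::real_vector) \<Rightarrow> nat \<Rightarrow> (nat \<Rightarrow> real) \<Rightarrow> 'a"
  where "lin_comb b n x = (\<Sum>i<n. x i *\<^sub>R b i)"

definition is_basis :: "(nat \<Rightarrow> 'a::real_vector) \<Rightarrow> nat \<Rightarrow> 'a set \<Rightarrow> bool"
  where "is_basis b n W \<longleftrightarrow>
    inj_on b {..<n} \<and> independent (b ` {..<n}) \<and> span (b ` {..<n}) = W"

text \<open>For \<open>F\<close> without zeros on the unit sphere of the \<open>n\<close>-dimensional space \<open>W\<close> with basis \<open>b\<close>,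
  this is the map \<open>F / |F|\<close> transported to the standard sphere: the sphere of \<open>W\<close> (in the norm of
  the ambient space) is identified with \<open>nsphere (n - 1)\<close> by coordinates and radial projection.\<close>

definition sphere_map ::
    "(nat \<Rightarrow> 'a::real_normed_vector) \<Rightarrow> nat \<Rightarrow> ('a \<Rightarrow> 'a) \<Rightarrow> (nat \<Rightarrow> real) \<Rightarrow> nat \<Rightarrow> real"
  where "sphere_map b n F x =
    (let v = lin_comb b n x;
         w = F (v /\<^sub>R norm v);
         y = (\<lambda>i. if i < n then representation (b ` {..<n}) w (b i) else 0)
     in (\<lambda>i. y i / L2_set y {..<n}))"

text \<open>Brouwer degree at \<open>0\<close> of \<open>F\<close> on the open unit ball of the finite-dimensional subspace \<open>W\<close>.
  It does not depend on the basis; on the zero space it is \<open>1\<close> (unique zero, empty sphere).\<close>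

definition brouwer_ball_degree :: "'a::real_normed_vector set \<Rightarrow> ('a \<Rightarrow> 'a) \<Rightarrow> int"
  where "brouwer_ball_degree W F =
    (if dim W = 0 then 1
     else Brouwer_degree2 (dim W - 1) (sphere_map (SOME b. is_basis b (dim W) W) (dim W) F))"

definition fin_dim_subspace :: "'a::real_vector set \<Rightarrow> bool"
  where "fin_dim_subspace W \<longleftrightarrow> (\<exists>B. finite B \<and> W = span B)"

text \<open>Leray--Schauder degree at \<open>0\<close> of \<open>T = Id - K\<close> on the open unit ball of the subspace \<open>X\<close>:
  the common Brouwer degree of all sufficiently good finite-dimensional approximations \<open>Id - g\<close>
  (\<open>g\<close> continuous, not necessarily linear, uniformly close to \<open>K\<close> on the closed ball), restricted
  to sufficiently large finite-dimensional subspaces \<open>W\<close> containing the range of \<open>g\<close>.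
  The closeness condition is written as \<open>\<parallel>(Id - g) - T\<parallel> < \<delta>\<close>.\<close>

definition leray_schauder_degree :: "'a::real_normed_vector set \<Rightarrow> ('a \<Rightarrow> 'a) \<Rightarrow> int"
  where "leray_schauder_degree X T =
    (THE d. \<exists>\<delta>>0. \<exists>W\<^sub>0. fin_dim_subspace W\<^sub>0 \<and> W\<^sub>0 \<subseteq> X \<and>
      (\<forall>W g. fin_dim_subspace W \<and> W\<^sub>0 \<subseteq> W \<and> W \<subseteq> X \<and>
             continuous_on (X \<inter> cball 0 1) g \<and> g ` (X \<inter> cball 0 1) \<subseteq> W \<and>
             (\<forall>x\<in>X \<inter> cball 0 1. norm ((x - g x) - T x) < \<delta>)
         \<longrightarrow> brouwer_ball_degree W (\<lambda>x. x - g x) = d))"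


section \<open>The equivariant degree with values in the Burnside ring\<close>

definition conj_class :: "('g, 'b) monoid_scheme \<Rightarrow> 'g set \<Rightarrow> 'g set set"
  where "conj_class G H = {g <#\<^bsub>G\<^esub> H #>\<^bsub>G\<^esub> inv\<^bsub>G\<^esub> g | g. g \<in> carrier G}"

definition conj_classes :: "('g, 'b) monoid_scheme \<Rightarrow> 'g set set set"
  where "conj_classes G = conj_class G ` {H. subgroup H G}"

definition class_less :: "('g, 'b) monoid_scheme \<Rightarrow> 'g set \<Rightarrow> 'g set set \<Rightarrow> bool"
  where "class_less G H C \<longleftrightarrow> (\<exists>K\<in>C. H \<subseteq> K) \<and> C \<noteq> conj_class G H"

definition num_above :: "'g set \<Rightarrow> 'g set set \<Rightarrow> nat"
  where "num_above H C = card {K \<in> C. H \<subseteq> K}"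

definition weyl_order :: "('g, 'b) monoid_scheme \<Rightarrow> 'g set \<Rightarrow> nat"
  where "weyl_order G H = Coset.order (G\<lparr>carrier := normalizer G H\<rparr> Mod H)"

definition class_rep :: "'g set set \<Rightarrow> 'g set"
  where "class_rep C = (SOME H. H \<in> C)"

lemma conj_self:
  assumes "group G" "subgroup H G" shows "H \<in> conj_class G H"
proof -
  interpret group G by fact
  have "H = \<one>\<^bsub>G\<^esub> <#\<^bsub>G\<^esub> H #>\<^bsub>G\<^esub> inv\<^bsub>G\<^esub> \<one>\<^bsub>G\<^esub>"
    using subgroup.subset[OF assms(2)] by (simp add: lcos_mult_one)
  then show ?thesis unfolding conj_class_def by blast
qed

lemma card_conj:
  assumes "group G" "subgroup H G" "K \<in> conj_class G H" shows "card K = card H"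
proof -
  interpret group G by fact
  obtain g where g: "g \<in> carrier G" "K = g <#\<^bsub>G\<^esub> H #>\<^bsub>G\<^esub> inv\<^bsub>G\<^esub> g"
    using assms(3) by (auto simp: conj_class_def)
  have H: "H \<subseteq> carrier G" by (rule subgroup.subset[OF assms(2)])
  have "K = (\<lambda>h. g \<otimes>\<^bsub>G\<^esub> h \<otimes>\<^bsub>G\<^esub> inv\<^bsub>G\<^esub> g) ` H"
    unfolding g(2) l_coset_def r_coset_def by auto
  moreover have "inj_on (\<lambda>h. g \<otimes>\<^bsub>G\<^esub> h \<otimes>\<^bsub>G\<^esub> inv\<^bsub>G\<^esub> g) H"
  proof (rule inj_onI)
    fix x y
    assume "x \<in> H" "y \<in> H" and eq: "g \<otimes>\<^bsub>G\<^esub> x \<otimes>\<^bsub>G\<^esub> inv\<^bsub>G\<^esub> g = g \<otimes>\<^bsub>G\<^esub> y \<otimes>\<^bsub>G\<^esub> inv\<^bsub>G\<^esub> g"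
    then have xy: "x \<in> carrier G" "y \<in> carrier G" using H by auto
    then have "g \<otimes>\<^bsub>G\<^esub> x = g \<otimes>\<^bsub>G\<^esub> y"
      using eq g(1) right_cancel[of "inv\<^bsub>G\<^esub> g"] by simp
    then show "x = y" using xy g(1) by simp
  qed
  ultimately show ?thesis by (simp add: card_image)
qed

lemma conj_subset:
  assumes "group G" "subgroup H G" "K \<in> conj_class G H" shows "K \<subseteq> carrier G"
proof -
  interpret group G by fact
  show ?thesis
    using assms(3) subgroup.subset[OF assms(2)]
    by (auto simp: conj_class_def l_coset_def r_coset_def subset_iff)
qed

lemma class_rep_in:
  assumes "group G" "C \<in> conj_classes G" shows "class_rep C \<in> C"
proof -
  obtain L where "subgroup L G" "C = conj_class G L"
    using assms(2) by (auto simp: conj_classes_def)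
  then have "L \<in> C" using conj_self[OF assms(1)] by simp
  then show ?thesis unfolding class_rep_def by (rule someI)
qed

lemma class_less_card:
  assumes "group G" "finite (carrier G)" "subgroup H G" "C \<in> conj_classes G" "class_less G H C"
  shows "card H < card (class_rep C)" "card (class_rep C) \<le> card (carrier G)"
proof -
  obtain L where L: "subgroup L G" "C = conj_class G L"
    using assms(4) by (auto simp: conj_classes_def)
  obtain K where K: "K \<in> C" "H \<subseteq> K" and ne: "C \<noteq> conj_class G H"
    using assms(5) by (auto simp: class_less_def)
  have KG: "K \<subseteq> carrier G" using conj_subset[OF assms(1) L(1)] K L by blast
  then have fK: "finite K" using assms(2) finite_subset by blast
  have cK: "card (class_rep C) = card K"
    using card_conj[OF assms(1) L(1)] class_rep_in[OF assms(1,4)] K L by simp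
  interpret group G by fact
  have "H \<noteq> K"
  proof
    assume "H = K"
    then obtain g where g: "g \<in> carrier G" "H = g <#\<^bsub>G\<^esub> L #>\<^bsub>G\<^esub> inv\<^bsub>G\<^esub> g"
      using K L by (auto simp: conj_class_def)
    have Ls: "L \<subseteq> carrier G" by (rule subgroup.subset[OF L(1)])
    have shift: "x <#\<^bsub>G\<^esub> (y <#\<^bsub>G\<^esub> M #>\<^bsub>G\<^esub> inv\<^bsub>G\<^esub> y) #>\<^bsub>G\<^esub> inv\<^bsub>G\<^esub> x =
        (x \<otimes>\<^bsub>G\<^esub> y) <#\<^bsub>G\<^esub> M #>\<^bsub>G\<^esub> inv\<^bsub>G\<^esub> (x \<otimes>\<^bsub>G\<^esub> y)"
      if "x \<in> carrier G" "y \<in> carrier G" "M \<subseteq> carrier G" for x y M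
    proof -
      have e: "x \<otimes>\<^bsub>G\<^esub> (y \<otimes>\<^bsub>G\<^esub> k \<otimes>\<^bsub>G\<^esub> inv\<^bsub>G\<^esub> y) \<otimes>\<^bsub>G\<^esub> inv\<^bsub>G\<^esub> x =
          (x \<otimes>\<^bsub>G\<^esub> y) \<otimes>\<^bsub>G\<^esub> k \<otimes>\<^bsub>G\<^esub> inv\<^bsub>G\<^esub> (x \<otimes>\<^bsub>G\<^esub> y)" if "k \<in> M" for k
        using that \<open>x \<in> carrier G\<close> \<open>y \<in> carrier G\<close> \<open>M \<subseteq> carrier G\<close>
        by (simp add: m_assoc inv_mult_group subset_iff)
      have "x <#\<^bsub>G\<^esub> (y <#\<^bsub>G\<^esub> M #>\<^bsub>G\<^esub> inv\<^bsub>G\<^esub> y) #>\<^bsub>G\<^esub> inv\<^bsub>G\<^esub> x =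
          (\<lambda>k. x \<otimes>\<^bsub>G\<^esub> (y \<otimes>\<^bsub>G\<^esub> k \<otimes>\<^bsub>G\<^esub> inv\<^bsub>G\<^esub> y) \<otimes>\<^bsub>G\<^esub> inv\<^bsub>G\<^esub> x) ` M"
        unfolding l_coset_def r_coset_def by auto
      also have "\<dots> = (\<lambda>k. (x \<otimes>\<^bsub>G\<^esub> y) \<otimes>\<^bsub>G\<^esub> k \<otimes>\<^bsub>G\<^esub> inv\<^bsub>G\<^esub> (x \<otimes>\<^bsub>G\<^esub> y)) ` M"
        using e by (rule image_cong[OF refl])
      also have "\<dots> = (x \<otimes>\<^bsub>G\<^esub> y) <#\<^bsub>G\<^esub> M #>\<^bsub>G\<^esub> inv\<^bsub>G\<^esub> (x \<otimes>\<^bsub>G\<^esub> y)"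
        unfolding l_coset_def r_coset_def by auto
      finally show ?thesis .
    qed
    have conv: "L = inv\<^bsub>G\<^esub> g <#\<^bsub>G\<^esub> H #>\<^bsub>G\<^esub> inv\<^bsub>G\<^esub> (inv\<^bsub>G\<^esub> g)"
    proof -
      have "inv\<^bsub>G\<^esub> g <#\<^bsub>G\<^esub> H #>\<^bsub>G\<^esub> inv\<^bsub>G\<^esub> (inv\<^bsub>G\<^esub> g) = \<one>\<^bsub>G\<^esub> <#\<^bsub>G\<^esub> L #>\<^bsub>G\<^esub> inv\<^bsub>G\<^esub> \<one>\<^bsub>G\<^esub>"
        using shift[OF inv_closed[OF g(1)] g(1) Ls] g(1) unfolding g(2) by simp
      then show ?thesis using Ls by (simp add: lcos_mult_one)
    qed
    have Hs: "H \<subseteq> carrier G" by (rule subgroup.subset[OF assms(3)])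
    have "conj_class G H \<subseteq> C"
    proof
      fix M assume "M \<in> conj_class G H"
      then obtain x where x: "x \<in> carrier G" "M = x <#\<^bsub>G\<^esub> H #>\<^bsub>G\<^esub> inv\<^bsub>G\<^esub> x"
        by (auto simp: conj_class_def)
      have "M = (x \<otimes>\<^bsub>G\<^esub> g) <#\<^bsub>G\<^esub> L #>\<^bsub>G\<^esub> inv\<^bsub>G\<^esub> (x \<otimes>\<^bsub>G\<^esub> g)"
        unfolding x(2) by (subst (1) g(2)) (rule shift[OF x(1) g(1) Ls])
      moreover have "x \<otimes>\<^bsub>G\<^esub> g \<in> carrier G" using x(1) g(1) by (rule m_closed)
      ultimately show "M \<in> C" unfolding L(2) conj_class_def by blast
    qed
    moreover have "C \<subseteq> conj_class G H"
    proof
      fix M assume "M \<in> C"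
      then obtain x where x: "x \<in> carrier G" "M = x <#\<^bsub>G\<^esub> L #>\<^bsub>G\<^esub> inv\<^bsub>G\<^esub> x"
        unfolding L(2) conj_class_def by blast
      have ig: "inv\<^bsub>G\<^esub> g \<in> carrier G" using g(1) by (rule inv_closed)
      have "M = (x \<otimes>\<^bsub>G\<^esub> inv\<^bsub>G\<^esub> g) <#\<^bsub>G\<^esub> H #>\<^bsub>G\<^esub> inv\<^bsub>G\<^esub> (x \<otimes>\<^bsub>G\<^esub> inv\<^bsub>G\<^esub> g)"
        unfolding x(2) by (subst (1) conv) (rule shift[OF x(1) ig Hs])
      moreover have "x \<otimes>\<^bsub>G\<^esub> inv\<^bsub>G\<^esub> g \<in> carrier G" using x(1) ig by (rule m_closed)
      ultimately show "M \<in> conj_class G H" unfolding conj_class_def by blast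
    qed
    ultimately show False using ne by blast
  qed
  then show "card H < card (class_rep C)" using K fK cK by (simp add: psubset_card_mono psubset_eq)
  show "card (class_rep C) \<le> card (carrier G)" using cK KG assms(2) by (simp add: card_mono)
qed

text \<open>The recursion for \<open>n\<^sub>H\<close> over a finite group, for a given function \<open>d\<close> of subgroups
  (\<open>d H\<close> being the degree on the \<open>H\<close>-fixed points). The sum runs over the conjugacy classes
  \<open>C = (K)\<close> with \<open>(K) > (H)\<close>; the quotient is exact in the situation of an equivariant degree.\<close>

function burnside_coeff :: "('g, 'b) monoid_scheme \<Rightarrow> ('g set \<Rightarrow> int) \<Rightarrow> 'g set \<Rightarrow> int"
  where "burnside_coeff G d H =
    (if group G \<and> finite (carrier G) \<and> subgroup H G then
       (d H - (\<Sum>C\<in>{C \<in> conj_classes G. class_less G H C}.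
                 burnside_coeff G d (class_rep C) * int (num_above H C)
                   * int (weyl_order G (class_rep C))))
       div int (weyl_order G H)
     else 0)"
  by pat_completeness auto
termination
proof (relation "Wellfounded.measure (\<lambda>(G, d, H). card (carrier G) - card H)", goal_cases)
  case 1
  show ?case by simp
next
  case (2 G d H C)
  then show ?case using class_less_card[of G H C] by auto
qed

declare burnside_coeff.simps [simp del]

definition fixed_subspace :: "('g \<Rightarrow> 'a \<Rightarrow> 'a) \<Rightarrow> 'a set \<Rightarrow> 'g set \<Rightarrow> 'a set"
  where "fixed_subspace act X H = {x \<in> X. \<forall>g\<in>H. act g x = x}"

text \<open>\<open>A(G)\<close> as a group is the free abelian group on \<open>conj_classes G\<close>; its elements are represented
  as in \<open>free_Abelian_group\<close>.\<close>

definition G_degree :: "('g, 'b) monoid_scheme \<Rightarrow> ('g \<Rightarrow> 'a::real_normed_vector \<Rightarrow> 'a) \<Rightarrow> 'a set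
    \<Rightarrow> ('a \<Rightarrow> 'a) \<Rightarrow> ('g set set \<Rightarrow>\<^sub>0 int)"
  where "G_degree G act X T =
    (\<Sum>C\<in>conj_classes G.
       frag_cmul
         (burnside_coeff G (\<lambda>H. leray_schauder_degree (fixed_subspace act X H) T) (class_rep C))
         (frag_of C))"


section \<open>Bounded \<open>C\<^sup>2\<close> functions and the periodic subspace\<close>

text \<open>Bounded \<open>C\<^sup>2\<close> functions with bounded first and second derivatives, normed by
  \<open>max {\<parallel>u\<parallel>\<^sub>\<infinity>, \<parallel>u'\<parallel>\<^sub>\<infinity>, \<parallel>u''\<parallel>\<^sub>\<infinity>}\<close>. Every periodic \<open>C\<^sup>2\<close> function is of this kind.\<close>

definition "c2b = {u :: real \<Rightarrow> 'v::real_normed_vector. bounded (range u) \<and>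
  (\<exists>(u\<^sub>1 :: real \<Rightarrow>\<^sub>C 'v) (u\<^sub>2 :: real \<Rightarrow>\<^sub>C 'v). \<forall>t. (u has_vector_derivative u\<^sub>1 t) (at t) \<and>
     (u\<^sub>1 has_vector_derivative u\<^sub>2 t) (at t))}"

lemma c2bI:
  fixes u1 u2 :: "real \<Rightarrow>\<^sub>C 'v::real_normed_vector"
  assumes "bounded (range u)" "\<And>t. (u has_vector_derivative u1 t) (at t)"
    and "\<And>t. (u1 has_vector_derivative u2 t) (at t)"
  shows "u \<in> c2b"
  using assms unfolding c2b_def by blast

typedef (overloaded) ('v::real_normed_vector) c2b = "c2b :: (real \<Rightarrow> 'v) set"
  morphisms apply_c2b Abs_c2b
proof
  show "(\<lambda>_. 0) \<in> (c2b :: (real \<Rightarrow> 'v) set)"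
    unfolding c2b_def by (auto intro!: exI[of _ "0 :: real \<Rightarrow>\<^sub>C 'v"])
qed

setup_lifting type_definition_c2b

definition c2_d0 :: "'v::real_normed_vector c2b \<Rightarrow> real \<Rightarrow>\<^sub>C 'v"
  where "c2_d0 u = Bcontfun (apply_c2b u)"

definition c2_d1 :: "'v::real_normed_vector c2b \<Rightarrow> real \<Rightarrow>\<^sub>C 'v"
  where "c2_d1 u = Bcontfun (\<lambda>t. vector_derivative (apply_c2b u) (at t))"

definition c2_d2 :: "'v::real_normed_vector c2b \<Rightarrow> real \<Rightarrow>\<^sub>C 'v"
  where "c2_d2 u = Bcontfun (\<lambda>t. vector_derivative (apply_bcontfun (c2_d1 u)) (at t))"

lemma c2_d0_apply [simp]: "apply_bcontfun (c2_d0 u) = apply_c2b u"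
proof -
  have "continuous_on UNIV (apply_c2b u)"
    using apply_c2b[of u] has_vector_derivative_continuous
    by (auto simp: c2b_def continuous_on_eq_continuous_at) blast
  then show ?thesis
    unfolding c2_d0_def using apply_c2b[of u]
    by (subst Bcontfun_inverse) (auto simp: bcontfun_def c2b_def)
qed

lemma c2_derivs:
  shows "(apply_c2b u has_vector_derivative c2_d1 u t) (at t)"
    and "(apply_bcontfun (c2_d1 u) has_vector_derivative c2_d2 u t) (at t)"
proof -
  obtain u1 u2 :: "real \<Rightarrow>\<^sub>C 'a" where
    1: "\<And>t. (apply_c2b u has_vector_derivative u1 t) (at t)" and
    2: "\<And>t. (apply_bcontfun u1 has_vector_derivative u2 t) (at t)"
    using apply_c2b[of u] unfolding c2b_def by auto
  have a: "c2_d1 u = u1"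
    unfolding c2_d1_def vector_derivative_at[OF 1] by (rule apply_bcontfun_inverse)
  have b: "c2_d2 u = u2"
    unfolding c2_d2_def a vector_derivative_at[OF 2] by (rule apply_bcontfun_inverse)
  show "(apply_c2b u has_vector_derivative c2_d1 u t) (at t)"
    "(apply_bcontfun (c2_d1 u) has_vector_derivative c2_d2 u t) (at t)"
    using 1 2 a b by auto
qed

lemma c2_d1_eqI:
  fixes v :: "real \<Rightarrow>\<^sub>C 'v::real_normed_vector"
  assumes "\<And>t. (apply_c2b u has_vector_derivative v t) (at t)"
  shows "c2_d1 u = v"
  by (rule bcontfun_eqI) (metis assms c2_derivs(1) vector_derivative_unique_at)

lemma c2_d2_eqI:
  fixes v :: "real \<Rightarrow>\<^sub>C 'v::real_normed_vector"
  assumes "\<And>t. (apply_bcontfun (c2_d1 u) has_vector_derivative v t) (at t)"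
  shows "c2_d2 u = v"
  by (rule bcontfun_eqI) (metis assms c2_derivs(2) vector_derivative_unique_at)

instantiation c2b :: (real_normed_vector) real_vector
begin

lift_definition zero_c2b :: "'a c2b" is "\<lambda>_. 0"
  unfolding c2b_def by (auto intro!: exI[of _ "0 :: real \<Rightarrow>\<^sub>C 'a"])

lift_definition plus_c2b :: "'a c2b \<Rightarrow> 'a c2b \<Rightarrow> 'a c2b" is "\<lambda>u v t. u t + v t"
proof -
  fix u v :: "real \<Rightarrow> 'a"
  assume "u \<in> c2b" "v \<in> c2b"
  then obtain u1 u2 v1 v2 :: "real \<Rightarrow>\<^sub>C 'a" where
    "bounded (range u)" "bounded (range v)"
    "\<And>t. (u has_vector_derivative u1 t) (at t)"
    "\<And>t. (apply_bcontfun u1 has_vector_derivative u2 t) (at t)"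
    "\<And>t. (v has_vector_derivative v1 t) (at t)"
    "\<And>t. (apply_bcontfun v1 has_vector_derivative v2 t) (at t)"
    unfolding c2b_def by blast
  then show "(\<lambda>t. u t + v t) \<in> c2b"
    by (intro c2bI[of _ "u1 + v1" "u2 + v2"] bounded_plus_comp)
      (auto intro!: has_vector_derivative_add)
qed

lift_definition scaleR_c2b :: "real \<Rightarrow> 'a c2b \<Rightarrow> 'a c2b" is "\<lambda>c u t. c *\<^sub>R u t"
proof -
  fix c :: real and u :: "real \<Rightarrow> 'a"
  assume "u \<in> c2b"
  then obtain u1 u2 :: "real \<Rightarrow>\<^sub>C 'a" where
    "bounded (range u)"
    "\<And>t. (u has_vector_derivative u1 t) (at t)"
    "\<And>t. (apply_bcontfun u1 has_vector_derivative u2 t) (at t)"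
    unfolding c2b_def by blast
  then show "(\<lambda>t. c *\<^sub>R u t) \<in> c2b"
    by (intro c2bI[of _ "c *\<^sub>R u1" "c *\<^sub>R u2"] bounded_scaleR_comp)
      (auto intro!: bounded_linear.has_vector_derivative[OF bounded_linear_scaleR_right])
qed

definition uminus_c2b :: "'a c2b \<Rightarrow> 'a c2b" where "uminus_c2b u = (-1) *\<^sub>R u"

definition minus_c2b :: "'a c2b \<Rightarrow> 'a c2b \<Rightarrow> 'a c2b" where "minus_c2b u v = u + (-1) *\<^sub>R v"

instance
  by standard
    (simp_all add: apply_c2b_inject[symmetric] fun_eq_iff uminus_c2b_def minus_c2b_def
      zero_c2b.rep_eq plus_c2b.rep_eq scaleR_c2b.rep_eq algebra_simps)

end

lemma c2_linear [simp]:
  "c2_d0 (u + v) = c2_d0 u + c2_d0 v" "c2_d0 (c *\<^sub>R u) = c *\<^sub>R c2_d0 u"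
  "c2_d1 (u + v) = c2_d1 u + c2_d1 v" "c2_d1 (c *\<^sub>R u) = c *\<^sub>R c2_d1 u"
  "c2_d2 (u + v) = c2_d2 u + c2_d2 v" "c2_d2 (c *\<^sub>R u) = c *\<^sub>R c2_d2 u"
proof -
  show "c2_d0 (u + v) = c2_d0 u + c2_d0 v" "c2_d0 (c *\<^sub>R u) = c *\<^sub>R c2_d0 u"
    by (auto intro!: bcontfun_eqI simp: plus_c2b.rep_eq scaleR_c2b.rep_eq)
  show p: "c2_d1 (u + v) = c2_d1 u + c2_d1 v"
    by (rule c2_d1_eqI) (auto simp: plus_c2b.rep_eq intro!: has_vector_derivative_add c2_derivs)
  show s: "c2_d1 (c *\<^sub>R u) = c *\<^sub>R c2_d1 u"
    by (rule c2_d1_eqI) (auto simp: scaleR_c2b.rep_eq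
        intro!: bounded_linear.has_vector_derivative[OF bounded_linear_scaleR_right] c2_derivs)
  show "c2_d2 (u + v) = c2_d2 u + c2_d2 v"
    by (rule c2_d2_eqI) (auto simp: p intro!: has_vector_derivative_add c2_derivs)
  show "c2_d2 (c *\<^sub>R u) = c *\<^sub>R c2_d2 u"
    by (rule c2_d2_eqI) (auto simp: s
        intro!: bounded_linear.has_vector_derivative[OF bounded_linear_scaleR_right] c2_derivs)
qed

instantiation c2b :: (real_normed_vector) real_normed_vector
begin

definition norm_c2b :: "'a c2b \<Rightarrow> real"
  where "norm_c2b u = max (norm (c2_d0 u)) (max (norm (c2_d1 u)) (norm (c2_d2 u)))"

definition dist_c2b :: "'a c2b \<Rightarrow> 'a c2b \<Rightarrow> real"
  where "dist_c2b u v = norm (u - v)"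

definition sgn_c2b :: "'a c2b \<Rightarrow> 'a c2b"
  where "sgn_c2b u = u /\<^sub>R norm u"

definition uniformity_c2b :: "('a c2b \<times> 'a c2b) filter"
  where "uniformity_c2b = (INF e\<in>{0 <..}. principal {(x, y). dist x y < e})"

definition open_c2b :: "'a c2b set \<Rightarrow> bool"
  where "open_c2b S = (\<forall>x\<in>S. \<forall>\<^sub>F (x', y) in uniformity. x' = x \<longrightarrow> y \<in> S)"

instance
proof
  fix u v :: "'a c2b" and c :: real
  have z: "c2_d0 0 = (0 :: real \<Rightarrow>\<^sub>C 'a)" "c2_d1 0 = (0 :: real \<Rightarrow>\<^sub>C 'a)" "c2_d2 0 = (0 :: real \<Rightarrow>\<^sub>C 'a)"
    using c2_linear(2,4,6)[of 0 0] by auto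
  show "norm u = 0 \<longleftrightarrow> u = 0"
  proof
    assume "norm u = 0"
    then have "norm (c2_d0 u) \<le> 0"
      unfolding norm_c2b_def by (metis max.cobounded1)
    then have "c2_d0 u = 0" by simp
    then have "apply_c2b u = apply_c2b 0" by (metis c2_d0_apply z(1))
    then show "u = 0" by (simp add: apply_c2b_inject)
  qed (simp add: norm_c2b_def z)
  show "norm (u + v) \<le> norm u + norm v"
    unfolding norm_c2b_def
    using norm_triangle_ineq[of "c2_d0 u" "c2_d0 v"] norm_triangle_ineq[of "c2_d1 u" "c2_d1 v"]
      norm_triangle_ineq[of "c2_d2 u" "c2_d2 v"]
    by (simp add: max_def)
  show "norm (c *\<^sub>R u) = \<bar>c\<bar> * norm u"
    unfolding norm_c2b_def by (simp add: max_mult_distrib_left)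
qed (simp_all add: dist_c2b_def sgn_c2b_def uniformity_c2b_def open_c2b_def)

end

text \<open>The space \<open>E\<close> of \<open>2\<pi>m\<close>-periodic functions.\<close>

definition per_space :: "nat \<Rightarrow> 'v::real_normed_vector c2b set"
  where "per_space m = {u. \<forall>t. apply_c2b u (t + 2 * pi * real m) = apply_c2b u t}"

lemma periodic_bcontfun:
  fixes f :: "real \<Rightarrow> 'v::real_normed_vector"
  assumes "p > 0" and per: "\<And>t. f (t + p) = f t" and cont: "continuous_on UNIV f"
  shows "f \<in> bcontfun"
proof -
  have shift: "f (t + real_of_int n * p) = f t" for t n
  proof (induction n rule: int_induct[where k = 0])
    case (step1 i)
    then show ?case using per[of "t + real_of_int i * p"] by (simp add: algebra_simps)
  next
    case (step2 i)
    then show ?case using per[of "t + real_of_int (i - 1) * p"] by (simp add: algebra_simps)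
  qed simp
  have "f t \<in> f ` {0..p}" for t
  proof
    show "f t = f (t + real_of_int (- \<lfloor>t / p\<rfloor>) * p)" by (rule shift[symmetric])
    have "0 \<le> t / p - \<lfloor>t / p\<rfloor>" "t / p - \<lfloor>t / p\<rfloor> \<le> 1" by linarith+
    then have "0 * p \<le> (t / p - \<lfloor>t / p\<rfloor>) * p" "(t / p - \<lfloor>t / p\<rfloor>) * p \<le> 1 * p"
      using \<open>p > 0\<close> by (intro mult_right_mono; simp)+
    then show "t + real_of_int (- \<lfloor>t / p\<rfloor>) * p \<in> {0..p}"
      using \<open>p > 0\<close> by (simp add: left_diff_distrib)
  qed
  moreover have "bounded (f ` {0..p})"
    by (intro compact_imp_bounded compact_continuous_image continuous_on_subset[OF cont]) auto
  ultimately show ?thesis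
    using cont unfolding bcontfun_def by (auto intro: bounded_subset)
qed

lemma periodic_C2_in_c2b:
  fixes u u1 u2 :: "real \<Rightarrow> 'v::real_normed_vector"
  assumes "p > 0" and per: "\<And>t. u (t + p) = u t"
    and d1: "\<And>t. (u has_vector_derivative u1 t) (at t)"
    and d2: "\<And>t. (u1 has_vector_derivative u2 t) (at t)"
    and cont: "continuous_on UNIV u2"
  shows "u \<in> c2b"
proof -
  have der: "g (t + p) = g t"
    if "\<And>t. h (t + p) = h t" "\<And>t. (h has_vector_derivative g t) (at t)"
    for g h :: "real \<Rightarrow> 'v" and t
  proof -
    have "((h \<circ> (\<lambda>s. s + p)) has_vector_derivative (1 *\<^sub>R g (t + p))) (at t)"
      by (rule vector_diff_chain_at) (auto intro!: derivative_eq_intros that)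
    moreover have "h \<circ> (\<lambda>s. s + p) = h" using that(1) by auto
    ultimately have "(h has_vector_derivative g (t + p)) (at t)" by simp
    from vector_derivative_unique_at[OF this that(2)] show ?thesis .
  qed
  have c: "continuous_on UNIV h" if "\<And>t. (h has_vector_derivative g t) (at t)"
    for g h :: "real \<Rightarrow> 'v"
    unfolding continuous_on_eq_continuous_at[OF open_UNIV]
    using has_vector_derivative_continuous[OF that] by blast
  have p1: "\<And>t. u1 (t + p) = u1 t" by (rule der[OF per d1])
  have p2: "\<And>t. u2 (t + p) = u2 t" by (rule der[OF p1 d2])
  have bc: "u \<in> bcontfun" "u1 \<in> bcontfun" "u2 \<in> bcontfun"
    by (rule periodic_bcontfun[OF \<open>p > 0\<close> per c[OF d1]]
        periodic_bcontfun[OF \<open>p > 0\<close> p1 c[OF d2]] periodic_bcontfun[OF \<open>p > 0\<close> p2 cont])+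
  show ?thesis
  proof (rule c2bI[of _ "Bcontfun u1" "Bcontfun u2"])
    show "bounded (range u)" using bc(1) by (simp add: bcontfun_def)
  qed (simp_all only: Bcontfun_inverse[OF bc(2)] Bcontfun_inverse[OF bc(3)] d1 d2)
qed

definition L_op :: "'v::real_normed_vector c2b \<Rightarrow> real \<Rightarrow>\<^sub>C 'v"
  where "L_op u = c2_d2 u - c2_d0 u"


section \<open>The dihedral group and its action\<close>

text \<open>The pair \<open>(j, False)\<close> stands for \<open>\<gamma>\<^sup>j\<close> and \<open>(j, True)\<close> for \<open>\<gamma>\<^sup>j \<kappa>\<close>,
  with \<open>\<kappa> \<gamma>\<^sup>j = \<gamma>\<^sup>-\<^sup>j \<kappa>\<close>.\<close>

definition dihedral_group :: "nat \<Rightarrow> (int \<times> bool) monoid"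
  where "dihedral_group m =
    \<lparr>carrier = {0..<int m} \<times> UNIV,
     monoid.mult = (\<lambda>(i, a) (j, b). ((if a then i - j else i + j) mod int m, a \<noteq> b)),
     one = (0, False)\<rparr>"

definition sign_group :: "int monoid"
  where "sign_group = \<lparr>carrier = {1, -1}, monoid.mult = (*), one = 1\<rparr>"

definition sym_group :: "nat \<Rightarrow> ((int \<times> bool) \<times> int) monoid"
  where "sym_group m = dihedral_group m \<times>\<times> sign_group"

lemma group_dihedral:
  assumes m: "m > 0" shows "group (dihedral_group m)"
proof -
  define M where "M = int m"
  have M: "M > 0" using m by (simp add: M_def)
  define mul where "mul = (\<lambda>(i, a) (j, b). ((if a then i - j else i + j) mod M, a \<noteq> b))"
  have G: "dihedral_group m = \<lparr>carrier = {0..<M} \<times> UNIV, monoid.mult = mul, one = (0, False)\<rparr>"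
    unfolding dihedral_group_def M_def mul_def ..
  have closed: "mul x y \<in> {0..<M} \<times> UNIV" for x y
    using M by (cases x; cases y) (auto simp: mul_def)
  have assoc: "mul (mul x y) z = mul x (mul y z)" for x y z
  proof -
    obtain i a j b k c where e: "x = (i, a)" "y = (j, b)" "z = (k, c)" by (metis surj_pair)
    have "(i - (j - k)) mod M = (i - j + k) mod M" "(i - (j + k)) mod M = (i - j - k) mod M"
      "(i + (j - k)) mod M = (i + j - k) mod M" "(i + (j + k)) mod M = (i + j + k) mod M"
      by (simp_all add: algebra_simps)
    then show ?thesis
      unfolding e mul_def
      by (cases a; cases b) (simp_all add: mod_diff_left_eq mod_diff_right_eq mod_add_left_eq mod_add_right_eq)
  qed
  show ?thesis
    unfolding G
  proof (rule groupI, goal_cases)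
    case (4 x)
    then show ?case by (auto simp: mul_def)
  next
    case (5 x)
    then obtain i a where x: "x = (i, a)" "0 \<le> i" "i < M" by auto
    define y where "y = (if a then i else (- i) mod M, a)"
    have "y \<in> {0..<M} \<times> UNIV" using x M by (auto simp: y_def)
    moreover have "mul y x = (0, False)"
      using M by (auto simp: x y_def mul_def mod_add_left_eq)
    ultimately show ?case by auto
  qed (use M closed assoc in auto)
qed

lemma group_sym_group: "m > 0 \<Longrightarrow> group (sym_group m)"
  unfolding sym_group_def
  by (intro DirProd_group group_dihedral, assumption, rule groupI) (auto simp: sign_group_def)

lemma finite_sym_group: "finite (carrier (sym_group m))"
  by (auto simp: sym_group_def dihedral_group_def sign_group_def)

lemma c2b_affine:
  fixes u :: "real \<Rightarrow> 'v::real_normed_vector"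
  assumes "u \<in> c2b"
  shows "(\<lambda>t. b *\<^sub>R u (a * (t + p))) \<in> c2b"
proof -
  obtain u1 u2 :: "real \<Rightarrow>\<^sub>C 'v" where u: "bounded (range u)"
    "\<And>t. (u has_vector_derivative u1 t) (at t)"
    "\<And>t. (apply_bcontfun u1 has_vector_derivative u2 t) (at t)"
    using assms unfolding c2b_def by blast
  define q where "q = (\<lambda>t. a * (t + p))"
  have der: "((\<lambda>t. c *\<^sub>R h (q t)) has_vector_derivative ((c * a) *\<^sub>R h' (q t))) (at t)"
    if h: "\<And>t. (h has_vector_derivative h' t) (at t)" for h h' :: "real \<Rightarrow> 'v" and c t
  proof -
    have "(q has_vector_derivative a) (at t)"
      unfolding q_def by (auto intro!: derivative_eq_intros)
    from vector_diff_chain_at[OF this h]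
    have "((h \<circ> q) has_vector_derivative (a *\<^sub>R h' (q t))) (at t)" .
    from bounded_linear.has_vector_derivative[OF bounded_linear_scaleR_right this, of c]
    show ?thesis by (simp add: o_def)
  qed
  have bdd: "bounded (range (\<lambda>t. c *\<^sub>R h (q t)))" if "bounded (range h)" for c and h :: "real \<Rightarrow> 'v"
    by (rule bounded_scaleR_comp, rule bounded_subset[OF that]) auto
  have bc: "(\<lambda>t. c *\<^sub>R h (q t)) \<in> bcontfun" for c and h :: "real \<Rightarrow>\<^sub>C 'v"
  proof -
    have "continuous_on UNIV q" unfolding q_def by (intro continuous_intros)
    then have "continuous_on UNIV (\<lambda>t. h (q t))"
      by (rule continuous_on_compose2[OF continuous_on_apply_bcontfun[of UNIV h]]) simp
    then have "continuous_on UNIV (\<lambda>t. c *\<^sub>R h (q t))"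
      by (intro continuous_on_scaleR continuous_on_const)
    then show ?thesis
      unfolding bcontfun_def using bdd[OF bounded_apply_bcontfun] by blast
  qed
  have "(\<lambda>t. b *\<^sub>R u (q t)) \<in> c2b"
    by (rule c2bI[of _ "Bcontfun (\<lambda>t. (b * a) *\<^sub>R u1 (q t))"
          "Bcontfun (\<lambda>t. (b * a * a) *\<^sub>R u2 (q t))"])
      (simp_all only: Bcontfun_inverse[OF bc] bdd[OF u(1)] der[OF u(2)] der[OF u(3)])
  then show ?thesis by (simp only: q_def)
qed

text \<open>\<open>((\<gamma>\<^sup>j, s) u)(t) = s u(t + 2\<pi>j)\<close> and \<open>((\<kappa>, s) u)(t) = s u(- t)\<close>, hence
  \<open>((\<gamma>\<^sup>j \<kappa>, s) u)(t) = s u(- (t + 2\<pi>j))\<close>.\<close>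

lift_definition sym_act :: "(int \<times> bool) \<times> int \<Rightarrow> 'v::real_normed_vector c2b \<Rightarrow> 'v c2b"
  is "\<lambda>g u t. of_int (snd g) *\<^sub>R
        u ((if snd (fst g) then -1 else 1) * (t + 2 * pi * of_int (fst (fst g))))"
  by (rule c2b_affine)

section \<open>The boundary value problem\<close>

definition real_spectrum :: "('v::real_vector \<Rightarrow> 'v) \<Rightarrow> real set"
  where "real_spectrum A = {\<mu>. \<exists>v. v \<noteq> 0 \<and> A v = \<mu> *\<^sub>R v}"

definition charpoly :: "(real ^ 'k \<Rightarrow> real ^ 'k) \<Rightarrow> real poly"
  where "charpoly A = det (\<chi> i j. (if i = j then [:0, 1:] else 0) - [:matrix A $ i $ j:])"

definition alg_mult :: "(real ^ 'k \<Rightarrow> real ^ 'k) \<Rightarrow> real \<Rightarrow> nat"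
  where "alg_mult A \<mu> = Polynomial.order \<mu> (charpoly A)"

definition alpha_pt :: "nat \<Rightarrow> nat \<Rightarrow> real \<Rightarrow> real"
  where "alpha_pt m j \<mu> = ((real j)\<^sup>2 + (real m)\<^sup>2 * \<mu>) / (real m)\<^sup>2"

definition bc_comp :: "('v \<Rightarrow> 'v) \<Rightarrow> (real \<Rightarrow>\<^sub>C 'v) \<Rightarrow> real \<Rightarrow>\<^sub>C 'v::real_normed_vector"
  where "bc_comp A v = Bcontfun (\<lambda>t. A (v t))"

text \<open>\<open>c2_d0\<close> is the inclusion \<open>j : E \<rightarrow> F\<close>; \<open>inv_into (per_space m) L_op\<close> is \<open>L\<^sup>-\<^sup>1\<close>.\<close>

definition lin_op :: "nat \<Rightarrow> ('v::real_normed_vector \<Rightarrow> 'v) \<Rightarrow> real \<Rightarrow> 'v c2b \<Rightarrow> 'v c2b"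
  where "lin_op m A \<alpha> u =
    u - inv_into (per_space m) L_op (bc_comp A (c2_d0 u) - (\<alpha> + 1) *\<^sub>R c2_d0 u)"

definition isomorphism_on :: "'a::real_normed_vector set \<Rightarrow> ('a \<Rightarrow> 'a) \<Rightarrow> bool"
  where "isomorphism_on X T \<longleftrightarrow>
    (\<forall>x\<in>X. \<forall>y\<in>X. T (x + y) = T x + T y) \<and> (\<forall>c. \<forall>x\<in>X. T (c *\<^sub>R x) = c *\<^sub>R T x) \<and>
    (\<exists>S. homeomorphism X X T S)"

definition critical_points :: "nat \<Rightarrow> ('v::real_normed_vector \<Rightarrow> 'v) \<Rightarrow> real set"
  where "critical_points m A = {\<alpha>. \<not> isomorphism_on (per_space m) (lin_op m A \<alpha>)}"

text \<open>The value does not depend on the choice of \<open>a = \<alpha>\<^sub>-\<close> and \<open>b = \<alpha>\<^sub>+\<close>.\<close>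

definition bif_invariant ::
    "nat \<Rightarrow> ('v::real_normed_vector \<Rightarrow> 'v) \<Rightarrow> real \<Rightarrow> (((int \<times> bool) \<times> int) set set \<Rightarrow>\<^sub>0 int)"
  where "bif_invariant m A \<alpha>\<^sub>0 =
    (THE w. \<exists>a b. a < \<alpha>\<^sub>0 \<and> \<alpha>\<^sub>0 < b \<and> {a..b} \<inter> critical_points m A = {\<alpha>\<^sub>0} \<and>
       w = G_degree (sym_group m) sym_act (per_space m) (lin_op m A a)
         - G_degree (sym_group m) sym_act (per_space m) (lin_op m A b))"

definition is_solution :: "nat \<Rightarrow> ('v::real_normed_vector \<Rightarrow> 'v) \<Rightarrow> (real \<Rightarrow> 'v \<Rightarrow> 'v) \<Rightarrow> real
    \<Rightarrow> 'v c2b \<Rightarrow> bool"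
  where "is_solution m A f \<alpha> u \<longleftrightarrow> u \<in> per_space m \<and>
    (\<forall>t. c2_d2 u t = - \<alpha> *\<^sub>R apply_c2b u t + A (apply_c2b u t) + f t (apply_c2b u t))"

definition bifurcation_point :: "nat \<Rightarrow> ('v::real_normed_vector \<Rightarrow> 'v) \<Rightarrow> (real \<Rightarrow> 'v \<Rightarrow> 'v) \<Rightarrow> real
    \<Rightarrow> bool"
  where "bifurcation_point m A f \<alpha>\<^sub>0 \<longleftrightarrow>
    (\<forall>U. open U \<and> (\<alpha>\<^sub>0, 0) \<in> U \<longrightarrow> (\<exists>\<alpha> u. (\<alpha>, u) \<in> U \<and> u \<noteq> 0 \<and> is_solution m A f \<alpha> u))"

end

theory Submission
  imports Defs
begin

text \<open>The operators commute with the Fourier projections \<open>P j\<close>, and on the \<open>j\<close>-th mode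
  \<open>\<A>(\<alpha>)\<close> is \<open>(A - (\<alpha> - j\<^sup>2 / m\<^sup>2) Id) / (1 + j\<^sup>2 / m\<^sup>2)\<close>. Hence the Leray--Schauder degree on
  a closed invariant subspace is the Brouwer degree on finitely many modes, i.e. a sign of a determinant, and at
  \<open>\<alpha>_{j0, \<mu>0}\<close> only the mode \<open>j0\<close> can change it.

  Let \<open>H\<close> be the isotropy group of \<open>cos (j0 t / m)\<close>. The \<open>j0\<close>-th modes fixed by \<open>H\<close> are the multiples
  \<open>cos (j0 t / m) v\<close> with \<open>v\<close> in \<open>V\<close>, on which the determinant is the characteristic polynomial of \<open>A\<close>; it changes
  sign at an eigenvalue of odd multiplicity. A subgroup properly containing a conjugate of \<open>H\<close> fixes no
  \<open>j0\<close>-th mode, so the coefficients above \<open>(H)\<close> do not jump and the coefficient of \<open>(H)\<close> jumps by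
  \<open>\<plusminus>2 / |W(H)|\<close>, where \<open>|W(H)|\<close> is \<open>1\<close> or \<open>2\<close>.

  Even functions form an invariant subspace for the nonlinear problem as well, and there the same
  sign change of the degree forces bifurcation. As \<open>L\<^sup>-\<^sup>1\<close> gains two derivatives, it suffices to find small solutions of
  the integral equation among continuous functions.\<close>

section \<open>Degrees in finite dimensions\<close>

text \<open>On the whole space the modes of a frequency j0 > 0 form two copies of V, cosines and
  sines, so their determinant is a square and the ordinary degree does not see \<mu>0; hence both
  conclusions pass to a subspace that keeps one copy. Degree and invariant are given by description
  operators and a conjugacy class by a chosen representative, so uniqueness of the described values
  and independence of that choice belong to the proof. Compactness has one source: L^-1 is
  convolution with the periodic Green kernel, which is symmetric and hence a uniform limit of cosine
  sums. In operator norm L^-1 is thus a limit of combinations of the Fourier projections, which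
  commute with A and with the group. On the modes beyond some N the compact part of the operator is
  a contraction with constant 1/2, and this yields the lower bounds behind the homotopies as well as
  solvability. Solvability is proved by a fixed point argument that uses completeness; it therefore
  runs in the continuous periodic functions, and the C^2 statements follow by regularity.\<close>

text \<open>Three isomorphisms carry the top homology of the sphere to that of the equator: passage
  to (sphere, lower hemisphere), excision from (upper hemisphere, equator), and the boundary map. A
  map preserving both closed hemispheres commutes with all three, so it acts by the same integer at
  both ends.\<close>

lemma suspension_degree:
  assumes cf: "continuous_map (nsphere p) (nsphere p) f"
    and cF: "continuous_map (nsphere (Suc p)) (nsphere (Suc p)) F"
    and ext: "\<And>x. x \<in> topspace (nsphere p) \<Longrightarrow> F x = f x"
    and up: "\<And>x. x \<in> topspace (nsphere (Suc p)) \<Longrightarrow> x (Suc p) \<ge> 0 \<Longrightarrow> F x (Suc p) \<ge> 0"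
    and lo: "\<And>x. x \<in> topspace (nsphere (Suc p)) \<Longrightarrow> x (Suc p) \<le> 0 \<Longrightarrow> F x (Suc p) \<le> 0"
  shows "Brouwer_degree2 (Suc p) F = Brouwer_degree2 p f"
proof -
  define S where "S = nsphere (Suc p)"
  define U where "U = subtopology S {x. x (Suc p) \<ge> 0}"
  define E where "E = {x::nat \<Rightarrow> real. x (Suc p) = 0}"
  define D where "D = {x::nat \<Rightarrow> real. x (Suc p) \<le> 0}"
  define G where "G = reduced_homology_group (int p) (nsphere p)"
  define G1 where "G1 = reduced_homology_group (int (Suc p)) S"
  \<comment> \<open>The half spaces used here are not confined to the sphere. The value 0 outside
    the sphere makes \<open>F'\<close> preserve them as sets of sequences, as naturality of relative
    homology requires.\<close>
  define F' where "F' = (\<lambda>x. if x \<in> topspace S then F x else (\<lambda>_. 0))"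
  have cF': "continuous_map S S F'"
    using cF unfolding S_def[symmetric] by (rule continuous_map_eq) (simp add: F'_def)
  have degF: "Brouwer_degree2 (Suc p) F' = Brouwer_degree2 (Suc p) F"
    by (rule Brouwer_degree2_eq) (simp add: F'_def S_def)
  have eqt: "subtopology U E = nsphere p"
  proof -
    have "{x. 0 \<le> x (Suc p)} \<inter> {x. x (Suc p) = 0} = {x. x (Suc p) = (0::real)}" by auto
    then show ?thesis
      unfolding U_def S_def E_def subtopology_subtopology
      by (simp add: subtopology_nsphere_equator)
  qed
  have FU: "F' \<in> {x. x (Suc p) \<ge> 0} \<rightarrow> {x. x (Suc p) \<ge> 0}" and FD: "F' \<in> D \<rightarrow> D"
    using up lo by (simp_all add: F'_def D_def S_def)
  have FE: "F' \<in> E \<rightarrow> E"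
  proof
    fix x assume "x \<in> E"
    then have "F' x (Suc p) \<ge> 0" "F' x (Suc p) \<le> 0" using FU FD by (auto simp: E_def D_def)
    then show "F' x \<in> E" by (simp add: E_def)
  qed
  have cU: "continuous_map U U F'"
    unfolding U_def
  proof (rule continuous_map_into_subtopology[OF continuous_map_from_subtopology[OF cF']])
    show "F' \<in> topspace (subtopology S {x. 0 \<le> x (Suc p)}) \<rightarrow> {x. 0 \<le> x (Suc p)}"
      using FU by auto
  qed
  let ?H = "hom_boundary (int (Suc p)) U E"
  let ?G2 = "relative_homology_group (int (Suc p)) U E"
  let ?H2 = "relative_homology_group (int (Suc p)) S D"
  let ?i = "hom_induced (int (Suc p)) U E S D id"
  let ?j = "hom_induced (int (Suc p)) S {} S D id"
  let ?F2 = "hom_induced (int (Suc p)) U E U E F'"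
  let ?FD = "hom_induced (int (Suc p)) S D S D F'"
  let ?FS = "hom_induced (int (Suc p)) S {} S {} F'"
  let ?f = "hom_induced (int p) (nsphere p) {} (nsphere p) {} F'"
  have isoH: "?H \<in> Group.iso ?G2 G"
    using iso_upper_hemisphere_reduced_homology_group[of "int p" p]
    by (simp add: U_def E_def S_def G_def add.commute)
  have isoi: "?i \<in> Group.iso ?G2 ?H2"
    unfolding U_def E_def S_def D_def by (rule iso_relative_homology_group_upper_hemisphere)
  have isoj: "?j \<in> Group.iso G1 ?H2"
    unfolding S_def D_def G1_def by (rule iso_reduced_homology_group_lower_hemisphere) simp
  have degf: "Brouwer_degree2 p F' = Brouwer_degree2 p f"
  proof (rule Brouwer_degree2_eq)
    fix x assume x: "x \<in> topspace (nsphere p)"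
    then have "x \<in> topspace S"
      by (simp flip: eqt add: U_def)
    then show "F' x = f x" using ext[OF x] by (simp add: F'_def)
  qed
  have cfF: "continuous_map (nsphere p) (nsphere p) F'"
    unfolding eqt[symmetric]
  proof (rule continuous_map_into_subtopology[OF continuous_map_from_subtopology[OF cU]])
    show "F' \<in> topspace (subtopology U E) \<rightarrow> E" using FE by auto
  qed
  have nat1: "?H (?F2 c) = ?f (?H c)" for c
    using fun_cong[OF naturality_hom_induced[OF cU FE, of "int (Suc p)"], of c]
    by (simp add: eqt)
  have nat2: "?FD (?i c) = ?i (?F2 c)" for c
  proof -
    have 1: "continuous_map U S id" by (simp add: U_def continuous_map_from_subtopology)
    have 2: "id \<in> E \<rightarrow> D" by (auto simp: E_def D_def)
    have "?FD \<circ> ?i = hom_induced (int (Suc p)) U E S D (F' \<circ> id)"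
      by (rule hom_induced_compose[OF 1 2 cF' FD, symmetric])
    moreover have "?i \<circ> ?F2 = hom_induced (int (Suc p)) U E S D (id \<circ> F')"
      by (rule hom_induced_compose[OF cU FE 1 2, symmetric])
    ultimately show ?thesis by (metis comp_apply comp_id id_comp)
  qed
  have nat3: "?FD (?j c) = ?j (?FS c)" for c
  proof -
    have 1: "continuous_map S S id" "id \<in> {} \<rightarrow> D" "F' \<in> {} \<rightarrow> {}" by auto
    have "?FD \<circ> ?j = hom_induced (int (Suc p)) S {} S D (F' \<circ> id)"
      by (rule hom_induced_compose[OF 1(1,2) cF' FD, symmetric])
    moreover have "?j \<circ> ?FS = hom_induced (int (Suc p)) S {} S D (id \<circ> F')"
      by (rule hom_induced_compose[OF cF' 1(3,1,2), symmetric])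
    ultimately show ?thesis by (metis comp_apply comp_id id_comp)
  qed
  let ?d = "Brouwer_degree2 p F'"
  have "?FS c = c [^]\<^bsub>G1\<^esub> ?d" if c: "c \<in> carrier G1" for c
  proof -
    interpret G: group G by (simp add: G_def)
    interpret G1: group G1 by (simp add: G1_def)
    interpret G2: group ?G2 by simp
    interpret H2: group ?H2 by simp
    interpret H: group_hom ?G2 G ?H
      using isoH by unfold_locales (rule iso_imp_homomorphism)
    interpret i: group_hom ?G2 ?H2 ?i
      using isoi by unfold_locales (rule iso_imp_homomorphism)
    interpret j: group_hom G1 ?H2 ?j
      using isoj by unfold_locales (rule iso_imp_homomorphism)
    have bi: "bij_betw ?i (carrier ?G2) (carrier ?H2)" using isoi unfolding iso_def by blast
    have iH: "inj_on ?H (carrier ?G2)" using isoH unfolding iso_def bij_betw_def by blast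
    have ij: "inj_on ?j (carrier G1)" using isoj unfolding iso_def bij_betw_def by blast
    have FSc: "?FS c \<in> carrier G1"
      using c unfolding G1_def by (simp add: hom_induced_reduced)
    \<comment> \<open>Diagram chase: \<open>c\<close> is matched with a class \<open>e\<close> of
      (upper hemisphere, equator), where the action is read off at the equator.\<close>
    have "?j c \<in> ?i ` carrier ?G2"
      unfolding bij_betw_imp_surj_on[OF bi] by (rule j.hom_closed[OF c])
    then obtain e where e': "?j c = ?i e" "e \<in> carrier ?G2" by (rule imageE)
    note e = e'(2) e'(1)[symmetric]
    have F2e: "?F2 e \<in> carrier ?G2" by (rule hom_induced_carrier)
    have "?H (?F2 e) = ?H e [^]\<^bsub>G\<^esub> ?d"
      unfolding nat1 unfolding G_def
      by (rule Brouwer_degree2) (rule H.hom_closed[OF e(1), unfolded G_def])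
    also have "\<dots> = ?H (e [^]\<^bsub>?G2\<^esub> ?d)" by (rule H.hom_int_pow[OF e(1), symmetric])
    finally have "?F2 e = e [^]\<^bsub>?G2\<^esub> ?d"
      using inj_onD[OF iH _ F2e G2.int_pow_closed[OF e(1)]] by blast
    then have "?j (?FS c) = ?i (e [^]\<^bsub>?G2\<^esub> ?d)"
      using nat2[of e] nat3[of c] e(2) by simp
    also have "\<dots> = ?j (c [^]\<^bsub>G1\<^esub> ?d)"
      unfolding i.hom_int_pow[OF e(1)] j.hom_int_pow[OF c] e(2) ..
    finally show ?thesis
      using inj_onD[OF ij _ FSc G1.int_pow_closed[OF c]] by blast
  qed
  then have "Brouwer_degree2 (Suc p) F' = ?d"
    using cF' by (intro Brouwer_degree2_unique) (simp_all add: S_def G1_def)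
  then show ?thesis by (simp add: degf degF)
qed

section \<open>Coordinate spheres, bases and coordinates\<close>

text \<open>For n > 0 this is the carrier of \<open>nsphere (n - 1)\<close>, as a plain set of
  sequences, so that \<open>continuous_on\<close> and compactness in the product topology
  apply.\<close>

definition usph :: "nat \<Rightarrow> (nat \<Rightarrow> real) set"
  where "usph n = {x. L2_set x {..<n} = 1 \<and> (\<forall>i\<ge>n. x i = 0)}"

lemma nsphere_eq_usph: "nsphere p = top_of_set (usph (Suc p))"
proof -
  have "{x. (\<Sum>i\<le>p. (x i)\<^sup>2) = 1 \<and> (\<forall>i>p. x i = 0)} = usph (Suc p)"
    by (auto simp: usph_def L2_set_def lessThan_Suc_atMost Suc_le_eq)
  then show ?thesis
    by (simp add: nsphere euclidean_product_topology)
qed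

lemma topspace_nsphere_usph: "topspace (nsphere p) = usph (Suc p)"
  by (simp add: nsphere_eq_usph)

definition nrm :: "nat \<Rightarrow> (nat \<Rightarrow> real) \<Rightarrow> nat \<Rightarrow> real"
  where "nrm n y = (\<lambda>i. y i / L2_set y {..<n})"

lemma L2_set_lessThan_pos:
  fixes y :: "nat \<Rightarrow> real"
  assumes "i < n" "y i \<noteq> 0" shows "L2_set y {..<n} > 0"
  using assms by (metis L2_set_eq_0_iff L2_set_nonneg finite_lessThan lessThan_iff order_less_le)

lemma nrm_in_usph:
  assumes "\<And>i. i \<ge> n \<Longrightarrow> y i = 0" "y \<noteq> (\<lambda>_. 0)"
  shows "nrm n y \<in> usph n"
proof -
  obtain i where i: "y i \<noteq> 0" using assms(2) by blast
  then have "i < n" using assms(1) not_le by blast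
  have pos: "L2_set y {..<n} > 0" using \<open>i < n\<close> i by (rule L2_set_lessThan_pos)
  have "L2_set (nrm n y) {..<n} = L2_set (\<lambda>i. (1 / L2_set y {..<n}) * y i) {..<n}"
    by (simp add: nrm_def)
  also have "\<dots> = 1 / L2_set y {..<n} * L2_set y {..<n}"
    using pos by (intro L2_set_right_distrib[symmetric]) simp
  finally show ?thesis using pos assms(1) by (simp add: usph_def nrm_def)
qed

lemma nrm_scale:
  assumes "c > 0" shows "nrm n (\<lambda>i. c * y i) = nrm n y"
proof -
  have "L2_set (\<lambda>i. c * y i) {..<n} = c * L2_set y {..<n}"
    using assms by (intro L2_set_right_distrib[symmetric]) simp
  then show ?thesis using assms by (simp add: nrm_def)
qed

lemma nrm_usph: "x \<in> usph n \<Longrightarrow> nrm n x = x"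
  by (simp add: usph_def nrm_def)

lemma usph_nonzero: "x \<in> usph n \<Longrightarrow> x \<noteq> (\<lambda>_. 0)"
  by (auto simp: usph_def L2_set_def)

text \<open>Normalisation turns a zero-free homotopy into one of the sphere; continuity into the
  product topology is checked coordinate by coordinate. With a constant homotopy this also gives
  plain continuity of a normalised map.\<close>

lemma nrm_homotopic:
  fixes h :: "real \<Rightarrow> (nat \<Rightarrow> real) \<Rightarrow> nat \<Rightarrow> real"
  assumes cont: "\<And>i. i < Suc p \<Longrightarrow> continuous_on ({0..1} \<times> usph (Suc p)) (\<lambda>z. h (fst z) (snd z) i)"
    and z: "\<And>s x i. s \<in> {0..1} \<Longrightarrow> x \<in> usph (Suc p) \<Longrightarrow> i \<ge> Suc p \<Longrightarrow> h s x i = 0"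
    and nz: "\<And>s x. s \<in> {0..1} \<Longrightarrow> x \<in> usph (Suc p) \<Longrightarrow> h s x \<noteq> (\<lambda>_. 0)"
  shows "homotopic_with (\<lambda>x. True) (nsphere p) (nsphere p) (\<lambda>x. nrm (Suc p) (h 0 x)) (\<lambda>x. nrm (Suc p) (h 1 x))"
proof -
  let ?S = "usph (Suc p)"
  let ?H = "\<lambda>z::real \<times> (nat \<Rightarrow> real). nrm (Suc p) (h (fst z) (snd z))"
  have pos: "L2_set (h s x) {..<Suc p} > 0" if sx: "s \<in> {0..1}" "x \<in> ?S" for s x
  proof -
    obtain i where "h s x i \<noteq> 0" using nz[OF sx] by blast
    moreover from this have "i < Suc p" using z[OF sx] not_le by blast
    ultimately show ?thesis by (intro L2_set_lessThan_pos)
  qed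
  have "continuous_on ({0..1} \<times> ?S) ?H"
  proof (rule continuous_on_coordinatewise_then_product)
    fix i
    show "continuous_on ({0..1} \<times> ?S) (\<lambda>z. ?H z i)"
    proof (cases "i < Suc p")
      case True
      have "continuous_on ({0..1} \<times> ?S) (\<lambda>z. L2_set (h (fst z) (snd z)) {..<Suc p})"
        unfolding L2_set_def
        by (intro continuous_on_real_sqrt continuous_on_sum continuous_on_power cont) simp
      then show ?thesis
        unfolding nrm_def using pos cont[OF True]
        by (intro continuous_on_divide) (auto simp: less_le)
    next
      case False
      then have "continuous_on ({0..1} \<times> ?S) (\<lambda>z. 0::real)" "\<And>y. y \<in> {0..1} \<times> ?S \<Longrightarrow> ?H y i = 0"
        using z by (auto simp: nrm_def)
      then show ?thesis by (subst continuous_on_cong[OF refl, where g = "\<lambda>z. 0"]) auto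
    qed
  qed
  moreover have "?H ` ({0..1} \<times> ?S) \<subseteq> ?S"
    using z nz by (auto intro!: nrm_in_usph)
  ultimately have "continuous_map (prod_topology (top_of_set {0..1}) (nsphere p)) (nsphere p) ?H"
    by (simp add: nsphere_eq_usph prod_topology_subtopology_eu image_subset_iff_funcset)
  then show "homotopic_with (\<lambda>x. True) (nsphere p) (nsphere p) (\<lambda>x. nrm (Suc p) (h 0 x)) (\<lambda>x. nrm (Suc p) (h 1 x))"
    unfolding homotopic_with_def by (intro exI[of _ ?H]) auto
qed

text \<open>Kernel and range of the linear combination map carry all the information, and this is
  the form in which bases are constructed below.\<close>

lemma is_basis_iff:
  "is_basis b n W \<longleftrightarrow> (\<forall>x. lin_comb b n x = 0 \<longrightarrow> (\<forall>i<n. x i = 0)) \<and> W = range (lin_comb b n)"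
proof
  assume "is_basis b n W"
  then have b: "inj_on b {..<n}" "independent (b ` {..<n})" "span (b ` {..<n}) = W"
    by (auto simp: is_basis_def)
  have s: "lin_comb b n (\<lambda>i. u (b i)) = (\<Sum>v\<in>b ` {..<n}. u v *\<^sub>R v)" for u
    by (simp add: lin_comb_def sum.reindex[OF b(1)])
  have "\<forall>i<n. x i = 0" if "lin_comb b n x = 0" for x
  proof -
    define u where "u = (\<lambda>v. x (inv_into {..<n} b v))"
    have "(\<Sum>v\<in>b ` {..<n}. u v *\<^sub>R v) = lin_comb b n x"
      unfolding s[symmetric] lin_comb_def using b(1) by (intro sum.cong) (simp_all add: u_def inv_into_f_f)
    then have "\<forall>v\<in>b ` {..<n}. u v = 0"
      using b(2) that unfolding dependent_finite[OF finite_imageI[OF finite_lessThan]] by auto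
    then show ?thesis using b(1) by (simp add: u_def inv_into_f_f)
  qed
  moreover have "W = range (lin_comb b n)"
  proof
    show "W \<subseteq> range (lin_comb b n)"
    proof
      fix w assume "w \<in> W"
      then obtain u where "w = (\<Sum>v\<in>b ` {..<n}. u v *\<^sub>R v)"
        unfolding b(3)[symmetric] by (auto simp: span_finite)
      then show "w \<in> range (lin_comb b n)" unfolding s[symmetric] by blast
    qed
    show "range (lin_comb b n) \<subseteq> W"
      unfolding b(3)[symmetric] lin_comb_def by (auto intro!: span_sum intro: span_scale span_base)
  qed
  ultimately show "(\<forall>x. lin_comb b n x = 0 \<longrightarrow> (\<forall>i<n. x i = 0)) \<and> W = range (lin_comb b n)" by blast
next
  assume r: "(\<forall>x. lin_comb b n x = 0 \<longrightarrow> (\<forall>i<n. x i = 0)) \<and> W = range (lin_comb b n)"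
  have inj: "inj_on b {..<n}"
  proof (rule inj_onI, rule ccontr)
    fix i j assume ij: "i \<in> {..<n}" "j \<in> {..<n}" "b i = b j" "i \<noteq> j"
    define x :: "nat \<Rightarrow> real" where "x = (\<lambda>k. (if k = i then 1 else 0) - (if k = j then 1 else 0))"
    have "lin_comb b n x = b i - b j"
      using ij by (simp add: lin_comb_def x_def scaleR_left_diff_distrib sum_subtractf if_distrib[of "\<lambda>c. c *\<^sub>R _"] cong: if_cong)
    then have "x i = 0" using r ij by simp
    then show False using ij by (simp add: x_def)
  qed
  have s: "lin_comb b n (\<lambda>i. u (b i)) = (\<Sum>v\<in>b ` {..<n}. u v *\<^sub>R v)" for u
    by (simp add: lin_comb_def sum.reindex[OF inj])
  have "independent (b ` {..<n})"
  proof
    assume "dependent (b ` {..<n})"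
    then obtain u where "\<exists>v\<in>b ` {..<n}. u v \<noteq> 0" "(\<Sum>v\<in>b ` {..<n}. u v *\<^sub>R v) = 0"
      unfolding dependent_finite[OF finite_imageI[OF finite_lessThan]] by blast
    then show False using r s[of u] by auto
  qed
  moreover have "span (b ` {..<n}) = W"
  proof
    show "span (b ` {..<n}) \<subseteq> W"
    proof
      fix w assume "w \<in> span (b ` {..<n})"
      then obtain u where "w = (\<Sum>v\<in>b ` {..<n}. u v *\<^sub>R v)" by (auto simp: span_finite)
      then show "w \<in> W" unfolding s[symmetric] using r by blast
    qed
    show "W \<subseteq> span (b ` {..<n})"
      using r unfolding lin_comb_def by (auto intro!: span_sum intro: span_scale span_base)
  qed
  ultimately show "is_basis b n W" using inj by (simp add: is_basis_def)
qed

lemma is_basis_dim: "is_basis b n W \<Longrightarrow> dim W = n"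
  by (metis card_image card_lessThan dim_span_eq_card_independent is_basis_def)

lemma fin_dim_subspace_basis:
  assumes "fin_dim_subspace W" obtains b where "is_basis b (dim W) W"
proof -
  obtain B where B: "finite B" "W = span B" using assms by (auto simp: fin_dim_subspace_def)
  obtain C where C: "C \<subseteq> W" "independent C" "W \<subseteq> span C" "card C = dim W" by (rule basis_exists)
  have fC: "finite C" using independent_span_bound[OF B(1) C(2)] C(1) B(2) by simp
  have "W = span C" using C B by (metis span_mono span_span subset_antisym)
  moreover obtain b where "bij_betw b {..<dim W} C"
    using bij_betw_from_nat_into_finite[OF fC] C(4) by metis
  ultimately have "is_basis b (dim W) W"
    using C(2) by (simp add: is_basis_def bij_betw_def)
  then show thesis by (rule that)
qed

text \<open>Coordinates padded with 0 from index n on, the sequences from which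
  \<open>sphere_map\<close> is built.\<close>

definition crd :: "(nat \<Rightarrow> 'a::real_vector) \<Rightarrow> nat \<Rightarrow> 'a \<Rightarrow> nat \<Rightarrow> real"
  where "crd b n w = (\<lambda>i. if i < n then representation (b ` {..<n}) w (b i) else 0)"

lemma lin_comb_crd:
  assumes "is_basis b n W" "w \<in> W" shows "lin_comb b n (crd b n w) = w"
proof -
  have b: "inj_on b {..<n}" "independent (b ` {..<n})" "span (b ` {..<n}) = W"
    using assms(1) by (auto simp: is_basis_def)
  have "lin_comb b n (crd b n w) = (\<Sum>v\<in>b ` {..<n}. representation (b ` {..<n}) w v *\<^sub>R v)"
    by (simp add: lin_comb_def crd_def sum.reindex[OF b(1)])
  also have "\<dots> = w" using b assms(2) by (intro real_vector.sum_representation_eq) auto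
  finally show ?thesis .
qed

lemma lin_comb_diff: "lin_comb b n (\<lambda>i. x i - y i) = lin_comb b n x - lin_comb b n y"
  by (simp add: lin_comb_def scaleR_left_diff_distrib sum_subtractf)

lemma lin_comb_scale: "lin_comb b n (\<lambda>i. c * x i) = c *\<^sub>R lin_comb b n x"
  by (simp add: lin_comb_def scaleR_sum_right)

lemma lin_comb_in: "is_basis b n W \<Longrightarrow> lin_comb b n x \<in> W"
  by (simp add: is_basis_iff)

lemma lin_comb_inj:
  assumes "is_basis b n W" "lin_comb b n x = lin_comb b n y" "i < n" shows "x i = y i"
proof -
  have "lin_comb b n (\<lambda>i. x i - y i) = 0" using assms(2) by (simp add: lin_comb_diff)
  then have "\<forall>i<n. x i - y i = 0" using assms(1) unfolding is_basis_iff by blast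
  then show ?thesis using assms(3) by simp
qed

lemma crd_lin_comb:
  assumes "is_basis b n W" "i < n" shows "crd b n (lin_comb b n x) i = x i"
  using lin_comb_inj[OF assms(1) lin_comb_crd[OF assms(1) lin_comb_in[OF assms(1)]] assms(2)] .

lemma crd_outside: "i \<ge> n \<Longrightarrow> crd b n w i = 0"
  by (simp add: crd_def)

lemma crd_unique:
  assumes "is_basis b n W" "lin_comb b n x = w" "\<And>i. i \<ge> n \<Longrightarrow> x i = 0" shows "crd b n w = x"
proof
  fix i show "crd b n w i = x i"
    using crd_lin_comb[OF assms(1), of i x] assms(2,3) by (cases "i < n") (auto simp: crd_outside)
qed

lemma subspace_basis: "is_basis b n W \<Longrightarrow> subspace W"
  unfolding is_basis_def using subspace_span by blast

lemma crd_scale: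
  assumes "is_basis b n W" "w \<in> W" shows "crd b n (c *\<^sub>R w) = (\<lambda>i. c * crd b n w i)"
  by (rule crd_unique[OF assms(1)]) (simp_all add: lin_comb_scale lin_comb_crd[OF assms] crd_outside)

lemma crd_diff:
  assumes "is_basis b n W" "v \<in> W" "w \<in> W" shows "crd b n (v - w) = (\<lambda>i. crd b n v i - crd b n w i)"
  by (rule crd_unique[OF assms(1)]) (simp_all add: lin_comb_diff lin_comb_crd[OF assms(1)] assms crd_outside)

lemma crd_nonzero:
  assumes "is_basis b n W" "w \<in> W" "w \<noteq> 0" shows "crd b n w \<noteq> (\<lambda>_. 0)"
proof
  assume "crd b n w = (\<lambda>_. 0)"
  then have "lin_comb b n (\<lambda>_. 0) = w" using lin_comb_crd[OF assms(1,2)] by simp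
  then show False using assms(3) by (simp add: lin_comb_def)
qed

lemma lin_comb_nonzero:
  assumes "is_basis b n W" "x \<in> usph n" shows "lin_comb b n x \<noteq> 0"
proof
  assume "lin_comb b n x = 0"
  then have "\<forall>i<n. x i = 0" using assms(1) by (simp add: is_basis_iff)
  then have "x = (\<lambda>_. 0)" using assms(2) by (intro ext) (auto simp: usph_def not_less[symmetric])
  then show False using usph_nonzero[OF assms(2)] by simp
qed

lemma abs_le_L2_set:
  fixes x :: "nat \<Rightarrow> real"
  assumes "i < n" shows "\<bar>x i\<bar> \<le> L2_set x {..<n}"
proof -
  have "(x i)\<^sup>2 \<le> (\<Sum>j<n. (x j)\<^sup>2)" using assms by (intro member_le_sum) auto
  then show ?thesis unfolding L2_set_def by (metis real_sqrt_abs real_sqrt_le_iff)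
qed

text \<open>A closed subset of a product of intervals [-1, 1], which is compact by
  Tychonoff.\<close>

lemma compact_usph: "compact (usph n)"
proof -
  have "compactin (product_topology (\<lambda>i::nat. euclidean) UNIV) (PiE UNIV (\<lambda>i. {-1..1::real}))"
    unfolding compactin_PiE by simp
  then have "compact (PiE UNIV (\<lambda>i::nat. {-1..1::real}))"
    by (simp add: euclidean_product_topology)
  moreover have "closed (usph n)"
  proof -
    have "usph n = {x. L2_set x {..<n} = 1} \<inter> (\<Inter>i\<in>{n..}. {x. x i = 0})"
      by (auto simp: usph_def)
    moreover have "closed {x::nat \<Rightarrow> real. L2_set x {..<n} = 1}"
      unfolding L2_set_def
      by (intro closed_Collect_eq continuous_on_real_sqrt continuous_on_sum continuous_on_power
          continuous_on_product_coordinates continuous_on_const)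
    moreover have "closed {x::nat \<Rightarrow> real. x i = 0}" for i
      by (intro closed_Collect_eq continuous_on_product_coordinates continuous_on_const)
    ultimately show ?thesis by (auto intro!: closed_Int closed_INT)
  qed
  moreover have "usph n \<subseteq> PiE UNIV (\<lambda>i::nat. {-1..1::real})"
  proof
    fix x assume x: "x \<in> usph n"
    have "\<bar>x i\<bar> \<le> 1" for i
    proof (cases "i < n")
      case True
      then show ?thesis using x abs_le_L2_set[of i n x] by (simp add: usph_def)
    qed (use x in \<open>simp add: usph_def\<close>)
    then show "x \<in> PiE UNIV (\<lambda>i::nat. {-1..1::real})" by (auto simp: abs_le_iff minus_le_iff)
  qed
  ultimately show ?thesis by (metis compact_Int_closed inf.absorb_iff2)
qed

lemma continuous_on_lin_comb:
  fixes b :: "nat \<Rightarrow> 'a::real_normed_vector"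
  shows "continuous_on S (lin_comb b n)"
proof -
  have "continuous_on S (\<lambda>x. \<Sum>i<n. x i *\<^sub>R b i)"
    by (intro continuous_on_sum continuous_on_scaleR continuous_on_const
        continuous_on_subset[OF continuous_on_product_coordinates]) auto
  then show ?thesis by (simp add: lin_comb_def[abs_def])
qed

text \<open>Equivalence of norms on a finite-dimensional subspace of any normed space: the norm is
  continuous and positive on the compact coordinate sphere, and its minimum d there gives the
  constant 1 / d.\<close>

lemma coordinate_bound:
  fixes b :: "nat \<Rightarrow> 'a::real_normed_vector"
  assumes b: "is_basis b n W"
  obtains C where "C > 0" "\<And>x. L2_set x {..<n} \<le> C * norm (lin_comb b n x)"
proof (cases "n = 0")
  case True
  then show thesis by (intro that[of 1]) (simp_all add: L2_set_def)
next
  case False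
  have "(\<lambda>i. if i = 0 then 1 else 0) \<in> usph n"
  proof -
    have "(\<Sum>i<n. (if i = 0 then 1 else (0::real))\<^sup>2) = (\<Sum>i<n. if i = 0 then 1 else 0)"
      by (intro sum.cong) auto
    then show ?thesis using False by (simp add: usph_def L2_set_def)
  qed
  then have ne: "usph n \<noteq> {}" by blast
  obtain x0 where x0: "x0 \<in> usph n" "\<And>x. x \<in> usph n \<Longrightarrow> norm (lin_comb b n x0) \<le> norm (lin_comb b n x)"
    using continuous_attains_inf[OF compact_usph ne, of "\<lambda>x. norm (lin_comb b n x)"]
      continuous_on_norm[OF continuous_on_lin_comb] by blast
  define d where "d = norm (lin_comb b n x0)"
  have d: "d > 0" using lin_comb_nonzero[OF b x0(1)] by (simp add: d_def)
  have "L2_set x {..<n} \<le> 1 / d * norm (lin_comb b n x)" for x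
  proof (cases "L2_set x {..<n} = 0")
    case True
    then show ?thesis using d by simp
  next
    case False
    define y where "y = (\<lambda>i. if i < n then x i else 0)"
    have Ly: "L2_set y {..<n} = L2_set x {..<n}" by (rule L2_set_cong) (auto simp: y_def)
    have pos: "L2_set x {..<n} > 0" using False by (simp add: less_le L2_set_nonneg)
    have "nrm n y \<in> usph n"
    proof (rule nrm_in_usph)
      show "y \<noteq> (\<lambda>_. 0)"
      proof
        assume "y = (\<lambda>_. 0)"
        then show False using pos Ly by (simp add: L2_set_def)
      qed
    qed (simp add: y_def)
    then have "d \<le> norm (lin_comb b n (nrm n y))" unfolding d_def by (rule x0)
    also have "nrm n y = (\<lambda>i. (1 / L2_set x {..<n}) * y i)" by (simp add: nrm_def Ly)
    also have "lin_comb b n \<dots> = (1 / L2_set x {..<n}) *\<^sub>R lin_comb b n x"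
      unfolding lin_comb_scale by (simp add: lin_comb_def y_def)
    finally show ?thesis using d pos by (simp add: field_simps)
  qed
  then show thesis using d by (intro that[of "1 / d"]) simp_all
qed

lemma continuous_on_crd:
  fixes b :: "nat \<Rightarrow> 'a::real_normed_vector"
  assumes b: "is_basis b n W" shows "continuous_on W (\<lambda>w. crd b n w i)"
proof (cases "i < n")
  case True
  obtain C where C: "C > 0" "\<And>x. L2_set x {..<n} \<le> C * norm (lin_comb b n x)"
    using coordinate_bound[OF b] by blast
  have "C-lipschitz_on W (\<lambda>w. crd b n w i)"
  proof (rule lipschitz_onI)
    fix v w assume vw: "v \<in> W" "w \<in> W"
    have "\<bar>crd b n (v - w) i\<bar> \<le> L2_set (crd b n (v - w)) {..<n}"
      by (rule abs_le_L2_set[OF True])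
    also have "\<dots> \<le> C * norm (lin_comb b n (crd b n (v - w)))" by (rule C)
    also have "lin_comb b n (crd b n (v - w)) = v - w"
      using b vw by (intro lin_comb_crd subspace_diff subspace_basis)
    finally show "dist (crd b n v i) (crd b n w i) \<le> C * dist v w"
      by (simp add: crd_diff[OF b vw] dist_norm)
  qed (use C in simp)
  then show ?thesis by (rule lipschitz_on_continuous_on)
next
  case False
  then show ?thesis by (simp add: crd_outside)
qed

lemma sphere_map_nrm:
  "sphere_map b n F x = nrm n (crd b n (F (lin_comb b n x /\<^sub>R norm (lin_comb b n x))))"
  by (simp add: sphere_map_def Let_def nrm_def crd_def)

text \<open>A basis identifies the sphere of \<open>W\<close> with the coordinate sphere, and a
  zero-free homotopy becomes a homotopy of sphere maps. It is stated for nonlinear maps because the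
  bifurcation argument applies it to them.\<close>

lemma ball_degree_homotopy:
  fixes W :: "'a::real_normed_vector set" and h :: "real \<Rightarrow> 'a \<Rightarrow> 'a"
  assumes W: "fin_dim_subspace W"
    and cont: "continuous_on ({0..1} \<times> (W \<inter> sphere 0 1)) (\<lambda>z. h (fst z) (snd z))"
    and into: "\<And>s x. s \<in> {0..1} \<Longrightarrow> x \<in> W \<Longrightarrow> norm x = 1 \<Longrightarrow> h s x \<in> W"
    and nz: "\<And>s x. s \<in> {0..1} \<Longrightarrow> x \<in> W \<Longrightarrow> norm x = 1 \<Longrightarrow> h s x \<noteq> 0"
  shows "brouwer_ball_degree W (h 0) = brouwer_ball_degree W (h 1)"
proof (cases "dim W")
  case 0
  then show ?thesis by (simp add: brouwer_ball_degree_def)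
next
  case (Suc p)
  define b where "b = (SOME b. is_basis b (dim W) W)"
  have b: "is_basis b (Suc p) W"
    unfolding b_def Suc[symmetric] using fin_dim_subspace_basis[OF W] by (metis someI)
  define v where "v = (\<lambda>x. lin_comb b (Suc p) x /\<^sub>R norm (lin_comb b (Suc p) x))"
  have v: "v x \<in> W" "norm (v x) = 1" if "x \<in> usph (Suc p)" for x
    using lin_comb_nonzero[OF b that] lin_comb_in[OF b] subspace_basis[OF b]
    by (auto simp: v_def subspace_scale)
  have cv: "continuous_on (usph (Suc p)) v"
    unfolding v_def using lin_comb_nonzero[OF b]
    by (intro continuous_on_scaleR continuous_on_inverse continuous_on_norm continuous_on_lin_comb) auto
  have "continuous_on ({0..1} \<times> usph (Suc p)) (\<lambda>z. (fst z, v (snd z)))"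
    by (intro continuous_on_Pair continuous_on_fst continuous_on_id
        continuous_on_compose2[OF cv continuous_on_snd[OF continuous_on_id]]) auto
  then have c1: "continuous_on ({0..1} \<times> usph (Suc p)) (\<lambda>z. h (fst z) (v (snd z)))"
    by (rule continuous_on_compose2[OF cont, where f = "\<lambda>z. (fst z, v (snd z))", simplified])
      (use v in auto)
  have "homotopic_with (\<lambda>x. True) (nsphere p) (nsphere p)
     (\<lambda>x. nrm (Suc p) (crd b (Suc p) (h 0 (v x)))) (\<lambda>x. nrm (Suc p) (crd b (Suc p) (h 1 (v x))))"
  proof (rule nrm_homotopic)
    fix i
    show "continuous_on ({0..1} \<times> usph (Suc p)) (\<lambda>z. crd b (Suc p) (h (fst z) (v (snd z))) i)"
      by (rule continuous_on_compose2[OF continuous_on_crd[OF b] c1]) (use v into in auto)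
  next
    fix s x assume "s \<in> {0..1::real}" "x \<in> usph (Suc p)"
    then show "crd b (Suc p) (h s (v x)) \<noteq> (\<lambda>_. 0)"
      using v into nz by (intro crd_nonzero[OF b]) auto
  qed (simp add: crd_outside)
  from Brouwer_degree2_homotopic[OF this] show ?thesis
    unfolding brouwer_ball_degree_def b_def[symmetric]
    unfolding Suc sphere_map_nrm[abs_def] v_def by simp
qed

section \<open>The degree of linear isomorphisms\<close>

text \<open>Linearity is asked for on \<open>W\<close> only, since inverses are built from
  coordinates of a subspace and are linear only there. Between spaces of equal finite dimension
  these are the linear isomorphisms.\<close>

definition lin_inj :: "'a::real_vector set \<Rightarrow> 'b::real_vector set \<Rightarrow> ('a \<Rightarrow> 'b) \<Rightarrow> bool"
  where "lin_inj W W' F \<longleftrightarrow> (\<forall>x\<in>W. \<forall>y\<in>W. F (x + y) = F x + F y) \<and>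
    (\<forall>c. \<forall>x\<in>W. F (c *\<^sub>R x) = c *\<^sub>R F x) \<and> F ` W \<subseteq> W' \<and> (\<forall>x\<in>W. F x = 0 \<longrightarrow> x = 0)"

lemma lin_injI:
  assumes "linear F" "\<And>x. x \<in> W \<Longrightarrow> F x \<in> W'" "\<And>x. x \<in> W \<Longrightarrow> F x = 0 \<Longrightarrow> x = 0"
  shows "lin_inj W W' F"
  using assms by (auto simp: lin_inj_def linear_add linear_scale)

lemma lin_inj_comp: "lin_inj W W' F \<Longrightarrow> lin_inj W' W'' G \<Longrightarrow> lin_inj W W'' (\<lambda>x. G (F x))"
  unfolding lin_inj_def by (auto simp: image_subset_iff)

lemma lin_inj_into: "lin_inj W W' F \<Longrightarrow> x \<in> W \<Longrightarrow> F x \<in> W'"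
  by (auto simp: lin_inj_def)

lemma lin_inj_id: "lin_inj W W (\<lambda>x. x)"
  by (simp add: lin_inj_def)

lemma lin_inj_cong:
  assumes "lin_inj W W' F" "\<And>x. x \<in> W \<Longrightarrow> G x = F x" "subspace W"
  shows "lin_inj W W' G"
  using assms unfolding lin_inj_def by (auto simp: subspace_add subspace_scale)

lemma lin_inj_lin_comb:
  assumes F: "lin_inj W W' F" and b: "is_basis b n W"
  shows "F (lin_comb b n x) = lin_comb (\<lambda>i. F (b i)) n x"
proof -
  have W: "subspace W" by (rule subspace_basis[OF b])
  have bW: "i < n \<Longrightarrow> b i \<in> W" for i
    using b unfolding is_basis_def by (metis image_eqI lessThan_iff span_base)
  have F0: "F 0 = 0"
    using F subspace_0[OF W] unfolding lin_inj_def by (metis scaleR_zero_left)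
  have "(\<Sum>i<k. x i *\<^sub>R b i) \<in> W \<and> F (\<Sum>i<k. x i *\<^sub>R b i) = (\<Sum>i<k. x i *\<^sub>R F (b i))" if "k \<le> n" for k
    using that
  proof (induction k)
    case 0
    then show ?case using F0 subspace_0[OF W] by simp
  next
    case (Suc k)
    then have k: "x k *\<^sub>R b k \<in> W" "b k \<in> W" using bW W by (auto simp: subspace_scale)
    moreover have "F (x k *\<^sub>R b k) = x k *\<^sub>R F (b k)" using F k by (simp add: lin_inj_def)
    ultimately show ?case using Suc F W by (simp add: subspace_add lin_inj_def)
  qed
  then show ?thesis by (simp add: lin_comb_def)
qed

text \<open>The images of the basis are independent; a vector of \<open>W'\<close> outside their
  span would make n + 1 independent vectors inside the span of n, against the exchange
  lemma.\<close>

lemma lin_inj_basis: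
  assumes F: "lin_inj W W' F" and b: "is_basis b n W" and b': "is_basis b' n W'"
  shows "is_basis (\<lambda>i. F (b i)) n W'"
proof -
  let ?b = "\<lambda>i. F (b i)"
  define S where "S = range (lin_comb ?b n)"
  have "\<forall>i<n. x i = 0" if x: "lin_comb ?b n x = 0" for x
  proof -
    have "lin_comb b n x = 0"
      using x F lin_comb_in[OF b] unfolding lin_inj_lin_comb[OF F b, symmetric] by (simp add: lin_inj_def)
    then show ?thesis using b by (simp add: is_basis_iff)
  qed
  then have S: "is_basis ?b n S" by (simp add: is_basis_iff S_def)
  have SW: "S \<subseteq> W'"
    unfolding S_def lin_inj_lin_comb[OF F b, symmetric] using lin_comb_in[OF b] F by (auto simp: lin_inj_def)
  have "W' \<subseteq> S"
  proof (rule ccontr)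
    assume "\<not> W' \<subseteq> S"
    then obtain w where w: "w \<in> W'" "w \<notin> S" by blast
    let ?B = "?b ` {..<n}"
    have B: "independent ?B" "span ?B = S" "inj_on ?b {..<n}" using S by (auto simp: is_basis_def)
    have BS: "?B \<subseteq> S" using span_superset[of ?B] unfolding B(2) .
    have "independent (insert w ?B)" using B w by (intro independent_insertI) auto
    moreover have "insert w ?B \<subseteq> span (b' ` {..<n})"
    proof -
      have "span (b' ` {..<n}) = W'" using b' by (simp add: is_basis_def)
      then show ?thesis using w(1) SW BS by auto
    qed
    ultimately have "card (insert w ?B) \<le> card (b' ` {..<n})"
      using independent_span_bound[of "b' ` {..<n}" "insert w ?B"] by simp
    moreover have "w \<notin> ?B" using BS w(2) by blast
    ultimately show False using card_image_le[of "{..<n}" b'] B(3) by (simp add: card_image)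
  qed
  then show ?thesis using S SW by auto
qed

lemma lin_inj_inverse:
  assumes F: "lin_inj W W' F" and b: "is_basis b n W" and b': "is_basis b' n W'"
  obtains G where "lin_inj W' W G" "\<And>x. x \<in> W \<Longrightarrow> G (F x) = x" "\<And>y. y \<in> W' \<Longrightarrow> F (G y) = y"
proof -
  define c where "c = (\<lambda>i. F (b i))"
  have c: "is_basis c n W'" unfolding c_def by (rule lin_inj_basis[OF assms])
  define G where "G = (\<lambda>y. lin_comb b n (crd c n y))"
  have FG: "F (G y) = y" if "y \<in> W'" for y
    unfolding G_def lin_inj_lin_comb[OF F b] c_def[symmetric] by (rule lin_comb_crd[OF c that])
  have inj: "x = y" if "x \<in> W" "y \<in> W" "F x = F y" for x y
  proof -
    have "x - y \<in> W" using that subspace_basis[OF b] by (simp add: subspace_diff)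
    moreover have "F (x - y) = 0"
    proof -
      have "F x = F (x - y) + F y" using F \<open>x - y \<in> W\<close> that by (metis diff_add_cancel lin_inj_def)
      then show ?thesis using that by simp
    qed
    ultimately show ?thesis using F unfolding lin_inj_def by (metis right_minus_eq)
  qed
  have GW: "G y \<in> W" for y unfolding G_def by (rule lin_comb_in[OF b])
  have W: "subspace W" "subspace W'" using subspace_basis b b' by blast+
  have GF: "G (F x) = x" if "x \<in> W" for x
    using that FG F GW by (intro inj) (auto simp: lin_inj_def)
  have "lin_inj W' W G"
    unfolding lin_inj_def
  proof (intro conjI ballI allI impI)
    fix x y assume "x \<in> W'" "y \<in> W'"
    then show "G (x + y) = G x + G y"
      using F FG GW W by (intro inj) (auto simp: lin_inj_def subspace_add)
  next
    fix c x assume "x \<in> W'"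
    then show "G (c *\<^sub>R x) = c *\<^sub>R G x"
      using F FG GW W by (intro inj) (auto simp: lin_inj_def subspace_scale)
  next
    fix x assume x: "x \<in> W'" "G x = 0"
    have "F 0 = 0" using F subspace_0[OF W(1)] unfolding lin_inj_def by (metis scaleR_zero_left)
    then show "x = 0" using FG[OF x(1)] x(2) by simp
  qed (use GW in auto)
  then show thesis using that FG GF by blast
qed

text \<open>Separate bases for source and target, in contrast to \<open>sphere_map\<close>, make a
  change of basis a composition. The argument is not rescaled to the unit sphere of
  \<open>W\<close>, because for a linear map a positive factor disappears in
  \<open>nrm\<close>.\<close>

definition smap :: "(nat \<Rightarrow> 'a::real_vector) \<Rightarrow> (nat \<Rightarrow> 'b::real_vector) \<Rightarrow> nat \<Rightarrow> ('a \<Rightarrow> 'b)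
    \<Rightarrow> (nat \<Rightarrow> real) \<Rightarrow> nat \<Rightarrow> real"
  where "smap b b' n F x = nrm n (crd b' n (F (lin_comb b n x)))"

lemma smap_nonzero:
  assumes "lin_inj W W' F" "is_basis b n W" "is_basis b' n W'" "x \<in> usph n"
  shows "crd b' n (F (lin_comb b n x)) \<noteq> (\<lambda>_. 0)"
  using assms lin_comb_nonzero[OF assms(2,4)] lin_comb_in[OF assms(2)]
  by (intro crd_nonzero[OF assms(3)]) (auto simp: lin_inj_def)

lemma smap_scale:
  assumes F: "lin_inj W W' F" and b: "is_basis b n W" and b': "is_basis b' n W'" and c: "c > 0"
    and y: "y \<in> W"
  shows "nrm n (crd b' n (F (c *\<^sub>R y))) = nrm n (crd b' n (F y))"
proof -
  have "F (c *\<^sub>R y) = c *\<^sub>R F y" "F y \<in> W'" using F y by (auto simp: lin_inj_def)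
  then show ?thesis by (simp add: crd_scale[OF b'] nrm_scale[OF c])
qed

lemma continuous_map_smap:
  fixes b :: "nat \<Rightarrow> 'a::real_normed_vector" and b' :: "nat \<Rightarrow> 'b::real_normed_vector"
  assumes F: "lin_inj W W' F" and b: "is_basis b (Suc p) W" and b': "is_basis b' (Suc p) W'"
  shows "continuous_map (nsphere p) (nsphere p) (smap b b' (Suc p) F)"
proof -
  have "homotopic_with (\<lambda>x. True) (nsphere p) (nsphere p)
      (\<lambda>x. nrm (Suc p) (crd b' (Suc p) (F (lin_comb b (Suc p) x))))
      (\<lambda>x. nrm (Suc p) (crd b' (Suc p) (F (lin_comb b (Suc p) x))))"
  proof (rule nrm_homotopic[where h = "\<lambda>s x. crd b' (Suc p) (F (lin_comb b (Suc p) x))"])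
    fix i
    have "continuous_on ({0..1::real} \<times> usph (Suc p)) (\<lambda>z. F (lin_comb b (Suc p) (snd z)))"
      unfolding lin_inj_lin_comb[OF F b]
      by (intro continuous_on_compose2[OF continuous_on_lin_comb[of UNIV]] continuous_on_snd continuous_on_id) auto
    then show "continuous_on ({0..1::real} \<times> usph (Suc p)) (\<lambda>z. crd b' (Suc p) (F (lin_comb b (Suc p) (snd z))) i)"
      by (rule continuous_on_compose2[OF continuous_on_crd[OF b']])
        (use lin_inj_into[OF F lin_comb_in[OF b]] in auto)
  qed (use smap_nonzero[OF F b b'] crd_outside in blast)+
  then show ?thesis
    unfolding smap_def[abs_def] using homotopic_with_imp_continuous_maps by blast
qed

text \<open>The normalisation between the two maps inserts a positive factor, which the outer
  normalisation removes.\<close>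

lemma smap_comp:
  assumes F: "lin_inj W W' F" and G: "lin_inj W' W'' G"
    and b: "is_basis b n W" and b': "is_basis b' n W'" and b'': "is_basis b'' n W''"
    and x: "x \<in> usph n"
  shows "smap b' b'' n G (smap b b' n F x) = smap b b'' n (\<lambda>x. G (F x)) x"
proof -
  define y where "y = crd b' n (F (lin_comb b n x))"
  have "y \<noteq> (\<lambda>_. 0)" unfolding y_def by (rule smap_nonzero[OF F b b' x])
  then obtain i where "i < n" "y i \<noteq> 0" by (metis crd_outside ext not_le y_def)
  then have pos: "1 / L2_set y {..<n} > 0" using L2_set_lessThan_pos[of i n y] by simp
  have "lin_comb b' n (nrm n y) = (1 / L2_set y {..<n}) *\<^sub>R lin_comb b' n y"
    unfolding lin_comb_scale[symmetric] by (simp add: nrm_def)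
  also have "lin_comb b' n y = F (lin_comb b n x)"
    unfolding y_def using F lin_comb_in[OF b] by (intro lin_comb_crd[OF b']) (auto simp: lin_inj_def)
  finally have *: "lin_comb b' n (nrm n y) = (1 / L2_set y {..<n}) *\<^sub>R F (lin_comb b n x)" .
  show ?thesis
    unfolding smap_def y_def[symmetric] *
    using F lin_comb_in[OF b] by (intro smap_scale[OF G b' b'' pos]) (auto simp: lin_inj_def)
qed

text \<open>A sign that depends on the pair of bases; the value 1 in dimension 0 agrees with
  \<open>brouwer_ball_degree\<close>.\<close>

definition lin_deg :: "(nat \<Rightarrow> 'a::real_vector) \<Rightarrow> (nat \<Rightarrow> 'b::real_vector) \<Rightarrow> nat \<Rightarrow> ('a \<Rightarrow> 'b) \<Rightarrow> int"
  where "lin_deg b b' n F = (if n = 0 then 1 else Brouwer_degree2 (n - 1) (smap b b' n F))"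

lemma lin_deg_comp:
  fixes b :: "nat \<Rightarrow> 'a::real_normed_vector" and b' :: "nat \<Rightarrow> 'b::real_normed_vector"
    and b'' :: "nat \<Rightarrow> 'c::real_normed_vector"
  assumes F: "lin_inj W W' F" and G: "lin_inj W' W'' G"
    and b: "is_basis b n W" and b': "is_basis b' n W'" and b'': "is_basis b'' n W''"
  shows "lin_deg b b'' n (\<lambda>x. G (F x)) = lin_deg b' b'' n G * lin_deg b b' n F"
proof (cases n)
  case (Suc p)
  have "Brouwer_degree2 p (smap b b'' n (\<lambda>x. G (F x))) = Brouwer_degree2 p (smap b' b'' n G \<circ> smap b b' n F)"
    by (rule Brouwer_degree2_eq)
      (simp add: topspace_nsphere_usph smap_comp[OF F G b b' b''] flip: Suc)
  also have "\<dots> = Brouwer_degree2 p (smap b' b'' n G) * Brouwer_degree2 p (smap b b' n F)"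
    using F G b b' b'' unfolding Suc by (intro Brouwer_degree2_compose continuous_map_smap)
  finally show ?thesis using Suc by (simp add: lin_deg_def)
qed (simp add: lin_deg_def)

lemma lin_deg_cong:
  assumes "is_basis b n W" "\<And>x. x \<in> W \<Longrightarrow> F x = G x"
  shows "lin_deg b b' n F = lin_deg b b' n G"
  unfolding lin_deg_def smap_def[abs_def] using assms(2)[OF lin_comb_in[OF assms(1)]] by simp

lemma lin_deg_id:
  assumes b: "is_basis b n W" and F: "\<And>x. x \<in> W \<Longrightarrow> F x = x" shows "lin_deg b b n F = 1"
proof (cases n)
  case (Suc p)
  have "Brouwer_degree2 p (smap b b n F) = Brouwer_degree2 p id"
  proof (rule Brouwer_degree2_eq)
    fix x assume "x \<in> topspace (nsphere p)"
    then have x: "x \<in> usph n" by (simp add: topspace_nsphere_usph Suc)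
    then have "crd b n (F (lin_comb b n x)) = x"
      using F lin_comb_in[OF b] by (intro crd_unique[OF b]) (auto simp: usph_def)
    then show "smap b b n F x = id x" by (simp add: smap_def nrm_usph[OF x])
  qed
  then show ?thesis using Suc by (simp add: lin_deg_def)
qed (simp add: lin_deg_def)

text \<open>The inverse isomorphism also has an integer degree, and the two multiply to the degree
  of the identity.\<close>

lemma abs_lin_deg:
  fixes b :: "nat \<Rightarrow> 'a::real_normed_vector" and b' :: "nat \<Rightarrow> 'b::real_normed_vector"
  assumes F: "lin_inj W W' F" and b: "is_basis b n W" and b': "is_basis b' n W'"
  shows "\<bar>lin_deg b b' n F\<bar> = 1"
proof -
  obtain G where G: "lin_inj W' W G" "\<And>x. x \<in> W \<Longrightarrow> G (F x) = x" "\<And>y. y \<in> W' \<Longrightarrow> F (G y) = y"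
    using lin_inj_inverse[OF assms] by blast
  have "lin_deg b' b n G * lin_deg b b' n F = lin_deg b b n (\<lambda>x. G (F x))"
    by (rule lin_deg_comp[OF F G(1) b b' b, symmetric])
  also have "\<dots> = 1" using G(2) by (rule lin_deg_id[OF b])
  finally have "\<bar>lin_deg b' b n G\<bar> * \<bar>lin_deg b b' n F\<bar> = 1" by (metis abs_1 abs_mult)
  then show ?thesis using zmult_eq_1_iff by fastforce
qed

text \<open>Degrees are multiplicative on both sides of the intertwining relation, and the degree of
  \<psi> is a nonzero integer that cancels. The identity in place of \<psi> gives independence of
  the basis.\<close>

lemma lin_deg_conj:
  fixes b :: "nat \<Rightarrow> 'a::real_normed_vector" and b' :: "nat \<Rightarrow> 'b::real_normed_vector"
  assumes \<psi>: "lin_inj W W' \<psi>" and F: "lin_inj W W F" and F': "lin_inj W' W' F'"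
    and eq: "\<And>x. x \<in> W \<Longrightarrow> F' (\<psi> x) = \<psi> (F x)"
    and b: "is_basis b n W" and b': "is_basis b' n W'"
  shows "lin_deg b' b' n F' = lin_deg b b n F"
proof -
  have nz: "lin_deg b b' n \<psi> \<noteq> 0" using abs_lin_deg[OF \<psi> b b'] by auto
  have "lin_deg b' b' n F' * lin_deg b b' n \<psi> = lin_deg b b' n (\<lambda>x. F' (\<psi> x))"
    by (rule lin_deg_comp[OF \<psi> F' b b' b', symmetric])
  also have "\<dots> = lin_deg b b' n (\<lambda>x. \<psi> (F x))" using eq by (rule lin_deg_cong[OF b])
  also have "\<dots> = lin_deg b b' n \<psi> * lin_deg b b n F" by (rule lin_deg_comp[OF F \<psi> b b b'])
  finally show ?thesis using nz by simp
qed

text \<open>Rescaling to the unit sphere is absorbed by \<open>nrm\<close>, and conjugation with the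
  identity exchanges the basis selected by \<open>SOME\<close> for the given one.\<close>

lemma ball_degree_lin_deg:
  fixes b :: "nat \<Rightarrow> 'a::real_normed_vector"
  assumes F: "lin_inj W W F" and b: "is_basis b n W"
  shows "brouwer_ball_degree W F = lin_deg b b n F"
proof (cases n)
  case 0
  then show ?thesis using is_basis_dim[OF b] by (simp add: brouwer_ball_degree_def lin_deg_def)
next
  case (Suc p)
  have n: "dim W = n" by (rule is_basis_dim[OF b])
  define c where "c = (SOME b. is_basis b n W)"
  have c: "is_basis c n W" unfolding c_def by (rule someI[of "\<lambda>b. is_basis b n W", OF b])
  have "brouwer_ball_degree W F = Brouwer_degree2 p (sphere_map c n F)"
    unfolding brouwer_ball_degree_def n c_def[symmetric] using Suc by simp
  also have "\<dots> = Brouwer_degree2 p (smap c c n F)"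
  proof (rule Brouwer_degree2_eq)
    fix x assume "x \<in> topspace (nsphere p)"
    then have x: "x \<in> usph n" by (simp add: topspace_nsphere_usph Suc)
    show "sphere_map c n F x = smap c c n F x"
      unfolding sphere_map_nrm smap_def
      by (rule smap_scale[OF F c c]) (use lin_comb_nonzero[OF c x] lin_comb_in[OF c] in auto)
  qed
  also have "\<dots> = lin_deg c c n F" using Suc by (simp add: lin_deg_def)
  also have "\<dots> = lin_deg b b n F"
    by (rule lin_deg_conj[OF lin_inj_id F F _ b c]) simp
  finally show ?thesis .
qed

lemma ball_degree_comp:
  fixes W :: "'a::real_normed_vector set"
  assumes "fin_dim_subspace W" "lin_inj W W F" "lin_inj W W G"
  shows "brouwer_ball_degree W (\<lambda>x. G (F x)) = brouwer_ball_degree W G * brouwer_ball_degree W F"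
proof -
  obtain b where b: "is_basis b (dim W) W" using fin_dim_subspace_basis[OF assms(1)] .
  show ?thesis
    using assms by (simp add: ball_degree_lin_deg[OF _ b] lin_inj_comp lin_deg_comp[OF _ _ b b b])
qed

lemma ball_degree_id:
  fixes W :: "'a::real_normed_vector set"
  assumes "fin_dim_subspace W" "\<And>x. x \<in> W \<Longrightarrow> F x = x"
  shows "brouwer_ball_degree W F = 1"
proof -
  obtain b where b: "is_basis b (dim W) W" using fin_dim_subspace_basis[OF assms(1)] .
  have "lin_inj W W F" using lin_inj_id assms(2) subspace_basis[OF b] by (rule lin_inj_cong)
  then show ?thesis using lin_deg_id[OF b assms(2)] by (simp add: ball_degree_lin_deg[OF _ b])
qed

lemma abs_ball_degree:
  fixes W :: "'a::real_normed_vector set"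
  assumes "fin_dim_subspace W" "lin_inj W W F"
  shows "\<bar>brouwer_ball_degree W F\<bar> = 1"
proof -
  obtain b where b: "is_basis b (dim W) W" using fin_dim_subspace_basis[OF assms(1)] .
  show ?thesis using abs_lin_deg[OF assms(2) b b] by (simp add: ball_degree_lin_deg[OF assms(2) b])
qed

lemma ball_degree_conj:
  fixes W :: "'a::real_normed_vector set" and W' :: "'b::real_normed_vector set"
  assumes W: "fin_dim_subspace W" and \<psi>: "lin_inj W W' \<psi>" "\<psi> ` W = W'"
    and F: "lin_inj W W F" and F': "lin_inj W' W' F'"
    and eq: "\<And>x. x \<in> W \<Longrightarrow> F' (\<psi> x) = \<psi> (F x)"
  shows "brouwer_ball_degree W' F' = brouwer_ball_degree W F"
proof -
  obtain b where b: "is_basis b (dim W) W" using fin_dim_subspace_basis[OF W] .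
  have "is_basis (\<lambda>i. \<psi> (b i)) (dim W) W'"
    unfolding is_basis_iff lin_inj_lin_comb[OF \<psi>(1) b, symmetric]
  proof (intro conjI allI impI)
    fix x i assume "\<psi> (lin_comb b (dim W) x) = 0" "i < dim W"
    moreover from this have "lin_comb b (dim W) x = 0"
      using \<psi>(1) lin_comb_in[OF b] by (simp add: lin_inj_def)
    ultimately show "x i = 0" using b by (simp add: is_basis_iff)
  next
    have "W = range (lin_comb b (dim W))" using b by (simp add: is_basis_iff)
    then show "W' = range (\<lambda>x. \<psi> (lin_comb b (dim W) x))" using \<psi>(2) by (metis image_image)
  qed
  from lin_deg_conj[OF \<psi>(1) F F' eq b this] show ?thesis
    by (simp add: ball_degree_lin_deg[OF F b] ball_degree_lin_deg[OF F' \<open>is_basis _ _ W'\<close>])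
qed

lemma is_basis_initial:
  assumes "is_basis b n W" "r \<le> n" shows "is_basis b r (range (lin_comb b r))"
  unfolding is_basis_iff
proof (intro conjI allI impI refl)
  fix x i assume x: "lin_comb b r x = 0" and i: "i < r"
  define y where "y = (\<lambda>i. if i < r then x i else 0)"
  have "lin_comb b n y = (\<Sum>i<r. y i *\<^sub>R b i)"
    unfolding lin_comb_def by (rule sum.mono_neutral_right) (use assms(2) in \<open>auto simp: y_def\<close>)
  also have "\<dots> = lin_comb b r x" unfolding lin_comb_def by (rule sum.cong) (auto simp: y_def)
  finally have "\<forall>i<n. y i = 0" using assms(1) x by (simp add: is_basis_iff)
  then show "x i = 0" using i assms(2) unfolding y_def by (metis order_less_le_trans)
qed

lemma lin_comb_Suc: "lin_comb b (Suc n) x = lin_comb b n x + x n *\<^sub>R b n"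
  by (simp add: lin_comb_def)

lemma lin_comb_cong: "(\<And>i. i < n \<Longrightarrow> x i = y i) \<Longrightarrow> lin_comb b n x = lin_comb b n y"
  by (simp add: lin_comb_def)

text \<open>In coordinates \<open>F\<close> acts on the first n entries as its restriction and
  leaves entry n alone. The normalised map keeps the sign of entry n and restricts to the map of the
  equator, which is the situation of a suspension.\<close>

lemma lin_deg_suspension:
  fixes b :: "nat \<Rightarrow> 'a::real_normed_vector"
  assumes b: "is_basis b (Suc n) W" and F: "lin_inj W W F"
    and FU: "F ` range (lin_comb b n) \<subseteq> range (lin_comb b n)" and Fn: "F (b n) = b n"
  shows "lin_deg b b (Suc n) F = lin_deg b b n F"
proof -
  define U where "U = range (lin_comb b n)"
  have bU: "is_basis b n U" unfolding U_def by (rule is_basis_initial[OF b]) simp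
  have UW: "U \<subseteq> W"
  proof -
    have "lin_comb b n x = lin_comb b (Suc n) (x(n := 0))" for x
      by (simp add: lin_comb_Suc) (rule lin_comb_cong, simp)
    then show ?thesis unfolding U_def using lin_comb_in[OF b] by auto
  qed
  have FU': "lin_inj U U F"
    using F FU UW unfolding lin_inj_def U_def[symmetric] by (auto simp: subset_iff)
  have bn: "b n \<in> W" using b unfolding is_basis_def by (metis image_eqI lessI lessThan_iff span_base)
  have key: "crd b (Suc n) (F (lin_comb b (Suc n) x)) = (crd b n (F (lin_comb b n x)))(n := x n)" for x
  proof (rule crd_unique[OF b])
    have "F (lin_comb b n x) \<in> U" using lin_inj_into[OF FU' lin_comb_in[OF bU]] .
    then have "lin_comb b n (crd b n (F (lin_comb b n x))) = F (lin_comb b n x)"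
      by (rule lin_comb_crd[OF bU])
    moreover have "lin_comb b n ((crd b n (F (lin_comb b n x)))(n := x n)) =
        lin_comb b n (crd b n (F (lin_comb b n x)))" by (rule lin_comb_cong) simp
    moreover have "F (lin_comb b n x + x n *\<^sub>R b n) = F (lin_comb b n x) + x n *\<^sub>R F (b n)"
      using F UW bn lin_comb_in[OF bU] subspace_basis[OF b] by (simp add: lin_inj_def subset_iff subspace_scale)
    ultimately show "lin_comb b (Suc n) ((crd b n (F (lin_comb b n x)))(n := x n)) = F (lin_comb b (Suc n) x)"
      by (simp add: lin_comb_Suc Fn)
  qed (simp add: crd_outside)
  show ?thesis
  proof (cases n)
    \<comment> \<open>The equator would be empty here, so this case is direct: \<open>F\<close> is
      the identity on a line.\<close>
    case 0
    have "F x = x" if xW: "x \<in> W" for x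
    proof -
      have "x \<in> range (lin_comb b (Suc n))" using xW b unfolding is_basis_iff by blast
      then obtain z where "x = lin_comb b (Suc n) z" by blast
      then have "x = z 0 *\<^sub>R b 0" using 0 by (simp add: lin_comb_def)
      then show ?thesis using F Fn bn 0 by (simp add: lin_inj_def)
    qed
    then show ?thesis using lin_deg_id[OF b] 0 by (simp add: lin_deg_def)
  next
    case (Suc p)
    have n: "Suc (n - 1) = n" using Suc by simp
    have "Brouwer_degree2 (Suc p) (smap b b (Suc n) F) = Brouwer_degree2 p (smap b b n F)"
    proof (rule suspension_degree)
      show "continuous_map (nsphere p) (nsphere p) (smap b b n F)"
        unfolding Suc by (rule continuous_map_smap) (use FU' bU Suc in auto)
      show "continuous_map (nsphere (Suc p)) (nsphere (Suc p)) (smap b b (Suc n) F)"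
        unfolding Suc by (rule continuous_map_smap) (use F b Suc in auto)
    next
      fix x assume "x \<in> topspace (nsphere p)"
      then have "x n = 0" by (simp add: topspace_nsphere_usph usph_def Suc)
      then have "crd b (Suc n) (F (lin_comb b (Suc n) x)) = crd b n (F (lin_comb b n x))"
        unfolding key by (simp add: fun_eq_iff crd_outside)
      then show "smap b b (Suc n) F x = smap b b n F x"
        by (simp add: smap_def nrm_def L2_set_def crd_outside)
    next
      fix x :: "nat \<Rightarrow> real" assume "0 \<le> x (Suc p)"
      then show "0 \<le> smap b b (Suc n) F x (Suc p)"
        unfolding smap_def key by (simp add: nrm_def Suc L2_set_nonneg)
    next
      fix x :: "nat \<Rightarrow> real" assume "x (Suc p) \<le> 0"
      then show "smap b b (Suc n) F x (Suc p) \<le> 0"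
        unfolding smap_def key by (simp add: nrm_def Suc L2_set_nonneg divide_nonpos_nonneg)
    qed
    then show ?thesis by (simp add: lin_deg_def Suc)
  qed
qed

lemma lin_deg_initial:
  fixes b :: "nat \<Rightarrow> 'a::real_normed_vector"
  assumes "r \<le> n" and b: "is_basis b n W" and F: "lin_inj W W F"
    and FU: "F ` range (lin_comb b r) \<subseteq> range (lin_comb b r)"
    and Fb: "\<And>i. r \<le> i \<Longrightarrow> i < n \<Longrightarrow> F (b i) = b i"
  shows "lin_deg b b n F = lin_deg b b r F"
proof -
  have "range (lin_comb b k) \<subseteq> W \<and> F ` range (lin_comb b k) \<subseteq> range (lin_comb b k) \<and>
      lin_deg b b k F = lin_deg b b r F" if "r \<le> k" "k \<le> n" for k
    using that
  proof (induction k rule: dec_induct)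
    case base
    have "lin_comb b r x = lin_comb b n (\<lambda>i. if i < r then x i else 0)" for x
      unfolding lin_comb_def by (rule sum.mono_neutral_cong_left) (use assms(1) in auto)
    then have "range (lin_comb b r) \<subseteq> W" using lin_comb_in[OF b] by auto
    then show ?case using FU by blast
  next
    case (step k)
    have bk: "is_basis b (Suc k) (range (lin_comb b (Suc k)))"
      using b step.prems by (rule is_basis_initial)
    have "lin_comb b (Suc k) x = lin_comb b n (\<lambda>i. if i < Suc k then x i else 0)" for x
      unfolding lin_comb_def by (rule sum.mono_neutral_cong_left) (use step in auto)
    then have W: "range (lin_comb b (Suc k)) \<subseteq> W" using lin_comb_in[OF b] by auto
    have IH: "F ` range (lin_comb b k) \<subseteq> range (lin_comb b k)" "range (lin_comb b k) \<subseteq> W"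
      "lin_deg b b k F = lin_deg b b r F"
      using step by simp_all
    have bn: "b k \<in> W" using b step.prems unfolding is_basis_def
      by (metis Suc_le_lessD image_eqI lessThan_iff span_base)
    have "F (lin_comb b (Suc k) x) \<in> range (lin_comb b (Suc k))" for x
    proof -
      have xk: "lin_comb b k x \<in> W" "x k *\<^sub>R b k \<in> W"
        using IH(2) bn subspace_basis[OF b] by (auto simp: subspace_scale)
      have "F (lin_comb b (Suc k) x) = F (lin_comb b k x) + x k *\<^sub>R b k"
        using F xk bn step Fb[of k] by (simp add: lin_inj_def lin_comb_Suc)
      moreover obtain y where "F (lin_comb b k x) = lin_comb b k y" using IH(1) by blast
      moreover have "lin_comb b k y + x k *\<^sub>R b k = lin_comb b (Suc k) (y(k := x k))"
        by (simp add: lin_comb_Suc) (rule lin_comb_cong, simp)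
      ultimately show ?thesis by (metis rangeI)
    qed
    then have FW: "F ` range (lin_comb b (Suc k)) \<subseteq> range (lin_comb b (Suc k))" by blast
    have "lin_inj (range (lin_comb b (Suc k))) (range (lin_comb b (Suc k))) F"
      using F W FW unfolding lin_inj_def by (auto simp: subset_iff)
    from lin_deg_suspension[OF bk this IH(1)] Fb[of k] step IH(3) W FW show ?case by simp
  qed
  from this[of n] assms(1) show ?thesis by simp
qed

lemma fin_dim_subspace_subset:
  assumes "fin_dim_subspace W" "subspace U" "U \<subseteq> W" shows "fin_dim_subspace U"
proof -
  obtain B0 where B0: "finite B0" "W = span B0" using assms(1) by (auto simp: fin_dim_subspace_def)
  obtain B where B: "B \<subseteq> U" "independent B" "U \<subseteq> span B" by (rule basis_exists)
  have "finite B" using independent_span_bound[OF B0(1) B(2)] B(1) assms(3) B0(2) by auto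
  moreover have "U = span B" using B assms(2) span_minimal by blast
  ultimately show ?thesis by (auto simp: fin_dim_subspace_def)
qed

text \<open>A basis of \<open>U\<close> followed by one of \<open>U'\<close> reduces this to
  \<open>lin_deg_initial\<close>, where the fixed basis vectors are stripped off one at a time by
  suspension.\<close>

lemma ball_degree_direct_sum:
  fixes W :: "'a::real_normed_vector set"
  assumes W: "fin_dim_subspace W" and U: "subspace U" "U \<subseteq> W" and U': "subspace U'" "U' \<subseteq> W"
    and sum: "\<And>w. w \<in> W \<Longrightarrow> \<exists>u\<in>U. \<exists>v\<in>U'. w = u + v" and int: "\<And>u. u \<in> U \<Longrightarrow> u \<in> U' \<Longrightarrow> u = 0"
    and F: "lin_inj W W F" and FU: "F ` U \<subseteq> U" and FU': "\<And>x. x \<in> U' \<Longrightarrow> F x = x"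
  shows "brouwer_ball_degree W F = brouwer_ball_degree U F"
proof -
  obtain c where c: "is_basis c (dim U) U"
    using fin_dim_subspace_basis[OF fin_dim_subspace_subset[OF W U]] .
  obtain d where d: "is_basis d (dim U') U'"
    using fin_dim_subspace_basis[OF fin_dim_subspace_subset[OF W U']] .
  have sW: "subspace W" using fin_dim_subspace_basis[OF W] subspace_basis by blast
  define r where "r = dim U"
  define n where "n = r + dim U'"
  define b where "b = (\<lambda>i. if i < r then c i else d (i - r))"
  note c = c[folded r_def]
  have lc: "lin_comb b r x = lin_comb c r x" for x
    unfolding lin_comb_def b_def by (rule sum.cong) auto
  have ln: "lin_comb b n x = lin_comb c r x + lin_comb d (dim U') (\<lambda>i. x (r + i))" for x
  proof -
    have "lin_comb b n x = (\<Sum>i<r. x i *\<^sub>R b i) + (\<Sum>i\<in>{r..<n}. x i *\<^sub>R b i)"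
      unfolding lin_comb_def by (subst sum.union_disjoint[symmetric]) (auto simp: n_def ivl_disj_un intro!: sum.cong)
    also have "(\<Sum>i<r. x i *\<^sub>R b i) = lin_comb c r x" using lc by (simp add: lin_comb_def)
    also have "(\<Sum>i\<in>{r..<n}. x i *\<^sub>R b i) = lin_comb d (dim U') (\<lambda>i. x (r + i))"
      unfolding lin_comb_def n_def
      by (rule sum.reindex_bij_witness[of _ "\<lambda>i. r + i" "\<lambda>i. i - r"]) (auto simp: b_def)
    finally show ?thesis .
  qed
  have bas: "is_basis b n W"
    unfolding is_basis_iff
  proof (intro conjI allI impI)
    fix x i assume x: "lin_comb b n x = 0" and i: "i < n"
    define u v where "u = lin_comb c r x" and "v = lin_comb d (dim U') (\<lambda>i. x (r + i))"
    have uv: "u \<in> U" "v \<in> U'" unfolding u_def v_def using lin_comb_in c d by blast+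
    have "u + v = 0" using x ln u_def v_def by simp
    then have "u = - v" by (simp add: eq_neg_iff_add_eq_0)
    then have "u \<in> U'" using uv U'(1) by (simp add: subspace_neg)
    then have "u = 0" using int uv by blast
    moreover have "v = 0" using \<open>u = - v\<close> \<open>u = 0\<close> by simp
    ultimately have x0: "\<forall>i<r. x i = 0" "\<forall>i<dim U'. x (r + i) = 0"
      using c d unfolding u_def v_def is_basis_iff by blast+
    show "x i = 0"
    proof (cases "i < r")
      case False
      then have "i = r + (i - r)" "i - r < dim U'" using i by (auto simp: n_def)
      then show ?thesis using x0(2) by metis
    qed (use x0 in blast)
  next
    show "W = range (lin_comb b n)"
    proof
      show "range (lin_comb b n) \<subseteq> W"
      proof
        fix w assume "w \<in> range (lin_comb b n)"
        then obtain x where "w = lin_comb c r x + lin_comb d (dim U') (\<lambda>i. x (r + i))"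
          by (auto simp: ln)
        moreover have "lin_comb c r x \<in> W" "lin_comb d (dim U') (\<lambda>i. x (r + i)) \<in> W"
          using lin_comb_in[OF c] lin_comb_in[OF d] U(2) U'(2) by blast+
        ultimately show "w \<in> W" using sW by (simp add: subspace_add)
      qed
      show "W \<subseteq> range (lin_comb b n)"
      proof
        fix w assume "w \<in> W"
        then obtain u v where uv: "u \<in> U" "v \<in> U'" "w = u + v" using sum by blast
        have "u \<in> range (lin_comb c r)" "v \<in> range (lin_comb d (dim U'))"
          using uv c d unfolding is_basis_iff by blast+
        then obtain x y where xy: "u = lin_comb c r x" "v = lin_comb d (dim U') y" by blast
        define z where "z = (\<lambda>i. if i < r then x i else y (i - r))"
        have "lin_comb c r z = u" "lin_comb d (dim U') (\<lambda>i. z (r + i)) = v"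
          unfolding xy z_def by (rule lin_comb_cong, simp)+
        then have "lin_comb b n z = w" using ln[of z] uv by simp
        then show "w \<in> range (lin_comb b n)" by blast
      qed
    qed
  qed
  have rU: "range (lin_comb b r) = U" using c by (simp add: lc[abs_def] is_basis_iff)
  have bU: "is_basis b r U" using is_basis_initial[OF bas, of r] by (simp add: n_def rU)
  have "lin_deg b b n F = lin_deg b b r F"
  proof (rule lin_deg_initial[OF _ bas F])
    show "r \<le> n" by (simp add: n_def)
    show "F ` range (lin_comb b r) \<subseteq> range (lin_comb b r)" unfolding rU by (rule FU)
  next
    fix i assume "r \<le> i" "i < n"
    then have "b i \<in> d ` {..<dim U'}" by (auto simp: b_def n_def)
    moreover have "d ` {..<dim U'} \<subseteq> U'" using d span_superset[of "d ` {..<dim U'}"] by (simp add: is_basis_def)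
    ultimately show "F (b i) = b i" using FU' by blast
  qed
  moreover have "lin_inj U U F" using F FU U(2) unfolding lin_inj_def by (auto simp: subset_iff)
  ultimately show ?thesis by (simp add: ball_degree_lin_deg[OF F bas] ball_degree_lin_deg[OF _ bU])
qed

text \<open>The fixed complement \<open>U'\<close> splits off and leaves the line through
  \<open>e\<close>, on whose two-point sphere the map is the swap, of degree -1.\<close>

lemma ball_degree_reflection:
  fixes W :: "'a::real_normed_vector set"
  assumes W: "fin_dim_subspace W" and e: "e \<in> W" "e \<noteq> 0" and U': "subspace U'" "U' \<subseteq> W" "e \<notin> U'"
    and sum: "\<And>w. w \<in> W \<Longrightarrow> \<exists>c. \<exists>v\<in>U'. w = c *\<^sub>R e + v"
    and F: "lin_inj W W F" and Fe: "F e = - e" and FU': "\<And>x. x \<in> U' \<Longrightarrow> F x = x"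
  shows "brouwer_ball_degree W F = - 1"
proof -
  define U where "U = span {e}"
  have UR: "U = range (\<lambda>c. c *\<^sub>R e)" by (simp add: U_def span_singleton)
  have FcE: "F (c *\<^sub>R e) = - (c *\<^sub>R e)" for c using F Fe e by (simp add: lin_inj_def)
  have sW: "subspace W" using fin_dim_subspace_basis[OF W] subspace_basis by blast
  have sub: "subspace U" "U \<subseteq> W" using e sW by (auto simp: UR subspace_scale) (simp add: U_def UR[symmetric])
  have "brouwer_ball_degree W F = brouwer_ball_degree U F"
  proof (rule ball_degree_direct_sum[OF W sub U'(1,2) _ _ F])
    fix u assume "u \<in> U" "u \<in> U'"
    then obtain c where c: "u = c *\<^sub>R e" by (auto simp: UR)
    have "c = 0"
    proof (rule ccontr)
      assume "c \<noteq> 0"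
      then have "e = (1 / c) *\<^sub>R u" using c by simp
      then show False using subspace_scale[OF U'(1) \<open>u \<in> U'\<close>] U'(3) by metis
    qed
    then show "u = 0" using c by simp
  next
    show "F ` U \<subseteq> U" using FcE by (auto simp: UR) (metis rangeI scaleR_minus_left)
  qed (use sum FU' UR in blast)+
  also have "\<dots> = - 1"
  proof -
    define b where "b = (\<lambda>i::nat. e)"
    have b: "is_basis b 1 U" using e by (auto simp: is_basis_iff b_def lin_comb_def UR image_def)
    have FU: "lin_inj U U F"
      using F sub FcE unfolding lin_inj_def by (auto simp: subset_iff UR) (metis rangeI scaleR_minus_left)
    have "lin_deg b b 1 F = Brouwer_degree2 0 (smap b b 1 F)" by (simp add: lin_deg_def)
    also have "\<dots> = Brouwer_degree2 0 (\<lambda>x i. if i = 0 then - x i else x i)"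
    proof (rule Brouwer_degree2_eq)
      fix x assume "x \<in> topspace (nsphere 0)"
      then have x: "x \<in> usph 1" by (simp add: topspace_nsphere_usph)
      have x': "x i = 0" if "i \<ge> 1" for i using x that by (simp add: usph_def)
      have "crd b 1 (F (lin_comb b 1 x)) = (\<lambda>i. if i = 0 then - x i else x i)"
        using FcE by (intro crd_unique[OF b]) (auto simp: lin_comb_def b_def x')
      moreover have "(\<lambda>i. if i = 0 then - x i else x i) \<in> usph 1"
        using x x' by (auto simp: usph_def L2_set_def)
      ultimately show "smap b b 1 F x = (\<lambda>i. if i = 0 then - x i else x i)"
        by (simp add: smap_def nrm_usph)
    qed
    also have "\<dots> = - 1" by (rule Brouwer_degree2_reflection)
    finally show ?thesis by (simp add: ball_degree_lin_deg[OF FU b])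
  qed
  finally show ?thesis .
qed

section \<open>Degree and sign of the determinant\<close>

lemma fin_dim_UNIV: "fin_dim_subspace (UNIV :: 'a::euclidean_space set)"
  unfolding fin_dim_subspace_def by (metis finite_Basis span_Basis)

lemma lin_inj_vec_iff:
  fixes f :: "real^'n \<Rightarrow> real^'n"
  assumes "linear f" shows "lin_inj UNIV UNIV f \<longleftrightarrow> det (matrix f) \<noteq> 0"
  using assms det_nz_iff_inj[OF assms] linear_injective_0[OF assms]
  by (auto simp: lin_inj_def linear_add linear_scale)

lemma ball_degree_linear_homotopy:
  fixes W :: "'a::real_normed_vector set" and h :: "real \<Rightarrow> 'a \<Rightarrow> 'a"
  assumes "fin_dim_subspace W"
    and "continuous_on ({0..1} \<times> (W \<inter> sphere 0 1)) (\<lambda>z. h (fst z) (snd z))"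
    and inj: "\<And>s. s \<in> {0..1} \<Longrightarrow> lin_inj W W (h s)"
  shows "brouwer_ball_degree W (h 0) = brouwer_ball_degree W (h 1)"
proof (rule ball_degree_homotopy[OF assms(1,2)])
  fix s :: real and x assume s: "s \<in> {0..1}" and x: "x \<in> W" "norm x = 1"
  show "h s x \<in> W" using inj[OF s] x by (auto simp: lin_inj_def)
  show "h s x \<noteq> 0" using inj[OF s] x unfolding lin_inj_def by fastforce
qed

lemma ball_degree_signs:
  fixes N :: "'n::finite set"
  shows "brouwer_ball_degree UNIV (\<lambda>x::real^'n. \<chi> i. if i \<in> N then - x $ i else x $ i) = (-1) ^ card N"
  using finite[of N]
proof (induction N rule: finite_induct)
  case empty
  show ?case by (simp add: ball_degree_id[OF fin_dim_UNIV])
next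
  case (insert k N)
  let ?s = "\<lambda>N x::real^'n. \<chi> i. if i \<in> N then - x $ i else x $ i"
  have inj: "lin_inj UNIV UNIV (?s N)" for N
    by (rule lin_injI) (auto simp: vec_eq_iff intro!: linearI split: if_splits)
  have refl: "brouwer_ball_degree UNIV (?s {k}) = - 1"
  proof (rule ball_degree_reflection[OF fin_dim_UNIV, where e = "axis k 1" and U' = "{x. x $ k = 0}"])
    fix w :: "real^'n"
    have "w = (w $ k) *\<^sub>R axis k 1 + (w - (w $ k) *\<^sub>R axis k 1)" by simp
    moreover have "w - (w $ k) *\<^sub>R axis k 1 \<in> {x. x $ k = 0}" by simp
    ultimately show "\<exists>c. \<exists>v\<in>{x. x $ k = 0}. w = c *\<^sub>R axis k 1 + v" by blast
  qed (use inj[of "{k}"] in \<open>auto simp: vec_eq_iff axis_def subspace_def\<close>)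
  have "?s (insert k N) = (\<lambda>x. ?s {k} (?s N x))" using insert(2) by (auto simp: fun_eq_iff vec_eq_iff)
  then have "brouwer_ball_degree UNIV (?s (insert k N)) = brouwer_ball_degree UNIV (?s {k}) * brouwer_ball_degree UNIV (?s N)"
    using ball_degree_comp[OF fin_dim_UNIV inj[of N] inj[of "{k}"]] by simp
  then show ?case using insert refl by simp
qed

text \<open>Every linear map is composed of elementary ones, and both the degree and the sign of the
  determinant are multiplicative. Diagonal maps deform to diagonal signs, shears deform to the
  identity, and a transposition is a reflection.\<close>

lemma ball_degree_det:
  fixes f :: "real^'n \<Rightarrow> real^'n"
  assumes "linear f" "det (matrix f) \<noteq> 0"
  shows "brouwer_ball_degree UNIV f = (if det (matrix f) > 0 then 1 else - 1)"
proof -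
  \<comment> \<open>The nonvanishing of the determinant becomes part of the induction claim, because
    the elementary maps include singular ones, for which the claim is void.\<close>
  have "det (matrix f) \<noteq> 0 \<longrightarrow> brouwer_ball_degree UNIV f = (if det (matrix f) > 0 then 1 else - 1)"
  proof (rule induct_linear_elementary[OF assms(1)])
    fix f g :: "real^'n \<Rightarrow> real^'n"
    assume lin: "linear f" "linear g"
      and f: "det (matrix f) \<noteq> 0 \<longrightarrow> brouwer_ball_degree UNIV f = (if det (matrix f) > 0 then 1 else - 1)"
      and g: "det (matrix g) \<noteq> 0 \<longrightarrow> brouwer_ball_degree UNIV g = (if det (matrix g) > 0 then 1 else - 1)"
    have d: "det (matrix (f \<circ> g)) = det (matrix f) * det (matrix g)"
      using lin by (simp add: matrix_compose det_mul)
    show "det (matrix (f \<circ> g)) \<noteq> 0 \<longrightarrow>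
      brouwer_ball_degree UNIV (f \<circ> g) = (if det (matrix (f \<circ> g)) > 0 then 1 else - 1)"
    proof
      assume "det (matrix (f \<circ> g)) \<noteq> 0"
      then have nz: "det (matrix f) \<noteq> 0" "det (matrix g) \<noteq> 0" using d by auto
      then have "brouwer_ball_degree UNIV (f \<circ> g) = brouwer_ball_degree UNIV f * brouwer_ball_degree UNIV g"
        using ball_degree_comp[OF fin_dim_UNIV, of g f] by (simp add: o_def lin lin_inj_vec_iff)
      then show "brouwer_ball_degree UNIV (f \<circ> g) = (if det (matrix (f \<circ> g)) > 0 then 1 else - 1)"
        using f g nz d by (auto simp: zero_less_mult_iff)
    qed
  next
    fix f :: "real^'n \<Rightarrow> real^'n" and i assume "linear f" "\<And>x. f x $ i = 0"
    then have "row i (matrix f) = 0" by (simp add: row_def matrix_def vec_eq_iff)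
    then have "det (matrix f) = 0" by (metis det_zero_row(2))
    then show "det (matrix f) \<noteq> 0 \<longrightarrow> brouwer_ball_degree UNIV f = (if det (matrix f) > 0 then 1 else - 1)"
      by simp
  next
    fix c :: "'n \<Rightarrow> real"
    let ?d = "\<lambda>c x::real^'n. \<chi> i. c i * x $ i"
    have lin: "linear (?d c)" for c by (rule linearI) (auto simp: vec_eq_iff algebra_simps)
    have det: "det (matrix (?d c)) = (\<Prod>i\<in>UNIV. c i)" for c
      by (subst det_diagonal) (auto simp: matrix_def axis_def)
    show "det (matrix (?d c)) \<noteq> 0 \<longrightarrow>
      brouwer_ball_degree UNIV (?d c) = (if det (matrix (?d c)) > 0 then 1 else - 1)"
    proof
      assume "det (matrix (?d c)) \<noteq> 0"
      then have c: "c i \<noteq> 0" for i using det[of c] by auto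
      define N where "N = {i. c i < 0}"
      \<comment> \<open>Each diagonal entry moves straight to its sign; it never meets 0, as both
        ends have the same sign.\<close>
      let ?h = "\<lambda>s::real. ?d (\<lambda>i. (1 - s) * c i + s * sgn (c i))"
      have "brouwer_ball_degree UNIV (?h 0) = brouwer_ball_degree UNIV (?h 1)"
      proof (rule ball_degree_linear_homotopy[OF fin_dim_UNIV])
        show "continuous_on ({0..1} \<times> (UNIV \<inter> sphere 0 1)) (\<lambda>z::real \<times> (real^'n). ?h (fst z) (snd z))"
          by (intro continuous_intros)
        fix s :: real assume s: "s \<in> {0..1}"
        have "(1 - s) * c i + s * sgn (c i) \<noteq> 0" for i
        proof -
          have "(1 - s) * c i + s * sgn (c i) = sgn (c i) * ((1 - s) * \<bar>c i\<bar> + s)"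
            using c[of i] by (auto simp: sgn_if abs_if algebra_simps)
          moreover have "(1 - s) * \<bar>c i\<bar> + s > 0"
            using s c[of i] by (cases "s = 1") (auto intro!: add_pos_nonneg mult_pos_pos)
          ultimately show ?thesis using c[of i] by (simp add: sgn_0_0)
        qed
        then show "lin_inj UNIV UNIV (?h s)"
          unfolding lin_inj_vec_iff[OF lin] det by simp
      qed
      moreover have "?h 0 = ?d c" by simp
      moreover have "?h 1 = (\<lambda>x. \<chi> i. if i \<in> N then - x $ i else x $ i)"
        using c by (auto simp: fun_eq_iff vec_eq_iff N_def sgn_if less_le)
      ultimately have deg: "brouwer_ball_degree UNIV (?d c) = (-1) ^ card N"
        using ball_degree_signs[of N] by simp
      have "(\<Prod>i\<in>UNIV. c i) = (\<Prod>i\<in>N. c i) * (\<Prod>i\<in>-N. c i)"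
        by (subst prod.union_disjoint[symmetric]) auto
      moreover have "(\<Prod>i\<in>N. c i) = (-1) ^ card N * (\<Prod>i\<in>N. - c i)"
        by (simp add: prod_uminus flip: power_mult_distrib)
      moreover have pos: "(\<Prod>i\<in>N. - c i) > 0" "(\<Prod>i\<in>-N. c i) > 0"
        using c by (intro prod_pos; force simp: N_def not_less order.order_iff_strict)+
      moreover define P where "P = (\<Prod>i\<in>N. - c i) * (\<Prod>i\<in>-N. c i)"
      ultimately have "(\<Prod>i\<in>UNIV. c i) = (-1) ^ card N * P" "P > 0"
        using mult_pos_pos[OF pos] by simp_all
      then show "brouwer_ball_degree UNIV (?d c) = (if det (matrix (?d c)) > 0 then 1 else - 1)"
        unfolding deg det by (cases "even (card N)") simp_all
    qed
  next
    fix m n :: 'n assume mn: "m \<noteq> n"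
    let ?f = "\<lambda>x::real^'n. \<chi> i. x $ Transposition.transpose m n i"
    have lin: "linear ?f" by (rule linearI) (auto simp: vec_eq_iff)
    have "matrix ?f = (\<chi> i j. mat 1 $ i $ Transposition.transpose m n j)"
      by (auto simp: matrix_def mat_def axis_def vec_eq_iff Transposition.transpose_def)
    then have det: "det (matrix ?f) = - 1"
      using mn by (simp add: det_permute_columns permutes_swap_id sign_swap_id)
    \<comment> \<open>The swap reverses the difference of the two axis vectors and fixes the
      hyperplane where the two coordinates agree.\<close>
    have "brouwer_ball_degree UNIV ?f = - 1"
    proof (rule ball_degree_reflection[OF fin_dim_UNIV, where e = "axis m 1 - axis n 1" and U' = "{x. x $ m = x $ n}"])
      fix w :: "real^'n"
      define c where "c = (w $ m - w $ n) / 2"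
      have "w = c *\<^sub>R (axis m 1 - axis n 1) + (w - c *\<^sub>R (axis m 1 - axis n 1))" by simp
      moreover have "w - c *\<^sub>R (axis m 1 - axis n 1) \<in> {x. x $ m = x $ n}"
        using mn by (auto simp: c_def axis_def field_simps)
      ultimately show "\<exists>c. \<exists>v\<in>{x. x $ m = x $ n}. w = c *\<^sub>R (axis m 1 - axis n 1) + v" by blast
    next
      show "lin_inj UNIV UNIV ?f" unfolding lin_inj_vec_iff[OF lin] det by simp
    qed (use mn in \<open>auto simp: vec_eq_iff axis_def subspace_def Transposition.transpose_def\<close>)
    then show "det (matrix ?f) \<noteq> 0 \<longrightarrow> brouwer_ball_degree UNIV ?f = (if det (matrix ?f) > 0 then 1 else - 1)"
      using det by simp
  next
    fix m n :: 'n assume mn: "m \<noteq> n"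
    let ?f = "\<lambda>s x::real^'n. \<chi> i. if i = m then x $ m + s * x $ n else x $ i"
    have lin: "linear (?f s)" for s by (rule linearI) (auto simp: vec_eq_iff algebra_simps)
    have "matrix (?f s) = (\<chi> k. if k = m then row m (mat 1) + s *s row n (mat 1) else row k (mat 1))" for s
      using mn by (auto simp: matrix_def mat_def axis_def vec_eq_iff row_def)
    then have det: "det (matrix (?f s)) = 1" for s
      using det_row_operation[OF mn, of "mat 1" s] by simp
    have "brouwer_ball_degree UNIV (?f 0) = brouwer_ball_degree UNIV (?f 1)"
    proof (rule ball_degree_linear_homotopy[OF fin_dim_UNIV])
      show "continuous_on ({0..1} \<times> (UNIV \<inter> sphere 0 1)) (\<lambda>z::real \<times> (real^'n). ?f (fst z) (snd z))"
      proof (rule continuous_on_vec_lambda)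
        fix i show "continuous_on ({0..1} \<times> (UNIV \<inter> sphere 0 1))
          (\<lambda>z::real \<times> (real^'n). if i = m then snd z $ m + fst z * snd z $ n else snd z $ i)"
          by (cases "i = m") (auto intro!: continuous_intros)
      qed
    qed (simp add: lin_inj_vec_iff[OF lin] det)
    moreover have "brouwer_ball_degree UNIV (?f 0) = 1"
      by (rule ball_degree_id[OF fin_dim_UNIV]) (simp add: vec_eq_iff)
    ultimately show "det (matrix (\<lambda>x::real^'n. \<chi> i. if i = m then x $ m + x $ n else x $ i)) \<noteq> 0 \<longrightarrow>
       brouwer_ball_degree UNIV (\<lambda>x::real^'n. \<chi> i. if i = m then x $ m + x $ n else x $ i) =
       (if det (matrix (\<lambda>x::real^'n. \<chi> i. if i = m then x $ m + x $ n else x $ i)) > 0 then 1 else - 1)"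
      using det[of 1] by (simp only: mult_1) simp
  qed
  then show ?thesis using assms(2) by blast
qed

section \<open>Reduction of the Leray--Schauder degree\<close>

lemma ball_degree_cong:
  fixes W :: "'a::real_normed_vector set"
  assumes W: "fin_dim_subspace W" and eq: "\<And>x. x \<in> W \<Longrightarrow> norm x = 1 \<Longrightarrow> F x = G x"
  shows "brouwer_ball_degree W F = brouwer_ball_degree W G"
proof (cases "dim W")
  case 0
  then show ?thesis by (simp add: brouwer_ball_degree_def)
next
  case (Suc p)
  define b where "b = (SOME b. is_basis b (dim W) W)"
  obtain b0 where "is_basis b0 (dim W) W" using fin_dim_subspace_basis[OF W] .
  then have b: "is_basis b (Suc p) W"
    unfolding b_def Suc[symmetric] by (rule someI[of "\<lambda>b. is_basis b (dim W) W"])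
  have "Brouwer_degree2 p (sphere_map b (Suc p) F) = Brouwer_degree2 p (sphere_map b (Suc p) G)"
  proof (rule Brouwer_degree2_eq)
    fix x assume "x \<in> topspace (nsphere p)"
    then have "x \<in> usph (Suc p)" by (simp add: topspace_nsphere_usph)
    then show "sphere_map b (Suc p) F x = sphere_map b (Suc p) G x"
      unfolding sphere_map_nrm using lin_comb_nonzero[OF b] lin_comb_in[OF b] subspace_basis[OF b]
      by (subst eq) (simp_all add: subspace_scale)
  qed
  then show ?thesis unfolding brouwer_ball_degree_def b_def[symmetric] by (simp add: Suc)
qed

lemma fin_dim_subspace_subspace: "fin_dim_subspace W \<Longrightarrow> subspace W"
  using fin_dim_subspace_basis subspace_basis by blast

lemma fin_dim_subspace_join:
  assumes "fin_dim_subspace U" "fin_dim_subspace V" "U \<subseteq> X" "V \<subseteq> X" "subspace X"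
  obtains W where "fin_dim_subspace W" "U \<subseteq> W" "V \<subseteq> W" "W \<subseteq> X"
proof -
  obtain B C where B: "finite B" "U = span B" and C: "finite C" "V = span C"
    using assms by (auto simp: fin_dim_subspace_def)
  show thesis
  proof (rule that[of "span (B \<union> C)"])
    show "fin_dim_subspace (span (B \<union> C))" using B C unfolding fin_dim_subspace_def by blast
    show "U \<subseteq> span (B \<union> C)" "V \<subseteq> span (B \<union> C)" unfolding B C by (auto intro!: span_mono)
    have "B \<subseteq> X" "C \<subseteq> X" using assms(3,4) B C span_superset by blast+
    then show "span (B \<union> C) \<subseteq> X" using assms(5) by (intro span_minimal) auto
  qed
qed

text \<open>\<open>T\<close> leaves the finite-dimensional range of the projection \<open>P\<close> invariant, and the segment from
  \<open>T\<close> to \<open>T P + (1 - P)\<close> consists of maps bounded below by \<open>\<eta>\<close>; the latter map has the Brouwer degree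
  of \<open>T\<close> on \<open>P ` X\<close> on every finite-dimensional subspace containing \<open>P ` X\<close>.\<close>

definition reduces :: "'a::real_normed_vector set \<Rightarrow> ('a \<Rightarrow> 'a) \<Rightarrow> ('a \<Rightarrow> 'a) \<Rightarrow> real \<Rightarrow> bool"
  where "reduces X P T \<eta> \<longleftrightarrow> subspace X \<and> bounded_linear P \<and> bounded_linear T \<and>
    fin_dim_subspace (P ` X) \<and> P ` X \<subseteq> X \<and> (\<forall>x\<in>X. P (P x) = P x) \<and> T ` (P ` X) \<subseteq> P ` X \<and> \<eta> > 0 \<and>
    (\<forall>s\<in>{0..1}. \<forall>x\<in>X. \<eta> * norm x \<le> norm ((1 - s) *\<^sub>R T x + s *\<^sub>R (T (P x) + (x - P x))))"

text \<open>On the unit sphere the straight line from \<open>h\<close> to \<open>T'\<close> avoids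
  0: at time s it differs from the segment in \<open>reduces\<close>, of norm at least \<eta>, by (1
  - s)(h - T), of norm less than \<eta>. Then \<open>T'\<close> splits into \<open>T\<close> on the
  range of \<open>P\<close> and the identity on its kernel.\<close>

lemma reduces_ball_degree:
  assumes red: "reduces X P T \<eta>"
    and W: "fin_dim_subspace W" "P ` X \<subseteq> W" "W \<subseteq> X"
    and cont: "continuous_on (W \<inter> sphere 0 1) h"
    and into: "\<And>x. x \<in> W \<Longrightarrow> norm x = 1 \<Longrightarrow> h x \<in> W"
    and close: "\<And>x. x \<in> W \<Longrightarrow> norm x = 1 \<Longrightarrow> norm (h x - T x) < \<eta>"
  shows "brouwer_ball_degree W h = brouwer_ball_degree (P ` X) T"
proof -
  define T' where "T' = (\<lambda>x. T (P x) + (x - P x))"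
  have X: "subspace X" and bl: "bounded_linear P" "bounded_linear T" and P: "\<And>x. x \<in> X \<Longrightarrow> P (P x) = P x"
    and TP: "T ` (P ` X) \<subseteq> P ` X" and fd: "fin_dim_subspace (P ` X)" and \<eta>: "\<eta> > 0"
    and bd: "\<And>s x. s \<in> {0..1} \<Longrightarrow> x \<in> X \<Longrightarrow> \<eta> * norm x \<le> norm ((1 - s) *\<^sub>R T x + s *\<^sub>R T' x)"
    using red unfolding reduces_def T'_def by auto
  have sW: "subspace W" by (rule fin_dim_subspace_subspace[OF W(1)])
  have lin: "linear P" "linear T" using bl bounded_linear.linear by blast+
  have linT': "linear T'" unfolding T'_def
    by (rule linearI) (simp_all add: linear_add[OF lin(1)] linear_add[OF lin(2)] linear_scale[OF lin(1)] linear_scale[OF lin(2)] algebra_simps)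
  have T'W: "T' x \<in> W" if "x \<in> W" for x
  proof -
    have "T (P x) \<in> W" "P x \<in> W" using that W TP by blast+
    then show ?thesis unfolding T'_def using that sW by (simp add: subspace_add subspace_diff)
  qed
  define H where "H = (\<lambda>s x. (1 - s) *\<^sub>R h x + s *\<^sub>R T' x)"
  have "brouwer_ball_degree W (H 0) = brouwer_ball_degree W (H 1)"
  proof (rule ball_degree_homotopy[OF W(1)])
    have "bounded_linear T'" unfolding T'_def
      using bl by (intro bounded_linear_add bounded_linear_sub bounded_linear_ident
          bounded_linear_compose[OF bl(2) bl(1)]) auto
    then have cT': "continuous_on S T'" for S using linear_continuous_on by blast
    show "continuous_on ({0..1} \<times> (W \<inter> sphere 0 1)) (\<lambda>z. H (fst z) (snd z))"
      unfolding H_def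
      by (intro continuous_intros continuous_on_compose2[OF cont] continuous_on_compose2[OF cT'[of UNIV]]) auto
  next
    fix s :: real and x assume s: "s \<in> {0..1}" and x: "x \<in> W" "norm x = 1"
    show "H s x \<in> W" using into T'W x sW by (simp add: H_def subspace_add subspace_scale)
    have "\<eta> \<le> norm ((1 - s) *\<^sub>R T x + s *\<^sub>R T' x)" using bd[OF s, of x] x W(3) by auto
    also have "(1 - s) *\<^sub>R T x + s *\<^sub>R T' x = H s x - (1 - s) *\<^sub>R (h x - T x)"
      by (simp add: H_def algebra_simps)
    also have "norm \<dots> \<le> norm (H s x) + norm ((1 - s) *\<^sub>R (h x - T x))" by (rule norm_triangle_ineq4)
    also have "norm ((1 - s) *\<^sub>R (h x - T x)) \<le> norm (h x - T x)"
      using s by (simp add: mult_left_le_one_le)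
    also have "\<dots> < \<eta>" by (rule close[OF x])
    finally show "H s x \<noteq> 0" by auto
  qed
  then have "brouwer_ball_degree W h = brouwer_ball_degree W T'" by (simp add: H_def)
  also have "\<dots> = brouwer_ball_degree (P ` X) T'"
  proof (rule ball_degree_direct_sum[OF W(1) fin_dim_subspace_subspace[OF fd] W(2)])
    show "subspace {w \<in> W. P w = 0}"
      using sW by (auto simp: subspace_def linear_0[OF lin(1)] linear_add[OF lin(1)] linear_scale[OF lin(1)])
    show "lin_inj W W T'"
    proof (rule lin_injI[OF linT' T'W])
      fix x assume x: "x \<in> W" "T' x = 0"
      then have "\<eta> * norm x \<le> 0" using bd[of 1 x] W(3) by auto
      then show "x = 0" using \<eta> by (simp add: mult_le_0_iff)
    qed
  next
    fix w assume w: "w \<in> W"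
    then have "P w \<in> P ` X" "w - P w \<in> {w \<in> W. P w = 0}" "w = P w + (w - P w)"
      using W P sW by (auto simp: linear_diff[OF lin(1)] intro!: subspace_diff)
    then show "\<exists>u\<in>P ` X. \<exists>v\<in>{w \<in> W. P w = 0}. w = u + v" by blast
  next
    show "T' ` P ` X \<subseteq> P ` X" using TP P by (auto simp: T'_def)
  qed (auto simp: P T'_def linear_0[OF lin(2)])
  also have "\<dots> = brouwer_ball_degree (P ` X) T"
    by (rule ball_degree_cong[OF fd]) (auto simp: T'_def P)
  finally show ?thesis .
qed

text \<open>For existence of the described value, \<delta> = \<eta> and the range of
  \<open>P\<close> serve as witnesses. For uniqueness, \<open>approx\<close> supplies a map
  admissible for both candidates at once, so that a second value cannot hold vacuously.\<close>

lemma leray_schauder_reduces: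
  fixes X :: "'a::real_normed_vector set"
  assumes red: "reduces X P T \<eta>"
    and approx: "\<And>\<epsilon>. \<epsilon> > 0 \<Longrightarrow> \<exists>W g. fin_dim_subspace W \<and> W \<subseteq> X \<and> continuous_on (X \<inter> cball 0 1) g \<and>
      g ` (X \<inter> cball 0 1) \<subseteq> W \<and> (\<forall>x\<in>X \<inter> cball 0 1. norm ((x - g x) - T x) < \<epsilon>)"
  shows "leray_schauder_degree X T = brouwer_ball_degree (P ` X) T"
proof -
  have X: "subspace X" and fd: "fin_dim_subspace (P ` X)" "P ` X \<subseteq> X" and \<eta>: "\<eta> > 0"
    using red unfolding reduces_def by blast+
  have key: "brouwer_ball_degree W (\<lambda>x. x - g x) = brouwer_ball_degree (P ` X) T"
    if W: "fin_dim_subspace W" "P ` X \<subseteq> W" "W \<subseteq> X"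
      and g: "continuous_on (X \<inter> cball 0 1) g" "g ` (X \<inter> cball 0 1) \<subseteq> W"
        "\<forall>x\<in>X \<inter> cball 0 1. norm ((x - g x) - T x) < \<eta>" for W g
  proof (rule reduces_ball_degree[OF red W])
    show "continuous_on (W \<inter> sphere 0 1) (\<lambda>x. x - g x)"
      using W(3) by (intro continuous_intros continuous_on_subset[OF g(1)]) auto
  next
    fix x assume x: "x \<in> W" "norm x = 1"
    then have "x \<in> X \<inter> cball 0 1" using W(3) by auto
    then have "g x \<in> W" "norm ((x - g x) - T x) < \<eta>" using g by blast+
    then show "x - g x \<in> W" "norm (x - g x - T x) < \<eta>"
      using x fin_dim_subspace_subspace[OF W(1)] by (auto simp: subspace_diff)
  qed
  show ?thesis
    unfolding leray_schauder_degree_def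
  proof (rule the_equality)
    show "\<exists>\<delta>>0. \<exists>W\<^sub>0. fin_dim_subspace W\<^sub>0 \<and> W\<^sub>0 \<subseteq> X \<and>
      (\<forall>W g. fin_dim_subspace W \<and> W\<^sub>0 \<subseteq> W \<and> W \<subseteq> X \<and>
             continuous_on (X \<inter> cball 0 1) g \<and> g ` (X \<inter> cball 0 1) \<subseteq> W \<and>
             (\<forall>x\<in>X \<inter> cball 0 1. norm ((x - g x) - T x) < \<delta>)
         \<longrightarrow> brouwer_ball_degree W (\<lambda>x. x - g x) = brouwer_ball_degree (P ` X) T)"
      by (intro exI[of _ \<eta>] exI[of _ "P ` X"] conjI allI impI \<eta> fd; elim conjE; rule key; assumption)
  next
    fix d
    assume "\<exists>\<delta>>0. \<exists>W\<^sub>0. fin_dim_subspace W\<^sub>0 \<and> W\<^sub>0 \<subseteq> X \<and>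
      (\<forall>W g. fin_dim_subspace W \<and> W\<^sub>0 \<subseteq> W \<and> W \<subseteq> X \<and>
             continuous_on (X \<inter> cball 0 1) g \<and> g ` (X \<inter> cball 0 1) \<subseteq> W \<and>
             (\<forall>x\<in>X \<inter> cball 0 1. norm ((x - g x) - T x) < \<delta>)
         \<longrightarrow> brouwer_ball_degree W (\<lambda>x. x - g x) = d)"
    then obtain \<delta> W1 where \<delta>: "\<delta> > 0" and W1: "fin_dim_subspace W1" "W1 \<subseteq> X" and
      d: "\<forall>W g. fin_dim_subspace W \<and> W1 \<subseteq> W \<and> W \<subseteq> X \<and>
             continuous_on (X \<inter> cball 0 1) g \<and> g ` (X \<inter> cball 0 1) \<subseteq> W \<and>
             (\<forall>x\<in>X \<inter> cball 0 1. norm ((x - g x) - T x) < \<delta>)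
         \<longrightarrow> brouwer_ball_degree W (\<lambda>x. x - g x) = d"
      by (elim exE conjE) (rule that)
    obtain W2 g where g: "fin_dim_subspace W2" "W2 \<subseteq> X" "continuous_on (X \<inter> cball 0 1) g"
      "g ` (X \<inter> cball 0 1) \<subseteq> W2" "\<forall>x\<in>X \<inter> cball 0 1. norm ((x - g x) - T x) < min \<delta> \<eta>"
      using approx[of "min \<delta> \<eta>"] \<delta> \<eta> by auto
    \<comment> \<open>Enlarging to a common subspace lets both descriptions apply to the same
      \<open>W\<close> and \<open>g\<close>.\<close>
    obtain W3 where W3: "fin_dim_subspace W3" "W1 \<subseteq> W3" "W2 \<subseteq> W3" "W3 \<subseteq> X"
      using fin_dim_subspace_join[OF W1(1) g(1) W1(2) g(2) X] .
    obtain W where W: "fin_dim_subspace W" "P ` X \<subseteq> W" "W3 \<subseteq> W" "W \<subseteq> X"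
      using fin_dim_subspace_join[OF fd(1) W3(1) fd(2) W3(4) X] .
    have gW: "g ` (X \<inter> cball 0 1) \<subseteq> W" using g(4) W3(3) W(3) by (meson order_trans)
    have "W1 \<subseteq> W" using W3(2) W(3) by (rule order_trans)
    moreover have close: "\<forall>x\<in>X \<inter> cball 0 1. norm ((x - g x) - T x) < \<delta>"
      "\<forall>x\<in>X \<inter> cball 0 1. norm ((x - g x) - T x) < \<eta>" using g(5) by simp_all
    ultimately have "brouwer_ball_degree W (\<lambda>x. x - g x) = d"
      by (intro d[rule_format] conjI W g(3) gW) auto
    moreover have "brouwer_ball_degree W (\<lambda>x. x - g x) = brouwer_ball_degree (P ` X) T"
      by (rule key[OF W(1,2,4) g(3) gW close(2)])
    ultimately show "d = brouwer_ball_degree (P ` X) T" by simp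
  qed
qed

section \<open>Convolution with periodic kernels\<close>

text \<open>The argument is t + r; for symmetric kernels and p-periodic functions this is ordinary
  convolution over one period. Only the values of \<open>k\<close> on [0, p] enter.\<close>

definition conv :: "real \<Rightarrow> (real \<Rightarrow> real) \<Rightarrow> (real \<Rightarrow> 'v::euclidean_space) \<Rightarrow> real \<Rightarrow> 'v"
  where "conv p k h t = integral {0..p} (\<lambda>r. k r *\<^sub>R h (t + r))"

lemma has_vector_derivative_shift:
  fixes h :: "real \<Rightarrow> 'v::real_normed_vector"
  assumes "(h has_vector_derivative d) (at (t + c))"
  shows "((\<lambda>t. h (t + c)) has_vector_derivative d) (at t)"
proof -
  have "((\<lambda>t. t + c) has_vector_derivative 1) (at t)"
    unfolding has_real_derivative_iff_has_vector_derivative[symmetric] by (auto intro!: derivative_eq_intros)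
  from vector_diff_chain_at[OF this, of h d] assms show ?thesis by (simp add: o_def)
qed

lemma integral_reverse:
  fixes g :: "real \<Rightarrow> 'v::euclidean_space"
  shows "integral {0..p} (\<lambda>r. g (p - r)) = integral {0..p} g"
  using Henstock_Kurzweil_Integration.integral_reflect_real[of p 0 g] integral_shift_real_ivl[of "- p" "- p" 0 "\<lambda>r. g (- r)"]
  by simp

lemma conv_integrable:
  fixes h :: "real \<Rightarrow> 'v::euclidean_space"
  assumes "continuous_on {0..p} k" "continuous_on UNIV h"
  shows "(\<lambda>r. k r *\<^sub>R h (t + r)) integrable_on {0..p}"
  using assms by (intro integrable_continuous_interval continuous_intros continuous_on_compose2[OF assms(2)]) auto

lemma continuous_on_conv:
  fixes h :: "real \<Rightarrow> 'v::euclidean_space"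
  assumes "continuous_on {0..p} k" "continuous_on UNIV h"
  shows "continuous_on UNIV (conv p k h)"
proof -
  have "continuous_on (UNIV \<times> cbox 0 p) (\<lambda>(t, r). k r *\<^sub>R h (t + r))"
    unfolding case_prod_beta
    by (intro continuous_intros continuous_on_compose2[OF assms(1)] continuous_on_compose2[OF assms(2)]) auto
  from integral_continuous_on_param[OF this] show ?thesis by (simp add: conv_def[abs_def])
qed

lemma conv_has_vector_derivative:
  fixes h :: "real \<Rightarrow> 'v::euclidean_space"
  assumes k: "continuous_on {0..p} k" and h: "\<And>t. (h has_vector_derivative h' t) (at t)"
    and h': "continuous_on UNIV h'"
  shows "(conv p k h has_vector_derivative conv p k h' t) (at t)"
proof -
  have ch: "continuous_on UNIV h"
    using h has_vector_derivative_continuous by (auto simp: continuous_on_eq_continuous_at) blast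
  have "((\<lambda>t. integral (cbox 0 p) (\<lambda>r. k r *\<^sub>R h (t + r))) has_vector_derivative
      integral (cbox 0 p) (\<lambda>r. k r *\<^sub>R h' (t + r))) (at t within UNIV)"
  proof (rule leibniz_rule_vector_derivative)
    fix s r :: real
    have "((\<lambda>s. h (s + r)) has_vector_derivative h' (s + r)) (at s)"
      by (rule has_vector_derivative_shift[OF h])
    from bounded_linear.has_vector_derivative[OF bounded_linear_scaleR_right this, of "k r"]
    show "((\<lambda>s. k r *\<^sub>R h (s + r)) has_vector_derivative k r *\<^sub>R h' (s + r)) (at s within UNIV)"
      by simp
  next
    fix s :: real
    show "(\<lambda>r. k r *\<^sub>R h (s + r)) integrable_on cbox 0 p"
      using conv_integrable[OF k ch] by simp
  next
    show "continuous_on (UNIV \<times> cbox 0 p) (\<lambda>(t, r). k r *\<^sub>R h' (t + r))"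
      unfolding case_prod_beta
      by (intro continuous_intros continuous_on_compose2[OF k] continuous_on_compose2[OF h']) auto
  qed auto
  then show ?thesis by (simp add: conv_def[abs_def])
qed

lemma norm_conv_le:
  fixes h :: "real \<Rightarrow> 'v::euclidean_space"
  assumes "p \<ge> 0" "continuous_on {0..p} k" "continuous_on UNIV h"
    and "\<And>r. r \<in> {0..p} \<Longrightarrow> \<bar>k r\<bar> \<le> C" "\<And>t. norm (h t) \<le> M"
  shows "norm (conv p k h t) \<le> p * C * M"
proof -
  have "0 \<le> C" using assms(4)[of 0] assms(1) by auto
  have "norm (conv p k h t) \<le> C * M * (p - 0)"
    unfolding conv_def
  proof (rule integral_bound)
    show "continuous_on {0..p} (\<lambda>r. k r *\<^sub>R h (t + r))"
      using assms by (intro continuous_intros continuous_on_compose2[OF assms(3)]) auto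
    show "norm (k r *\<^sub>R h (t + r)) \<le> C * M" if "r \<in> {0..p}" for r
      using assms(4)[OF that] assms(5)[of "t + r"] \<open>0 \<le> C\<close> by (auto intro!: mult_mono)
  qed (use assms in auto)
  then show ?thesis by (simp add: mult_ac)
qed

lemma conv_add:
  fixes h :: "real \<Rightarrow> 'v::euclidean_space"
  assumes "continuous_on {0..p} k" "continuous_on UNIV h" "continuous_on UNIV g"
  shows "conv p k (\<lambda>t. h t + g t) t = conv p k h t + conv p k g t"
  using integral_add[OF conv_integrable[OF assms(1,2)] conv_integrable[OF assms(1,3)]]
  by (simp add: conv_def scaleR_right_distrib)

lemma conv_linear:
  fixes h :: "real \<Rightarrow> 'v::euclidean_space" and A :: "'v \<Rightarrow> 'w::euclidean_space"
  assumes "continuous_on {0..p} k" "continuous_on UNIV h" "linear A"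
  shows "conv p k (\<lambda>t. A (h t)) t = A (conv p k h t)"
proof -
  have "integral {0..p} (A \<circ> (\<lambda>r. k r *\<^sub>R h (t + r))) = A (conv p k h t)"
    unfolding conv_def
    using assms by (intro integral_linear conv_integrable) (simp_all add: linear_conv_bounded_linear)
  then show ?thesis by (simp add: conv_def o_def linear_scale[OF assms(3)])
qed

lemma conv_kernel_sum:
  fixes h :: "real \<Rightarrow> 'v::euclidean_space"
  assumes "finite I" "\<And>i. i \<in> I \<Longrightarrow> continuous_on {0..p} (k i)" "continuous_on UNIV h"
  shows "conv p (\<lambda>r. \<Sum>i\<in>I. c i * k i r) h t = (\<Sum>i\<in>I. c i *\<^sub>R conv p (k i) h t)"
proof -
  have "integral {0..p} (\<lambda>r. \<Sum>i\<in>I. c i *\<^sub>R (k i r *\<^sub>R h (t + r))) =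
      (\<Sum>i\<in>I. integral {0..p} (\<lambda>r. c i *\<^sub>R (k i r *\<^sub>R h (t + r))))"
    using assms by (intro integral_sum integrable_cmul conv_integrable) auto
  then show ?thesis by (simp add: conv_def scaleR_sum_left flip: scaleR_scaleR)
qed

lemma conv_kernel_diff:
  fixes h :: "real \<Rightarrow> 'v::euclidean_space"
  assumes "continuous_on {0..p} k" "continuous_on {0..p} l" "continuous_on UNIV h"
  shows "conv p (\<lambda>r. k r - l r) h t = conv p k h t - conv p l h t"
  using integral_diff[OF conv_integrable[OF assms(1,3)] conv_integrable[OF assms(2,3)]]
  by (simp add: conv_def scaleR_left_diff_distrib)

lemma conv_kernel_cong: "(\<And>r. r \<in> {0..p} \<Longrightarrow> k r = l r) \<Longrightarrow> conv p k h t = conv p l h t"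
  unfolding conv_def by (rule integral_cong) simp

text \<open>Fubini on the square with side [0, p].\<close>

lemma conv_commute:
  fixes h :: "real \<Rightarrow> 'v::euclidean_space"
  assumes k: "continuous_on {0..p} k" and l: "continuous_on {0..p} l" and h: "continuous_on UNIV h"
  shows "conv p k (conv p l h) t = conv p l (conv p k h) t"
proof -
  have *: "k r *\<^sub>R conv p l h (t + r) = integral {0..p} (\<lambda>s. (k r * l s) *\<^sub>R h (t + r + s))" for r k l
    by (simp add: conv_def add.assoc flip: integral_cmul scaleR_scaleR)
  have "conv p k (conv p l h) t = integral (cbox 0 p) (\<lambda>r. integral (cbox 0 p) (\<lambda>s. (k r * l s) *\<^sub>R h (t + r + s)))"
    by (simp add: conv_def[of p k] *)
  also have "\<dots> = integral (cbox 0 p) (\<lambda>s. integral (cbox 0 p) (\<lambda>r. (k r * l s) *\<^sub>R h (t + r + s)))"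
  proof (rule integral_swap_continuous)
    have c: "continuous_on (cbox (0, 0) (p, p)) (\<lambda>z. k (fst z))" "continuous_on (cbox (0, 0) (p, p)) (\<lambda>z. l (snd z))"
      by (rule continuous_on_compose2[OF k continuous_on_fst[OF continuous_on_id]], force)
        (rule continuous_on_compose2[OF l continuous_on_snd[OF continuous_on_id]], force)
    show "continuous_on (cbox (0, 0) (p, p)) (\<lambda>(r, s). (k r * l s) *\<^sub>R h (t + r + s))"
      unfolding case_prod_beta by (intro continuous_intros c continuous_on_compose2[OF h]) auto
  qed
  also have "\<dots> = integral {0..p} (\<lambda>s. l s *\<^sub>R conv p k h (t + s))"
    unfolding *[of l _ k] by (simp add: mult.commute add_ac)
  also have "\<dots> = conv p l (conv p k h) t" by (simp add: conv_def[of p l])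
  finally show ?thesis .
qed

text \<open>Near \<open>t0\<close> the window integral is G (t + p) - G t for an antiderivative
  \<open>G\<close>, taken on a compact interval that contains every window starting within distance
  1 of \<open>t0\<close>.\<close>

lemma window_integral_deriv:
  fixes g :: "real \<Rightarrow> 'v::euclidean_space"
  assumes "p \<ge> 0" "continuous_on UNIV g"
  shows "((\<lambda>t. integral {0..p} (\<lambda>r. g (t + r))) has_vector_derivative (g (t0 + p) - g t0)) (at t0)"
proof -
  let ?I = "{t0 - 1..t0 + p + 1}"
  obtain G where G: "\<And>x. x \<in> ?I \<Longrightarrow> (G has_vector_derivative g x) (at x within ?I)"
    using antiderivative_continuous[OF continuous_on_subset[OF assms(2)]] by (metis subset_UNIV)
  have Gi: "(G has_vector_derivative g x) (at x)" if "x \<in> {t0 - 1<..<t0 + p + 1}" for x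
    using G[of x] that at_within_interior[of x ?I] by (simp add: interior_atLeastAtMost_real)
  have eq: "integral {0..p} (\<lambda>r. g (t + r)) = G (t + p) - G t" if t: "t \<in> {t0 - 1<..<t0 + 1}" for t
  proof -
    have "((\<lambda>r. g (t + r)) has_integral G (t + p) - G (t + 0)) {0..p}"
    proof (rule fundamental_theorem_of_calculus[OF assms(1)])
      fix r assume "r \<in> {0..p}"
      then have "t + r \<in> {t0 - 1<..<t0 + p + 1}" using t by auto
      then have "((\<lambda>r. G (r + t)) has_vector_derivative g (r + t)) (at r)"
        by (intro has_vector_derivative_shift Gi) (simp add: add.commute)
      then have "((\<lambda>r. G (t + r)) has_vector_derivative g (t + r)) (at r)"
        by (simp add: add.commute)
      then show "((\<lambda>r. G (t + r)) has_vector_derivative g (t + r)) (at r within {0..p})"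
        by (rule has_vector_derivative_at_within)
    qed
    then show ?thesis by (simp add: integral_unique)
  qed
  have dG: "((\<lambda>t. G (t + p) - G t) has_vector_derivative (g (t0 + p) - g t0)) (at t0)"
  proof (rule has_vector_derivative_diff)
    have "t0 + p \<in> {t0 - 1<..<t0 + p + 1}" "t0 \<in> {t0 - 1<..<t0 + p + 1}" using assms by auto
    note Gi = this[THEN Gi]
    show "((\<lambda>t. G (t + p)) has_vector_derivative g (t0 + p)) (at t0)"
      by (rule has_vector_derivative_shift[OF Gi(1)])
    show "(G has_vector_derivative g t0) (at t0)" by (rule Gi(2))
  qed
  show ?thesis
    by (rule has_vector_derivative_transform_within_open[OF dG, where S = "{t0 - 1<..<t0 + 1}"])
      (simp_all add: eq)
qed

text \<open>As a function of t the window integral has derivative g (t + p) - g t = 0.\<close>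

lemma integral_periodic_shift:
  fixes g :: "real \<Rightarrow> 'v::euclidean_space"
  assumes "p \<ge> 0" "continuous_on UNIV g" "\<And>t. g (t + p) = g t"
  shows "integral {0..p} (\<lambda>r. g (t + r)) = integral {0..p} g"
proof -
  have "((\<lambda>t. integral {0..p} (\<lambda>r. g (t + r))) has_vector_derivative 0) (at t within UNIV)" for t
    using window_integral_deriv[OF assms(1,2), of t] assms(3) by simp
  then obtain c where "\<And>t. t \<in> UNIV \<Longrightarrow> integral {0..p} (\<lambda>r. g (t + r)) = c"
    using has_vector_derivative_zero_constant[OF convex_UNIV, of "\<lambda>t. integral {0..p} (\<lambda>r. g (t + r))"] by blast
  from this[of t] this[of 0] show ?thesis by simp
qed

lemma conv_periodic:
  assumes "\<And>t. h (t + p) = h t" shows "conv p k h (t + p) = conv p k h t"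
proof -
  have "h (t + p + r) = h (t + r)" for r using assms[of "t + r"] by (simp add: add_ac)
  then show ?thesis by (simp add: conv_def)
qed

lemma conv_shift: "conv p k (\<lambda>t. h (t + c)) t = conv p k h (t + c)"
  by (simp add: conv_def add_ac)

text \<open>Substituting p - r for r leaves the kernel invariant and changes the argument of
  \<open>h\<close> by a full period.\<close>

lemma conv_reflect:
  fixes h :: "real \<Rightarrow> 'v::euclidean_space"
  assumes k: "continuous_on {0..p} k" "\<And>r. r \<in> {0..p} \<Longrightarrow> k (p - r) = k r"
    and h: "continuous_on UNIV h" "\<And>t. h (t + p) = h t"
  shows "conv p k (\<lambda>t. h (- t)) t = conv p k h (- t)"
proof -
  have "conv p k h (- t) = integral {0..p} (\<lambda>r. k (p - r) *\<^sub>R h (- t + (p - r)))"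
    unfolding conv_def by (rule integral_reverse[symmetric])
  also have "\<dots> = conv p k (\<lambda>t. h (- t)) t"
    unfolding conv_def
  proof (rule integral_cong)
    fix r assume r: "r \<in> {0..p}"
    have "- t + (p - r) = - (t + r) + p" by simp
    then have "h (- t + (p - r)) = h (- (t + r))" by (metis h(2))
    then show "k (p - r) *\<^sub>R h (- t + (p - r)) = k r *\<^sub>R h (- (t + r))" using k(2)[OF r] by simp
  qed
  finally show ?thesis ..
qed

lemma conv_kernel_lincomb:
  fixes h :: "real \<Rightarrow> 'v::euclidean_space"
  assumes "continuous_on {0..p} k" "continuous_on {0..p} l" "continuous_on UNIV h"
  shows "conv p (\<lambda>r. a * k r + b * l r) h t = a *\<^sub>R conv p k h t + b *\<^sub>R conv p l h t"
proof -
  have "conv p (\<lambda>r. a * k r + b * l r) h t =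
      integral {0..p} (\<lambda>r. a *\<^sub>R (k r *\<^sub>R h (t + r)) + b *\<^sub>R (l r *\<^sub>R h (t + r)))"
    by (simp add: conv_def scaleR_left_distrib)
  also have "\<dots> = integral {0..p} (\<lambda>r. a *\<^sub>R (k r *\<^sub>R h (t + r))) + integral {0..p} (\<lambda>r. b *\<^sub>R (l r *\<^sub>R h (t + r)))"
    using assms by (intro integral_add integrable_cmul conv_integrable)
  finally show ?thesis by (simp only: conv_def integral_cmul)
qed

section \<open>The periodic Green function of u'' - u\<close>

text \<open>Pulling out exp (- c t) leaves a window integral, so the derivative exists for merely
  continuous \<open>h\<close>. The term with exp (c p) - 1 is the jump of the kernel between the two
  ends of the period.\<close>

lemma conv_exp_deriv:
  fixes h :: "real \<Rightarrow> 'v::euclidean_space"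
  assumes p: "p \<ge> 0" and h: "continuous_on UNIV h" "\<And>t. h (t + p) = h t"
  shows "(conv p (\<lambda>r. exp (c * r)) h has_vector_derivative
    (- c) *\<^sub>R conv p (\<lambda>r. exp (c * r)) h t + (exp (c * p) - 1) *\<^sub>R h t) (at t)"
proof -
  define g where "g = (\<lambda>s. exp (c * s) *\<^sub>R h s)"
  have cg: "continuous_on UNIV g" unfolding g_def by (intro continuous_intros h)
  have eq: "conv p (\<lambda>r. exp (c * r)) h = (\<lambda>t. exp (- (c * t)) *\<^sub>R integral {0..p} (\<lambda>r. g (t + r)))"
  proof
    fix t
    have "exp (- (c * t)) *\<^sub>R g (t + r) = exp (c * r) *\<^sub>R h (t + r)" for r
      by (simp add: g_def distrib_left flip: exp_add)
    then show "conv p (\<lambda>r. exp (c * r)) h t = exp (- (c * t)) *\<^sub>R integral {0..p} (\<lambda>r. g (t + r))"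
      by (simp add: conv_def flip: integral_cmul)
  qed
  have d1: "((\<lambda>t. exp (- (c * t))) has_real_derivative (- c * exp (- (c * t)))) (at t)"
    by (auto intro!: derivative_eq_intros)
  have "((\<lambda>t. exp (- (c * t)) *\<^sub>R integral {0..p} (\<lambda>r. g (t + r))) has_vector_derivative
      (exp (- (c * t)) *\<^sub>R (g (t + p) - g t) + (- c * exp (- (c * t))) *\<^sub>R integral {0..p} (\<lambda>r. g (t + r)))) (at t)"
    by (rule has_vector_derivative_scaleR[OF d1 window_integral_deriv[OF p cg]])
  moreover have "exp (- (c * t)) *\<^sub>R (g (t + p) - g t) = (exp (c * p) - 1) *\<^sub>R h t"
    by (simp add: g_def h(2) distrib_left exp_add exp_minus scaleR_diff_right scaleR_diff_left)
  ultimately show ?thesis unfolding eq by (simp add: add.commute)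
qed

text \<open>This is - cosh (r - p / 2) / (2 sinh (p / 2)), the Green function of u'' - u under
  p-periodic boundary conditions, written with exponentials so that \<open>conv_exp_deriv\<close>
  applies.\<close>

definition green :: "real \<Rightarrow> real \<Rightarrow> real"
  where "green p r = - (exp (- r) + exp (r - p)) / (2 * (1 - exp (- p)))"

text \<open>Minus the r-derivative of \<open>green\<close>: the t-derivative falls on h (t + r), and
  integration by parts moves it to the kernel with a change of sign.\<close>

definition dgreen :: "real \<Rightarrow> real \<Rightarrow> real"
  where "dgreen p r = - (exp (- r) - exp (r - p)) / (2 * (1 - exp (- p)))"

lemma continuous_on_green: "continuous_on S (green p)" "continuous_on S (dgreen p)"
  unfolding green_def[abs_def] dgreen_def[abs_def] divide_inverse by (intro continuous_intros)+

lemma green_symmetric: "green p (p - r) = green p r"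
  by (simp add: green_def)

text \<open>Both kernels are combinations of exp (- r) and exp r. The jumps of the two exponentials
  contribute 1/2 and -1/2 to the first derivative and cancel; in the second they add up to 1, which
  produces the summand \<open>h\<close>.\<close>

lemma conv_green_deriv:
  fixes h :: "real \<Rightarrow> 'v::euclidean_space"
  assumes p: "p > 0" and h: "continuous_on UNIV h" "\<And>t. h (t + p) = h t"
  shows "(conv p (green p) h has_vector_derivative conv p (dgreen p) h t) (at t)"
    "(conv p (dgreen p) h has_vector_derivative (conv p (green p) h t + h t)) (at t)"
proof -
  define D where "D = 2 * (1 - exp (- p))"
  define a where "a = - 1 / D"
  define b where "b = a * exp (- p)"
  let ?m = "conv p (\<lambda>r. exp (- 1 * r)) h" and ?q = "conv p (\<lambda>r. exp (1 * r)) h"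
  have nz: "D > 0" using p by (simp add: D_def)
  have er: "exp (r - p) = exp (- p) * exp r" for r by (simp flip: exp_add)
  have gr: "green p r = - (exp (- r) + exp (- p) * exp r) / D" for r
    by (simp only: green_def D_def er)
  have dgr: "dgreen p r = - (exp (- r) - exp (- p) * exp r) / D" for r
    by (simp only: dgreen_def D_def er)
  have ce: "continuous_on {0..p} (\<lambda>r. exp (c * r))" for c :: real by (intro continuous_intros)
  have g: "conv p (green p) h = (\<lambda>t. a *\<^sub>R ?m t + b *\<^sub>R ?q t)"
    unfolding conv_kernel_lincomb[OF ce ce h(1), symmetric]
    by (intro ext conv_kernel_cong) (use nz in \<open>simp add: gr a_def b_def field_simps\<close>)
  have d: "conv p (dgreen p) h = (\<lambda>t. a *\<^sub>R ?m t + (- b) *\<^sub>R ?q t)"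
    unfolding conv_kernel_lincomb[OF ce ce h(1), symmetric]
    by (intro ext conv_kernel_cong) (use nz in \<open>simp add: dgr a_def b_def field_simps\<close>)
  note m = conv_exp_deriv[OF less_imp_le[OF p] h, of "- 1" t]
  note q = conv_exp_deriv[OF less_imp_le[OF p] h, of 1 t]
  have eD: "exp (- p) - 1 = - D / 2" by (simp add: D_def)
  have e1: "a * (exp (- p) - 1) = 1 / 2" unfolding eD a_def using nz by simp
  have ep: "exp (- p) * exp p = 1" by (simp flip: exp_add)
  have "b * (exp p - 1) = - (a * (exp (- p) - 1))"
    by (simp add: b_def right_diff_distrib mult.assoc ep)
  then have e2: "b * (exp p - 1) = - 1 / 2" using e1 by simp
  have lin: "((\<lambda>t. c *\<^sub>R ?m t + e *\<^sub>R ?q t) has_vector_derivative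
     c *\<^sub>R (?m t + (exp (- p) - 1) *\<^sub>R h t) + e *\<^sub>R (- ?q t + (exp p - 1) *\<^sub>R h t)) (at t)" for c e
    using bounded_linear.has_vector_derivative[OF bounded_linear_scaleR_right m, of c]
      bounded_linear.has_vector_derivative[OF bounded_linear_scaleR_right q, of e]
    by (auto intro!: has_vector_derivative_add)
  have "a *\<^sub>R (?m t + (exp (- p) - 1) *\<^sub>R h t) + b *\<^sub>R (- ?q t + (exp p - 1) *\<^sub>R h t) =
      a *\<^sub>R ?m t + (- b) *\<^sub>R ?q t + (a * (exp (- p) - 1) + b * (exp p - 1)) *\<^sub>R h t"
    by (simp add: algebra_simps)
  then show "(conv p (green p) h has_vector_derivative conv p (dgreen p) h t) (at t)"
    using lin[of a b] unfolding g d e1 e2 by simp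
  have "a *\<^sub>R (?m t + (exp (- p) - 1) *\<^sub>R h t) + (- b) *\<^sub>R (- ?q t + (exp p - 1) *\<^sub>R h t) =
      a *\<^sub>R ?m t + b *\<^sub>R ?q t + (a * (exp (- p) - 1) - b * (exp p - 1)) *\<^sub>R h t"
    by (simp add: algebra_simps)
  then show "(conv p (dgreen p) h has_vector_derivative (conv p (green p) h t + h t)) (at t)"
    using lin[of a "- b"] unfolding g d e1 e2 by simp
qed

text \<open>Solutions have the form exp (c t) w, unbounded in one direction of time unless w =
  0.\<close>

lemma exp_ode_bounded_zero:
  fixes v :: "real \<Rightarrow> 'v::euclidean_space"
  assumes d: "\<And>t. (v has_vector_derivative c *\<^sub>R v t) (at t)" and c: "c \<noteq> 0" and b: "bounded (range v)"
  shows "v t = 0"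
proof -
  have "((\<lambda>t. exp (- (c * t)) *\<^sub>R v t) has_vector_derivative
      (exp (- (c * t)) *\<^sub>R (c *\<^sub>R v t) + (- c * exp (- (c * t))) *\<^sub>R v t)) (at t)" for t
    by (rule has_vector_derivative_scaleR[OF _ d]) (auto intro!: derivative_eq_intros)
  then have "((\<lambda>t. exp (- (c * t)) *\<^sub>R v t) has_vector_derivative 0) (at t within UNIV)" for t
    by (simp add: mult.commute)
  then obtain w where w: "\<And>t. t \<in> UNIV \<Longrightarrow> exp (- (c * t)) *\<^sub>R v t = w"
    using has_vector_derivative_zero_constant[OF convex_UNIV, of "\<lambda>t. exp (- (c * t)) *\<^sub>R v t"] by blast
  have v: "v t = exp (c * t) *\<^sub>R w" for t
    using w[of t] by (auto simp: exp_minus)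
  obtain B where B: "\<And>t. norm (v t) \<le> B" using b by (auto simp: bounded_iff)
  have "w = 0"
  proof (rule ccontr)
    assume "w \<noteq> 0"
    \<comment> \<open>At time s / c the norm is exp s times norm w, while the bound \<open>B\<close>
      is s times norm w, and exp s exceeds s.\<close>
    define s where "s = B / norm w"
    have "exp s * norm w \<le> B" using B[of "s / c"] c by (simp add: v)
    then have "exp s \<le> s" using \<open>w \<noteq> 0\<close> by (simp add: s_def field_simps)
    moreover have "1 + s \<le> exp s" by (rule exp_ge_add_one_self)
    ultimately show False by simp
  qed
  then show ?thesis by (simp add: v)
qed

text \<open>The sum u' + u solves v' = v, so it vanishes by boundedness, and what remains is u' = -
  u.\<close>

lemma green_ode_unique:
  fixes u :: "real \<Rightarrow> 'v::euclidean_space"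
  assumes d1: "\<And>t. (u has_vector_derivative u1 t) (at t)" and d2: "\<And>t. (u1 has_vector_derivative u t) (at t)"
    and b: "bounded (range u)" "bounded (range u1)"
  shows "u t = 0"
proof -
  have "u1 t + u t = 0" for t
  proof (rule exp_ode_bounded_zero[of "\<lambda>t. u1 t + u t" 1])
    show "((\<lambda>t. u1 t + u t) has_vector_derivative 1 *\<^sub>R (u1 t + u t)) (at t)" for t
      using has_vector_derivative_add[OF d2 d1, of t] by (simp add: add.commute)
    show "bounded (range (\<lambda>t. u1 t + u t))" using b by (intro bounded_plus_comp)
  qed simp
  then have "u1 t = - u t" for t by (simp add: eq_neg_iff_add_eq_0)
  then show ?thesis
    using d1 b(1) by (intro exp_ode_bounded_zero[of u "- 1"]) simp_all
qed

section \<open>Fourier modes and projections\<close>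

definition freq :: "real \<Rightarrow> nat \<Rightarrow> real"
  where "freq p j = 2 * pi * real j / p"

definition mode :: "real \<Rightarrow> 'v::real_vector \<Rightarrow> 'v \<Rightarrow> real \<Rightarrow> 'v"
  where "mode \<omega> a b t = cos (\<omega> * t) *\<^sub>R a + sin (\<omega> * t) *\<^sub>R b"

lemma continuous_on_mode:
  fixes a :: "'v::real_normed_vector" shows "continuous_on S (mode \<omega> a b)"
  unfolding mode_def[abs_def] by (intro continuous_intros)

lemma freq_mult: "p > 0 \<Longrightarrow> freq p j * p = 2 * pi * real j"
  by (simp add: freq_def)

lemma cos_freq_shift: "p > 0 \<Longrightarrow> cos (freq p j * (t + p)) = cos (freq p j * t)"
  and sin_freq_shift: "p > 0 \<Longrightarrow> sin (freq p j * (t + p)) = sin (freq p j * t)"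
proof -
  assume "p > 0"
  then have e: "freq p j * (t + p) = freq p j * t + 2 * pi * real j" by (simp add: distrib_left freq_mult)
  have "cos (2 * pi * real j) = 1" "sin (2 * pi * real j) = 0"
    using cos_int_2pin[of "int j"] sin_int_2pin[of "int j"] by simp_all
  then show "cos (freq p j * (t + p)) = cos (freq p j * t)" "sin (freq p j * (t + p)) = sin (freq p j * t)"
    unfolding e cos_add sin_add by simp_all
qed

lemma mode_periodic: "p > 0 \<Longrightarrow> mode (freq p j) a b (t + p) = mode (freq p j) a b t"
  by (simp add: mode_def cos_freq_shift sin_freq_shift)

lemma mode_deriv:
  fixes a :: "'v::real_normed_vector"
  shows "(mode \<omega> a b has_vector_derivative mode \<omega> (\<omega> *\<^sub>R b) ((- \<omega>) *\<^sub>R a) t) (at t)"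
proof -
  have "((\<lambda>t. cos (\<omega> * t)) has_real_derivative - (\<omega> * sin (\<omega> * t))) (at t)"
    "((\<lambda>t. sin (\<omega> * t)) has_real_derivative \<omega> * cos (\<omega> * t)) (at t)"
    by (auto intro!: derivative_eq_intros)
  note this[unfolded has_real_derivative_iff_has_vector_derivative,
      THEN bounded_linear.has_vector_derivative[OF bounded_linear_scaleR_left]]
  then have "((\<lambda>t. cos (\<omega> * t) *\<^sub>R a) has_vector_derivative (- (\<omega> * sin (\<omega> * t))) *\<^sub>R a) (at t)"
    "((\<lambda>t. sin (\<omega> * t) *\<^sub>R b) has_vector_derivative (\<omega> * cos (\<omega> * t)) *\<^sub>R b) (at t)"
    by blast+
  from has_vector_derivative_add[OF this] show ?thesis
    by (simp add: mode_def[abs_def] mult.commute add.commute)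
qed

lemma mode_scale: "c *\<^sub>R mode \<omega> a b t = mode \<omega> (c *\<^sub>R a) (c *\<^sub>R b) t"
  by (simp add: mode_def algebra_simps)

lemma mode_deriv2:
  fixes a :: "'v::real_normed_vector"
  shows "(mode \<omega> (\<omega> *\<^sub>R b) ((- \<omega>) *\<^sub>R a) has_vector_derivative (- \<omega>\<^sup>2) *\<^sub>R mode \<omega> a b t) (at t)"
  using mode_deriv[of \<omega> "\<omega> *\<^sub>R b" "(- \<omega>) *\<^sub>R a" t] by (simp add: mode_scale power2_eq_square)

text \<open>Periodicity moves the window back to [0, p], after which the addition theorem for the
  cosine of a difference separates s from t.\<close>

lemma conv_cos_eq_mode:
  fixes h :: "real \<Rightarrow> 'v::euclidean_space"
  assumes p: "p > 0" and h: "continuous_on UNIV h" "\<And>t. h (t + p) = h t"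
  shows "conv p (\<lambda>r. cos (freq p j * r)) h t =
    mode (freq p j) (integral {0..p} (\<lambda>r. cos (freq p j * r) *\<^sub>R h r)) (integral {0..p} (\<lambda>r. sin (freq p j * r) *\<^sub>R h r)) t"
proof -
  let ?w = "freq p j"
  define g where "g = (\<lambda>s. cos (?w * (s - t)) *\<^sub>R h s)"
  have "g (s + p) = g s" for s
  proof -
    have "s + p - t = (s - t) + p" by simp
    then show ?thesis by (simp only: g_def h(2) cos_freq_shift[OF p])
  qed
  moreover have "continuous_on UNIV g" unfolding g_def by (intro continuous_intros h)
  ultimately have per: "integral {0..p} (\<lambda>r. g (t + r)) = integral {0..p} g"
    using p by (intro integral_periodic_shift) auto
  have gs: "g = (\<lambda>s. cos (?w * t) *\<^sub>R (cos (?w * s) *\<^sub>R h s) + sin (?w * t) *\<^sub>R (sin (?w * s) *\<^sub>R h s))"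
    by (simp add: g_def fun_eq_iff right_diff_distrib cos_diff algebra_simps)
  have "conv p (\<lambda>r. cos (?w * r)) h t = integral {0..p} (\<lambda>r. g (t + r))"
    by (simp add: conv_def g_def)
  also note per
  also have "integral {0..p} g = integral {0..p} (\<lambda>s. cos (?w * t) *\<^sub>R (cos (?w * s) *\<^sub>R h s)) +
      integral {0..p} (\<lambda>s. sin (?w * t) *\<^sub>R (sin (?w * s) *\<^sub>R h s))"
    unfolding gs
    by (intro integral_add integrable_continuous_interval continuous_intros continuous_on_subset[OF h(1)]) auto
  finally show ?thesis unfolding integral_cmul mode_def .
qed

text \<open>Orthogonality by eigenvalues: the convolution is a mode of frequency i, yet it commutes
  with the second derivative and so also has the eigenvalue of frequency j. Frequencies are
  nonnegative, so their squares differ when i and j do.\<close>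

lemma conv_cos_mode_other:
  fixes a :: "'v::euclidean_space"
  assumes p: "p > 0" and ij: "i \<noteq> j"
  shows "conv p (\<lambda>r. cos (freq p i * r)) (mode (freq p j) a b) t = 0"
proof -
  let ?w = "freq p j" and ?v = "freq p i" and ?h = "mode (freq p j) a b"
  let ?k = "\<lambda>r. cos (freq p i * r)"
  have ck: "continuous_on {0..p} ?k" by (intro continuous_intros)
  obtain a' b' where m: "conv p ?k ?h = mode ?v a' b'"
    using conv_cos_eq_mode[OF p continuous_on_mode mode_periodic[OF p], of i j a b] by blast
  have c: "conv p ?k (\<lambda>s. (- ?w\<^sup>2) *\<^sub>R ?h s) t = (- ?w\<^sup>2) *\<^sub>R mode ?v a' b' t" for t
    unfolding m[symmetric]
    by (rule conv_linear[OF ck continuous_on_mode bounded_linear.linear[OF bounded_linear_scaleR_right]])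
  have d1: "(conv p ?k ?h has_vector_derivative conv p ?k (mode ?w (?w *\<^sub>R b) ((- ?w) *\<^sub>R a)) t) (at t)" for t
    by (rule conv_has_vector_derivative[OF ck mode_deriv continuous_on_mode])
  have "conv p ?k (mode ?w (?w *\<^sub>R b) ((- ?w) *\<^sub>R a)) = mode ?v (?v *\<^sub>R b') ((- ?v) *\<^sub>R a')"
    using vector_derivative_unique_at[OF d1[unfolded m] mode_deriv] by blast
  moreover have "(conv p ?k (mode ?w (?w *\<^sub>R b) ((- ?w) *\<^sub>R a)) has_vector_derivative
      conv p ?k (\<lambda>s. (- ?w\<^sup>2) *\<^sub>R ?h s) t) (at t)"
    by (rule conv_has_vector_derivative[OF ck mode_deriv2]) (intro continuous_intros continuous_on_mode)
  ultimately have "(- ?w\<^sup>2) *\<^sub>R mode ?v a' b' t = (- ?v\<^sup>2) *\<^sub>R mode ?v a' b' t"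
    unfolding c using vector_derivative_unique_at mode_deriv2 by metis
  moreover have "?w\<^sup>2 \<noteq> ?v\<^sup>2"
    using ij p by (simp add: freq_def power_divide power_mult_distrib)
  ultimately show ?thesis unfolding m by simp
qed

lemma has_integral_trig:
  assumes p: "p > 0" and j: "j > 0"
  shows "((\<lambda>r. cos (freq p j * r) * cos (freq p j * r)) has_integral p / 2) {0..p}"
    "((\<lambda>r. sin (freq p j * r) * sin (freq p j * r)) has_integral p / 2) {0..p}"
    "((\<lambda>r. cos (freq p j * r) * sin (freq p j * r)) has_integral 0) {0..p}"
proof -
  let ?w = "freq p j"
  have w: "?w \<noteq> 0" using p j by (simp add: freq_def)
  have s0: "sin (?w * p) = 0" "cos (?w * p) = 1"
    using sin_freq_shift[OF p, of j 0] cos_freq_shift[OF p, of j 0] by simp_all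
  have i: "(f has_integral (F p - F 0)) {0..p}" if "\<And>x. (F has_real_derivative f x) (at x)" for f F :: "real \<Rightarrow> real"
    using p that by (intro fundamental_theorem_of_calculus)
      (auto simp: has_real_derivative_iff_has_vector_derivative[symmetric] intro: has_field_derivative_at_within)
  have sc: "sin x * sin x = 1 - cos x * cos x" for x :: real
    using sin_cos_squared_add[of x] by (simp add: power2_eq_square)
  have "((\<lambda>r. r / 2 + sin (?w * r) * cos (?w * r) / (2 * ?w)) has_real_derivative cos (?w * x) * cos (?w * x)) (at x)" for x
    using w by (auto intro!: derivative_eq_intros simp: field_simps sc)
  from i[OF this] show "((\<lambda>r. cos (?w * r) * cos (?w * r)) has_integral p / 2) {0..p}" by (simp add: s0)
  have "((\<lambda>r. r / 2 - sin (?w * r) * cos (?w * r) / (2 * ?w)) has_real_derivative sin (?w * x) * sin (?w * x)) (at x)" for x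
    using w by (auto intro!: derivative_eq_intros simp: field_simps sc)
  from i[OF this] show "((\<lambda>r. sin (?w * r) * sin (?w * r)) has_integral p / 2) {0..p}" by (simp add: s0)
  have "((\<lambda>r. sin (?w * r) * sin (?w * r) / (2 * ?w)) has_real_derivative cos (?w * x) * sin (?w * x)) (at x)" for x
    using w by (auto intro!: derivative_eq_intros simp: field_simps)
  from i[OF this] show "((\<lambda>r. cos (?w * r) * sin (?w * r)) has_integral 0) {0..p}" by (simp add: s0)
qed

text \<open>The factor makes the convolution idempotent on its modes: the squared cosine has mean
  1/2 over a period for j > 0 and mean 1 for j = 0.\<close>

definition proj_kernel :: "real \<Rightarrow> nat \<Rightarrow> real \<Rightarrow> real"
  where "proj_kernel p j r = (if j = 0 then 1 / p else 2 / p) * cos (freq p j * r)"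

lemma continuous_on_proj_kernel: "continuous_on S (proj_kernel p j)"
  unfolding proj_kernel_def[abs_def] by (intro continuous_intros)

lemma proj_kernel_symmetric: "p > 0 \<Longrightarrow> proj_kernel p j (p - r) = proj_kernel p j r"
  using cos_freq_shift[of p j "- r"] by (simp add: proj_kernel_def)

lemma conv_proj_kernel:
  fixes h :: "real \<Rightarrow> 'v::euclidean_space"
  shows "conv p (proj_kernel p j) h t = (if j = 0 then 1 / p else 2 / p) *\<^sub>R conv p (\<lambda>r. cos (freq p j * r)) h t"
  unfolding conv_def proj_kernel_def scaleR_scaleR[symmetric] integral_cmul ..

lemma conv_proj_eq_mode:
  fixes h :: "real \<Rightarrow> 'v::euclidean_space"
  assumes p: "p > 0" and h: "continuous_on UNIV h" "\<And>t. h (t + p) = h t"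
  obtains a b where "conv p (proj_kernel p j) h = mode (freq p j) a b"
proof (rule that, rule ext)
  show "conv p (proj_kernel p j) h t =
    mode (freq p j) ((if j = 0 then 1 / p else 2 / p) *\<^sub>R integral {0..p} (\<lambda>r. cos (freq p j * r) *\<^sub>R h r))
      ((if j = 0 then 1 / p else 2 / p) *\<^sub>R integral {0..p} (\<lambda>r. sin (freq p j * r) *\<^sub>R h r)) t" for t
    unfolding conv_proj_kernel conv_cos_eq_mode[OF assms] mode_scale ..
qed

lemma conv_proj_mode:
  fixes a :: "'v::euclidean_space"
  assumes p: "p > 0"
  shows "conv p (proj_kernel p i) (mode (freq p j) a b) t = (if i = j then mode (freq p j) a b t else 0)"
proof (cases "i = j")
  case False
  then show ?thesis by (simp add: conv_proj_kernel conv_cos_mode_other[OF p])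
next
  case True
  show ?thesis
  proof (cases "j = 0")
    case True
    then show ?thesis using \<open>i = j\<close> p unfolding conv_proj_kernel by (simp add: conv_def freq_def mode_def)
  next
    case False
    then have j: "j > 0" by simp
    let ?w = "freq p j"
    have I: "((\<lambda>r. f r *\<^sub>R mode ?w a b r) has_integral (x *\<^sub>R a + y *\<^sub>R b)) {0..p}"
      if "((\<lambda>r. f r * cos (?w * r)) has_integral x) {0..p}" "((\<lambda>r. f r * sin (?w * r)) has_integral y) {0..p}" for f x y
      using has_integral_add[OF has_integral_scaleR_left[OF that(1), of a] has_integral_scaleR_left[OF that(2), of b]]
      by (simp add: mode_def algebra_simps)
    note t = has_integral_trig[OF p j]
    have "integral {0..p} (\<lambda>r. cos (?w * r) *\<^sub>R mode ?w a b r) = (p / 2) *\<^sub>R a"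
      using integral_unique[OF I[OF t(1,3)]] by simp
    moreover have "integral {0..p} (\<lambda>r. sin (?w * r) *\<^sub>R mode ?w a b r) = (p / 2) *\<^sub>R b"
      using integral_unique[OF I[of "\<lambda>r. sin (?w * r)" 0 "p / 2"]] t by (simp add: mult.commute)
    ultimately show ?thesis
      using \<open>i = j\<close> False p
      by (simp add: conv_proj_kernel conv_cos_eq_mode[OF p continuous_on_mode mode_periodic[OF p]] mode_scale)
  qed
qed

text \<open>The image u satisfies u'' = u + h, and as convolution commutes with differentiation also
  u'' = - \<omega>^2 u with \<omega> the frequency; equating the two determines u.\<close>

lemma conv_green_mode:
  fixes a :: "'v::euclidean_space"
  assumes p: "p > 0"
  shows "conv p (green p) (mode (freq p j) a b) t = (- 1 / (1 + (freq p j)\<^sup>2)) *\<^sub>R mode (freq p j) a b t"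
proof -
  let ?w = "freq p j" and ?h = "mode (freq p j) a b" and ?c = "conv p (green p)"
  note ck = continuous_on_green(1)[of "{0..p}" p]
  have d1: "(?c ?h has_vector_derivative ?c (mode ?w (?w *\<^sub>R b) ((- ?w) *\<^sub>R a)) t) (at t)" for t
    by (rule conv_has_vector_derivative[OF ck mode_deriv continuous_on_mode])
  note g = conv_green_deriv[OF p continuous_on_mode mode_periodic[OF p], of j a b]
  have "?c (mode ?w (?w *\<^sub>R b) ((- ?w) *\<^sub>R a)) = conv p (dgreen p) ?h"
    using vector_derivative_unique_at[OF d1 g(1)] by blast
  moreover have "(?c (mode ?w (?w *\<^sub>R b) ((- ?w) *\<^sub>R a)) has_vector_derivative
      ?c (\<lambda>s. (- ?w\<^sup>2) *\<^sub>R ?h s) t) (at t)"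
    by (rule conv_has_vector_derivative[OF ck mode_deriv2]) (intro continuous_intros continuous_on_mode)
  ultimately have "?c (\<lambda>s. (- ?w\<^sup>2) *\<^sub>R ?h s) t = ?c ?h t + ?h t"
    using vector_derivative_unique_at g(2) by metis
  then have "(- ?w\<^sup>2) *\<^sub>R ?c ?h t = ?c ?h t + ?h t"
    using conv_linear[OF ck continuous_on_mode bounded_linear.linear[OF bounded_linear_scaleR_right],
        of "- ?w\<^sup>2" ?w a b t] by (simp only:)
  then have eq: "?c ?h t + ?h t = (- ?w\<^sup>2) *\<^sub>R ?c ?h t" by (rule sym)
  have "(1 + ?w\<^sup>2) *\<^sub>R ?c ?h t + ?h t = ?w\<^sup>2 *\<^sub>R ?c ?h t + (?c ?h t + ?h t)"
    by (simp add: scaleR_left_distrib)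
  also have "\<dots> = 0" unfolding eq by simp
  finally have "(1 + ?w\<^sup>2) *\<^sub>R ?c ?h t = - ?h t" by (simp add: eq_neg_iff_add_eq_0)
  moreover have "1 + ?w\<^sup>2 \<noteq> 0" by (simp add: add_nonneg_eq_0_iff)
  moreover have "?c ?h t = (1 / (1 + ?w\<^sup>2)) *\<^sub>R ((1 + ?w\<^sup>2) *\<^sub>R ?c ?h t)"
    using calculation(2) by simp
  ultimately show ?thesis by simp
qed

section \<open>Weierstrass approximation of symmetric kernels\<close>

text \<open>Even trigonometric polynomials. They are closed under multiplication by cos x and so
  contain the polynomials in cos x; written by frequencies, they match the projection
  kernels.\<close>

definition cos_poly :: "(real \<Rightarrow> real) \<Rightarrow> bool"
  where "cos_poly f \<longleftrightarrow> (\<exists>n c. \<forall>x. f x = (\<Sum>j\<le>n. c j * cos (real j * x)))"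

lemma cos_poly_add:
  assumes "cos_poly f" "cos_poly g" shows "cos_poly (\<lambda>x. f x + g x)"
proof -
  obtain n c where f: "\<And>x. f x = (\<Sum>j\<le>n. c j * cos (real j * x))" using assms(1) by (auto simp: cos_poly_def)
  obtain m d where g: "\<And>x. g x = (\<Sum>j\<le>m. d j * cos (real j * x))" using assms(2) by (auto simp: cos_poly_def)
  define c' where "c' = (\<lambda>j. if j \<le> n then c j else 0)"
  define d' where "d' = (\<lambda>j. if j \<le> m then d j else 0)"
  have "f x = (\<Sum>j\<le>n + m. c' j * cos (real j * x))" for x
    unfolding f by (rule sum.mono_neutral_cong_left) (auto simp: c'_def)
  moreover have "g x = (\<Sum>j\<le>n + m. d' j * cos (real j * x))" for x
    unfolding g by (rule sum.mono_neutral_cong_left) (auto simp: d'_def)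
  ultimately have "f x + g x = (\<Sum>j\<le>n + m. (c' j + d' j) * cos (real j * x))" for x
    by (simp add: distrib_right sum.distrib)
  then show ?thesis
    unfolding cos_poly_def by (intro exI[of _ "n + m"] exI[of _ "\<lambda>j. c' j + d' j"]) blast
qed

lemma cos_poly_scale: "cos_poly f \<Longrightarrow> cos_poly (\<lambda>x. a * f x)"
  unfolding cos_poly_def
proof (elim exE)
  fix n c assume "\<forall>x. f x = (\<Sum>j\<le>n. c j * cos (real j * x))"
  then have "\<forall>x. a * f x = (\<Sum>j\<le>n. (a * c j) * cos (real j * x))" by (simp add: sum_distrib_left mult.assoc)
  then show "\<exists>n c. \<forall>x. a * f x = (\<Sum>j\<le>n. c j * cos (real j * x))"
    by (intro exI[of _ n] exI[of _ "\<lambda>j. a * c j"])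
qed

lemma cos_poly_sum: "finite I \<Longrightarrow> (\<And>i. i \<in> I \<Longrightarrow> cos_poly (f i)) \<Longrightarrow> cos_poly (\<lambda>x. \<Sum>i\<in>I. f i x)"
proof (induction I rule: finite_induct)
  case empty
  have "\<forall>x. 0 = (\<Sum>j\<le>0::nat. (\<lambda>_. 0) j * cos (real j * x))" by simp
  then show ?case unfolding cos_poly_def sum.empty by (intro exI)
next
  case (insert i I)
  then show ?case using cos_poly_add[of "f i" "\<lambda>x. \<Sum>i\<in>I. f i x"] by simp
qed

lemma cos_poly_cos: "cos_poly (\<lambda>x. cos (real j * x))"
proof -
  have "(\<Sum>i\<le>j. (if i = j then 1 else 0) * cos (real i * x)) = (\<Sum>i\<le>j. if i = j then cos (real i * x) else 0)" for x :: real
    by (rule sum.cong) auto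
  then have "\<forall>x. cos (real j * x) = (\<Sum>i\<le>j. (if i = j then 1 else 0) * cos (real i * x))" by simp
  then show ?thesis
    unfolding cos_poly_def by (intro exI[of _ j] exI[of _ "\<lambda>i. if i = j then 1 else 0"])
qed

lemma cos_poly_mult_cos:
  assumes "cos_poly f" shows "cos_poly (\<lambda>x. cos x * f x)"
proof -
  obtain n c where f: "\<And>x. f x = (\<Sum>j\<le>n. c j * cos (real j * x))" using assms by (auto simp: cos_poly_def)
  have "cos_poly (\<lambda>x. cos x * cos (real j * x))" for j
  proof (cases j)
    case 0
    then show ?thesis using cos_poly_cos[of 1] by simp
  next
    case (Suc i)
    have "cos x * cos (real j * x) = 1 / 2 * (cos (real i * x) + cos (real (Suc j) * x))" for x
    proof -
      have e: "real j * x - x = real i * x" "real j * x + x = real (Suc j) * x"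
        by (simp_all add: Suc algebra_simps)
      have "cos x * cos (real j * x) = (cos (real j * x - x) + cos (real j * x + x)) / 2"
        by (simp add: cos_add cos_diff)
      then show ?thesis unfolding e by simp
    qed
    then show ?thesis
      by (simp only:) (intro cos_poly_scale cos_poly_add cos_poly_cos)
  qed
  then have "cos_poly (\<lambda>x. \<Sum>j\<le>n. c j * (cos x * cos (real j * x)))"
    by (intro cos_poly_sum cos_poly_scale) auto
  then show ?thesis by (simp add: f sum_distrib_left mult.left_commute)
qed

lemma cos_poly_power: "cos_poly (\<lambda>x. cos x ^ i)"
proof (induction i)
  case 0
  then show ?case using cos_poly_cos[of 0] by simp
next
  case (Suc i)
  then show ?case using cos_poly_mult_cos by simp
qed

text \<open>A symmetric kernel is a function of \<open>cos (2 \<pi> r / p)\<close>, to which Weierstrass' theorem applies.\<close>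

lemma symmetric_kernel_approx:
  assumes p: "p > 0" and k: "continuous_on {0..p} k" "\<And>r. r \<in> {0..p} \<Longrightarrow> k (p - r) = k r" and e: "e > 0"
  obtains n c where "\<And>r. r \<in> {0..p} \<Longrightarrow> \<bar>k r - (\<Sum>j\<le>n. c j * proj_kernel p j r)\<bar> \<le> e"
proof -
  \<comment> \<open>The arccosine covers r in [0, p / 2] only; the other half of the period is
    reached through the symmetry of \<open>k\<close>.\<close>
  define g where "g = (\<lambda>x. k (p / (2 * pi) * arccos x))"
  have im: "p / (2 * pi) * arccos x \<in> {0..p}" if "x \<in> {- 1..1}" for x
  proof -
    have "0 \<le> arccos x" "arccos x \<le> 2 * pi"
      using that arccos_lbound[of x] arccos_ubound[of x] pi_gt_zero by auto
    then show ?thesis using p by (auto simp: field_simps)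
  qed
  have "continuous_on {- 1..1} (\<lambda>x. p / (2 * pi) * arccos x)"
    by (intro continuous_intros continuous_on_arccos) auto
  then have "continuous_on {- 1..1} g"
    unfolding g_def using im by (intro continuous_on_compose2[OF k(1)]) auto
  then obtain q where q: "real_polynomial_function q" "\<And>x. x \<in> {- 1..1} \<Longrightarrow> \<bar>g x - q x\<bar> < e"
    using Stone_Weierstrass_real_polynomial_function[OF compact_Icc, of "- 1" 1 g e] e by auto
  then obtain a n where a: "q = (\<lambda>x. \<Sum>i\<le>n. a i * x ^ i)"
    unfolding real_polynomial_function_iff_sum by blast
  have "cos_poly (\<lambda>x. q (cos x))"
    unfolding a by (intro cos_poly_sum cos_poly_scale cos_poly_power) auto
  then obtain N c where c: "\<And>x. q (cos x) = (\<Sum>j\<le>N. c j * cos (real j * x))"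
    by (auto simp: cos_poly_def)
  define d where "d = (\<lambda>j. c j / (if j = 0 then 1 / p else 2 / p))"
  have "\<bar>k r - (\<Sum>j\<le>N. d j * proj_kernel p j r)\<bar> \<le> e" if r: "r \<in> {0..p}" for r
  proof -
    define x where "x = 2 * pi * r / p"
    have x: "0 \<le> x" "x \<le> 2 * pi" using r p by (auto simp: x_def field_simps)
    have "g (cos x) = k r"
    proof (cases "x \<le> pi")
      case True
      then have "arccos (cos x) = x" using x by (simp add: arccos_cos)
      then show ?thesis using p by (simp add: g_def x_def)
    next
      case False
      have "cos x = cos (2 * pi - x)" by (simp add: cos_diff)
      moreover have "arccos (cos (2 * pi - x)) = 2 * pi - x" using x False by (intro arccos_cos) auto
      ultimately have "g (cos x) = k (p / (2 * pi) * (2 * pi - x))" by (simp add: g_def)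
      also have "p / (2 * pi) * (2 * pi - x) = p - r" using p by (simp add: x_def field_simps)
      finally show ?thesis using k(2)[OF r] by simp
    qed
    moreover have "q (cos x) = (\<Sum>j\<le>N. d j * proj_kernel p j r)"
      unfolding c using p by (intro sum.cong) (auto simp: d_def proj_kernel_def freq_def x_def mult_ac)
    ultimately show ?thesis using q(2)[of "cos x"] by simp
  qed
  then show thesis by (rule that)
qed

section \<open>Operators commuting with the Fourier projections\<close>

text \<open>The images of a basis form a basis of the image, so \<open>F x\<close> controls the
  coordinates of x, and these control its norm.\<close>

lemma fin_dim_lower_bound:
  fixes F :: "'a::real_normed_vector \<Rightarrow> 'b::real_normed_vector"
  assumes W: "fin_dim_subspace W" and F: "linear F" "\<And>x. x \<in> W \<Longrightarrow> F x = 0 \<Longrightarrow> x = 0"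
  obtains c where "c > 0" "\<And>x. x \<in> W \<Longrightarrow> c * norm x \<le> norm (F x)"
proof -
  obtain b where b: "is_basis b (dim W) W" using fin_dim_subspace_basis[OF W] .
  define n where "n = dim W"
  note b = b[folded n_def]
  have FL: "F (lin_comb b n x) = lin_comb (\<lambda>i. F (b i)) n x" for x
    by (simp add: lin_comb_def linear_sum[OF F(1)] linear_scale[OF F(1)])
  have "is_basis (\<lambda>i. F (b i)) n (range (lin_comb (\<lambda>i. F (b i)) n))"
    unfolding is_basis_iff FL[symmetric]
    using F(2)[OF lin_comb_in[OF b]] b by (auto simp: is_basis_iff)
  then obtain C where C: "C > 0" "\<And>x. L2_set x {..<n} \<le> C * norm (lin_comb (\<lambda>i. F (b i)) n x)"
    using coordinate_bound by blast
  define M where "M = 1 + (\<Sum>i<n. norm (b i))"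
  have M: "M > 0" unfolding M_def by (simp add: add_pos_nonneg sum_nonneg)
  have "1 / (M * C) * norm x \<le> norm (F x)" if x: "x \<in> W" for x
  proof -
    define y where "y = crd b n x"
    have xy: "x = lin_comb b n y" unfolding y_def using lin_comb_crd[OF b x] by simp
    have "norm x \<le> (\<Sum>i<n. \<bar>y i\<bar> * norm (b i))"
      unfolding xy lin_comb_def by (rule order_trans[OF norm_sum]) simp
    also have "\<dots> \<le> (\<Sum>i<n. L2_set y {..<n} * norm (b i))"
      by (intro sum_mono mult_right_mono abs_le_L2_set) auto
    also have "\<dots> = L2_set y {..<n} * (\<Sum>i<n. norm (b i))" by (simp add: sum_distrib_left)
    also have "\<dots> \<le> L2_set y {..<n} * M" by (intro mult_left_mono) (simp_all add: M_def L2_set_nonneg)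
    also have "\<dots> = M * L2_set y {..<n}" by (rule mult.commute)
    also have "\<dots> \<le> M * (C * norm (F x))"
      using C(2)[of y] M unfolding FL[symmetric] xy[symmetric] by (intro mult_left_mono) auto
    finally show ?thesis using M C(1) by (simp add: field_simps)
  qed
  then show thesis using M C(1) by (intro that[of "1 / (M * C)"]) auto
qed

text \<open>The calculus shared by two function spaces: the C^2 functions, on which the degrees are
  defined, and the continuous functions, in which equations are solved. Elements are determined by
  their values \<open>ev\<close>, through which identities transfer from functions;
  \<open>cv\<close> is convolution and \<open>am\<close> applies \<open>A\<close> pointwise. The
  periodic elements form a subspace \<open>S\<close>, as the underlying type also has nonperiodic
  ones.\<close>

locale periodic_ops =
  fixes p :: real and S :: "'e::real_normed_vector set" and ev :: "'e \<Rightarrow> real \<Rightarrow> real ^ 'k"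
    and cv :: "(real \<Rightarrow> real) \<Rightarrow> 'e \<Rightarrow> 'e" and am :: "'e \<Rightarrow> 'e" and A :: "real ^ 'k \<Rightarrow> real ^ 'k"
  assumes p: "p > 0" and A: "linear A"
    and S_def: "S = {x. \<forall>t. ev x (t + p) = ev x t}"
    and ev_add: "ev (x + y) t = ev x t + ev y t" and ev_scale: "ev (c *\<^sub>R x) t = c *\<^sub>R ev x t"
    and ev_inj: "ev x = ev y \<Longrightarrow> x = y"
    and ev_cont: "continuous_on UNIV (ev x)"
    and ev_cv: "continuous_on {0..p} k \<Longrightarrow> ev (cv k x) = conv p k (ev x)"
    and norm_cv: "continuous_on {0..p} k \<Longrightarrow> (\<And>r. r \<in> {0..p} \<Longrightarrow> \<bar>k r\<bar> \<le> C) \<Longrightarrow> norm (cv k x) \<le> p * C * norm x"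
    and ev_am: "ev (am x) t = A (ev x t)" and norm_am: "norm (am x) \<le> onorm A * norm x"
    and mode_ex: "\<exists>x. ev x = mode (freq p j) a b"
begin

lemma ev_zero: "ev 0 t = 0" using ev_scale[of 0 0 t] by simp

lemma ev_diff: "ev (x - y) t = ev x t - ev y t"
  using ev_add[of x "- 1 *\<^sub>R y" t] ev_scale[of "- 1" y t] by simp

lemma ev_sum: "ev (\<Sum>i\<in>I. f i) t = (\<Sum>i\<in>I. ev (f i) t)"
  by (induction I rule: infinite_finite_induct) (simp_all add: ev_zero ev_add)

lemma S_per: "x \<in> S \<Longrightarrow> ev x (t + p) = ev x t" by (simp add: S_def)

lemma subspace_S: "subspace S"
  by (auto simp: S_def subspace_def ev_zero ev_add ev_scale)

lemma cv_S: "continuous_on {0..p} k \<Longrightarrow> x \<in> S \<Longrightarrow> cv k x \<in> S"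
  by (simp add: S_def ev_cv conv_periodic)

lemma am_S: "x \<in> S \<Longrightarrow> am x \<in> S"
  by (simp add: S_def ev_am)

lemma linear_cv:
  assumes k: "continuous_on {0..p} k" shows "linear (cv k)"
proof (rule linearI; rule ev_inj; rule ext)
  fix x y t
  show "ev (cv k (x + y)) t = ev (cv k x + cv k y) t"
    using conv_add[OF k ev_cont[of x] ev_cont[of y], of t] by (simp add: ev_cv[OF k] ev_add[abs_def] ev_add)
next
  fix c x t
  have "conv p k (\<lambda>t. c *\<^sub>R ev x t) t = c *\<^sub>R conv p k (ev x) t"
    by (rule conv_linear[OF k ev_cont bounded_linear.linear[OF bounded_linear_scaleR_right]])
  then show "ev (cv k (c *\<^sub>R x)) t = ev (c *\<^sub>R cv k x) t"
    by (simp add: ev_cv[OF k] ev_scale[abs_def] ev_scale)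
qed

lemma bounded_linear_cv:
  assumes k: "continuous_on {0..p} k" shows "bounded_linear (cv k)"
proof -
  obtain C where "\<forall>y\<in>k ` {0..p}. norm y \<le> C"
    using compact_imp_bounded[OF compact_continuous_image[OF k compact_Icc]] unfolding bounded_iff by blast
  then have "norm (cv k x) \<le> norm x * (p * C)" for x
    using norm_cv[OF k, of C x] by (simp add: mult.commute)
  then show ?thesis using linear_cv[OF k] by (intro bounded_linear_intro[where K = "p * C"]) (auto simp: linear_add linear_scale)
qed

lemma bounded_linear_am: "bounded_linear am"
proof (rule bounded_linear_intro[where K = "onorm A"])
  show "am (x + y) = am x + am y" for x y
    by (rule ev_inj) (simp add: fun_eq_iff ev_add ev_am linear_add[OF A])
  show "am (c *\<^sub>R x) = c *\<^sub>R am x" for c x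
    by (rule ev_inj) (simp add: fun_eq_iff ev_scale ev_am linear_scale[OF A])
qed (use norm_am in \<open>simp add: mult.commute\<close>)

text \<open>\<open>P j\<close> is the projection onto mode j and \<open>Q N\<close> the projection
  onto the modes up to N. On \<open>S\<close>, \<open>G\<close> is the inverse of u'' - u, and
  \<open>T \<alpha>\<close> is the operator \<A>(\<alpha>) of the problem, or its counterpart for
  continuous functions.\<close>

definition "P j = cv (proj_kernel p j)"
definition "G = cv (green p)"
definition "Q N x = (\<Sum>j\<le>N. P j x)"
definition "B \<alpha> x = am x - (\<alpha> + 1) *\<^sub>R x"
definition "T \<alpha> x = x - G (B \<alpha> x)"

lemma ev_B: "ev (B \<alpha> x) t = A (ev x t) - (\<alpha> + 1) *\<^sub>R ev x t"
  by (simp only: B_def ev_diff ev_scale ev_am)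

lemma bl_P: "bounded_linear (P j)" unfolding P_def by (rule bounded_linear_cv[OF continuous_on_proj_kernel])
lemma bl_G: "bounded_linear G" unfolding G_def by (rule bounded_linear_cv[OF continuous_on_green(1)])
lemma bl_Q: "bounded_linear (Q N)" unfolding Q_def[abs_def] by (intro bounded_linear_sum bl_P)
lemma bl_B: "bounded_linear (B \<alpha>)" unfolding B_def[abs_def]
  by (intro bounded_linear_sub bounded_linear_am bounded_linear_scaleR_right)
lemma bl_T: "bounded_linear (T \<alpha>)" unfolding T_def[abs_def]
  by (intro bounded_linear_sub bounded_linear_ident bounded_linear_compose[OF bl_G bl_B])

lemmas lin_P = bounded_linear.linear[OF bl_P] and lin_G = bounded_linear.linear[OF bl_G]
  and lin_Q = bounded_linear.linear[OF bl_Q] and lin_B = bounded_linear.linear[OF bl_B]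
  and lin_T = bounded_linear.linear[OF bl_T]

lemma cv_commute:
  assumes "continuous_on {0..p} k" "continuous_on {0..p} l" shows "cv k (cv l x) = cv l (cv k x)"
  by (rule ev_inj) (simp add: fun_eq_iff ev_cv assms conv_commute[OF assms ev_cont])

lemma cv_am:
  assumes "continuous_on {0..p} k" shows "cv k (am x) = am (cv k x)"
  by (rule ev_inj) (simp add: fun_eq_iff ev_cv assms ev_am[abs_def] ev_am conv_linear[OF assms ev_cont A])

lemma P_G: "P j (G x) = G (P j x)"
  unfolding P_def G_def by (rule cv_commute[OF continuous_on_proj_kernel continuous_on_green(1)])

lemma P_B: "P j (B \<alpha> x) = B \<alpha> (P j x)"
proof -
  have "P j (am x) = am (P j x)" unfolding P_def by (rule cv_am[OF continuous_on_proj_kernel])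
  then show ?thesis by (simp add: B_def linear_diff[OF lin_P] linear_scale[OF lin_P])
qed

lemma P_T: "P j (T \<alpha> x) = T \<alpha> (P j x)"
  by (simp add: T_def linear_diff[OF lin_P] P_G P_B)

lemma Q_T: "Q N (T \<alpha> x) = T \<alpha> (Q N x)"
  by (simp add: Q_def P_T linear_sum[OF lin_T])

lemma P_S: "x \<in> S \<Longrightarrow> P j x \<in> S" unfolding P_def by (rule cv_S[OF continuous_on_proj_kernel])
lemma G_S: "x \<in> S \<Longrightarrow> G x \<in> S" unfolding G_def by (rule cv_S[OF continuous_on_green(1)])
lemma Q_S: "x \<in> S \<Longrightarrow> Q N x \<in> S" unfolding Q_def by (intro subspace_sum subspace_S P_S)
lemma B_S: "x \<in> S \<Longrightarrow> B \<alpha> x \<in> S"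
  unfolding B_def by (intro subspace_diff subspace_scale subspace_S am_S)
lemma T_S: "x \<in> S \<Longrightarrow> T \<alpha> x \<in> S"
  unfolding T_def by (intro subspace_diff subspace_S G_S B_S)

lemma ev_P_mode:
  assumes "x \<in> S" obtains a b where "ev (P j x) = mode (freq p j) a b"
  using conv_proj_eq_mode[OF p ev_cont S_per[OF assms], of j] that
  by (metis P_def ev_cv continuous_on_proj_kernel)

lemma P_mode: "ev x = mode (freq p j) a b \<Longrightarrow> P i x = (if i = j then x else 0)"
proof (rule ev_inj, rule ext)
  fix t assume "ev x = mode (freq p j) a b"
  then show "ev (P i x) t = ev (if i = j then x else 0) t"
    by (simp add: P_def ev_cv continuous_on_proj_kernel conv_proj_mode[OF p] ev_zero)
qed

lemma P_P: "x \<in> S \<Longrightarrow> P i (P j x) = (if i = j then P j x else 0)"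
  by (rule ev_P_mode[of x j]) (auto simp: P_mode)

lemma G_mode: "ev x = mode (freq p j) a b \<Longrightarrow> G x = (- 1 / (1 + (freq p j)\<^sup>2)) *\<^sub>R x"
proof (rule ev_inj, rule ext)
  fix t assume "ev x = mode (freq p j) a b"
  then show "ev (G x) t = ev ((- 1 / (1 + (freq p j)\<^sup>2)) *\<^sub>R x) t"
    unfolding ev_scale by (simp add: G_def ev_cv continuous_on_green conv_green_mode[OF p])
qed

lemma G_P: "x \<in> S \<Longrightarrow> G (P j x) = (- 1 / (1 + (freq p j)\<^sup>2)) *\<^sub>R P j x"
  by (rule ev_P_mode[of x j]) (auto simp: G_mode)

lemma Q_P: "x \<in> S \<Longrightarrow> j \<le> N \<Longrightarrow> Q N (P j x) = P j x"
  by (simp add: Q_def P_P sum.delta)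

lemma P_Q: "x \<in> S \<Longrightarrow> j \<le> N \<Longrightarrow> P j (Q N x) = P j x"
  by (simp add: Q_def linear_sum[OF lin_P] P_P sum.delta cong: if_cong)

lemma Q_Q: "x \<in> S \<Longrightarrow> Q N (Q N x) = Q N x"
  by (simp add: Q_def[of N "Q N x"] P_Q) (simp add: Q_def)

text \<open>A kernel within \<epsilon> / p of the Green kernel gives an operator within \<epsilon>.
  Finite-rank approximations, tail estimates and total boundedness all come from this.\<close>

lemma G_approx:
  assumes "\<epsilon> > 0"
  obtains n c where "\<And>x. norm (G x - (\<Sum>j\<le>n. c j *\<^sub>R P j x)) \<le> \<epsilon> * norm x"
proof -
  have "\<epsilon> / p > 0" using assms p by simp
  then obtain n c where c: "\<And>r. r \<in> {0..p} \<Longrightarrow> \<bar>green p r - (\<Sum>j\<le>n. c j * proj_kernel p j r)\<bar> \<le> \<epsilon> / p"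
    using symmetric_kernel_approx[OF p continuous_on_green(1) green_symmetric] by blast
  let ?s = "\<lambda>r. \<Sum>j\<le>n. c j * proj_kernel p j r"
  let ?k = "\<lambda>r. green p r - ?s r"
  have cs: "continuous_on {0..p} ?s" by (intro continuous_intros continuous_on_proj_kernel)
  have ck: "continuous_on {0..p} ?k" by (rule continuous_on_diff[OF continuous_on_green(1) cs])
  have "norm (G x - (\<Sum>j\<le>n. c j *\<^sub>R P j x)) \<le> \<epsilon> * norm x" for x
  proof -
    have "cv ?k x = G x - (\<Sum>j\<le>n. c j *\<^sub>R P j x)"
    proof (rule ev_inj, rule ext)
      fix t
      have "ev (cv ?k x) t = conv p (green p) (ev x) t - conv p ?s (ev x) t"
        unfolding ev_cv[OF ck] by (rule conv_kernel_diff[OF continuous_on_green(1) cs ev_cont])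
      also have "conv p ?s (ev x) t = (\<Sum>j\<le>n. c j *\<^sub>R conv p (proj_kernel p j) (ev x) t)"
        by (rule conv_kernel_sum[OF _ continuous_on_proj_kernel ev_cont]) simp
      finally show "ev (cv ?k x) t = ev (G x - (\<Sum>j\<le>n. c j *\<^sub>R P j x)) t"
        by (simp add: ev_diff ev_sum ev_scale G_def P_def ev_cv continuous_on_green continuous_on_proj_kernel)
    qed
    then show ?thesis using norm_cv[OF ck c, of x] p by simp
  qed
  then show thesis by (rule that)
qed

text \<open>All approximating sums vanish at x, so \<open>G x\<close> is arbitrarily small. A
  conclusion about \<open>G x\<close> is what the kernel of \<open>T \<alpha>\<close> calls for,
  since a kernel vector x equals G (B \<alpha> x).\<close>

lemma P_separating:
  assumes "\<And>j. P j x = 0" shows "G x = 0"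
proof (rule ccontr)
  assume nz: "G x \<noteq> 0"
  \<comment> \<open>The summand 1 keeps the denominator positive also for x = 0.\<close>
  define d where "d = norm x + 1"
  define \<epsilon> where "\<epsilon> = norm (G x) / d / 2"
  have x1: "d > 0" by (simp add: d_def add_nonneg_pos)
  then have "\<epsilon> > 0" using nz by (simp add: \<epsilon>_def)
  then obtain n c where "\<And>x. norm (G x - (\<Sum>j\<le>n. c j *\<^sub>R P j x)) \<le> \<epsilon> * norm x"
    using G_approx by blast
  from this[of x] have "norm (G x) \<le> \<epsilon> * norm x" using assms by simp
  also have "\<dots> \<le> \<epsilon> * d" using \<open>\<epsilon> > 0\<close> by (simp add: d_def)
  also have "\<dots> = norm (G x) / 2" using x1 by (simp add: \<epsilon>_def)
  finally show False using nz by simp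
qed

lemma T_kernel:
  assumes x: "x \<in> S" "T \<alpha> x = 0" "x \<noteq> 0"
  obtains j where "P j x \<noteq> 0"
proof -
  have "\<exists>j. P j x \<noteq> 0"
  proof (rule ccontr)
    assume "\<not> ?thesis"
    then have "P j (B \<alpha> x) = 0" for j using P_B linear_0[OF lin_B] by simp
    then have "G (B \<alpha> x) = 0" by (rule P_separating)
    then show False using x by (simp add: T_def)
  qed
  then show thesis using that by blast
qed

lemma T_mode:
  assumes "ev x = mode (freq p j) a b"
  shows "T \<alpha> x = (1 / (1 + (freq p j)\<^sup>2)) *\<^sub>R (am x - (\<alpha> - (freq p j)\<^sup>2) *\<^sub>R x)"
proof -
  have d: "1 + (freq p j)\<^sup>2 \<noteq> 0" by (simp add: add_nonneg_eq_0_iff)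
  have "ev (B \<alpha> x) = mode (freq p j) (A a - (\<alpha> + 1) *\<^sub>R a) (A b - (\<alpha> + 1) *\<^sub>R b)"
    by (simp add: fun_eq_iff ev_B assms mode_def linear_add[OF A] linear_scale[OF A] algebra_simps)
  then have "G (B \<alpha> x) = (- 1 / (1 + (freq p j)\<^sup>2)) *\<^sub>R B \<alpha> x" by (rule G_mode)
  then have "T \<alpha> x = (1 / (1 + (freq p j)\<^sup>2)) *\<^sub>R ((1 + (freq p j)\<^sup>2) *\<^sub>R x + B \<alpha> x)"
    using d by (simp add: T_def scaleR_add_right)
  also have "(1 + (freq p j)\<^sup>2) *\<^sub>R x + B \<alpha> x = am x - (\<alpha> - (freq p j)\<^sup>2) *\<^sub>R x"
    by (simp add: B_def algebra_simps)
  finally show ?thesis .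
qed

text \<open>\<open>P j\<close> commutes with \<open>T \<alpha>\<close>, so the projected vector is
  in the kernel too, and there the equation says that each nonzero value is an eigenvector of
  \<open>A\<close>.\<close>

lemma T_kernel_spectrum:
  assumes x: "x \<in> S" "T \<alpha> x = 0" "P j x \<noteq> 0"
  shows "\<alpha> - (freq p j)\<^sup>2 \<in> real_spectrum A"
proof -
  obtain a b where m: "ev (P j x) = mode (freq p j) a b" using ev_P_mode[OF x(1)] .
  have "T \<alpha> (P j x) = 0" using x(2) P_T[of j \<alpha> x] linear_0[OF lin_P] by simp
  moreover have "1 + (freq p j)\<^sup>2 \<noteq> 0" by (simp add: add_nonneg_eq_0_iff)
  ultimately have "am (P j x) - (\<alpha> - (freq p j)\<^sup>2) *\<^sub>R P j x = 0" unfolding T_mode[OF m] by simp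
  then have "am (P j x) = (\<alpha> - (freq p j)\<^sup>2) *\<^sub>R P j x" by simp
  then have eq: "A (ev (P j x) t) = (\<alpha> - (freq p j)\<^sup>2) *\<^sub>R ev (P j x) t" for t
    unfolding ev_am[symmetric] ev_scale[symmetric] by (rule arg_cong)
  have "\<exists>t. ev (P j x) t \<noteq> 0"
  proof (rule ccontr)
    assume "\<not> ?thesis"
    then have "ev (P j x) = ev 0" by (simp add: fun_eq_iff ev_zero)
    then show False using ev_inj x(3) by blast
  qed
  then show ?thesis using eq by (auto simp: real_spectrum_def)
qed

text \<open>Without modes up to N the compact part contracts by 1/2. The lower bounds and the fixed
  point argument of the infinite-dimensional part both rest on this.\<close>

definition "tail N \<alpha> \<longleftrightarrow> (\<forall>x\<in>S. (\<forall>j\<le>N. P j x = 0) \<longrightarrow> norm (G (B \<alpha> x)) \<le> 1 / 2 * norm x)"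

lemma norm_B_le: "\<bar>\<alpha>\<bar> \<le> R \<Longrightarrow> norm (B \<alpha> x) \<le> (onorm A + R + 1) * norm x"
proof -
  assume "\<bar>\<alpha>\<bar> \<le> R"
  then have "\<bar>\<alpha> + 1\<bar> * norm x \<le> (R + 1) * norm x" by (intro mult_right_mono) auto
  moreover have "norm (B \<alpha> x) \<le> norm (am x) + norm ((\<alpha> + 1) *\<^sub>R x)" unfolding B_def by (rule norm_triangle_ineq4)
  moreover have "norm ((\<alpha> + 1) *\<^sub>R x) = \<bar>\<alpha> + 1\<bar> * norm x" by (rule norm_scaleR)
  moreover have "(onorm A + R + 1) * norm x = onorm A * norm x + (R + 1) * norm x" by (simp add: algebra_simps)
  ultimately show ?thesis using norm_am[of x] by linarith
qed

text \<open>The finite sum approximating \<open>G\<close> annihilates vectors without low modes, and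
  the accuracy 1 / (2 M) is matched to a bound M for \<open>B \<alpha>\<close> that is uniform for
  bounded \<alpha>.\<close>

lemma tail_exists: obtains N where "\<And>N' \<alpha>. N' \<ge> N \<Longrightarrow> \<bar>\<alpha>\<bar> \<le> R \<Longrightarrow> tail N' \<alpha>"
proof -
  define M where "M = onorm A + \<bar>R\<bar> + 1"
  have M: "M > 0" using onorm_pos_le[OF linear_conv_bounded_linear[THEN iffD1, OF A]] by (simp add: M_def add_nonneg_pos)
  then have "1 / (2 * M) > 0" by simp
  then obtain n c where c: "\<And>x. norm (G x - (\<Sum>j\<le>n. c j *\<^sub>R P j x)) \<le> 1 / (2 * M) * norm x"
    using G_approx by blast
  have "tail N' \<alpha>" if "N' \<ge> n" "\<bar>\<alpha>\<bar> \<le> R" for N' \<alpha>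
    unfolding tail_def
  proof (intro ballI impI)
    fix x assume x: "x \<in> S" "\<forall>j\<le>N'. P j x = 0"
    have "P j (B \<alpha> x) = 0" if "j \<le> n" for j
      using x(2) that \<open>N' \<ge> n\<close> by (simp add: P_B linear_0[OF lin_B])
    then have "norm (G (B \<alpha> x)) \<le> 1 / (2 * M) * norm (B \<alpha> x)" using c[of "B \<alpha> x"] by simp
    also have "\<dots> \<le> 1 / (2 * M) * (M * norm x)"
      using norm_B_le[of \<alpha> "\<bar>R\<bar>" x] that M by (intro mult_left_mono) (auto simp: M_def)
    finally show "norm (G (B \<alpha> x)) \<le> 1 / 2 * norm x" using M by simp
  qed
  then show thesis by (rule that)
qed

end

section \<open>Degrees on invariant subspaces\<close>

context periodic_ops
begin

text \<open>What the fixed-point spaces of the group and the space of even functions have in common.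
  Invariance of their finite-mode parts under \<open>G\<close> and \<open>T \<alpha>\<close>
  follows, as \<open>G\<close> is a scalar on each mode.\<close>

definition "nice X \<longleftrightarrow> subspace X \<and> X \<subseteq> S \<and> (\<forall>x\<in>X. \<forall>j. P j x \<in> X) \<and> (\<forall>x\<in>X. am x \<in> X)"

lemma niceD:
  assumes "nice X"
  shows "subspace X" "X \<subseteq> S" "\<And>x j. x \<in> X \<Longrightarrow> P j x \<in> X" "\<And>x. x \<in> X \<Longrightarrow> am x \<in> X"
    "\<And>x. x \<in> X \<Longrightarrow> x \<in> S"
  using assms by (auto simp: nice_def)

lemma nice_S: "nice S"
  by (simp add: nice_def subspace_S P_S am_S)

lemma nice_Q: "nice X \<Longrightarrow> x \<in> X \<Longrightarrow> Q N x \<in> X"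
  unfolding Q_def by (intro subspace_sum niceD)

lemma nice_B: "nice X \<Longrightarrow> x \<in> X \<Longrightarrow> B \<alpha> x \<in> X"
  unfolding B_def by (intro subspace_diff subspace_scale niceD)

lemma Q_image_fix: "nice X \<Longrightarrow> y \<in> Q N ` X \<Longrightarrow> Q N y = y \<and> y \<in> X"
  using Q_Q nice_Q niceD(5) by auto

lemma T_Q_image:
  assumes X: "nice X" and y: "y \<in> Q N ` X" shows "T \<alpha> y \<in> Q N ` X"
proof -
  have y: "Q N y = y" "y \<in> X" using Q_image_fix[OF X y] by auto
  have "B \<alpha> y = B \<alpha> (Q N y)" using y by simp
  also have "\<dots> = (\<Sum>j\<le>N. P j (B \<alpha> y))" by (simp add: Q_def linear_sum[OF lin_B] P_B)
  finally have "G (B \<alpha> y) = (\<Sum>j\<le>N. G (P j (B \<alpha> y)))" by (metis linear_sum[OF lin_G])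
  also have "\<dots> = (\<Sum>j\<le>N. (- 1 / (1 + (freq p j)\<^sup>2)) *\<^sub>R P j (B \<alpha> y))"
    by (rule sum.cong) (simp_all add: G_P B_S niceD(5)[OF X y(2)])
  also have "\<dots> \<in> X" using X y by (intro subspace_sum subspace_scale niceD nice_B)
  finally have "T \<alpha> y \<in> X" unfolding T_def using X y by (intro subspace_diff niceD)
  moreover have "Q N (T \<alpha> y) = T \<alpha> y" by (simp add: Q_T y)
  ultimately show ?thesis by (metis image_eqI)
qed

definition "mel j a b = (SOME x. ev x = mode (freq p j) a b)"

lemma ev_mel: "ev (mel j a b) = mode (freq p j) a b"
  unfolding mel_def using mode_ex[of j a b] by (rule someI_ex)

lemma mel_S: "mel j a b \<in> S"
  by (simp add: S_def ev_mel mode_periodic[OF p])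

text \<open>Cosines and sines of the frequencies up to N, multiplied by the standard basis vectors,
  form a finite spanning set.\<close>

lemma fin_dim_Q:
  assumes X: "nice X" shows "fin_dim_subspace (Q N ` X)"
proof -
  define D where "D = (\<Union>j\<in>{..N}. \<Union>i\<in>UNIV. {mel j (axis i 1) 0, mel j 0 (axis i 1)})"
  have "finite D" unfolding D_def by simp
  have P: "P j x \<in> span D" if x: "x \<in> S" and j: "j \<le> N" for x j
  proof -
    obtain a b where m: "ev (P j x) = mode (freq p j) a b" using ev_P_mode[OF x] .
    have "P j x = (\<Sum>i\<in>UNIV. (a $ i) *\<^sub>R mel j (axis i 1) 0 + (b $ i) *\<^sub>R mel j 0 (axis i 1))"
    proof (rule ev_inj, rule ext)
      fix t
      show "ev (P j x) t = ev (\<Sum>i\<in>UNIV. (a $ i) *\<^sub>R mel j (axis i 1) 0 + (b $ i) *\<^sub>R mel j 0 (axis i 1)) t"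
        unfolding m ev_sum ev_add ev_scale ev_mel
        by (simp add: vec_eq_iff mode_def axis_def sum.distrib if_distrib cong: if_cong)
    qed
    also have "\<dots> \<in> span D"
      using j by (intro span_sum span_add span_scale span_base) (auto simp: D_def)
    finally show ?thesis .
  qed
  have "Q N ` X \<subseteq> span D"
    unfolding Q_def using P niceD(5)[OF X] by (auto intro!: span_sum)
  moreover have "subspace (Q N ` X)"
    using linear_subspace_image[OF lin_Q niceD(1)[OF X]] .
  moreover have "fin_dim_subspace (span D)" using \<open>finite D\<close> by (auto simp: fin_dim_subspace_def)
  ultimately show ?thesis using fin_dim_subspace_subset by blast
qed

text \<open>Let y be a value of the segment. Its low modes are T (Q x), bounded below by c in finite
  dimension. After subtracting them, y differs from z = x - Q x by at most half the norm of z.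
  Adding both estimates gives 1 / \<eta> = M / c + 2 (1 + M), with M the norm of
  \<open>Q N\<close>.\<close>

lemma T_reduces:
  assumes X: "nice X" and tail: "tail N \<alpha>" and inj: "\<And>x. x \<in> X \<Longrightarrow> T \<alpha> x = 0 \<Longrightarrow> x = 0"
  obtains \<eta> where "reduces X (Q N) (T \<alpha>) \<eta>"
proof -
  have W: "fin_dim_subspace (Q N ` X)" by (rule fin_dim_Q[OF X])
  obtain c where c: "c > 0" "\<And>x. x \<in> Q N ` X \<Longrightarrow> c * norm x \<le> norm (T \<alpha> x)"
    using fin_dim_lower_bound[OF W lin_T] inj Q_image_fix[OF X] by blast
  define M where "M = onorm (Q N)"
  have M: "M \<ge> 0" "\<And>y. norm (Q N y) \<le> M * norm y"
    unfolding M_def using onorm_pos_le[OF bl_Q] onorm[OF bl_Q] by auto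
  define \<eta> where "\<eta> = 1 / (M / c + 2 * (1 + M))"
  have den: "M / c + 2 * (1 + M) > 0" using M c by (simp add: add_nonneg_pos)
  have "\<eta> * norm x \<le> norm ((1 - s) *\<^sub>R T \<alpha> x + s *\<^sub>R (T \<alpha> (Q N x) + (x - Q N x)))"
    if s: "s \<in> {0..1}" and x: "x \<in> X" for s x
  proof -
    define y where "y = (1 - s) *\<^sub>R T \<alpha> x + s *\<^sub>R (T \<alpha> (Q N x) + (x - Q N x))"
    have xS: "x \<in> S" by (rule niceD(5)[OF X x])
    have "Q N y = (1 - s) *\<^sub>R T \<alpha> (Q N x) + s *\<^sub>R T \<alpha> (Q N x)"
      by (simp add: y_def linear_add[OF lin_Q] linear_scale[OF lin_Q] linear_diff[OF lin_Q] Q_T Q_Q[OF xS])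
    then have Qy: "Q N y = T \<alpha> (Q N x)" by (simp flip: scaleR_left_distrib)
    have "c * norm (Q N x) \<le> norm (T \<alpha> (Q N x))" using c x by blast
    also have "\<dots> \<le> M * norm y" using M(2)[of y] Qy by simp
    finally have 1: "norm (Q N x) \<le> M / c * norm y" using c(1) by (simp add: field_simps)
    define z where "z = x - Q N x"
    have "P j z = 0" if "j \<le> N" for j
      using that by (simp add: z_def linear_diff[OF lin_P] P_Q[OF xS])
    moreover have "z \<in> S" unfolding z_def by (intro subspace_diff subspace_S Q_S xS)
    ultimately have Kz: "norm (G (B \<alpha> z)) \<le> 1 / 2 * norm z" using tail by (simp add: tail_def)
    have Tx: "T \<alpha> x = T \<alpha> (Q N x) + (z - G (B \<alpha> z))"
      using linear_add[OF lin_T, of \<alpha> "Q N x" z] by (simp add: z_def T_def)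
    have "y - T \<alpha> (Q N x) = z - (1 - s) *\<^sub>R G (B \<alpha> z)"
      unfolding y_def z_def[symmetric] Tx by (simp add: algebra_simps)
    then have "norm z - norm ((1 - s) *\<^sub>R G (B \<alpha> z)) \<le> norm (y - T \<alpha> (Q N x))"
      by (metis norm_triangle_ineq2)
    moreover have "norm ((1 - s) *\<^sub>R G (B \<alpha> z)) \<le> norm (G (B \<alpha> z))"
      using s by (simp add: mult_left_le_one_le)
    moreover have "norm (y - T \<alpha> (Q N x)) \<le> norm y + M * norm y"
      using norm_triangle_ineq4[of y "T \<alpha> (Q N x)"] M(2)[of y] Qy by simp
    ultimately have 2: "norm z \<le> 2 * (1 + M) * norm y" using Kz by (simp add: algebra_simps)
    have "norm x \<le> norm (Q N x) + norm z" unfolding z_def by (rule norm_triangle_sub)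
    then have "norm x \<le> (M / c + 2 * (1 + M)) * norm y" using 1 2 by (simp add: distrib_right)
    then show ?thesis unfolding y_def[symmetric] \<eta>_def using den by (simp add: field_simps)
  qed
  moreover have "\<eta> > 0" using den by (simp add: \<eta>_def)
  ultimately have "reduces X (Q N) (T \<alpha>) \<eta>"
    unfolding reduces_def using W niceD(1)[OF X] bl_Q bl_T Q_image_fix[OF X] T_Q_image[OF X] by blast
  then show thesis by (rule that)
qed

text \<open>The approximations demanded by the definition are finite combinations of projections
  after \<open>B \<alpha>\<close>; accuracy \<epsilon> / (2 M) for \<open>G\<close> leaves an error
  of at most \<epsilon> / 2 on the unit ball.\<close>

lemma leray_schauder_T:
  assumes X: "nice X" and tail: "tail N \<alpha>" and inj: "\<And>x. x \<in> X \<Longrightarrow> T \<alpha> x = 0 \<Longrightarrow> x = 0"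
  shows "leray_schauder_degree X (T \<alpha>) = brouwer_ball_degree (Q N ` X) (T \<alpha>)"
proof -
  obtain \<eta> where red: "reduces X (Q N) (T \<alpha>) \<eta>" using T_reduces[OF assms] by blast
  show ?thesis
  proof (rule leray_schauder_reduces[OF red])
    fix \<epsilon> :: real assume \<epsilon>: "\<epsilon> > 0"
    define M where "M = onorm (B \<alpha>) + 1"
    have M: "M > 0" using onorm_pos_le[OF bl_B, of \<alpha>] by (simp add: M_def)
    have BM: "norm (B \<alpha> x) \<le> M * norm x" for x
      using onorm[OF bl_B, of \<alpha> x] unfolding M_def distrib_right by (simp add: add_increasing2)
    have "\<epsilon> / (2 * M) > 0" using M \<epsilon> by simp
    then obtain n c where c: "\<And>x. norm (G x - (\<Sum>j\<le>n. c j *\<^sub>R P j x)) \<le> \<epsilon> / (2 * M) * norm x"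
      using G_approx by blast
    define g where "g = (\<lambda>x. \<Sum>j\<le>n. c j *\<^sub>R P j (B \<alpha> x))"
    have blg: "bounded_linear g" unfolding g_def
      by (intro bounded_linear_sum bounded_linear_compose[OF bounded_linear_scaleR_right]
          bounded_linear_compose[OF bl_P bl_B])
    have gX: "g x \<in> Q n ` X" if x: "x \<in> X" for x
    proof -
      have "Q n (g x) = g x"
        using B_S[OF niceD(5)[OF X x]] by (simp add: g_def linear_sum[OF lin_Q] linear_scale[OF lin_Q] Q_P)
      moreover have "g x \<in> X"
        unfolding g_def using X x by (intro subspace_sum subspace_scale niceD nice_B)
      ultimately show ?thesis by (metis image_eqI)
    qed
    have close: "norm ((x - g x) - T \<alpha> x) < \<epsilon>" if "x \<in> X \<inter> cball 0 1" for x
    proof -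
      have "norm ((x - g x) - T \<alpha> x) = norm (G (B \<alpha> x) - g x)" by (simp add: T_def)
      also have "\<dots> \<le> \<epsilon> / (2 * M) * norm (B \<alpha> x)" unfolding g_def by (rule c)
      also have "\<dots> \<le> \<epsilon> / (2 * M) * (M * norm x)" using BM M \<epsilon> by (intro mult_left_mono) auto
      also have "\<dots> = \<epsilon> / 2 * norm x" using M by simp
      also have "\<dots> \<le> \<epsilon> / 2 * 1" using that \<epsilon> by (intro mult_left_mono) auto
      also have "\<dots> < \<epsilon>" using \<epsilon> by simp
      finally show ?thesis .
    qed
    show "\<exists>W g. fin_dim_subspace W \<and> W \<subseteq> X \<and> continuous_on (X \<inter> cball 0 1) g \<and>
      g ` (X \<inter> cball 0 1) \<subseteq> W \<and> (\<forall>x\<in>X \<inter> cball 0 1. norm ((x - g x) - T \<alpha> x) < \<epsilon>)"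
    proof (intro exI conjI ballI)
      show "fin_dim_subspace (Q n ` X)" by (rule fin_dim_Q[OF X])
      show "Q n ` X \<subseteq> X" using nice_Q[OF X] by blast
      show "continuous_on (X \<inter> cball 0 1) g" using blg linear_continuous_on by blast
      show "g ` (X \<inter> cball 0 1) \<subseteq> Q n ` X" using gX by blast
    qed (rule close)
  qed
qed

lemma lin_inj_T:
  assumes X: "nice X" and inj: "\<And>x. x \<in> X \<Longrightarrow> T \<alpha> x = 0 \<Longrightarrow> x = 0"
  shows "lin_inj (Q N ` X) (Q N ` X) (T \<alpha>)"
  using T_Q_image[OF X] Q_image_fix[OF X] inj by (intro lin_injI[OF lin_T]) blast+

text \<open>Affine dependence on \<alpha> gives the joint continuity in parameter and point that
  homotopies ask for.\<close>

lemma T_affine: "T \<alpha> x = T 0 x + \<alpha> *\<^sub>R G x"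
  by (simp add: T_def B_def linear_diff[OF lin_G] linear_scale[OF lin_G] linear_add[OF lin_G] scaleR_left_distrib)

lemma continuous_on_T:
  assumes "continuous_on Z a" "continuous_on Z f"
  shows "continuous_on Z (\<lambda>z. T (a z) (f z))"
  unfolding T_affine[of "a _"]
  by (intro continuous_intros assms bounded_linear.continuous_on[OF bl_T] bounded_linear.continuous_on[OF bl_G])

lemma ball_degree_T_const:
  assumes X: "nice X" and "a \<le> b"
    and inj: "\<And>\<alpha> x. \<alpha> \<in> {a..b} \<Longrightarrow> x \<in> X \<Longrightarrow> T \<alpha> x = 0 \<Longrightarrow> x = 0"
  shows "brouwer_ball_degree (Q N ` X) (T a) = brouwer_ball_degree (Q N ` X) (T b)"
proof -
  define h where "h = (\<lambda>s. T ((1 - s) * a + s * b))"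
  have "brouwer_ball_degree (Q N ` X) (h 0) = brouwer_ball_degree (Q N ` X) (h 1)"
  proof (rule ball_degree_linear_homotopy[OF fin_dim_Q[OF X]])
    show "continuous_on ({0..1} \<times> (Q N ` X \<inter> sphere 0 1)) (\<lambda>z. h (fst z) (snd z))"
      unfolding h_def by (intro continuous_on_T continuous_intros)
    fix s :: real assume s: "s \<in> {0..1}"
    have "(1 - s) * a + s * b \<in> {a..b}"
      using s \<open>a \<le> b\<close> convex_bound_le[of a b b "1 - s" s] convex_bound_le[of "- a" "- a" "- b" "1 - s" s]
      by (auto simp: algebra_simps mult_left_mono)
    then show "lin_inj (Q N ` X) (Q N ` X) (h s)"
      unfolding h_def using inj by (intro lin_inj_T[OF X]) blast
  qed
  then show ?thesis by (simp add: h_def)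
qed

text \<open>One N serves both parameters, so the two degrees become Brouwer degrees on the same
  finite-dimensional space, where the segment of operators is a homotopy.\<close>

lemma leray_schauder_T_const:
  assumes X: "nice X" and "a \<le> b"
    and inj: "\<And>\<alpha> x. \<alpha> \<in> {a..b} \<Longrightarrow> x \<in> X \<Longrightarrow> T \<alpha> x = 0 \<Longrightarrow> x = 0"
  shows "leray_schauder_degree X (T a) = leray_schauder_degree X (T b)"
proof -
  obtain N where N: "\<And>N' \<alpha>. N' \<ge> N \<Longrightarrow> \<bar>\<alpha>\<bar> \<le> max \<bar>a\<bar> \<bar>b\<bar> \<Longrightarrow> tail N' \<alpha>"
    using tail_exists[of "max \<bar>a\<bar> \<bar>b\<bar>"] by blast
  have "tail N a" "tail N b" by (rule N; simp)+
  then show ?thesis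
    using leray_schauder_T[OF X, of N a] leray_schauder_T[OF X, of N b] inj[of a] inj[of b] \<open>a \<le> b\<close>
      ball_degree_T_const[OF assms, where N = N] by simp
qed

end

section \<open>Change of degree at a critical mode\<close>

context periodic_ops
begin

text \<open>On finitely many modes \<open>T \<alpha>\<close> factors as S1 after S0, where S0 acts
  on the critical mode and S1 on the others. S1 stays invertible from a to b, so its degree is
  constant. By \<open>Y\<close> the critical mode is one copy of V, on which S0 is a positive
  multiple of A - (\<alpha> - \<omega>^2) with \<omega> the critical frequency, so its degree is the
  sign of a determinant.\<close>

lemma T_degree_flip:
  assumes X: "nice X" and Y: "P j\<^sub>0 ` X = {x. \<exists>v. ev x = (\<lambda>t. w t *\<^sub>R v)}" and wm: "w = mode (freq p j\<^sub>0) (c::real) e"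
    and w: "w t\<^sub>0 \<noteq> 0"
    and "a \<le> b"
    and inj: "\<And>x. x \<in> X \<Longrightarrow> T a x = 0 \<Longrightarrow> x = 0" "\<And>x. x \<in> X \<Longrightarrow> T b x = 0 \<Longrightarrow> x = 0"
    and inj1: "\<And>\<alpha> x. \<alpha> \<in> {a..b} \<Longrightarrow> x \<in> X \<Longrightarrow> P j\<^sub>0 x = 0 \<Longrightarrow> T \<alpha> x = 0 \<Longrightarrow> x = 0"
    and det: "det (matrix (\<lambda>v. A v - (a - (freq p j\<^sub>0)\<^sup>2) *\<^sub>R v)) * det (matrix (\<lambda>v. A v - (b - (freq p j\<^sub>0)\<^sup>2) *\<^sub>R v)) < 0"
    and N: "j\<^sub>0 \<le> N"
  shows "brouwer_ball_degree (Q N ` X) (T a) = - brouwer_ball_degree (Q N ` X) (T b)"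
proof -
  define W where "W = Q N ` X"
  define Y0 where "Y0 = P j\<^sub>0 ` X"
  let ?P = "P j\<^sub>0"
  note Xs = niceD(5)[OF X]
  have fW: "fin_dim_subspace W" unfolding W_def by (rule fin_dim_Q[OF X])
  have sW: "subspace W" by (rule fin_dim_subspace_subspace[OF fW])
  have WX: "x \<in> W \<Longrightarrow> x \<in> X" for x unfolding W_def using Q_image_fix[OF X] by blast
  have PW: "?P x \<in> W" if "x \<in> X" for x
    unfolding W_def using Q_P[OF Xs[OF that] N] niceD(3)[OF X that] by (metis image_eqI)
  have TW: "T \<alpha> x \<in> W" if "x \<in> W" for \<alpha> x using that unfolding W_def by (rule T_Q_image[OF X])
  have Y0W: "Y0 \<subseteq> W" using PW by (auto simp: Y0_def)
  have sY0: "subspace Y0" unfolding Y0_def by (rule linear_subspace_image[OF lin_P niceD(1)[OF X]])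
  have PP: "?P (?P x) = ?P x" if "x \<in> X" for x using P_P[OF Xs[OF that]] by simp
  have PY: "?P x = x" if "x \<in> Y0" for x using that PP by (auto simp: Y0_def)
  define S0 where "S0 = (\<lambda>\<alpha> x. T \<alpha> (?P x) + (x - ?P x))"
  define S1 where "S1 = (\<lambda>\<alpha> x. ?P x + T \<alpha> (x - ?P x))"
  have lS0: "linear (S0 \<alpha>)" and lS1: "linear (S1 \<alpha>)" for \<alpha>
    unfolding S0_def S1_def
    by (auto intro!: linearI simp: linear_add[OF lin_P] linear_scale[OF lin_P] linear_add[OF lin_T]
        linear_scale[OF lin_T] linear_diff[OF lin_T] algebra_simps)
  have S0W: "S0 \<alpha> x \<in> W" and S1W: "S1 \<alpha> x \<in> W" if "x \<in> W" for \<alpha> x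
    unfolding S0_def S1_def using that sW by (auto intro!: subspace_add subspace_diff TW PW WX)
  have PS0: "?P (S0 \<alpha> x) = T \<alpha> (?P x)" if "x \<in> X" for \<alpha> x
    using PP[OF that] by (simp add: S0_def linear_add[OF lin_P] linear_diff[OF lin_P] P_T)
  have PS1: "?P (S1 \<alpha> x) = ?P x" if "x \<in> X" for \<alpha> x
    using PP[OF that] by (simp add: S1_def linear_add[OF lin_P] linear_diff[OF lin_P] P_T linear_0[OF lin_T])
  have fac: "S1 \<alpha> (S0 \<alpha> x) = T \<alpha> x" if "x \<in> X" for \<alpha> x
    unfolding S1_def PS0[OF that] unfolding S0_def using linear_add[OF lin_T, of \<alpha> "?P x" "x - ?P x"] by simp
  have iS0: "lin_inj W W (S0 \<alpha>)" if "\<And>x. x \<in> X \<Longrightarrow> T \<alpha> x = 0 \<Longrightarrow> x = 0" for \<alpha>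
  proof (rule lin_injI[OF lS0 S0W])
    fix x assume x: "x \<in> W" "S0 \<alpha> x = 0"
    then have "T \<alpha> x = 0" using fac[OF WX[OF x(1)], of \<alpha>] linear_0[OF lS1] by simp
    then show "x = 0" using that WX x(1) by blast
  qed
  have iS1: "lin_inj W W (S1 \<alpha>)" if "\<alpha> \<in> {a..b}" for \<alpha>
  proof (rule lin_injI[OF lS1 S1W])
    fix x assume x: "x \<in> W" "S1 \<alpha> x = 0"
    then have "?P x = 0" using PS1[OF WX[OF x(1)], of \<alpha>] linear_0[OF lin_P] by simp
    moreover from this have "T \<alpha> x = 0" using x(2) by (simp add: S1_def)
    ultimately show "x = 0" using inj1[OF that WX[OF x(1)]] by blast
  qed
  have "brouwer_ball_degree W (S1 ((1 - 0) * a + 0 * b)) = brouwer_ball_degree W (S1 ((1 - 1) * a + 1 * b))"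
  proof (rule ball_degree_linear_homotopy[OF fW, of "\<lambda>s. S1 ((1 - s) * a + s * b)"])
    show "continuous_on ({0..1} \<times> (W \<inter> sphere 0 1)) (\<lambda>z. S1 ((1 - fst z) * a + fst z * b) (snd z))"
      unfolding S1_def by (intro continuous_on_add continuous_on_T continuous_intros bounded_linear.continuous_on[OF bl_P])
    fix s :: real assume s: "s \<in> {0..1}"
    have "(1 - s) * a + s * b \<in> {a..b}"
      using s \<open>a \<le> b\<close> convex_bound_le[of a b b "1 - s" s] convex_bound_le[of "- a" "- a" "- b" "1 - s" s]
      by (auto simp: algebra_simps mult_left_mono)
    then show "lin_inj W W (S1 ((1 - s) * a + s * b))" by (rule iS1)
  qed
  then have S1ab: "brouwer_ball_degree W (S1 a) = brouwer_ball_degree W (S1 b)" by simp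
  have dT: "brouwer_ball_degree W (T \<alpha>) = brouwer_ball_degree W (S1 \<alpha>) * brouwer_ball_degree W (S0 \<alpha>)"
    if "\<alpha> \<in> {a..b}" "\<And>x. x \<in> X \<Longrightarrow> T \<alpha> x = 0 \<Longrightarrow> x = 0" for \<alpha>
  proof -
    have "brouwer_ball_degree W (T \<alpha>) = brouwer_ball_degree W (\<lambda>x. S1 \<alpha> (S0 \<alpha> x))"
      by (rule ball_degree_cong[OF fW]) (simp add: fac WX)
    also have "\<dots> = brouwer_ball_degree W (S1 \<alpha>) * brouwer_ball_degree W (S0 \<alpha>)"
      using that by (intro ball_degree_comp[OF fW iS0 iS1])
    finally show ?thesis .
  qed
  define d where "d = 1 + (freq p j\<^sub>0)\<^sup>2"
  have d: "d > 0" by (simp add: d_def add_pos_nonneg)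
  define f where "f = (\<lambda>\<alpha> v. A v - (\<alpha> - (freq p j\<^sub>0)\<^sup>2) *\<^sub>R v)"
  have lf: "linear (f \<alpha>)" for \<alpha>
    unfolding f_def by (rule linearI) (simp_all add: linear_add[OF A] linear_scale[OF A] algebra_simps)
  define F where "F = (\<lambda>\<alpha> v. (1 / d) *\<^sub>R f \<alpha> v)"
  have lF: "linear (F \<alpha>)" for \<alpha>
    unfolding F_def by (rule linearI) (simp_all add: linear_add[OF lf] linear_scale[OF lf] algebra_simps)
  \<comment> \<open>The factor 1 / d enters to the power of the dimension and, being positive,
    preserves the sign.\<close>
  have detF: "det (matrix (F \<alpha>)) = (1 / d) ^ CARD('k) * det (matrix (f \<alpha>))" for \<alpha>
  proof -
    have "F \<alpha> = (*\<^sub>R) (1 / d) \<circ> f \<alpha>" by (simp add: F_def fun_eq_iff)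
    then have "matrix (F \<alpha>) = matrix ((*\<^sub>R) (1 / d)) ** matrix (f \<alpha>)"
      by (simp only: matrix_compose[OF lf bounded_linear.linear[OF bounded_linear_scaleR_right]])
    then show ?thesis by (simp only: det_mul det_matrix_scaleR)
  qed
  have dS0: "brouwer_ball_degree W (S0 \<alpha>) = (if det (matrix (f \<alpha>)) > 0 then 1 else - 1)"
    if \<alpha>: "\<And>x. x \<in> X \<Longrightarrow> T \<alpha> x = 0 \<Longrightarrow> x = 0" and nz: "det (matrix (f \<alpha>)) \<noteq> 0" for \<alpha>
  proof -
    have TY: "T \<alpha> x \<in> Y0" if "x \<in> Y0" for x
    proof -
      have "?P (T \<alpha> x) = T \<alpha> x" using PY[OF that] by (simp add: P_T)
      moreover have "T \<alpha> x \<in> X" using TW that Y0W WX by blast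
      ultimately show ?thesis unfolding Y0_def by (metis image_eqI)
    qed
    have "brouwer_ball_degree W (S0 \<alpha>) = brouwer_ball_degree Y0 (S0 \<alpha>)"
    proof (rule ball_degree_direct_sum[OF fW sY0 Y0W, where U' = "{x \<in> W. ?P x = 0}"])
      show "subspace {x \<in> W. ?P x = 0}"
        using sW by (auto simp: subspace_def linear_0[OF lin_P] linear_add[OF lin_P] linear_scale[OF lin_P])
      fix x assume x: "x \<in> W"
      have "x = ?P x + (x - ?P x)" by simp
      moreover have "?P x \<in> Y0" using WX[OF x] by (simp add: Y0_def)
      moreover have "x - ?P x \<in> {x \<in> W. ?P x = 0}"
        using x PP WX PW sW by (simp add: linear_diff[OF lin_P] subspace_diff)
      ultimately show "\<exists>u\<in>Y0. \<exists>v\<in>{x \<in> W. ?P x = 0}. x = u + v" by blast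
    next
      show "S0 \<alpha> ` Y0 \<subseteq> Y0" using TY PY by (auto simp: S0_def)
    qed (use iS0[OF \<alpha>] PY in \<open>auto simp: S0_def linear_0[OF lin_T]\<close>)
    also have "\<dots> = brouwer_ball_degree Y0 (T \<alpha>)"
      by (rule ball_degree_cong[OF fin_dim_subspace_subset[OF fW sY0 Y0W]]) (simp add: S0_def PY)
    also have "\<dots> = brouwer_ball_degree UNIV (F \<alpha>)"
    proof -
      \<comment> \<open>The isomorphism of V with the critical modes; it is injective because the
        profile \<open>w\<close> is nonzero at \<open>t\<^sub>0\<close>.\<close>
      define \<psi> where "\<psi> = (\<lambda>v. SOME x. ev x = (\<lambda>t. w t *\<^sub>R v))"
      have ex: "\<exists>x. ev x = (\<lambda>t. w t *\<^sub>R v)" for v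
      proof -
        have "(\<lambda>t. w t *\<^sub>R v) = mode (freq p j\<^sub>0) (c *\<^sub>R v) (e *\<^sub>R v)"
          by (simp add: wm fun_eq_iff mode_def algebra_simps)
        then show ?thesis using mode_ex by simp
      qed
      have ev\<psi>: "ev (\<psi> v) = (\<lambda>t. w t *\<^sub>R v)" for v unfolding \<psi>_def by (rule someI_ex[OF ex])
      have \<psi>Y: "\<psi> v \<in> Y0" for v unfolding Y0_def Y using ev\<psi> by blast
      have l\<psi>: "linear \<psi>"
        by (rule linearI; rule ev_inj) (simp_all add: fun_eq_iff ev\<psi> ev_add ev_scale algebra_simps)
      have i\<psi>: "lin_inj UNIV Y0 \<psi>"
      proof (rule lin_injI[OF l\<psi> \<psi>Y])
        fix v assume "\<psi> v = 0"
        then have "w t\<^sub>0 *\<^sub>R v = 0" using ev\<psi>[of v] ev_zero[of t\<^sub>0] by metis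
        then show "v = 0" using w by simp
      qed
      have s\<psi>: "\<psi> ` UNIV = Y0"
      proof
        show "Y0 \<subseteq> \<psi> ` UNIV"
        proof
          fix x assume "x \<in> Y0"
          then obtain v where "ev x = (\<lambda>t. w t *\<^sub>R v)" unfolding Y0_def Y by blast
          then have "x = \<psi> v" by (intro ev_inj) (simp add: ev\<psi>)
          then show "x \<in> \<psi> ` UNIV" by blast
        qed
      qed (use \<psi>Y in blast)
      have eq: "T \<alpha> (\<psi> v) = \<psi> (F \<alpha> v)" for v
      proof (rule ev_inj, rule ext)
        fix t
        have "\<psi> v \<in> X" using \<psi>Y Y0W WX by blast
        then obtain c e where "ev (?P (\<psi> v)) = mode (freq p j\<^sub>0) c e" using ev_P_mode[OF Xs] by blast
        then have "ev (\<psi> v) = mode (freq p j\<^sub>0) c e" using PY[OF \<psi>Y] by simp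
        note Tm = T_mode[OF this, of \<alpha>, folded d_def]
        have "ev (T \<alpha> (\<psi> v)) t = (1 / d) *\<^sub>R (A (w t *\<^sub>R v) - (\<alpha> - (freq p j\<^sub>0)\<^sup>2) *\<^sub>R (w t *\<^sub>R v))"
          unfolding Tm by (simp only: ev_scale ev_diff ev_am ev\<psi>)
        also have "\<dots> = ev (\<psi> (F \<alpha> v)) t"
          by (simp add: ev\<psi> F_def f_def linear_scale[OF A] algebra_simps)
        finally show "ev (T \<alpha> (\<psi> v)) t = ev (\<psi> (F \<alpha> v)) t" .
      qed
      show ?thesis
      proof (rule ball_degree_conj[OF fin_dim_UNIV i\<psi> s\<psi>])
        show "lin_inj UNIV UNIV (F \<alpha>)" unfolding lin_inj_vec_iff[OF lF] detF using nz d by simp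
        show "lin_inj Y0 Y0 (T \<alpha>)"
          using TY \<alpha> Y0W WX by (intro lin_injI[OF lin_T]) blast+
      qed (rule eq)
    qed
    also have "\<dots> = (if det (matrix (F \<alpha>)) > 0 then 1 else - 1)"
      by (rule ball_degree_det[OF lF]) (use nz d in \<open>simp add: detF\<close>)
    also have "det (matrix (F \<alpha>)) > 0 \<longleftrightarrow> det (matrix (f \<alpha>)) > 0"
      unfolding detF using d by (simp add: zero_less_mult_iff)
    finally show ?thesis .
  qed
  have nz: "det (matrix (f a)) \<noteq> 0" "det (matrix (f b)) \<noteq> 0" "det (matrix (f a)) * det (matrix (f b)) < 0"
    using det by (auto simp: f_def)
  have "brouwer_ball_degree W (S0 a) = - brouwer_ball_degree W (S0 b)"
  proof -
    have "brouwer_ball_degree W (S0 a) = (if det (matrix (f a)) > 0 then 1 else - 1)"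
      by (rule dS0[OF _ nz(1)]) (rule inj(1))
    moreover have "brouwer_ball_degree W (S0 b) = (if det (matrix (f b)) > 0 then 1 else - 1)"
      by (rule dS0[OF _ nz(2)]) (rule inj(2))
    ultimately show ?thesis using nz(3) by (auto simp: mult_less_0_iff)
  qed
  then show ?thesis
    unfolding W_def[symmetric] using dT[of a] dT[of b] inj \<open>a \<le> b\<close> S1ab by simp
qed

end

section \<open>Compactness, solvability and small solutions\<close>

text \<open>Bounded vectors have bounded coordinates and so lie in the continuous image of a compact
  cube of sequences.\<close>

lemma fin_dim_bounded_totally_bounded:
  fixes W :: "'a::real_normed_vector set"
  assumes "fin_dim_subspace W" "e > 0"
  obtains k where "finite k" "W \<inter> cball 0 M \<subseteq> (\<Union>x\<in>k. ball x e)"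
proof -
  obtain b where b: "is_basis b (dim W) W" using fin_dim_subspace_basis[OF assms(1)] .
  let ?n = "dim W"
  obtain C where C: "C > 0" "\<And>x. L2_set x {..<?n} \<le> C * norm (lin_comb b ?n x)"
    using coordinate_bound[OF b] by blast
  define K where "K = PiE UNIV (\<lambda>i::nat. {- (C * \<bar>M\<bar>)..C * \<bar>M\<bar>})"
  have "compactin (product_topology (\<lambda>i::nat. euclidean) UNIV) K"
    unfolding K_def compactin_PiE by simp
  then have "compact K" by (simp add: euclidean_product_topology)
  then have "compact (lin_comb b ?n ` K)" by (rule compact_continuous_image[OF continuous_on_lin_comb])
  then obtain k where k: "finite k" "lin_comb b ?n ` K \<subseteq> (\<Union>x\<in>k. ball x e)"
    using assms(2) unfolding compact_eq_totally_bounded by blast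
  have "W \<inter> cball 0 M \<subseteq> lin_comb b ?n ` K"
  proof
    fix w assume w: "w \<in> W \<inter> cball 0 M"
    define y where "y = crd b ?n w"
    have wy: "lin_comb b ?n y = w" unfolding y_def using w by (intro lin_comb_crd[OF b]) auto
    have "\<bar>y i\<bar> \<le> C * \<bar>M\<bar>" for i
    proof (cases "i < ?n")
      case True
      then have "\<bar>y i\<bar> \<le> L2_set y {..<?n}" by (rule abs_le_L2_set)
      also have "\<dots> \<le> C * norm w" using C(2)[of y] by (simp add: wy)
      also have "\<dots> \<le> C * \<bar>M\<bar>" using w C(1) by (intro mult_left_mono) auto
      finally show ?thesis .
    next
      case False
      then show ?thesis using C(1) by (simp add: y_def crd_outside)
    qed
    then have "y \<in> K" by (auto simp: K_def abs_le_iff minus_le_iff)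
    then show "w \<in> lin_comb b ?n ` K" using wy by blast
  qed
  then show thesis using k that by blast
qed

context periodic_ops
begin

text \<open>On a bounded set \<open>G\<close> is within e / 4 of a finite-rank operator, whose image
  is totally bounded; completeness of \<open>S\<close> then makes the closure of the image
  compact.\<close>

lemma G_compact:
  assumes S: "complete S" and x: "\<And>n. x n \<in> S" "\<And>n. norm (x n) \<le> R"
  obtains r l where "strict_mono (r :: nat \<Rightarrow> nat)" "(\<lambda>n. G (x (r n))) \<longlonglongrightarrow> l" "l \<in> S"
proof -
  define Z where "Z = G ` (S \<inter> cball 0 R)"
  have ZS: "closure Z \<subseteq> S"
    using G_S complete_imp_closed[OF S] by (intro closure_minimal) (auto simp: Z_def)
  have R: "R \<ge> 0" using x(2)[of 0] norm_ge_zero order_trans by blast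
  have "complete (closure Z)" by (rule complete_closed_subset[OF closed_closure ZS S])
  moreover have "\<exists>k. finite k \<and> closure Z \<subseteq> (\<Union>y\<in>k. ball y e)" if e: "e > 0" for e
  proof -
    define R1 where "R1 = R + 1"
    have R1: "R1 > 0" "R \<le> R1" using R by (auto simp: R1_def)
    then have "e / (4 * R1) > 0" using e by simp
    then obtain n c where c: "\<And>x. norm (G x - (\<Sum>j\<le>n. c j *\<^sub>R P j x)) \<le> e / (4 * R1) * norm x"
      using G_approx by blast
    define g where "g = (\<lambda>x. \<Sum>j\<le>n. c j *\<^sub>R P j x)"
    have "bounded_linear g" unfolding g_def
      by (intro bounded_linear_sum bounded_linear_compose[OF bounded_linear_scaleR_right] bl_P)
    then obtain L where L: "L > 0" "\<And>x. norm (g x) \<le> norm x * L" using bounded_linear.pos_bounded by blast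
    have gW: "g x \<in> Q n ` S" if "x \<in> S" for x
    proof -
      have "Q n (g x) = g x" by (simp add: g_def linear_sum[OF lin_Q] linear_scale[OF lin_Q] Q_P that)
      moreover have "g x \<in> S" unfolding g_def by (intro subspace_sum subspace_S subspace_scale P_S that)
      ultimately show ?thesis by (metis image_eqI)
    qed
    have "e / 4 > 0" using e by simp
    then obtain k where k: "finite k" "Q n ` S \<inter> cball 0 (R * L) \<subseteq> (\<Union>y\<in>k. ball y (e / 4))"
      using fin_dim_bounded_totally_bounded[OF fin_dim_Q[OF nice_S]] by blast
    have "Z \<subseteq> (\<Union>y\<in>k. cball y (e / 2))"
    proof
      fix z assume "z \<in> Z"
      then obtain x where x: "x \<in> S" "norm x \<le> R" "z = G x" by (auto simp: Z_def)
      have "norm (g x) \<le> R * L" using L x(2) mult_right_mono[of "norm x" R L] by (meson less_imp_le order_trans)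
      then obtain y where y: "y \<in> k" "dist y (g x) < e / 4" using k(2) gW[OF x(1)] by (auto simp: subset_iff)
      have "norm (G x - g x) \<le> e / (4 * R1) * norm x" unfolding g_def by (rule c)
      also have "\<dots> \<le> e / (4 * R1) * R1" using x(2) R1 e by (intro mult_left_mono) auto
      also have "\<dots> = e / 4" using R1 by simp
      finally have "dist (g x) z \<le> e / 4" by (simp add: dist_norm x(3) norm_minus_commute)
      then have "dist y z \<le> e / 2" using y(2) dist_triangle[of y z "g x"] by simp
      then show "z \<in> (\<Union>y\<in>k. cball y (e / 2))" using y(1) by auto
    qed
    then have "closure Z \<subseteq> (\<Union>y\<in>k. cball y (e / 2))"
      using k(1) by (intro closure_minimal closed_UN) auto
    also have "\<dots> \<subseteq> (\<Union>y\<in>k. ball y e)" using e by auto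
    finally show ?thesis using k(1) by blast
  qed
  ultimately have "compact (closure Z)" by (simp add: compact_eq_totally_bounded)
  moreover have "G (x n) \<in> closure Z" for n
    using x closure_subset[of Z] by (auto simp: Z_def)
  ultimately obtain l r where "l \<in> closure Z" "strict_mono r" "((\<lambda>n. G (x n)) \<circ> r) \<longlonglongrightarrow> l"
    using seq_compactE[of "closure Z" "\<lambda>n. G (x n)"] compact_imp_seq_compact by metis
  then show thesis using ZS that by (auto simp: o_def)
qed

text \<open>Modes up to N are solved by linear algebra in V, where A - (\<alpha> - \<omega>^2) is
  injective, hence onto, at each frequency \<omega>. The rest y' of the right-hand side has high
  modes only, and there x = y' + G (B \<alpha> x) is a contraction problem.\<close>

lemma T_surj:
  assumes S: "complete S" and \<alpha>: "\<And>j. \<alpha> - (freq p j)\<^sup>2 \<notin> real_spectrum A" and y: "y \<in> S"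
  obtains x where "x \<in> S" "T \<alpha> x = y"
proof -
  obtain N where N: "\<And>N' \<beta>. N' \<ge> N \<Longrightarrow> \<bar>\<beta>\<bar> \<le> \<bar>\<alpha>\<bar> \<Longrightarrow> tail N' \<beta>" using tail_exists[of "\<bar>\<alpha>\<bar>"] by blast
  have tail: "tail N \<alpha>" by (rule N) auto
  have "\<exists>x\<in>S. T \<alpha> x = P j y" for j
  proof -
    obtain a b where m: "ev (P j y) = mode (freq p j) a b" using ev_P_mode[OF y] .
    define \<beta> where "\<beta> = \<alpha> - (freq p j)\<^sup>2"
    define d where "d = 1 + (freq p j)\<^sup>2"
    have d: "d > 0" by (simp add: d_def add_pos_nonneg)
    have lf: "linear (\<lambda>v. A v - \<beta> *\<^sub>R v)"
      by (rule linearI) (simp_all add: linear_add[OF A] linear_scale[OF A] algebra_simps)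
    have "inj (\<lambda>v. A v - \<beta> *\<^sub>R v)"
      unfolding linear_injective_0[OF lf] using \<alpha>[of j] by (auto simp: real_spectrum_def \<beta>_def)
    then have "surj (\<lambda>v. A v - \<beta> *\<^sub>R v)" by (rule linear_inj_imp_surj[OF lf])
    then have onto: "\<exists>v. u = A v - \<beta> *\<^sub>R v" for u by (rule surjD)
    obtain a' where a': "d *\<^sub>R a = A a' - \<beta> *\<^sub>R a'" using onto by blast
    obtain b' where b': "d *\<^sub>R b = A b' - \<beta> *\<^sub>R b'" using onto by blast
    note ab = a'[symmetric] b'[symmetric]
    define x where "x = mel j a' b'"
    have ex: "ev x = mode (freq p j) a' b'" unfolding x_def by (rule ev_mel)
    have "T \<alpha> x = P j y"
    proof (rule ev_inj, rule ext)
      fix t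
      have "ev (T \<alpha> x) t = (1 / d) *\<^sub>R (A (ev x t) - \<beta> *\<^sub>R ev x t)"
        unfolding T_mode[OF ex] \<beta>_def[symmetric] d_def[symmetric] by (simp only: ev_scale ev_diff ev_am)
      also have "A (ev x t) - \<beta> *\<^sub>R ev x t =
          cos (freq p j * t) *\<^sub>R (A a' - \<beta> *\<^sub>R a') + sin (freq p j * t) *\<^sub>R (A b' - \<beta> *\<^sub>R b')"
        by (simp add: ex mode_def linear_add[OF A] linear_scale[OF A] algebra_simps)
      also have "(1 / d) *\<^sub>R \<dots> = ev (P j y) t" unfolding ab m using d by (simp add: mode_def scaleR_add_right)
      finally show "ev (T \<alpha> x) t = ev (P j y) t" .
    qed
    moreover have "x \<in> S" unfolding x_def by (rule mel_S)
    ultimately show ?thesis by blast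
  qed
  then obtain X where X: "\<And>j. X j \<in> S" "\<And>j. T \<alpha> (X j) = P j y" by metis
  define x1 where "x1 = (\<Sum>j\<le>N. X j)"
  have x1: "x1 \<in> S" "T \<alpha> x1 = Q N y"
    unfolding x1_def Q_def using X by (auto simp: linear_sum[OF lin_T] intro!: subspace_sum subspace_S)
  define y' where "y' = y - Q N y"
  \<comment> \<open>Closed in \<open>S\<close>, hence complete, and invariant under the
    contraction.\<close>
  define S' where "S' = S \<inter> (\<Inter>j\<in>{..N}. {x. P j x = 0})"
  have y': "y' \<in> S'"
    using y by (auto simp: S'_def y'_def linear_diff[OF lin_P] P_Q intro!: subspace_diff subspace_S Q_S)
  have "closed {x. P j x = 0}" for j
    by (intro closed_Collect_eq continuous_on_const bounded_linear.continuous_on[OF bl_P] continuous_on_id)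
  then have cS': "complete S'" unfolding S'_def by (intro complete_Int_closed S closed_INT) auto
  have sub: "subspace S'"
    by (auto simp: S'_def subspace_def subspace_0[OF subspace_S] subspace_add[OF subspace_S]
        subspace_scale[OF subspace_S] linear_0[OF lin_P] linear_add[OF lin_P] linear_scale[OF lin_P])
  have KS': "G (B \<alpha> x) \<in> S'" if "x \<in> S'" for x
    using that by (auto simp: S'_def P_G P_B linear_0[OF lin_B] linear_0[OF lin_G] intro!: G_S B_S)
  have "\<exists>!x\<in>S'. y' + G (B \<alpha> x) = x"
  proof (rule Banach_fix[OF cS', of "1 / 2"])
    show "S' \<noteq> {}" using y' by blast
    show "(\<lambda>x. y' + G (B \<alpha> x)) ` S' \<subseteq> S'" using KS' y' sub by (auto intro!: subspace_add)
    fix x z assume xz: "x \<in> S'" "z \<in> S'"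
    then have "x - z \<in> S'" by (rule subspace_diff[OF sub])
    then have "norm (G (B \<alpha> (x - z))) \<le> 1 / 2 * norm (x - z)" using tail by (auto simp: tail_def S'_def)
    then show "dist (y' + G (B \<alpha> x)) (y' + G (B \<alpha> z)) \<le> 1 / 2 * dist x z"
      by (simp add: dist_norm linear_diff[OF lin_G] linear_diff[OF lin_B])
  qed auto
  then obtain x2 where x2: "x2 \<in> S'" "y' + G (B \<alpha> x2) = x2" by blast
  then have "T \<alpha> x2 = y'" by (simp add: T_def algebra_simps)
  then have "T \<alpha> (x1 + x2) = y" using x1 by (simp add: linear_add[OF lin_T] y'_def)
  moreover have "x1 + x2 \<in> S" using x1 x2 by (intro subspace_add subspace_S) (auto simp: S'_def)
  ultimately show thesis using that by blast
qed

text \<open>Fix a small r and suppose that no point of norm r solves the equation up to some error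
  e. A finite-rank replacement of \<open>G\<close> then gives a zero-free homotopy over the
  parameter interval whose ends have the degrees of \<open>T a\<close> and \<open>T b\<close>, which
  differ. So there are solutions up to 1 / (n + 1) for every n, and compactness of \<open>G\<close>
  yields an exact one of norm r.\<close>

lemma bifurcation_solutions:
  assumes S: "complete S" and X: "nice X" "closed X" and ab: "a \<le> b"
    and F: "\<And>x. x \<in> X \<Longrightarrow> F x \<in> X" "continuous_on X F"
    and small: "\<And>\<epsilon>. \<epsilon> > 0 \<Longrightarrow> \<exists>\<delta>>0. \<forall>x\<in>X. norm x \<le> \<delta> \<longrightarrow> norm (F x) \<le> \<epsilon> * norm x"
    and inj: "\<And>x. x \<in> X \<Longrightarrow> T a x = 0 \<Longrightarrow> x = 0" "\<And>x. x \<in> X \<Longrightarrow> T b x = 0 \<Longrightarrow> x = 0"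
    and tail: "tail N a" "tail N b"
    and deg: "brouwer_ball_degree (Q N ` X) (T a) \<noteq> brouwer_ball_degree (Q N ` X) (T b)"
    and \<delta>: "\<delta> > 0"
  obtains \<alpha> x where "\<alpha> \<in> {a..b}" "x \<in> X" "x \<noteq> 0" "norm x \<le> \<delta>" "T \<alpha> x = G (F x)"
proof -
  note Xs = niceD(5)[OF X(1)]
  have sX: "subspace X" by (rule niceD(1)[OF X(1)])
  obtain \<eta>1 where \<eta>1: "reduces X (Q N) (T a) \<eta>1" using T_reduces[OF X(1) tail(1) inj(1)] by blast
  obtain \<eta>2 where \<eta>2: "reduces X (Q N) (T b) \<eta>2" using T_reduces[OF X(1) tail(2) inj(2)] by blast
  define \<eta> where "\<eta> = min \<eta>1 \<eta>2"
  have \<eta>: "\<eta> > 0" using \<eta>1 \<eta>2 by (simp add: \<eta>_def reduces_def)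
  obtain M where M: "M > 0" "\<And>x. norm (G x) \<le> norm x * M" using bounded_linear.pos_bounded[OF bl_G] by blast
  \<comment> \<open>With this threshold the nonlinear term G (F x) is at most \<eta> / 2 times norm
    x.\<close>
  have "\<eta> / (2 * M) > 0" using M \<eta> by simp
  then obtain \<delta>1 where \<delta>1: "\<delta>1 > 0" "\<And>x. x \<in> X \<Longrightarrow> norm x \<le> \<delta>1 \<Longrightarrow> norm (F x) \<le> \<eta> / (2 * M) * norm x"
    using small by meson
  define r where "r = min \<delta> \<delta>1"
  have r: "r > 0" "r \<le> \<delta>" "r \<le> \<delta>1" using \<delta> \<delta>1 by (auto simp: r_def)
  \<comment> \<open>A bound for the argument of \<open>G\<close> at norm r, uniform over the
    parameter interval; it sets the accuracy of the finite-rank replacement and the ball used for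
    compactness.\<close>
  define R where "R = (onorm A + max \<bar>a\<bar> \<bar>b\<bar> + 1 + \<eta> / (2 * M)) * r"
  have oA: "onorm A \<ge> 0" using A linear_conv_bounded_linear onorm_pos_le by blast
  have bdd: "norm (B \<alpha> x + F x) \<le> R" if "\<alpha> \<in> {a..b}" "x \<in> X" "norm x = r" for \<alpha> x
  proof -
    have "norm (B \<alpha> x) \<le> (onorm A + max \<bar>a\<bar> \<bar>b\<bar> + 1) * norm x"
      using that by (intro norm_B_le) auto
    moreover have "norm (F x) \<le> \<eta> / (2 * M) * norm x" using that r by (intro \<delta>1) auto
    ultimately show ?thesis
      using norm_triangle_ineq[of "B \<alpha> x" "F x"] that(3) by (simp add: R_def distrib_right)
  qed
  have R: "R \<ge> 0" using oA \<eta> M r by (simp add: R_def)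
  have near: "\<exists>\<alpha>\<in>{a..b}. \<exists>x\<in>X. norm x = r \<and> norm (T \<alpha> x - G (F x)) \<le> e" if e: "e > 0" for e
  proof (rule ccontr)
    assume "\<not> ?thesis"
    then have far: "norm (T \<alpha> x - G (F x)) > e" if "\<alpha> \<in> {a..b}" "x \<in> X" "norm x = r" for \<alpha> x
      using that by (auto simp: not_le)
    \<comment> \<open>Below e, so that a zero of the homotopy contradicts the assumption; below
      \<eta> r / 4, so that after division by r the total error at the ends is at most 3 \<eta> /
      4.\<close>
    define e' where "e' = min e (\<eta> * r / 4)"
    have e': "e' > 0" "e' \<le> e" "e' \<le> \<eta> * r / 4" using e \<eta> r by (auto simp: e'_def)
    have "e' / (R + 1) > 0" using e' R by simp
    then obtain n c where c: "\<And>x. norm (G x - (\<Sum>j\<le>n. c j *\<^sub>R P j x)) \<le> e' / (R + 1) * norm x"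
      using G_approx by blast
    define g where "g = (\<lambda>x. \<Sum>j\<le>n. c j *\<^sub>R P j x)"
    have blg: "bounded_linear g" unfolding g_def
      by (intro bounded_linear_sum bounded_linear_compose[OF bounded_linear_scaleR_right] bl_P)
    have Gg: "norm (G (B \<alpha> x + F x) - g (B \<alpha> x + F x)) \<le> e'" if "\<alpha> \<in> {a..b}" "x \<in> X" "norm x = r" for \<alpha> x
    proof -
      have "norm (G (B \<alpha> x + F x) - g (B \<alpha> x + F x)) \<le> e' / (R + 1) * norm (B \<alpha> x + F x)"
        unfolding g_def by (rule c)
      also have "\<dots> \<le> e' / (R + 1) * (R + 1)" using bdd[OF that] R e' by (intro mult_left_mono) auto
      finally show ?thesis using R by simp
    qed
    \<comment> \<open>At least n, so that \<open>W\<close> contains the range of \<open>g\<close> on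
      \<open>X\<close>, and at least \<open>N\<close>, so that it contains the space on which the
      degrees are given.\<close>
    define N' where "N' = max N n"
    define W where "W = Q N' ` X"
    have fW: "fin_dim_subspace W" unfolding W_def by (rule fin_dim_Q[OF X(1)])
    have sW: "subspace W" by (rule fin_dim_subspace_subspace[OF fW])
    have WX: "W \<subseteq> X" using nice_Q[OF X(1)] by (auto simp: W_def)
    have PW: "P j x \<in> W" if "x \<in> X" "j \<le> N'" for x j
      unfolding W_def using Q_P[OF Xs[OF that(1)] that(2)] niceD(3)[OF X(1) that(1)] by (metis image_eqI)
    have QW: "Q N ` X \<subseteq> W" unfolding Q_def using PW sW by (auto simp: N'_def intro!: subspace_sum)
    have gW: "g x \<in> W" if "x \<in> X" for x
      unfolding g_def using PW[OF that] sW by (auto simp: N'_def intro!: subspace_sum subspace_scale)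
    \<comment> \<open>The approximate equation at norm r, rescaled to the unit sphere, with the
      parameter moving from a to b.\<close>
    define h where "h = (\<lambda>s x. (1 / r) *\<^sub>R (r *\<^sub>R x - g (B ((1 - s) * a + s * b) (r *\<^sub>R x) + F (r *\<^sub>R x))))"
    have ch: "continuous_on ({0..1} \<times> (W \<inter> sphere 0 1)) (\<lambda>z. h (fst z) (snd z))"
    proof -
      have Be: "B \<alpha> x = am x - (\<alpha> + 1) *\<^sub>R x" for \<alpha> x by (simp add: B_def)
      have "continuous_on ({0..1} \<times> (W \<inter> sphere 0 1)) (\<lambda>z::real \<times> 'e. F (r *\<^sub>R snd z))"
        using WX niceD(1)[OF X(1)]
        by (intro continuous_on_compose2[OF F(2)] continuous_intros) (auto simp: subspace_scale)
      then show ?thesis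
        unfolding h_def Be
        by (intro continuous_intros bounded_linear.continuous_on[OF blg] bounded_linear.continuous_on[OF bounded_linear_am])
    qed
    have rX: "r *\<^sub>R x \<in> X" "norm (r *\<^sub>R x) = r" if "x \<in> W" "norm x = 1" for x
      using that WX r niceD(1)[OF X(1)] by (auto simp: subspace_scale)
    have hW: "h s x \<in> W" if "x \<in> W" "norm x = 1" for s x
    proof -
      have "B ((1 - s) * a + s * b) (r *\<^sub>R x) + F (r *\<^sub>R x) \<in> X"
        using rX[OF that] by (intro subspace_add sX nice_B X F)
      then show ?thesis unfolding h_def using gW that sW by (simp add: subspace_scale subspace_diff)
    qed
    have conv: "(1 - s) * a + s * b \<in> {a..b}" if s: "s \<in> {0..1}" for s
      using s ab convex_bound_le[of a b b "1 - s" s] convex_bound_le[of "- a" "- a" "- b" "1 - s" s]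
      by (auto simp: algebra_simps mult_left_mono)
    have "brouwer_ball_degree W (h 0) = brouwer_ball_degree W (h 1)"
    proof (rule ball_degree_homotopy[OF fW ch hW])
      fix s :: real and x assume s: "s \<in> {0..1}" and x: "x \<in> W" "norm x = 1"
      let ?\<alpha> = "(1 - s) * a + s * b" and ?y = "r *\<^sub>R x"
      show "h s x \<noteq> 0"
      proof
        assume "h s x = 0"
        then have "?y = g (B ?\<alpha> ?y + F ?y)" using r by (simp add: h_def)
        then have "T ?\<alpha> ?y - G (F ?y) = g (B ?\<alpha> ?y + F ?y) - G (B ?\<alpha> ?y + F ?y)"
          by (simp add: T_def linear_add[OF lin_G])
        then have "norm (T ?\<alpha> ?y - G (F ?y)) \<le> e'"
          using Gg[OF conv[OF s] rX[OF x]] by (simp add: norm_minus_commute)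
        then show False using far[OF conv[OF s] rX[OF x]] e'(2) by simp
      qed
    qed
    moreover have close: "norm (h s x - T ((1 - s) * a + s * b) x) < \<eta>"
      if s: "s \<in> {0..1}" and x: "x \<in> W" "norm x = 1" for s x
    proof -
      let ?\<alpha> = "(1 - s) * a + s * b" and ?y = "r *\<^sub>R x"
      have y: "?y \<in> X" "norm ?y = r" using rX[OF x] .
      have "T ?\<alpha> x = (1 / r) *\<^sub>R T ?\<alpha> ?y" using r by (simp add: linear_scale[OF lin_T])
      then have "h s x - T ?\<alpha> x = (1 / r) *\<^sub>R (G (B ?\<alpha> ?y + F ?y) - g (B ?\<alpha> ?y + F ?y) - G (F ?y))"
        by (simp add: h_def T_def linear_add[OF lin_G] scaleR_diff_right scaleR_add_right)
      then have "norm (h s x - T ?\<alpha> x) = (1 / r) * norm (G (B ?\<alpha> ?y + F ?y) - g (B ?\<alpha> ?y + F ?y) - G (F ?y))"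
        using r by simp
      also have "\<dots> \<le> (1 / r) * (e' + norm (G (F ?y)))"
        using norm_triangle_ineq4[of "G (B ?\<alpha> ?y + F ?y) - g (B ?\<alpha> ?y + F ?y)" "G (F ?y)"] Gg[OF conv[OF s] y] r
        by (intro mult_left_mono) auto
      also have "norm (G (F ?y)) \<le> \<eta> / (2 * M) * r * M"
        using M(2)[of "F ?y"] \<delta>1(2)[OF y(1)] y(2) r M(1) by (smt (verit) mult_right_mono)
      also have "(1 / r) * (e' + \<eta> / (2 * M) * r * M) \<le> (1 / r) * (\<eta> * r / 4 + \<eta> * r / 2)"
        using e' r M(1) by (intro mult_left_mono add_mono) auto
      also have "\<dots> < \<eta>" using r \<eta> by (simp add: field_simps)
      finally show ?thesis using r by (auto simp: divide_right_mono)
    qed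
    have c01: "continuous_on (W \<inter> sphere 0 1) (h s)" if "s \<in> {0..1}" for s
      by (rule continuous_on_compose2[OF ch, of _ "\<lambda>x. (s, x)", simplified]) (use that in \<open>auto intro!: continuous_intros\<close>)
    have "brouwer_ball_degree W (h 0) = brouwer_ball_degree (Q N ` X) (T a)"
      by (rule reduces_ball_degree[OF \<eta>1 fW QW WX c01 hW]) (use close[of 0] in \<open>auto simp: \<eta>_def\<close>)
    moreover have "brouwer_ball_degree W (h 1) = brouwer_ball_degree (Q N ` X) (T b)"
      by (rule reduces_ball_degree[OF \<eta>2 fW QW WX c01 hW]) (use close[of 1] in \<open>auto simp: \<eta>_def\<close>)
    ultimately show False using deg by simp
  qed
  have "\<exists>z. fst z \<in> {a..b} \<and> snd z \<in> X \<and> norm (snd z) = r \<and>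
      norm (T (fst z) (snd z) - G (F (snd z))) \<le> 1 / real (Suc n)" for n
    using near[of "1 / real (Suc n)"] by (metis fst_conv of_nat_0_less_iff snd_conv zero_less_Suc zero_less_divide_1_iff)
  then obtain z where z: "\<And>n. fst (z n) \<in> {a..b}" "\<And>n. snd (z n) \<in> X" "\<And>n. norm (snd (z n)) = r"
      "\<And>n. norm (T (fst (z n)) (snd (z n)) - G (F (snd (z n)))) \<le> 1 / real (Suc n)"
    by metis
  define \<alpha> x where "\<alpha> = (\<lambda>n. fst (z n))" and "x = (\<lambda>n. snd (z n))"
  have ax: "\<And>n. \<alpha> n \<in> {a..b}" "\<And>n. x n \<in> X" "\<And>n. norm (x n) = r"
      "\<And>n. norm (T (\<alpha> n) (x n) - G (F (x n))) \<le> 1 / real (Suc n)"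
    using z by (auto simp: \<alpha>_def x_def)
  have bS: "B (\<alpha> n) (x n) + F (x n) \<in> S" for n
    by (intro subspace_add subspace_S B_S Xs F(1) ax(2))
  have bR: "norm (B (\<alpha> n) (x n) + F (x n)) \<le> R" for n using ax by (intro bdd)
  obtain q l where q: "strict_mono (q :: nat \<Rightarrow> nat)" "(\<lambda>n. G (B (\<alpha> (q n)) (x (q n)) + F (x (q n)))) \<longlonglongrightarrow> l"
    using G_compact[OF S, of "\<lambda>n. B (\<alpha> n) (x n) + F (x n)" R] bS bR by metis
  obtain \<beta> s where s: "\<beta> \<in> {a..b}" "strict_mono s" "((\<alpha> \<circ> q) \<circ> s) \<longlonglongrightarrow> \<beta>"
    using seq_compactE[OF compact_imp_seq_compact[OF compact_Icc[of a b]], of "\<alpha> \<circ> q"] ax(1) by auto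
  define k where "k = (\<lambda>n. q (s n))"
  have k: "strict_mono k" using q(1) s(2) by (auto simp: k_def strict_mono_def)
  have "(\<lambda>n. 1 / real (Suc n)) \<longlonglongrightarrow> 0" by (rule LIMSEQ_Suc[OF lim_1_over_n])
  then have "(\<lambda>n. T (\<alpha> n) (x n) - G (F (x n))) \<longlonglongrightarrow> 0"
    by (rule Lim_null_comparison[rotated]) (use ax(4) in auto)
  then have Tk: "(\<lambda>n. T (\<alpha> (k n)) (x (k n)) - G (F (x (k n)))) \<longlonglongrightarrow> 0"
    using LIMSEQ_subseq_LIMSEQ[OF _ k] by (fastforce simp: o_def)
  moreover have Gk: "(\<lambda>n. G (B (\<alpha> (k n)) (x (k n)) + F (x (k n)))) \<longlonglongrightarrow> l"
    using LIMSEQ_subseq_LIMSEQ[OF q(2) s(2)] by (simp add: k_def o_def)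
  \<comment> \<open>The two summands add up to x (k n), so the approximate solutions themselves
    converge.\<close>
  ultimately have "(\<lambda>n. (T (\<alpha> (k n)) (x (k n)) - G (F (x (k n)))) + G (B (\<alpha> (k n)) (x (k n)) + F (x (k n)))) \<longlonglongrightarrow> 0 + l"
    by (rule tendsto_add)
  then have xl: "(\<lambda>n. x (k n)) \<longlonglongrightarrow> l" by (simp add: T_def linear_add[OF lin_G])
  have lX: "l \<in> X" using closed_sequentially[OF X(2) _ xl] ax(2) by blast
  have nl: "norm l = r" using tendsto_norm[OF xl] by (simp add: ax(3) LIMSEQ_const_iff)
  have ak: "(\<lambda>n. \<alpha> (k n)) \<longlonglongrightarrow> \<beta>" using s(3) by (simp add: k_def o_def)
  have "(\<lambda>n. F (x (k n))) \<longlonglongrightarrow> F l"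
    using F(2) lX ax(2) xl by (auto simp: continuous_on_sequentially o_def)
  then have GF: "(\<lambda>n. G (F (x (k n)))) \<longlonglongrightarrow> G (F l)" by (rule bounded_linear.tendsto[OF bl_G])
  have "(\<lambda>n. T (\<alpha> (k n)) (x (k n))) \<longlonglongrightarrow> T \<beta> l"
    unfolding T_affine[of "\<alpha> _"] T_affine[of \<beta>]
    by (intro tendsto_intros bounded_linear.tendsto[OF bl_T] bounded_linear.tendsto[OF bl_G] xl ak)
  from tendsto_diff[OF this GF] have "T \<beta> l - G (F l) = 0" using Tk LIMSEQ_unique by blast
  then have "T \<beta> l = G (F l)" by simp
  moreover have "l \<noteq> 0" using nl r by auto
  ultimately show thesis using that s(1) lX nl r(2) by blast
qed

end

section \<open>Burnside ring coefficients and isotropy groups\<close>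

lemma conj_eq_image:
  "g <#\<^bsub>G\<^esub> H #>\<^bsub>G\<^esub> inv\<^bsub>G\<^esub> g = (\<lambda>h. g \<otimes>\<^bsub>G\<^esub> h \<otimes>\<^bsub>G\<^esub> inv\<^bsub>G\<^esub> g) ` H"
  unfolding l_coset_def r_coset_def by auto

lemma conj_conj:
  assumes "group G" "x \<in> carrier G" "y \<in> carrier G" "M \<subseteq> carrier G"
  shows "x <#\<^bsub>G\<^esub> (y <#\<^bsub>G\<^esub> M #>\<^bsub>G\<^esub> inv\<^bsub>G\<^esub> y) #>\<^bsub>G\<^esub> inv\<^bsub>G\<^esub> x =
    (x \<otimes>\<^bsub>G\<^esub> y) <#\<^bsub>G\<^esub> M #>\<^bsub>G\<^esub> inv\<^bsub>G\<^esub> (x \<otimes>\<^bsub>G\<^esub> y)"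
proof -
  interpret group G by fact
  show ?thesis
    unfolding conj_eq_image image_image
    using assms(2-) by (intro image_cong) (auto simp: m_assoc inv_mult_group subset_iff)
qed

lemma conj_class_eq:
  assumes G: "group G" and H: "subgroup H G" and K: "K \<in> conj_class G H"
  shows "conj_class G K = conj_class G H"
proof -
  interpret group G by fact
  have Hs: "H \<subseteq> carrier G" by (rule subgroup.subset[OF H])
  obtain g where g: "g \<in> carrier G" "K = g <#\<^bsub>G\<^esub> H #>\<^bsub>G\<^esub> inv\<^bsub>G\<^esub> g"
    using K by (auto simp: conj_class_def)
  have Ks: "K \<subseteq> carrier G" by (rule conj_subset[OF G H K])
  have Hg: "H = inv\<^bsub>G\<^esub> g <#\<^bsub>G\<^esub> K #>\<^bsub>G\<^esub> inv\<^bsub>G\<^esub> (inv\<^bsub>G\<^esub> g)"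
    unfolding g(2) conj_conj[OF G inv_closed[OF g(1)] g(1) Hs] l_inv[OF g(1)]
    using Hs by (simp add: lcos_mult_one)
  show ?thesis
  proof
    show "conj_class G K \<subseteq> conj_class G H"
      unfolding conj_class_def g(2) using conj_conj[OF G _ g(1) Hs] g(1) by auto
    show "conj_class G H \<subseteq> conj_class G K"
    proof
      fix M assume "M \<in> conj_class G H"
      then obtain x where x: "x \<in> carrier G" "M = x <#\<^bsub>G\<^esub> H #>\<^bsub>G\<^esub> inv\<^bsub>G\<^esub> x"
        by (auto simp: conj_class_def)
      have "M = (x \<otimes>\<^bsub>G\<^esub> inv\<^bsub>G\<^esub> g) <#\<^bsub>G\<^esub> K #>\<^bsub>G\<^esub> inv\<^bsub>G\<^esub> (x \<otimes>\<^bsub>G\<^esub> inv\<^bsub>G\<^esub> g)"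
        unfolding x(2) by (subst Hg) (rule conj_conj[OF G x(1) inv_closed[OF g(1)] Ks])
      then show "M \<in> conj_class G K" unfolding conj_class_def using x(1) g(1) by blast
    qed
  qed
qed

lemma conj_classes_conj:
  assumes G: "group G" and C: "C \<in> conj_classes G" "K \<in> C" "K' \<in> C"
  obtains x where "x \<in> carrier G" "K' = x <#\<^bsub>G\<^esub> K #>\<^bsub>G\<^esub> inv\<^bsub>G\<^esub> x"
proof -
  obtain H where H: "subgroup H G" "C = conj_class G H" using C(1) by (auto simp: conj_classes_def)
  have "K' \<in> conj_class G K" using conj_class_eq[OF G H(1)] C H(2) by blast
  then show thesis using that by (auto simp: conj_class_def)
qed

lemma conj_classes_subset:
  assumes "group G" "C \<in> conj_classes G" "K \<in> C" shows "K \<subseteq> carrier G"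
  using assms conj_subset by (auto simp: conj_classes_def)

text \<open>The recursion at \<open>H\<close> refers only to representatives of larger classes, so
  agreement on a family that is upward closed in this sense propagates to the coefficients.\<close>

lemma burnside_coeff_eqI:
  assumes G: "group G" "finite (carrier G)"
    and up: "\<And>H C. H \<in> U \<Longrightarrow> C \<in> conj_classes G \<Longrightarrow> class_less G H C \<Longrightarrow> class_rep C \<in> U"
    and eq: "\<And>H. H \<in> U \<Longrightarrow> d H = d' H"
    and H: "H \<in> U"
  shows "burnside_coeff G d H = burnside_coeff G d' H"
  using H
proof (induction "card (carrier G) - card H" arbitrary: H rule: less_induct)
  case less
  show ?case
  proof (cases "subgroup H G")
    case False
    then show ?thesis by (simp add: burnside_coeff.simps[of G _ H])
  next
    case True
    have "burnside_coeff G d (class_rep C) = burnside_coeff G d' (class_rep C)"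
      if C: "C \<in> conj_classes G" "class_less G H C" for C
    proof (rule less(1))
      show "card (carrier G) - card (class_rep C) < card (carrier G) - card H"
        using class_less_card[OF G True C] by linarith
      show "class_rep C \<in> U" using up less(2) C by blast
    qed
    then have "(\<Sum>C\<in>{C \<in> conj_classes G. class_less G H C}.
         burnside_coeff G d (class_rep C) * int (num_above H C) * int (weyl_order G (class_rep C))) =
      (\<Sum>C\<in>{C \<in> conj_classes G. class_less G H C}.
         burnside_coeff G d' (class_rep C) * int (num_above H C) * int (weyl_order G (class_rep C)))"
      by (intro sum.cong) auto
    then show ?thesis unfolding burnside_coeff.simps[of G _ H] eq[OF less(2)] by (simp only:)
  qed
qed

text \<open>The quotient in the recursion is an integer division, so a jump of \<open>d H\<close> is only visible in the
  coefficient when \<open>|W(H)|\<close> does not exceed it.\<close>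

lemma burnside_coeff_neqI:
  assumes G: "group G" "finite (carrier G)" "subgroup H G"
    and eq: "\<And>C. C \<in> conj_classes G \<Longrightarrow> class_less G H C \<Longrightarrow>
      burnside_coeff G d (class_rep C) = burnside_coeff G d' (class_rep C)"
    and d: "\<bar>d H - d' H\<bar> \<ge> 2" and w: "weyl_order G H = 1 \<or> weyl_order G H = 2"
  shows "burnside_coeff G d H \<noteq> burnside_coeff G d' H"
proof -
  define s where "s = (\<Sum>C\<in>{C \<in> conj_classes G. class_less G H C}.
         burnside_coeff G d (class_rep C) * int (num_above H C) * int (weyl_order G (class_rep C)))"
  have s': "s = (\<Sum>C\<in>{C \<in> conj_classes G. class_less G H C}.
         burnside_coeff G d' (class_rep C) * int (num_above H C) * int (weyl_order G (class_rep C)))"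
    unfolding s_def using eq by (intro sum.cong) auto
  have "(d H - s) div int (weyl_order G H) \<noteq> (d' H - s) div int (weyl_order G H)"
    using w d by auto
  then show ?thesis
    using G unfolding burnside_coeff.simps[of G _ H] s_def[symmetric] s'[symmetric] by simp
qed

lemma finite_conj_classes: "finite (carrier G) \<Longrightarrow> finite (conj_classes G)"
proof -
  assume "finite (carrier G)"
  then have "finite {H. subgroup H G}"
    by (rule finite_subset[OF _ finite_Pow_iff[THEN iffD2], rotated]) (auto dest: subgroup.subset)
  then show ?thesis by (simp add: conj_classes_def)
qed

lemma lookup_G_degree:
  assumes "finite (carrier G)" "C \<in> conj_classes G"
  shows "Poly_Mapping.lookup (G_degree G act X T) C =
    burnside_coeff G (\<lambda>H. leray_schauder_degree (fixed_subspace act X H) T) (class_rep C)"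
  unfolding G_degree_def using assms finite_conj_classes[OF assms(1)]
  by (simp add: lookup_sum if_distrib[of "\<lambda>x. _ * x"] sum.delta cong: if_cong)

lemma G_degree_eqI:
  assumes "\<And>C. C \<in> conj_classes G \<Longrightarrow>
    burnside_coeff G (\<lambda>H. leray_schauder_degree (fixed_subspace act X H) T) (class_rep C) =
    burnside_coeff G (\<lambda>H. leray_schauder_degree (fixed_subspace act X H) T') (class_rep C)"
  shows "G_degree G act X T = G_degree G act X T'"
  unfolding G_degree_def using assms by (intro sum.cong) auto

text \<open>The condition puts the normaliser into the union of the two cosets H and H z.\<close>

lemma weyl_order_le_2:
  assumes G: "group G" "finite (carrier G)" and H: "subgroup H G" and z: "z \<in> carrier G"
    and N: "\<And>a. a \<in> carrier G \<Longrightarrow> a <#\<^bsub>G\<^esub> H #>\<^bsub>G\<^esub> inv\<^bsub>G\<^esub> a = H \<Longrightarrow> a \<in> H \<or> a \<otimes>\<^bsub>G\<^esub> inv\<^bsub>G\<^esub> z \<in> H"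
  shows "weyl_order G H = 1 \<or> weyl_order G H = 2"
proof -
  interpret group G by fact
  let ?N = "normalizer G H"
  have Hs: "H \<subseteq> carrier G" by (rule subgroup.subset[OF H])
  have NG: "?N \<subseteq> carrier G" and Nc: "\<And>a. a \<in> ?N \<Longrightarrow> a <#\<^bsub>G\<^esub> H #>\<^bsub>G\<^esub> inv\<^bsub>G\<^esub> a = H"
    using Hs by (auto simp: normalizer_def stabilizer_def)
  have car: "carrier (G\<lparr>carrier := ?N\<rparr> Mod H) = (\<lambda>a. H #>\<^bsub>G\<^esub> a) ` ?N"
    by (auto simp: FactGroup_def RCOSETS_def r_coset_def)
  have sub: "(\<lambda>a. H #>\<^bsub>G\<^esub> a) ` ?N \<subseteq> {H, H #>\<^bsub>G\<^esub> z}"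
  proof
    fix c assume "c \<in> (\<lambda>a. H #>\<^bsub>G\<^esub> a) ` ?N"
    then obtain a where a: "a \<in> ?N" "c = H #>\<^bsub>G\<^esub> a" by blast
    have aG: "a \<in> carrier G" using a NG by blast
    from N[OF aG Nc[OF a(1)]] show "c \<in> {H, H #>\<^bsub>G\<^esub> z}"
    proof
      assume "a \<in> H"
      then show ?thesis using a H coset_join2[OF aG H] by simp
    next
      assume h: "a \<otimes>\<^bsub>G\<^esub> inv\<^bsub>G\<^esub> z \<in> H"
      have "a = (a \<otimes>\<^bsub>G\<^esub> inv\<^bsub>G\<^esub> z) \<otimes>\<^bsub>G\<^esub> z" using aG z by (simp add: m_assoc)
      then have "a \<in> H #>\<^bsub>G\<^esub> z" using h by (auto simp: r_coset_def)
      then have "H #>\<^bsub>G\<^esub> z = H #>\<^bsub>G\<^esub> a" by (rule repr_independence[OF _ z H])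
      then show ?thesis using a by simp
    qed
  qed
  have "\<one>\<^bsub>G\<^esub> \<in> ?N"
    unfolding normalizer_def stabilizer_def using Hs by (auto simp: lcos_mult_one)
  then have "card ((\<lambda>a. H #>\<^bsub>G\<^esub> a) ` ?N) \<noteq> 0"
    using finite_subset[OF sub] by auto
  moreover have "card ((\<lambda>a. H #>\<^bsub>G\<^esub> a) ` ?N) \<le> card {H, H #>\<^bsub>G\<^esub> z}" by (rule card_mono[OF _ sub]) simp
  moreover have "card {H, H #>\<^bsub>G\<^esub> z} \<le> 2" by (simp add: card_insert_if)
  ultimately show ?thesis unfolding weyl_order_def Coset.order_def car by linarith
qed

section \<open>The action on functions and the isotropy groups of cosines\<close>

definition periodic :: "real \<Rightarrow> (real \<Rightarrow> 'v) \<Rightarrow> bool"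
  where "periodic p h \<longleftrightarrow> (\<forall>t. h (t + p) = h t)"

text \<open>The formula of \<open>sym_act\<close> on bare functions with values in any vector space,
  so that the scalar profile cos (\<omega> t) and vector-valued functions are treated alike.\<close>

definition fun_act :: "(int \<times> bool) \<times> int \<Rightarrow> (real \<Rightarrow> 'v::real_vector) \<Rightarrow> real \<Rightarrow> 'v"
  where "fun_act g h t = of_int (snd g) *\<^sub>R h ((if snd (fst g) then - 1 else 1) * (t + 2 * pi * of_int (fst (fst g))))"

lemma sym_group_simps:
  "carrier (sym_group m) = ({0..<int m} \<times> UNIV) \<times> {1, - 1}"
  "((i, a), s) \<otimes>\<^bsub>sym_group m\<^esub> ((j, b), s') = (((if a then i - j else i + j) mod int m, a \<noteq> b), s * s')"
  "\<one>\<^bsub>sym_group m\<^esub> = ((0, False), 1)"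
  by (simp_all add: sym_group_def dihedral_group_def sign_group_def DirProd_def)

lemma periodic_int_shift:
  fixes h :: "real \<Rightarrow> 'v"
  assumes "periodic p h" shows "h (t + of_int n * p) = h t"
proof (induction n rule: int_induct[where k = 0])
  case (step1 i)
  then show ?case using assms[unfolded periodic_def, rule_format, of "t + of_int i * p"] by (simp add: algebra_simps)
next
  case (step2 i)
  then show ?case using assms[unfolded periodic_def, rule_format, of "t + of_int (i - 1) * p"] by (simp add: algebra_simps)
qed simp

text \<open>Exponents of rotations are reduced mod m in the group, so the two sides differ by a
  shift through a multiple of 2 pi m, which periodicity absorbs.\<close>

lemma fun_act_mult:
  fixes h :: "real \<Rightarrow> 'v::real_vector"
  assumes h: "periodic (2 * pi * real m) h"
  shows "fun_act (x \<otimes>\<^bsub>sym_group m\<^esub> y) h = fun_act x (fun_act y h)"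
proof
  fix t
  obtain i a s where x: "x = ((i, a), s)" by (metis surj_pair)
  obtain j b s' where y: "y = ((j, b), s')" by (metis surj_pair)
  define k where "k = (if a then i - j else i + j)"
  have k: "k mod int m = k - int m * (k div int m)" by (simp add: minus_mult_div_eq_mod)
  define \<epsilon> :: "bool \<Rightarrow> int" where "\<epsilon> = (\<lambda>a. if a then - 1 else 1)"
  have \<epsilon>: "(if a then - 1 else 1) = real_of_int (\<epsilon> a)" for a by (simp add: \<epsilon>_def)
  have \<epsilon>2: "\<epsilon> (a \<noteq> b) = \<epsilon> a * \<epsilon> b" "\<epsilon> a * \<epsilon> a = 1" for a b by (auto simp: \<epsilon>_def)
  have kj: "k = i + \<epsilon> a * j" by (simp add: k_def \<epsilon>_def)
  \<comment> \<open>The last summand is that multiple of the period; the rest is the composed shift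
    and reflection.\<close>
  have E: "real_of_int (\<epsilon> (a \<noteq> b)) * (t + 2 * pi * of_int (k mod int m)) =
      real_of_int (\<epsilon> b) * (real_of_int (\<epsilon> a) * (t + 2 * pi * of_int i) + 2 * pi * of_int j) +
      of_int (- (\<epsilon> a * \<epsilon> b * (k div int m))) * (2 * pi * real m)"
  proof -
    have e: "real_of_int (\<epsilon> a) * real_of_int (\<epsilon> a) = 1" using \<epsilon>2(2)[of a] by (metis of_int_1 of_int_mult)
    have "real_of_int (\<epsilon> (a \<noteq> b)) * (t + 2 * pi * of_int (k mod int m)) =
      real_of_int (\<epsilon> b) * (real_of_int (\<epsilon> a) * (t + 2 * pi * of_int i) + (real_of_int (\<epsilon> a) * real_of_int (\<epsilon> a)) * (2 * pi * of_int j)) +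
      of_int (- (\<epsilon> a * \<epsilon> b * (k div int m))) * (2 * pi * real m)"
      unfolding k \<epsilon>2(1) by (simp add: kj algebra_simps)
    then show ?thesis unfolding e by simp
  qed
  show "fun_act (x \<otimes>\<^bsub>sym_group m\<^esub> y) h t = fun_act x (fun_act y h) t"
    unfolding x y sym_group_simps fun_act_def fst_conv snd_conv \<epsilon> k_def[symmetric]
    unfolding E periodic_int_shift[OF h] by simp
qed

lemma fun_act_one: "fun_act \<one>\<^bsub>sym_group m\<^esub> h = h"
  by (simp add: fun_act_def sym_group_simps fun_eq_iff)

lemma fun_act_scaleR: "fun_act g (\<lambda>t. w t *\<^sub>R v) = (\<lambda>t. fun_act g w t *\<^sub>R v)"
  by (simp add: fun_act_def fun_eq_iff)

lemma fun_act_periodic: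
  fixes h :: "real \<Rightarrow> 'v::real_vector"
  assumes "periodic p h" shows "periodic p (fun_act g h)"
  unfolding periodic_def
proof
  fix t
  have "h (- (t + p + c)) = h (- (t + c))" for c
    using assms[unfolded periodic_def, rule_format, of "- (t + p + c)"] by (simp add: algebra_simps)
  moreover have "h (t + p + c) = h (t + c)" for c
    using assms[unfolded periodic_def, rule_format, of "t + c"] by (simp add: algebra_simps)
  ultimately show "fun_act g h (t + p) = fun_act g h t" by (simp add: fun_act_def)
qed

text \<open>A rotation is the phase shift \<theta> and a reflection changes the sign of the sine;
  the addition theorems absorb both.\<close>

lemma fun_act_mode: "\<exists>a' b'. fun_act g (mode \<omega> a b) = mode \<omega> a' b'"
proof -
  define e :: real where "e = (if snd (fst g) then - 1 else 1)"
  define s :: real where "s = of_int (snd g)"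
  define \<theta> where "\<theta> = \<omega> * (2 * pi * of_int (fst (fst g)))"
  have ce: "cos (e * x) = cos x" "sin (e * x) = e * sin x" for x by (auto simp: e_def)
  have eqt: "\<omega> * (e * (t + 2 * pi * of_int (fst (fst g)))) = e * (\<omega> * t + \<theta>)" for t
    by (simp add: \<theta>_def algebra_simps)
  have "fun_act g (mode \<omega> a b) t = s *\<^sub>R (cos (\<omega> * t + \<theta>) *\<^sub>R a + (e * sin (\<omega> * t + \<theta>)) *\<^sub>R b)" for t
    unfolding fun_act_def mode_def e_def[symmetric] s_def[symmetric] eqt ce ..
  then have "fun_act g (mode \<omega> a b) = mode \<omega> (s *\<^sub>R (cos \<theta> *\<^sub>R a + (e * sin \<theta>) *\<^sub>R b)) (s *\<^sub>R ((e * cos \<theta>) *\<^sub>R b - sin \<theta> *\<^sub>R a))"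
    by (simp add: fun_eq_iff mode_def cos_add sin_add algebra_simps)
  then show ?thesis by blast
qed

text \<open>The cosine is even, so of \<open>g\<close> only the phase shift and the sign remain
  visible.\<close>

lemma fun_act_cos:
  assumes "g \<in> carrier (sym_group m)"
  shows "fun_act g (\<lambda>t. cos (\<omega> * t)) t = of_int (snd g) * cos (\<omega> * (t + 2 * pi * of_int (fst (fst g))))"
    "\<bar>of_int (snd g) :: real\<bar> = 1"
proof -
  have "cos (\<omega> * (- 1 * x)) = cos (\<omega> * x)" "cos (\<omega> * (1 * x)) = cos (\<omega> * x)" for x by simp_all
  then show "fun_act g (\<lambda>t. cos (\<omega> * t)) t = of_int (snd g) * cos (\<omega> * (t + 2 * pi * of_int (fst (fst g))))"
    unfolding fun_act_def by (cases "snd (fst g)") (simp_all only: if_True if_False real_scaleR_def)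
  show "\<bar>of_int (snd g) :: real\<bar> = 1" using assms by (auto simp: sym_group_simps)
qed

definition cos_isotropy :: "nat \<Rightarrow> real \<Rightarrow> ((int \<times> bool) \<times> int) set"
  where "cos_isotropy m \<omega> = {g \<in> carrier (sym_group m). fun_act g (\<lambda>t. cos (\<omega> * t)) = (\<lambda>t. cos (\<omega> * t))}"

lemma subgroup_isotropy:
  fixes w :: "real \<Rightarrow> 'v::real_vector"
  assumes m: "m > 0" and w: "periodic (2 * pi * real m) w"
  shows "subgroup {g \<in> carrier (sym_group m). fun_act g w = w} (sym_group m)"
proof -
  interpret group "sym_group m" by (rule group_sym_group[OF m])
  show ?thesis
  proof (rule subgroupI)
    show "{g \<in> carrier (sym_group m). fun_act g w = w} \<noteq> {}" using one_closed fun_act_one[of m w] by blast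
  next
    fix g assume "g \<in> {g \<in> carrier (sym_group m). fun_act g w = w}"
    then have g: "g \<in> carrier (sym_group m)" "fun_act g w = w" by auto
    have "fun_act (inv\<^bsub>sym_group m\<^esub> g) w = fun_act (inv\<^bsub>sym_group m\<^esub> g) (fun_act g w)" by (simp add: g)
    also have "\<dots> = fun_act (inv\<^bsub>sym_group m\<^esub> g \<otimes>\<^bsub>sym_group m\<^esub> g) w" by (rule fun_act_mult[OF w, symmetric])
    also have "\<dots> = w" using g(1) by (simp add: fun_act_one)
    finally show "inv\<^bsub>sym_group m\<^esub> g \<in> {g \<in> carrier (sym_group m). fun_act g w = w}" using g(1) by simp
  next
    fix g h assume "g \<in> {g \<in> carrier (sym_group m). fun_act g w = w}" "h \<in> {g \<in> carrier (sym_group m). fun_act g w = w}"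
    then show "g \<otimes>\<^bsub>sym_group m\<^esub> h \<in> {g \<in> carrier (sym_group m). fun_act g w = w}"
      by (simp add: fun_act_mult[OF w])
  qed auto
qed

lemma fun_act_inv_cancel:
  fixes w :: "real \<Rightarrow> 'v::real_vector"
  assumes m: "m > 0" and w: "periodic (2 * pi * real m) w" and g: "g \<in> carrier (sym_group m)"
  shows "fun_act (inv\<^bsub>sym_group m\<^esub> g) (fun_act g w) = w" "fun_act g (fun_act (inv\<^bsub>sym_group m\<^esub> g) w) = w"
proof -
  interpret group "sym_group m" by (rule group_sym_group[OF m])
  show "fun_act (inv\<^bsub>sym_group m\<^esub> g) (fun_act g w) = w" "fun_act g (fun_act (inv\<^bsub>sym_group m\<^esub> g) w) = w"
    using g by (simp_all add: fun_act_one flip: fun_act_mult[OF w])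
qed

lemma isotropy_conj:
  fixes w :: "real \<Rightarrow> 'v::real_vector"
  assumes m: "m > 0" and w: "periodic (2 * pi * real m) w" and g: "g \<in> carrier (sym_group m)"
  shows "g <#\<^bsub>sym_group m\<^esub> {x \<in> carrier (sym_group m). fun_act x w = w} #>\<^bsub>sym_group m\<^esub> inv\<^bsub>sym_group m\<^esub> g =
    {x \<in> carrier (sym_group m). fun_act x (fun_act g w) = fun_act g w}"
proof -
  let ?G = "sym_group m"
  interpret group ?G by (rule group_sym_group[OF m])
  have gw: "periodic (2 * pi * real m) (fun_act g w)" by (rule fun_act_periodic[OF w])
  show ?thesis
    unfolding conj_eq_image
  proof (intro equalityI subsetI)
    fix x assume "x \<in> (\<lambda>h. g \<otimes>\<^bsub>?G\<^esub> h \<otimes>\<^bsub>?G\<^esub> inv\<^bsub>?G\<^esub> g) ` {x \<in> carrier ?G. fun_act x w = w}"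
    then obtain h where h: "h \<in> carrier ?G" "fun_act h w = w" "x = g \<otimes>\<^bsub>?G\<^esub> h \<otimes>\<^bsub>?G\<^esub> inv\<^bsub>?G\<^esub> g" by blast
    have "fun_act x (fun_act g w) = fun_act (g \<otimes>\<^bsub>?G\<^esub> h) (fun_act (inv\<^bsub>?G\<^esub> g) (fun_act g w))"
      unfolding h(3) by (rule fun_act_mult[OF gw])
    also have "\<dots> = fun_act g w" unfolding fun_act_inv_cancel(1)[OF m w g] fun_act_mult[OF w] h(2) ..
    finally show "x \<in> {x \<in> carrier ?G. fun_act x (fun_act g w) = fun_act g w}" using h g by simp
  next
    fix x assume "x \<in> {x \<in> carrier ?G. fun_act x (fun_act g w) = fun_act g w}"
    then have x: "x \<in> carrier ?G" "fun_act x (fun_act g w) = fun_act g w" by auto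
    have "fun_act (inv\<^bsub>?G\<^esub> g \<otimes>\<^bsub>?G\<^esub> x \<otimes>\<^bsub>?G\<^esub> g) w = fun_act (inv\<^bsub>?G\<^esub> g) (fun_act x (fun_act g w))"
      unfolding fun_act_mult[OF w] by (rule fun_act_mult[OF gw])
    then have "fun_act (inv\<^bsub>?G\<^esub> g \<otimes>\<^bsub>?G\<^esub> x \<otimes>\<^bsub>?G\<^esub> g) w = w"
      unfolding x(2) fun_act_inv_cancel(1)[OF m w g] .
    moreover have "x = g \<otimes>\<^bsub>?G\<^esub> (inv\<^bsub>?G\<^esub> g \<otimes>\<^bsub>?G\<^esub> x \<otimes>\<^bsub>?G\<^esub> g) \<otimes>\<^bsub>?G\<^esub> inv\<^bsub>?G\<^esub> g"
    proof -
      have "g \<otimes>\<^bsub>?G\<^esub> (inv\<^bsub>?G\<^esub> g \<otimes>\<^bsub>?G\<^esub> x \<otimes>\<^bsub>?G\<^esub> g) \<otimes>\<^bsub>?G\<^esub> inv\<^bsub>?G\<^esub> g =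
          (g \<otimes>\<^bsub>?G\<^esub> inv\<^bsub>?G\<^esub> g) \<otimes>\<^bsub>?G\<^esub> x \<otimes>\<^bsub>?G\<^esub> (g \<otimes>\<^bsub>?G\<^esub> inv\<^bsub>?G\<^esub> g)"
        using g x(1) by (simp only: m_assoc m_closed inv_closed)
      then show ?thesis using g x(1) by simp
    qed
    moreover have "inv\<^bsub>?G\<^esub> g \<otimes>\<^bsub>?G\<^esub> x \<otimes>\<^bsub>?G\<^esub> g \<in> carrier ?G" using g x(1) by simp
    ultimately show "x \<in> (\<lambda>h. g \<otimes>\<^bsub>?G\<^esub> h \<otimes>\<^bsub>?G\<^esub> inv\<^bsub>?G\<^esub> g) ` {x \<in> carrier ?G. fun_act x w = w}" by blast
  qed
qed

lemma freq_periodic: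
  assumes "m > 0"
  shows "periodic (2 * pi * real m) (\<lambda>t. cos (freq (2 * pi * real m) j * t))"
  unfolding periodic_def using assms by (intro allI cos_freq_shift) simp

text \<open>Transport back by the inverse of \<open>g\<close>: the resulting mode is fixed by the
  reflection \<kappa>, which fixes the cosine, so it is even and has no sine part.\<close>

lemma fixed_mode_multiple:
  fixes a b :: "'v::real_vector"
  assumes m: "m > 0" and \<omega>: "\<omega> = freq (2 * pi * real m) j" and g: "g \<in> carrier (sym_group m)"
    and fixd: "\<And>x. x \<in> carrier (sym_group m) \<Longrightarrow> fun_act x (fun_act g (\<lambda>t. cos (\<omega> * t))) = fun_act g (\<lambda>t. cos (\<omega> * t)) \<Longrightarrow>
      fun_act x (mode \<omega> a b) = mode \<omega> a b"
  obtains v where "mode \<omega> a b = (\<lambda>t. fun_act g (\<lambda>t. cos (\<omega> * t)) t *\<^sub>R v)"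
proof -
  let ?G = "sym_group m" and ?c = "\<lambda>t. cos (\<omega> * t)"
  interpret group ?G by (rule group_sym_group[OF m])
  have per: "periodic (2 * pi * real m) (mode \<omega> a b)" for a b :: 'v
    unfolding \<omega> periodic_def using m by (intro allI mode_periodic) simp
  have cper: "periodic (2 * pi * real m) ?c" unfolding \<omega> by (rule freq_periodic[OF m])
  define \<kappa> where "\<kappa> = ((0::int, True), 1::int)"
  have \<kappa>: "\<kappa> \<in> carrier ?G" using m by (auto simp: \<kappa>_def sym_group_simps)
  have \<kappa>h: "fun_act \<kappa> h = (\<lambda>t. h (- t))" for h :: "real \<Rightarrow> 'w::real_vector" by (simp add: fun_act_def \<kappa>_def fun_eq_iff)
  have "\<kappa> \<in> {x \<in> carrier ?G. fun_act x ?c = ?c}" using \<kappa> by (simp add: \<kappa>h)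
  then have "g \<otimes>\<^bsub>?G\<^esub> \<kappa> \<otimes>\<^bsub>?G\<^esub> inv\<^bsub>?G\<^esub> g \<in> {x \<in> carrier ?G. fun_act x (fun_act g ?c) = fun_act g ?c}"
    unfolding isotropy_conj[OF m cper g, symmetric] conj_eq_image by blast
  then have fx: "fun_act (g \<otimes>\<^bsub>?G\<^esub> \<kappa> \<otimes>\<^bsub>?G\<^esub> inv\<^bsub>?G\<^esub> g) (mode \<omega> a b) = mode \<omega> a b" using fixd by blast
  obtain a' b' where h0: "fun_act (inv\<^bsub>?G\<^esub> g) (mode \<omega> a b) = mode \<omega> a' b'" using fun_act_mode by blast
  have "fun_act (inv\<^bsub>?G\<^esub> g) (fun_act (g \<otimes>\<^bsub>?G\<^esub> \<kappa> \<otimes>\<^bsub>?G\<^esub> inv\<^bsub>?G\<^esub> g) (mode \<omega> a b)) = fun_act \<kappa> (mode \<omega> a' b')"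
  proof -
    have "fun_act (g \<otimes>\<^bsub>?G\<^esub> \<kappa> \<otimes>\<^bsub>?G\<^esub> inv\<^bsub>?G\<^esub> g) (mode \<omega> a b) = fun_act (g \<otimes>\<^bsub>?G\<^esub> \<kappa>) (mode \<omega> a' b')"
      unfolding h0[symmetric] by (rule fun_act_mult[OF per])
    also have "\<dots> = fun_act g (fun_act \<kappa> (mode \<omega> a' b'))" by (rule fun_act_mult[OF per])
    finally show ?thesis
      using fun_act_inv_cancel(1)[OF m fun_act_periodic[OF per] g] by simp
  qed
  then have "fun_act \<kappa> (mode \<omega> a' b') = mode \<omega> a' b'" unfolding fx h0 by (rule sym)
  then have "sin (\<omega> * t) *\<^sub>R b' = 0" for t
  proof -
    have "mode \<omega> a' b' (- t) = mode \<omega> a' b' t" using \<open>fun_act \<kappa> (mode \<omega> a' b') = mode \<omega> a' b'\<close> unfolding \<kappa>h by (rule fun_cong)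
    then have "- (sin (\<omega> * t) *\<^sub>R b') = sin (\<omega> * t) *\<^sub>R b'" by (simp add: mode_def)
    then have "sin (\<omega> * t) *\<^sub>R b' + sin (\<omega> * t) *\<^sub>R b' = 0" by (metis right_minus)
    then show ?thesis unfolding scaleR_2[symmetric] by simp
  qed
  then have "mode \<omega> a' b' = (\<lambda>t. ?c t *\<^sub>R a')" by (simp add: mode_def fun_eq_iff)
  then have "fun_act g (mode \<omega> a' b') = (\<lambda>t. fun_act g ?c t *\<^sub>R a')" by (simp add: fun_act_scaleR)
  moreover have "fun_act g (mode \<omega> a' b') = mode \<omega> a b"
    unfolding h0[symmetric] by (rule fun_act_inv_cancel(2)[OF m per g])
  ultimately show thesis using that by simp
qed

text \<open>For \<open>a\<close> in the normaliser, a w is again a mode fixed by \<open>H\<close>,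
  hence v w with a scalar v. Both functions are signed shifted cosines with maximal absolute value
  1, so v is 1 or -1; in the second case the product of \<open>a\<close> with the element acting as
  -1 fixes w. The general \<open>g\<close> accounts for the unknown representative of the
  class.\<close>

lemma weyl_order_cos_isotropy:
  assumes m: "m > 0" and \<omega>: "\<omega> = freq (2 * pi * real m) j" and g: "g \<in> carrier (sym_group m)"
    and H: "H = {x \<in> carrier (sym_group m). fun_act x (fun_act g (\<lambda>t. cos (\<omega> * t))) = fun_act g (\<lambda>t. cos (\<omega> * t))}"
  shows "weyl_order (sym_group m) H = 1 \<or> weyl_order (sym_group m) H = 2"
proof -
  let ?G = "sym_group m" and ?c = "\<lambda>t. cos (\<omega> * t)"
  interpret group ?G by (rule group_sym_group[OF m])
  define w where "w = fun_act g ?c"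
  have cper: "periodic (2 * pi * real m) ?c" unfolding \<omega> by (rule freq_periodic[OF m])
  have wper: "periodic (2 * pi * real m) w"
    unfolding w_def by (rule fun_act_periodic[OF cper])
  have Hw: "H = {x \<in> carrier ?G. fun_act x w = w}" by (simp add: H w_def)
  have subH: "subgroup H ?G" unfolding Hw by (rule subgroup_isotropy[OF m wper])
  define z where "z = ((0::int, False), - 1::int)"
  have z: "z \<in> carrier ?G" using m by (auto simp: z_def sym_group_simps)
  have zz: "z \<otimes>\<^bsub>?G\<^esub> z = \<one>\<^bsub>?G\<^esub>" by (simp add: z_def sym_group_simps)
  have iz: "inv\<^bsub>?G\<^esub> z = z" by (rule inv_equality[OF zz z z])
  show ?thesis
  proof (rule weyl_order_le_2[OF group_sym_group[OF m] finite_sym_group subH z])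
    fix a assume a: "a \<in> carrier ?G" and aH: "a <#\<^bsub>?G\<^esub> H #>\<^bsub>?G\<^esub> inv\<^bsub>?G\<^esub> a = H"
    obtain c e :: real where m1: "fun_act a w = mode \<omega> c e"
    proof -
      have "?c = mode \<omega> 1 0" by (simp add: mode_def fun_eq_iff)
      then show thesis using that fun_act_mode unfolding w_def by metis
    qed
    have Ha: "{x \<in> carrier ?G. fun_act x (fun_act a w) = fun_act a w} = H"
      using isotropy_conj[OF m wper a] aH Hw by simp
    have "fun_act x (mode \<omega> c e) = mode \<omega> c e" if "x \<in> carrier ?G" "fun_act x (fun_act g ?c) = fun_act g ?c" for x
      using Ha that unfolding Hw w_def[symmetric] m1 by blast
    then obtain v where v: "mode \<omega> c e = (\<lambda>t. fun_act g ?c t *\<^sub>R v)"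
      using fixed_mode_multiple[OF m \<omega> g] by blast
    have aw: "fun_act a w t = v * w t" for t unfolding m1 unfolding v w_def by (simp only: real_scaleR_def mult.commute)
    have ag: "fun_act a w = fun_act (a \<otimes>\<^bsub>?G\<^esub> g) ?c" unfolding w_def by (rule fun_act_mult[OF cper, symmetric])
    have agG: "a \<otimes>\<^bsub>?G\<^esub> g \<in> carrier ?G" using a g by simp
    have bound: "\<bar>fun_act x ?c t\<bar> \<le> 1" if "x \<in> carrier ?G" for x t
      unfolding fun_act_cos(1)[OF that] by (simp add: abs_mult fun_act_cos(2)[OF that] abs_cos_le_one)
    have peak: "\<exists>t. \<bar>fun_act x ?c t\<bar> = 1" if "x \<in> carrier ?G" for x
      unfolding fun_act_cos(1)[OF that]
      by (intro exI[of _ "- (2 * pi * of_int (fst (fst x)))"]) (simp add: abs_mult fun_act_cos(2)[OF that])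
    obtain t1 where "\<bar>w t1\<bar> = 1" unfolding w_def using peak[OF g] by blast
    moreover have "\<bar>fun_act a w t1\<bar> \<le> 1" unfolding ag by (rule bound[OF agG])
    ultimately have "\<bar>v\<bar> \<le> 1" unfolding aw by (simp add: abs_mult)
    moreover obtain t2 where "\<bar>fun_act a w t2\<bar> = 1" unfolding ag using peak[OF agG] by blast
    moreover have "\<bar>w t2\<bar> \<le> 1" unfolding w_def by (rule bound[OF g])
    ultimately have "\<bar>v\<bar> = 1"
      unfolding aw abs_mult using mult_left_le[of "\<bar>w t2\<bar>" "\<bar>v\<bar>"] by simp
    then consider "v = 1" | "v = - 1" by linarith
    then show "a \<in> H \<or> a \<otimes>\<^bsub>?G\<^esub> inv\<^bsub>?G\<^esub> z \<in> H"
    proof cases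
      case 1
      then have "fun_act a w = w" using aw by (simp add: fun_eq_iff)
      then show ?thesis using a by (simp add: Hw)
    next
      case 2
      have zw: "fun_act z w = (\<lambda>t. - w t)" by (simp add: fun_act_def z_def fun_eq_iff)
      have "fun_act (a \<otimes>\<^bsub>?G\<^esub> z) w = fun_act a (fun_act z w)" by (rule fun_act_mult[OF wper])
      also have "\<dots> = (\<lambda>t. - fun_act a w t)" unfolding zw by (simp add: fun_act_def fun_eq_iff)
      also have "\<dots> = w" using aw 2 by (simp add: fun_eq_iff)
      finally show ?thesis using a z by (simp add: Hw iz)
    qed
  qed
qed

section \<open>The two function spaces\<close>

definition c2b_conv :: "real \<Rightarrow> (real \<Rightarrow> real) \<Rightarrow> (real ^ 'k) c2b \<Rightarrow> (real ^ 'k) c2b"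
  where "c2b_conv p k u = Abs_c2b (conv p k (apply_c2b u))"

definition c2b_comp :: "('v \<Rightarrow> 'v) \<Rightarrow> 'v::real_normed_vector c2b \<Rightarrow> 'v c2b"
  where "c2b_comp A u = Abs_c2b (\<lambda>t. A (apply_c2b u t))"

definition bc_conv :: "real \<Rightarrow> (real \<Rightarrow> real) \<Rightarrow> (real \<Rightarrow>\<^sub>C (real ^ 'k)) \<Rightarrow> real \<Rightarrow>\<^sub>C (real ^ 'k)"
  where "bc_conv p k v = Bcontfun (conv p k v)"

lemma kernel_bound:
  fixes k :: "real \<Rightarrow> real"
  assumes "continuous_on {0..p} k" obtains C where "\<And>r. r \<in> {0..p} \<Longrightarrow> \<bar>k r\<bar> \<le> C"
proof -
  obtain C where "\<forall>y\<in>k ` {0..p}. norm y \<le> C"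
    using compact_imp_bounded[OF compact_continuous_image[OF assms compact_Icc]] unfolding bounded_iff by blast
  then show thesis using that[of C] by simp
qed

lemma bc_conv_apply:
  fixes v :: "real \<Rightarrow>\<^sub>C (real ^ 'k)"
  assumes p: "p > 0" and k: "continuous_on {0..p} k"
  shows "apply_bcontfun (bc_conv p k v) = conv p k v"
proof -
  obtain C where C: "\<And>r. r \<in> {0..p} \<Longrightarrow> \<bar>k r\<bar> \<le> C" using kernel_bound[OF k] by blast
  have "norm (conv p k v t) \<le> p * C * norm v" for t
    using p k C by (intro norm_conv_le norm_bounded continuous_on_apply_bcontfun) auto
  then have "bounded (range (conv p k v))" unfolding bounded_iff by blast
  moreover have "continuous_on UNIV (conv p k v)"
    by (rule continuous_on_conv[OF k continuous_on_apply_bcontfun])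
  ultimately show ?thesis unfolding bc_conv_def by (simp add: Bcontfun_inverse bcontfun_def)
qed

lemma norm_bc_conv:
  fixes v :: "real \<Rightarrow>\<^sub>C (real ^ 'k)"
  assumes p: "p > 0" and k: "continuous_on {0..p} k" and C: "\<And>r. r \<in> {0..p} \<Longrightarrow> \<bar>k r\<bar> \<le> C"
  shows "norm (bc_conv p k v) \<le> p * C * norm v"
proof (rule norm_bound)
  show "norm (bc_conv p k v t) \<le> p * C * norm v" for t
    unfolding bc_conv_apply[OF p k]
    using p k C by (intro norm_conv_le norm_bounded continuous_on_apply_bcontfun) auto
qed

lemma bc_conv_derivative:
  fixes v v' :: "real \<Rightarrow>\<^sub>C (real ^ 'k)"
  assumes p: "p > 0" and k: "continuous_on {0..p} k"
    and d: "\<And>t. (apply_bcontfun v has_vector_derivative v' t) (at t)"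
  shows "(apply_bcontfun (bc_conv p k v) has_vector_derivative bc_conv p k v' t) (at t)"
  unfolding bc_conv_apply[OF p k]
  by (rule conv_has_vector_derivative[OF k d continuous_on_apply_bcontfun])

lemma c2b_eqI: "(\<And>t. apply_c2b u t = apply_c2b v t) \<Longrightarrow> u = v"
  by (metis apply_c2b_inject ext)

lemma bounded_c2b: "bounded (range (apply_c2b u))"
  using bounded_apply_bcontfun[of "c2_d0 u"] by simp

text \<open>Convolution passes through derivatives, so function and derivatives are convolved with
  the same kernel and the sup-norm bound carries over to the C^2 norm.\<close>

lemma c2b_conv_props:
  assumes p: "p > 0" and k: "continuous_on {0..p} k"
  shows "apply_c2b (c2b_conv p k u) = conv p k (apply_c2b u)" (is ?ap)
    and "c2_d0 (c2b_conv p k u) = bc_conv p k (c2_d0 u)" (is ?d0)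
    and "c2_d1 (c2b_conv p k u) = bc_conv p k (c2_d1 u)" (is ?d1)
    and "c2_d2 (c2b_conv p k u) = bc_conv p k (c2_d2 u)" (is ?d2)
proof -
  have e: "apply_bcontfun (bc_conv p k (c2_d0 u)) = conv p k (apply_c2b u)"
    by (simp add: bc_conv_apply[OF p k])
  have d: "(conv p k (apply_c2b u) has_vector_derivative bc_conv p k (c2_d1 u) t) (at t)"
    "(apply_bcontfun (bc_conv p k (c2_d1 u)) has_vector_derivative bc_conv p k (c2_d2 u) t) (at t)" for t
    unfolding e[symmetric] by (rule bc_conv_derivative[OF p k], simp only: c2_d0_apply, rule c2_derivs)
      (rule bc_conv_derivative[OF p k c2_derivs(2)])
  have "conv p k (apply_c2b u) \<in> c2b"
  proof (rule c2bI[OF _ d])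
    show "bounded (range (conv p k (apply_c2b u)))" unfolding e[symmetric] by (rule bounded_apply_bcontfun)
  qed
  then show ap: ?ap unfolding c2b_conv_def by (rule Abs_c2b_inverse)
  show ?d0 by (rule bcontfun_eqI) (simp add: ap e)
  show d1: ?d1 by (rule c2_d1_eqI) (simp only: ap d)
  show ?d2 by (rule c2_d2_eqI) (simp only: d1 d)
qed

lemma bc_comp_apply:
  fixes A :: "real ^ 'k \<Rightarrow> real ^ 'k"
  assumes A: "linear A" shows "apply_bcontfun (bc_comp A v) = (\<lambda>t. A (v t))"
proof -
  have bl: "bounded_linear A" using A linear_conv_bounded_linear by blast
  have "continuous_on UNIV (\<lambda>t. A (v t))"
    by (rule bounded_linear.continuous_on[OF bl continuous_on_apply_bcontfun])
  moreover have "bounded (range (\<lambda>t. A (v t)))"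
    using bounded_linear_image[OF bounded_apply_bcontfun bl, of v] by (simp add: image_image)
  ultimately show ?thesis unfolding bc_comp_def by (simp add: Bcontfun_inverse bcontfun_def)
qed

lemma norm_bc_comp:
  fixes A :: "real ^ 'k \<Rightarrow> real ^ 'k"
  assumes A: "linear A" shows "norm (bc_comp A v) \<le> onorm A * norm v"
proof (rule norm_bound)
  fix t
  have bl: "bounded_linear A" using A linear_conv_bounded_linear by blast
  have "norm (A (v t)) \<le> onorm A * norm (v t)" by (rule onorm[OF bl])
  also have "\<dots> \<le> onorm A * norm v" by (intro mult_left_mono norm_bounded onorm_pos_le[OF bl])
  finally show "norm (bc_comp A v t) \<le> onorm A * norm v" by (simp add: bc_comp_apply[OF A])
qed

lemma c2b_comp_props:
  fixes A :: "real ^ 'k \<Rightarrow> real ^ 'k"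
  assumes A: "linear A"
  shows "apply_c2b (c2b_comp A u) = (\<lambda>t. A (apply_c2b u t))" (is ?ap)
    and "c2_d0 (c2b_comp A u) = bc_comp A (c2_d0 u)" (is ?d0)
    and "c2_d1 (c2b_comp A u) = bc_comp A (c2_d1 u)" (is ?d1)
    and "c2_d2 (c2b_comp A u) = bc_comp A (c2_d2 u)" (is ?d2)
proof -
  have bl: "bounded_linear A" using A linear_conv_bounded_linear by blast
  have d: "((\<lambda>t. A (apply_c2b u t)) has_vector_derivative bc_comp A (c2_d1 u) t) (at t)"
    "(apply_bcontfun (bc_comp A (c2_d1 u)) has_vector_derivative bc_comp A (c2_d2 u) t) (at t)" for t
    unfolding bc_comp_apply[OF A]
    by (rule bounded_linear.has_vector_derivative[OF bl c2_derivs(1)])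
      (rule bounded_linear.has_vector_derivative[OF bl c2_derivs(2)])
  have "(\<lambda>t. A (apply_c2b u t)) \<in> c2b"
  proof (rule c2bI[OF _ d])
    show "bounded (range (\<lambda>t. A (apply_c2b u t)))"
      using bounded_linear_image[OF bounded_c2b bl, of u] by (simp add: image_image)
  qed
  then show ap: ?ap unfolding c2b_comp_def by (rule Abs_c2b_inverse)
  show ?d0 by (rule bcontfun_eqI) (simp add: ap bc_comp_apply[OF A])
  show d1: ?d1 by (rule c2_d1_eqI) (simp only: ap d)
  show ?d2 by (rule c2_d2_eqI) (simp only: d1 d)
qed

lemma norm_c2b_le:
  assumes "norm (c2_d0 u) \<le> c * norm (c2_d0 v)" "norm (c2_d1 u) \<le> c * norm (c2_d1 v)"
    "norm (c2_d2 u) \<le> c * norm (c2_d2 v)" and "c \<ge> 0"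
  shows "norm u \<le> c * norm v"
proof -
  have "c * norm (c2_d0 v) \<le> c * norm v" "c * norm (c2_d1 v) \<le> c * norm v" "c * norm (c2_d2 v) \<le> c * norm v"
    using assms(4) by (auto intro!: mult_left_mono simp: norm_c2b_def)
  then show ?thesis using assms(1-3) by (simp add: norm_c2b_def[of u])
qed

lemma periodic_ops_c2b:
  fixes A :: "real ^ 'k \<Rightarrow> real ^ 'k"
  assumes m: "m > 0" and A: "linear A"
  shows "periodic_ops (2 * pi * real m) (per_space m) apply_c2b (c2b_conv (2 * pi * real m)) (c2b_comp A) A"
proof -
  define p where "p = 2 * pi * real m"
  have p: "p > 0" using m by (simp add: p_def)
  show ?thesis
    unfolding p_def[symmetric]
  proof (unfold_locales)
    show "per_space m = {x :: (real ^ 'k) c2b. \<forall>t. apply_c2b x (t + p) = apply_c2b x t}"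
      by (simp add: per_space_def p_def)
    show "continuous_on UNIV (apply_c2b x)" for x :: "(real ^ 'k) c2b"
      using continuous_on_apply_bcontfun[of UNIV "c2_d0 x"] by simp
    show "norm (c2b_conv p k x) \<le> p * C * norm x"
      if k: "continuous_on {0..p} k" and C: "\<And>r. r \<in> {0..p} \<Longrightarrow> \<bar>k r\<bar> \<le> C" for k C and x :: "(real ^ 'k) c2b"
    proof (rule norm_c2b_le)
      have "C \<ge> 0" using C[of 0] p by auto
      then show "p * C \<ge> 0" using p by simp
    qed (simp_all only: c2b_conv_props[OF p k] norm_bc_conv[OF p k C])
    show "norm (c2b_comp A x) \<le> onorm A * norm x" for x
    proof (rule norm_c2b_le)
      show "onorm A \<ge> 0" using A linear_conv_bounded_linear onorm_pos_le by blast
    qed (simp_all only: c2b_comp_props[OF A] norm_bc_comp[OF A])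
    show "\<exists>x. apply_c2b x = mode (freq p j) a b" for j and a b :: "real ^ 'k"
    proof -
      have "mode (freq p j) a b \<in> c2b"
        by (rule periodic_C2_in_c2b[OF p mode_periodic[OF p] mode_deriv mode_deriv2])
          (intro continuous_intros continuous_on_mode)
      then show ?thesis by (metis Abs_c2b_inverse)
    qed
  qed (use p in \<open>simp_all add: linear_add[OF A] linear_scale[OF A] A plus_c2b.rep_eq scaleR_c2b.rep_eq c2b_conv_props c2b_comp_props apply_c2b_inject\<close>)
qed

section \<open>Continuous periodic functions and the inverse of L\<close>

definition bc_periodic :: "real \<Rightarrow> (real \<Rightarrow>\<^sub>C 'v::real_normed_vector) set"
  where "bc_periodic p = {v. \<forall>t. apply_bcontfun v (t + p) = apply_bcontfun v t}"

text \<open>Evaluations are 1-Lipschitz, so periodicity is a closed condition in the Banach space of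
  bounded continuous functions. Both the contraction and the compactness argument draw on
  this.\<close>

lemma complete_bc_periodic: "complete (bc_periodic p :: (real \<Rightarrow>\<^sub>C 'v::banach) set)"
proof -
  have "closed {v :: real \<Rightarrow>\<^sub>C 'v. apply_bcontfun v s = apply_bcontfun v t}" for s t
  proof -
    have "continuous_on UNIV (\<lambda>v :: real \<Rightarrow>\<^sub>C 'v. apply_bcontfun v s)" for s
      by (rule lipschitz_on_continuous_on[of 1]) (auto intro!: lipschitz_onI dist_bounded)
    then show ?thesis by (intro closed_Collect_eq)
  qed
  then have "closed (\<Inter>t. {v :: real \<Rightarrow>\<^sub>C 'v. apply_bcontfun v (t + p) = apply_bcontfun v t})"
    by (intro closed_INT) auto
  moreover have "bc_periodic p = (\<Inter>t. {v :: real \<Rightarrow>\<^sub>C 'v. apply_bcontfun v (t + p) = apply_bcontfun v t})"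
    by (auto simp: bc_periodic_def)
  ultimately show ?thesis by (simp add: complete_eq_closed)
qed

lemma periodic_ops_bc:
  fixes A :: "real ^ 'k \<Rightarrow> real ^ 'k"
  assumes p: "p > 0" and A: "linear A"
  shows "periodic_ops p (bc_periodic p) apply_bcontfun (bc_conv p) (bc_comp A) A"
proof (unfold_locales)
  show "continuous_on UNIV (apply_bcontfun x)" for x :: "real \<Rightarrow>\<^sub>C (real ^ 'k)"
    by (rule continuous_on_apply_bcontfun)
  show "norm (bc_conv p k x) \<le> p * C * norm x"
    if k: "continuous_on {0..p} k" and C: "\<And>r. r \<in> {0..p} \<Longrightarrow> \<bar>k r\<bar> \<le> C" for k C and x :: "real \<Rightarrow>\<^sub>C (real ^ 'k)"
    by (rule norm_bc_conv[OF p k C])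
  show "norm (bc_comp A x) \<le> onorm A * norm x" for x by (rule norm_bc_comp[OF A])
  show "\<exists>x. apply_bcontfun x = mode (freq p j) a b" for j and a b :: "real ^ 'k"
    using Bcontfun_inverse[OF periodic_bcontfun[OF p mode_periodic[OF p] continuous_on_mode]] by blast
  show "apply_bcontfun (bc_conv p k x) = conv p k (apply_bcontfun x)" if "continuous_on {0..p} k"
    for k and x :: "real \<Rightarrow>\<^sub>C (real ^ 'k)" by (rule bc_conv_apply[OF p that])
qed (use p in \<open>simp_all add: linear_add[OF A] linear_scale[OF A] A bc_periodic_def bc_comp_apply apply_bcontfun_inject\<close>)

text \<open>By uniqueness of derivatives the second derivative of the C^2 element is the one
  computed from the Green kernel, namely the element itself plus v.\<close>

lemma L_op_conv_green:
  fixes v :: "(real ^ 'k) c2b"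
  assumes m: "m > 0" and v: "v \<in> per_space m"
  shows "L_op (c2b_conv (2 * pi * real m) (green (2 * pi * real m)) v) = c2_d0 v"
proof -
  define p where "p = 2 * pi * real m"
  have p: "p > 0" using m by (simp add: p_def)
  note k = continuous_on_green(1)[of "{0..p}" p]
  let ?u = "c2b_conv p (green p) v"
  have per: "apply_c2b v (t + p) = apply_c2b v t" for t using v by (simp add: per_space_def p_def)
  have cont: "continuous_on UNIV (apply_c2b v)" using continuous_on_apply_bcontfun[of UNIV "c2_d0 v"] by simp
  note g = conv_green_deriv[OF p cont per]
  have "(conv p (green p) (apply_c2b v) has_vector_derivative c2_d1 ?u t) (at t)" for t
    using c2_derivs(1)[of ?u t] by (simp only: c2b_conv_props(1)[OF p k])
  then have "c2_d1 ?u t = conv p (dgreen p) (apply_c2b v) t" for t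
    using g(1) vector_derivative_unique_at by blast
  then have "apply_bcontfun (c2_d1 ?u) = conv p (dgreen p) (apply_c2b v)" by (rule ext)
  then have "c2_d2 ?u t = conv p (green p) (apply_c2b v) t + apply_c2b v t" for t
    using g(2)[of t] c2_derivs(2)[of ?u t] vector_derivative_unique_at by metis
  then have "L_op ?u = c2_d0 v"
    by (intro bcontfun_eqI) (simp add: L_op_def c2b_conv_props(1)[OF p k])
  then show ?thesis by (simp add: p_def)
qed

text \<open>The difference w satisfies w'' = w and is bounded together with w', hence it is 0. This
  determines the value of \<open>inv_into\<close>.\<close>

lemma L_op_inj:
  fixes u v :: "'v::euclidean_space c2b"
  assumes "L_op u = L_op v" shows "u = v"
proof -
  define w where "w = u - v"
  have diff: "c2_d0 (u - v) = c2_d0 u - c2_d0 v" "c2_d2 (u - v) = c2_d2 u - c2_d2 v"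
    unfolding minus_c2b_def c2_linear by simp_all
  have "c2_d2 w = c2_d0 w" using assms unfolding w_def diff L_op_def by (simp add: algebra_simps)
  then have d2: "(apply_bcontfun (c2_d1 w) has_vector_derivative apply_c2b w t) (at t)" for t
    using c2_derivs(2)[of w t] by simp
  have "apply_c2b w t = 0" for t
    by (rule green_ode_unique[OF c2_derivs(1) d2 bounded_c2b bounded_apply_bcontfun])
  then have "w = 0" by (intro c2b_eqI) (simp add: zero_c2b.rep_eq)
  then show ?thesis by (simp add: w_def)
qed

section \<open>Characteristic polynomial and critical points\<close>

text \<open>The characteristic polynomial is det (x - A), which differs from det (A - x) by one sign
  per dimension.\<close>

lemma poly_charpoly:
  fixes A :: "real ^ 'k \<Rightarrow> real ^ 'k"
  shows "poly (charpoly A) \<beta> = (- 1) ^ CARD('k) * det (matrix (\<lambda>v. A v - \<beta> *\<^sub>R v))"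
proof -
  have e: "poly ((if i = j then [:0, 1:] else 0) - [:matrix A $ i $ j:]) \<beta> = - (matrix (\<lambda>v. A v - \<beta> *\<^sub>R v) $ i $ j)" for i j
    by (auto simp: matrix_def axis_def)
  have "poly (charpoly A) \<beta> = (\<Sum>q | q permutes (UNIV :: 'k set). of_int (sign q) *
      (\<Prod>i\<in>UNIV. - (matrix (\<lambda>v. A v - \<beta> *\<^sub>R v) $ i $ q i)))"
    unfolding charpoly_def det_def by (simp add: poly_sum poly_prod e del: poly_diff)
  also have "\<dots> = (- 1) ^ CARD('k) * det (matrix (\<lambda>v. A v - \<beta> *\<^sub>R v))"
    unfolding det_def by (simp add: prod_uminus sum_distrib_left mult_ac)
  finally show ?thesis .
qed

lemma linear_diff_scale:
  fixes A :: "'v::real_vector \<Rightarrow> 'v"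
  assumes "linear A" shows "linear (\<lambda>v. A v - \<beta> *\<^sub>R v)"
  using assms by (intro linearI) (simp_all add: linear_add linear_scale algebra_simps)

lemma real_spectrum_iff_charpoly:
  fixes A :: "real ^ 'k \<Rightarrow> real ^ 'k"
  assumes "linear A" shows "\<beta> \<in> real_spectrum A \<longleftrightarrow> poly (charpoly A) \<beta> = 0"
proof -
  have "det (matrix (\<lambda>v. A v - \<beta> *\<^sub>R v)) = 0 \<longleftrightarrow> \<not> inj (\<lambda>v. A v - \<beta> *\<^sub>R v)"
    using det_nz_iff_inj[OF linear_diff_scale[OF assms]] by blast
  also have "\<dots> \<longleftrightarrow> \<beta> \<in> real_spectrum A"
    unfolding linear_injective_0[OF linear_diff_scale[OF assms]] by (auto simp: real_spectrum_def)
  finally show ?thesis by (simp add: poly_charpoly)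
qed

text \<open>The number onorm A + 1 exceeds every eigenvalue, so it is not a root.\<close>

lemma charpoly_nonzero:
  fixes A :: "real ^ 'k \<Rightarrow> real ^ 'k"
  assumes "linear A" shows "charpoly A \<noteq> 0"
proof
  assume "charpoly A = 0"
  then have "onorm A + 1 \<in> real_spectrum A" by (simp add: real_spectrum_iff_charpoly[OF assms])
  then obtain v where v: "v \<noteq> 0" "A v = (onorm A + 1) *\<^sub>R v" by (auto simp: real_spectrum_def)
  have bl: "bounded_linear A" using assms linear_conv_bounded_linear by blast
  have "(onorm A + 1) * norm v \<le> onorm A * norm v"
    using onorm[OF bl, of v] onorm_pos_le[OF bl] by (simp add: v(2))
  then show False using v(1) by (simp add: distrib_right)
qed

lemma finite_real_spectrum:
  fixes A :: "real ^ 'k \<Rightarrow> real ^ 'k"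
  assumes "linear A" shows "finite (real_spectrum A)"
proof -
  have "real_spectrum A = {x. poly (charpoly A) x = 0}" using real_spectrum_iff_charpoly[OF assms] by auto
  then show ?thesis using poly_roots_finite[OF charpoly_nonzero[OF assms]] by simp
qed

text \<open>Splitting off the power of (x - \<mu>) leaves a factor without zeros on [a, b], of
  constant sign by the intermediate value theorem, while the odd power changes sign. The
  dimension-dependent signs cancel in the product.\<close>

lemma det_sign_change:
  fixes A :: "real ^ 'k \<Rightarrow> real ^ 'k"
  assumes A: "linear A" and odd: "odd (alg_mult A \<mu>)" and ab: "a < \<mu>" "\<mu> < b"
    and only: "\<And>x. x \<in> real_spectrum A \<Longrightarrow> a \<le> x \<Longrightarrow> x \<le> b \<Longrightarrow> x = \<mu>"
  shows "det (matrix (\<lambda>v. A v - a *\<^sub>R v)) * det (matrix (\<lambda>v. A v - b *\<^sub>R v)) < 0"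
proof -
  let ?d = "Polynomial.order \<mu> (charpoly A)"
  obtain q where q: "charpoly A = [:- \<mu>, 1:] ^ ?d * q" "\<not> [:- \<mu>, 1:] dvd q"
    using order_decomp[OF charpoly_nonzero[OF A]] by blast
  have pq: "poly (charpoly A) x = (x - \<mu>) ^ ?d * poly q x" for x
    by (subst q(1)) (simp add: poly_power)
  have nz: "poly q x \<noteq> 0" if "a \<le> x" "x \<le> b" for x
  proof
    assume 0: "poly q x = 0"
    then have "x \<in> real_spectrum A" by (simp add: real_spectrum_iff_charpoly[OF A] pq)
    then have "x = \<mu>" using only that by blast
    then show False using 0 q(2) poly_eq_0_iff_dvd by blast
  qed
  have qq: "poly q a * poly q b > 0"
  proof (rule ccontr)
    assume "\<not> ?thesis"
    moreover have "poly q a * poly q b \<noteq> 0" using nz ab by simp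
    ultimately have "poly q a * poly q b < 0" by linarith
    then obtain x where "x > a" "x < b" "poly q x = 0" using poly_IVT[of a b q] ab by auto
    then show False using nz by simp
  qed
  have "(a - \<mu>) ^ ?d * (b - \<mu>) ^ ?d < 0"
    using odd ab by (intro mult_neg_pos) (simp_all add: alg_mult_def power_less_zero_eq)
  from mult_neg_pos[OF this qq]
  have neg: "poly (charpoly A) a * poly (charpoly A) b < 0" by (simp add: pq mult_ac)
  have "poly (charpoly A) a * poly (charpoly A) b =
      ((- 1) ^ CARD('k) * (- 1) ^ CARD('k)) * (det (matrix (\<lambda>v. A v - a *\<^sub>R v)) * det (matrix (\<lambda>v. A v - b *\<^sub>R v)))"
    unfolding poly_charpoly by (simp only: mult_ac)
  also have "(- 1) ^ CARD('k) * (- 1) ^ CARD('k) = (1 :: real)" by (simp flip: power_mult_distrib)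
  finally show ?thesis using neg by simp
qed

lemma freq_sqr: "m > 0 \<Longrightarrow> alpha_pt m j \<mu> = (freq (2 * pi * real m) j)\<^sup>2 + \<mu>"
  by (simp add: alpha_pt_def freq_def power_divide field_simps)

text \<open>For j > J quadratic growth beats the bounded set \<sigma> and gives distance more than
  1; up to J only finitely many pairs remain.\<close>

lemma isolated_alpha:
  assumes m: "m > 0" and fin: "finite \<sigma>" and e: "e > (0::real)"
    and distinct: "\<And>j \<mu>. \<mu> \<in> \<sigma> \<Longrightarrow> (j, \<mu>) \<noteq> (j\<^sub>0, \<mu>\<^sub>0) \<Longrightarrow> alpha_pt m j \<mu> \<noteq> alpha_pt m j\<^sub>0 \<mu>\<^sub>0"
  obtains \<epsilon> where "\<epsilon> > 0" "\<epsilon> < e"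
    "\<And>j \<mu>. \<mu> \<in> \<sigma> \<Longrightarrow> (j, \<mu>) \<noteq> (j\<^sub>0, \<mu>\<^sub>0) \<Longrightarrow> \<bar>alpha_pt m j \<mu> - alpha_pt m j\<^sub>0 \<mu>\<^sub>0\<bar> > \<epsilon>"
proof -
  define \<alpha> where "\<alpha> = alpha_pt m j\<^sub>0 \<mu>\<^sub>0"
  obtain M where M: "\<And>\<mu>. \<mu> \<in> \<sigma> \<Longrightarrow> \<bar>\<mu>\<bar> \<le> M"
    using finite_imp_bounded[OF fin] by (auto simp: bounded_iff)
  define J where "J = nat \<lceil>(real m)\<^sup>2 * (\<bar>\<alpha>\<bar> + 1 + \<bar>M\<bar>)\<rceil>"
  have far: "\<bar>alpha_pt m j \<mu> - \<alpha>\<bar> > 1" if \<mu>: "\<mu> \<in> \<sigma>" and j: "j > J" for j \<mu>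
  proof -
    have "(real m)\<^sup>2 * (\<bar>\<alpha>\<bar> + 1 + \<bar>M\<bar>) < real j" using j unfolding J_def by linarith
    also have "real j \<le> (real j)\<^sup>2" using j by (simp add: power2_eq_square)
    finally have "\<bar>\<alpha>\<bar> + 1 + \<bar>M\<bar> < (real j)\<^sup>2 / (real m)\<^sup>2" using m by (simp add: field_simps)
    moreover have "alpha_pt m j \<mu> = (real j)\<^sup>2 / (real m)\<^sup>2 + \<mu>" using m by (simp add: alpha_pt_def field_simps)
    ultimately show ?thesis using M[OF \<mu>] by linarith
  qed
  \<comment> \<open>The entry min e 1 keeps the set nonempty, caps the result by e, and covers the
    indices beyond \<open>J\<close>.\<close>
  define D where "D = insert (min e 1) ((\<lambda>(j, \<mu>). \<bar>alpha_pt m j \<mu> - \<alpha>\<bar>) ` (({..J} \<times> \<sigma>) - {(j\<^sub>0, \<mu>\<^sub>0)}))"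
  have D: "finite D" "D \<noteq> {}" using fin by (auto simp: D_def)
  have pos: "Min D > 0"
    unfolding Min_gr_iff[OF D]
  proof
    fix d assume "d \<in> D"
    then consider "d = min e 1" | j \<mu> where "d = \<bar>alpha_pt m j \<mu> - \<alpha>\<bar>" "\<mu> \<in> \<sigma>" "(j, \<mu>) \<noteq> (j\<^sub>0, \<mu>\<^sub>0)"
      unfolding D_def by (elim insertE imageE DiffE SigmaE) auto
    then show "d > 0"
    proof cases
      case 2
      then show ?thesis using distinct[OF 2(2,3)] by (simp add: \<alpha>_def)
    qed (use e in simp)
  qed
  have le: "Min D \<le> min e 1" using D(1) by (rule Min_le) (simp add: D_def)
  show thesis
  proof (rule that[of "Min D / 2"])
    show "Min D / 2 > 0" "Min D / 2 < e" using pos le by auto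
    fix j \<mu> assume \<mu>: "\<mu> \<in> \<sigma>" "(j, \<mu>) \<noteq> (j\<^sub>0, \<mu>\<^sub>0)"
    show "\<bar>alpha_pt m j \<mu> - alpha_pt m j\<^sub>0 \<mu>\<^sub>0\<bar> > Min D / 2"
    proof (cases "j \<le> J")
      case True
      then have "\<bar>alpha_pt m j \<mu> - \<alpha>\<bar> \<in> D" using \<mu> by (force simp: D_def)
      then have "Min D \<le> \<bar>alpha_pt m j \<mu> - \<alpha>\<bar>" using D(1) by (rule Min_le[rotated])
      then show ?thesis using pos by (simp add: \<alpha>_def)
    next
      case False
      then show ?thesis using far[OF \<mu>(1), of j] le pos by (simp add: \<alpha>_def)
    qed
  qed
qed

context periodic_ops
begin

lemma T_inj_noncritical:
  assumes "\<And>j. \<alpha> - (freq p j)\<^sup>2 \<notin> real_spectrum A" "x \<in> S" "T \<alpha> x = 0" shows "x = 0"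
  using T_kernel[OF assms(2,3)] T_kernel_spectrum[OF assms(2,3)] assms(1) by blast

lemma T_inj_except:
  assumes "\<And>j. j \<noteq> j\<^sub>0 \<Longrightarrow> \<alpha> - (freq p j)\<^sup>2 \<notin> real_spectrum A" "x \<in> S" "T \<alpha> x = 0" "P j\<^sub>0 x = 0"
  shows "x = 0"
  using T_kernel[OF assms(2,3)] T_kernel_spectrum[OF assms(2,3)] assms(1,4) by metis

text \<open>By \<open>iso\<close> only the pair (j0, \<mu>0) is critical within \<epsilon>, so the
  other modes stay invertible throughout, and the determinant on the critical mode crosses one
  eigenvalue, of odd multiplicity.\<close>

lemma T_flip_at_odd:
  assumes X: "nice X" and Y: "P j\<^sub>0 ` X = {x. \<exists>v. ev x = (\<lambda>t. w t *\<^sub>R v)}"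
    and w: "w = mode (freq p j\<^sub>0) (c::real) e" "w t\<^sub>0 \<noteq> 0"
    and \<alpha>\<^sub>0: "\<alpha>\<^sub>0 = (freq p j\<^sub>0)\<^sup>2 + \<mu>\<^sub>0" and \<mu>\<^sub>0: "odd (alg_mult A \<mu>\<^sub>0)" and \<epsilon>: "\<epsilon> > 0"
    and iso: "\<And>j \<mu>. \<mu> \<in> real_spectrum A \<Longrightarrow> (j, \<mu>) \<noteq> (j\<^sub>0, \<mu>\<^sub>0) \<Longrightarrow> \<bar>(freq p j)\<^sup>2 + \<mu> - \<alpha>\<^sub>0\<bar> > \<epsilon>"
    and N: "j\<^sub>0 \<le> N"
  shows "brouwer_ball_degree (Q N ` X) (T (\<alpha>\<^sub>0 - \<epsilon>)) = - brouwer_ball_degree (Q N ` X) (T (\<alpha>\<^sub>0 + \<epsilon>))"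
    and "\<bar>brouwer_ball_degree (Q N ` X) (T (\<alpha>\<^sub>0 + \<epsilon>))\<bar> = 1"
proof -
  have nc: "\<alpha> - (freq p j)\<^sup>2 \<notin> real_spectrum A" if "\<alpha> \<in> {\<alpha>\<^sub>0 - \<epsilon>..\<alpha>\<^sub>0 + \<epsilon>}" "j \<noteq> j\<^sub>0 \<or> \<alpha> \<noteq> \<alpha>\<^sub>0" for \<alpha> j
  proof
    assume s: "\<alpha> - (freq p j)\<^sup>2 \<in> real_spectrum A"
    have "(j, \<alpha> - (freq p j)\<^sup>2) \<noteq> (j\<^sub>0, \<mu>\<^sub>0)" using that(2) \<alpha>\<^sub>0 by auto
    then have "\<epsilon> < \<bar>(freq p j)\<^sup>2 + (\<alpha> - (freq p j)\<^sup>2) - \<alpha>\<^sub>0\<bar>" by (rule iso[OF s])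
    then show False using that(1) by auto
  qed
  have inj: "x = 0" if "x \<in> X" "T \<alpha> x = 0" "\<alpha> \<in> {\<alpha>\<^sub>0 - \<epsilon>, \<alpha>\<^sub>0 + \<epsilon>}" for x \<alpha>
    by (rule T_inj_noncritical[OF nc niceD(5)[OF X that(1)] that(2)]) (use that(3) \<epsilon> in auto)
  show "brouwer_ball_degree (Q N ` X) (T (\<alpha>\<^sub>0 - \<epsilon>)) = - brouwer_ball_degree (Q N ` X) (T (\<alpha>\<^sub>0 + \<epsilon>))"
  proof (rule T_degree_flip[OF X Y w _ _ _ _ _ N])
    fix \<alpha> x assume "\<alpha> \<in> {\<alpha>\<^sub>0 - \<epsilon>..\<alpha>\<^sub>0 + \<epsilon>}" "x \<in> X" "P j\<^sub>0 x = 0" "T \<alpha> x = 0"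
    then show "x = 0" using nc by (intro T_inj_except[of j\<^sub>0 \<alpha> x] niceD(5)[OF X]) auto
  next
    have e: "\<alpha>\<^sub>0 - \<epsilon> - (freq p j\<^sub>0)\<^sup>2 = \<mu>\<^sub>0 - \<epsilon>" "\<alpha>\<^sub>0 + \<epsilon> - (freq p j\<^sub>0)\<^sup>2 = \<mu>\<^sub>0 + \<epsilon>" by (simp_all add: \<alpha>\<^sub>0)
    show "det (matrix (\<lambda>v. A v - (\<alpha>\<^sub>0 - \<epsilon> - (freq p j\<^sub>0)\<^sup>2) *\<^sub>R v)) *
        det (matrix (\<lambda>v. A v - (\<alpha>\<^sub>0 + \<epsilon> - (freq p j\<^sub>0)\<^sup>2) *\<^sub>R v)) < 0"
      unfolding e
    proof (rule det_sign_change[OF A \<mu>\<^sub>0])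
      fix x assume x: "x \<in> real_spectrum A" "\<mu>\<^sub>0 - \<epsilon> \<le> x" "x \<le> \<mu>\<^sub>0 + \<epsilon>"
      show "x = \<mu>\<^sub>0"
      proof (rule ccontr)
        assume "x \<noteq> \<mu>\<^sub>0"
        then show False using iso[OF x(1), of j\<^sub>0] x(2,3) by (simp add: \<alpha>\<^sub>0 abs_le_iff not_le[symmetric])
      qed
    qed (use \<epsilon> in auto)
  qed (use \<epsilon> inj in auto)
  show "\<bar>brouwer_ball_degree (Q N ` X) (T (\<alpha>\<^sub>0 + \<epsilon>))\<bar> = 1"
    using inj by (intro abs_ball_degree fin_dim_Q[OF X] lin_inj_T[OF X]) auto
qed

end

section \<open>The problem in both function spaces\<close>

lemma leray_schauder_degree_cong:
  assumes "\<And>x. x \<in> X \<Longrightarrow> T x = T' x"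
  shows "leray_schauder_degree X T = leray_schauder_degree X T'"
proof -
  have "(\<forall>x\<in>X \<inter> cball 0 1. norm ((x - g x) - T x) < \<delta>) \<longleftrightarrow> (\<forall>x\<in>X \<inter> cball 0 1. norm ((x - g x) - T' x) < \<delta>)" for g \<delta>
    using assms by auto
  then show ?thesis unfolding leray_schauder_degree_def by (simp only:)
qed

definition period :: "nat \<Rightarrow> real"
  where "period m = 2 * pi * real m"

text \<open>Below, \<open>E\<close> is the C^2 setting, in which the theorem is stated, and
  \<open>F\<close> the continuous one; their operators are given by the same formulas on
  values.\<close>

locale linear_bvp =
  fixes m :: nat and A :: "real ^ 'k \<Rightarrow> real ^ 'k"
  assumes m: "m > 0" and A: "linear A"
begin

abbreviation "per \<equiv> period m"

lemma per_pos: "per > 0" using m by (simp add: period_def)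

sublocale E: periodic_ops "period m" "per_space m" apply_c2b "c2b_conv (period m)" "c2b_comp A" A
  unfolding period_def by (rule periodic_ops_c2b[OF m A])

sublocale F: periodic_ops "period m" "bc_periodic (period m)" apply_bcontfun "bc_conv (period m)" "bc_comp A" A
  by (rule periodic_ops_bc[OF per_pos A])

text \<open>The argument of the inverse of \<open>L_op\<close> is the inclusion of the C^2 function
  \<open>E.B \<alpha> u\<close>, so convolution with the Green kernel produces its preimage, and
  injectivity of \<open>L_op\<close> settles \<open>inv_into\<close>.\<close>

lemma lin_op_eq:
  assumes u: "u \<in> per_space m" shows "lin_op m A \<alpha> u = E.T \<alpha> u"
proof -
  have d0: "c2_d0 (E.B \<alpha> u) = bc_comp A (c2_d0 u) - (\<alpha> + 1) *\<^sub>R c2_d0 u"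
  proof (rule bcontfun_eqI)
    fix t
    have "apply_bcontfun (bc_comp A (c2_d0 u) - (\<alpha> + 1) *\<^sub>R c2_d0 u) t = A (apply_c2b u t) - (\<alpha> + 1) *\<^sub>R apply_c2b u t"
      by (simp add: bc_comp_apply[OF A])
    then show "c2_d0 (E.B \<alpha> u) t = (bc_comp A (c2_d0 u) - (\<alpha> + 1) *\<^sub>R c2_d0 u) t"
      by (simp only: c2_d0_apply E.ev_B)
  qed
  have inj: "inj_on L_op (per_space m :: (real ^ 'k) c2b set)" by (rule inj_onI) (rule L_op_inj)
  have "L_op (E.G (E.B \<alpha> u)) = c2_d0 (E.B \<alpha> u)"
    unfolding E.G_def by (rule L_op_conv_green[OF m E.B_S[OF u], folded period_def])
  then have "inv_into (per_space m) L_op (c2_d0 (E.B \<alpha> u)) = E.G (E.B \<alpha> u)"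
    using inv_into_f_f[OF inj E.G_S[OF E.B_S[OF u, of \<alpha>]]] by simp
  then show ?thesis unfolding lin_op_def d0[symmetric] E.T_def by simp
qed

text \<open>Derivatives of the image are given by \<open>dgreen\<close> and by G h + h; the summand
  1 in the constant pays for the additional h.\<close>

lemma regularity:
  "\<exists>C>0. \<forall>h\<in>bc_periodic per. \<exists>u\<in>per_space m. apply_c2b u = conv per (green per) (apply_bcontfun h) \<and>
    (\<forall>t. c2_d2 u t = conv per (green per) (apply_bcontfun h) t + apply_bcontfun h t) \<and>
    norm (u :: (real ^ 'k) c2b) \<le> C * norm h"
proof -
  note k = continuous_on_green[of "{0..per}" per]
  obtain C1 where C1: "\<And>r. r \<in> {0..per} \<Longrightarrow> \<bar>green per r\<bar> \<le> C1" using kernel_bound[OF k(1)] by blast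
  obtain C2 where C2: "\<And>r. r \<in> {0..per} \<Longrightarrow> \<bar>dgreen per r\<bar> \<le> C2" using kernel_bound[OF k(2)] by blast
  define C where "C = per * (\<bar>C1\<bar> + \<bar>C2\<bar>) + 1"
  have C: "C > 0" using per_pos by (simp add: C_def add_nonneg_pos)
  have b1: "norm (bc_conv per (green per) h) \<le> per * \<bar>C1\<bar> * norm h"
    and b2: "norm (bc_conv per (dgreen per) h) \<le> per * \<bar>C2\<bar> * norm h" for h :: "real \<Rightarrow>\<^sub>C (real ^ 'k)"
    using C1 C2 by (intro norm_bc_conv[OF per_pos] k; force)+
  have "\<exists>u\<in>per_space m. apply_c2b u = conv per (green per) h \<and>
    (\<forall>t. c2_d2 u t = conv per (green per) h t + apply_bcontfun h t) \<and> norm u \<le> C * norm h"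
    if h: "h \<in> bc_periodic per" for h :: "real \<Rightarrow>\<^sub>C (real ^ 'k)"
  proof -
    have hper: "apply_bcontfun h (t + per) = apply_bcontfun h t" for t using h by (simp add: bc_periodic_def)
    note g = conv_green_deriv[OF per_pos continuous_on_apply_bcontfun hper]
    define u where "u = Abs_c2b (conv per (green per) h)"
    have e: "apply_bcontfun (bc_conv per (green per) h) = conv per (green per) h"
      "apply_bcontfun (bc_conv per (dgreen per) h) = conv per (dgreen per) h"
      by (rule bc_conv_apply[OF per_pos] k)+
    have d1: "(conv per (green per) h has_vector_derivative bc_conv per (dgreen per) h t) (at t)"
      and d2: "(apply_bcontfun (bc_conv per (dgreen per) h) has_vector_derivative (bc_conv per (green per) h + h) t) (at t)" for t
      using g[of t] by (simp_all add: e)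
    have "conv per (green per) h \<in> c2b"
    proof (rule c2bI[OF _ d1 d2])
      show "bounded (range (conv per (green per) h))" unfolding e[symmetric] by (rule bounded_apply_bcontfun)
    qed
    then have ap: "apply_c2b u = conv per (green per) h" unfolding u_def by (rule Abs_c2b_inverse)
    have D0: "c2_d0 u = bc_conv per (green per) h" by (rule bcontfun_eqI) (simp add: ap e)
    have D1: "c2_d1 u = bc_conv per (dgreen per) h" by (rule c2_d1_eqI) (simp only: ap d1)
    have D2: "c2_d2 u = bc_conv per (green per) h + h" by (rule c2_d2_eqI) (simp only: D1 d2)
    have "norm (bc_conv per (green per) h + h) \<le> norm (bc_conv per (green per) h) + norm h" by (rule norm_triangle_ineq)
    moreover have "per * \<bar>C1\<bar> * norm h \<ge> 0" "per * \<bar>C2\<bar> * norm h \<ge> 0" using per_pos by simp_all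
    moreover have "C * norm h = per * \<bar>C1\<bar> * norm h + per * \<bar>C2\<bar> * norm h + norm h" by (simp add: C_def algebra_simps)
    ultimately have "norm (bc_conv per (green per) h) \<le> C * norm h" "norm (bc_conv per (dgreen per) h) \<le> C * norm h"
      "norm (bc_conv per (green per) h + h) \<le> C * norm h"
      using b1[of h] b2[of h] norm_ge_zero[of h] by linarith+
    then have "norm u \<le> C * norm h" by (simp add: norm_c2b_def D0 D1 D2)
    moreover have "u \<in> per_space m"
      unfolding E.S_def mem_Collect_eq ap using conv_periodic[of "apply_bcontfun h", OF hper] by blast
    moreover have "c2_d2 u t = conv per (green per) h t + apply_bcontfun h t" for t by (simp add: D2 e)
    ultimately show ?thesis using ap by blast
  qed
  then show ?thesis using C by blast
qed

text \<open>The equation is solved by a continuous v. It satisfies v = G h + y with h = B v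
  continuous, so G h is C^2 by regularity, and with y also v.\<close>

lemma E_T_surj:
  assumes nc: "\<And>j. \<alpha> - (freq per j)\<^sup>2 \<notin> real_spectrum A" and y: "y \<in> per_space m"
  obtains x where "x \<in> per_space m" "E.T \<alpha> x = y"
proof -
  have y0: "c2_d0 y \<in> bc_periodic per" using y by (simp add: bc_periodic_def per_space_def period_def)
  obtain v where v: "v \<in> bc_periodic per" "F.T \<alpha> v = c2_d0 y"
    using F.T_surj[OF complete_bc_periodic nc y0] by blast
  define h where "h = F.B \<alpha> v"
  have h: "h \<in> bc_periodic per" unfolding h_def by (rule F.B_S[OF v(1)])
  obtain u where u: "u \<in> per_space m" "apply_c2b u = conv per (green per) h"
    using regularity h by blast
  have Gh: "apply_bcontfun (F.G h) = conv per (green per) h"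
    unfolding F.G_def by (rule bc_conv_apply[OF per_pos continuous_on_green(1)])
  have v_eq: "apply_bcontfun v t = apply_c2b (u + y) t" for t
  proof -
    have "v - F.G h = c2_d0 y" using v(2) by (simp only: F.T_def h_def)
    then have "v = F.G h + c2_d0 y" by (metis add.commute diff_add_cancel)
    then have "apply_bcontfun v t = apply_bcontfun (F.G h) t + apply_c2b y t" by simp
    then show ?thesis by (simp add: Gh u(2) plus_c2b.rep_eq)
  qed
  have hB: "apply_c2b (E.B \<alpha> (u + y)) = apply_bcontfun h"
    unfolding h_def by (rule ext) (simp only: E.ev_B F.ev_B v_eq)
  have "E.G (E.B \<alpha> (u + y)) = u"
  proof (rule c2b_eqI)
    fix t
    show "apply_c2b (E.G (E.B \<alpha> (u + y))) t = apply_c2b u t"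
      unfolding E.G_def c2b_conv_props(1)[OF per_pos continuous_on_green(1)] hB u(2) ..
  qed
  then have "E.T \<alpha> (u + y) = y" by (simp add: E.T_def)
  moreover have "u + y \<in> per_space m" using u(1) y by (rule subspace_add[OF E.subspace_S])
  ultimately show thesis using that by blast
qed

text \<open>Injectivity yields a lower bound \<eta> for the operator, and surjectivity holds by
  regularity, so the inverse is Lipschitz with constant 1 / \<eta>.\<close>

lemma isomorphism_noncritical:
  assumes nc: "\<And>j. \<alpha> - (freq per j)\<^sup>2 \<notin> real_spectrum A"
  shows "isomorphism_on (per_space m) (lin_op m A \<alpha>)"
proof -
  let ?S = "per_space m :: (real ^ 'k) c2b set"
  have inj: "x = 0" if "x \<in> ?S" "E.T \<alpha> x = 0" for x by (rule E.T_inj_noncritical[OF nc that])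
  obtain N where N: "\<And>N' \<beta>. N' \<ge> N \<Longrightarrow> \<bar>\<beta>\<bar> \<le> \<bar>\<alpha>\<bar> \<Longrightarrow> E.tail N' \<beta>" using E.tail_exists[of "\<bar>\<alpha>\<bar>"] by blast
  have tail: "E.tail N \<alpha>" by (rule N) auto
  obtain \<eta> where "reduces ?S (E.Q N) (E.T \<alpha>) \<eta>"
    using E.T_reduces[OF E.nice_S tail inj] by blast
  then have \<eta>: "\<eta> > 0" and bd: "\<eta> * norm x \<le> norm (E.T \<alpha> x)" if "x \<in> ?S" for x
  proof -
    assume r: "reduces ?S (E.Q N) (E.T \<alpha>) \<eta>"
    show "\<eta> > 0" using r by (simp add: reduces_def)
    have "\<And>s x. s \<in> {0..1} \<Longrightarrow> x \<in> ?S \<Longrightarrow>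
      \<eta> * norm x \<le> norm ((1 - s) *\<^sub>R E.T \<alpha> x + s *\<^sub>R (E.T \<alpha> (E.Q N x) + (x - E.Q N x)))"
      using r unfolding reduces_def by auto
    \<comment> \<open>At s = 0 the segment is the operator itself.\<close>
    from this[of 0 x] show "\<eta> * norm x \<le> norm (E.T \<alpha> x)" using that by simp
  qed
  have inj_on: "inj_on (E.T \<alpha>) ?S"
  proof (rule inj_onI)
    fix x y assume xy: "x \<in> ?S" "y \<in> ?S" "E.T \<alpha> x = E.T \<alpha> y"
    then have "x - y \<in> ?S" "E.T \<alpha> (x - y) = 0"
      by (simp_all add: subspace_diff[OF E.subspace_S] linear_diff[OF E.lin_T])
    then show "x = y" using inj by fastforce
  qed
  have img: "E.T \<alpha> ` ?S = ?S" using E.T_S E_T_surj[OF nc] by blast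
  define R where "R = inv_into ?S (E.T \<alpha>)"
  have R: "R y \<in> ?S" "E.T \<alpha> (R y) = y" if "y \<in> ?S" for y
    using that unfolding R_def by (intro inv_into_into f_inv_into_f; simp add: img)+
  have RT: "R (E.T \<alpha> x) = x" if "x \<in> ?S" for x unfolding R_def by (rule inv_into_f_f[OF inj_on that])
  have "continuous_on ?S R"
  proof (rule lipschitz_on_continuous_on[of "1 / \<eta>"], rule lipschitz_onI)
    have \<eta>0: "\<eta> > 0" using \<eta> subspace_0[OF E.subspace_S] by blast
    then show "0 \<le> 1 / \<eta>" by simp
    fix x y assume xy: "x \<in> ?S" "y \<in> ?S"
    have "\<eta> * norm (R x - R y) \<le> norm (E.T \<alpha> (R x - R y))"
      by (rule bd) (use R xy in \<open>auto intro: subspace_diff[OF E.subspace_S]\<close>)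
    also have "E.T \<alpha> (R x - R y) = x - y" using R xy by (simp add: linear_diff[OF E.lin_T])
    finally show "dist (R x) (R y) \<le> 1 / \<eta> * dist x y" using \<eta>0 by (simp add: dist_norm field_simps)
  qed
  then have hom: "homeomorphism ?S ?S (E.T \<alpha>) R"
    unfolding homeomorphism_def
  proof (intro conjI ballI)
    show "continuous_on ?S (E.T \<alpha>)" by (rule bounded_linear.continuous_on[OF E.bl_T continuous_on_id])
    show "R ` ?S = ?S"
    proof
      show "?S \<subseteq> R ` ?S"
      proof
        fix x :: "(real ^ 'k) c2b" assume x: "x \<in> ?S"
        then have "x = R (E.T \<alpha> x)" "E.T \<alpha> x \<in> ?S" by (simp_all add: RT E.T_S)
        then show "x \<in> R ` ?S" by blast
      qed
    qed (use R(1) in blast)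
  qed (use R RT img in auto)
  have "homeomorphism ?S ?S (lin_op m A \<alpha>) R"
    by (rule homeomorphism_cong[OF hom]) (simp_all add: lin_op_eq)
  then show ?thesis
    unfolding isomorphism_on_def
    by (auto simp: lin_op_eq subspace_add[OF E.subspace_S] subspace_scale[OF E.subspace_S]
        linear_add[OF E.lin_T] linear_scale[OF E.lin_T])
qed

text \<open>With an eigenvector v of \<mu>, the function cos (j t / m) v lies in the kernel.\<close>

lemma critical_alpha:
  assumes "\<mu> \<in> real_spectrum A" shows "alpha_pt m j \<mu> \<in> critical_points m A"
proof -
  obtain v where v: "v \<noteq> 0" "A v = \<mu> *\<^sub>R v" using assms by (auto simp: real_spectrum_def)
  define u where "u = E.mel j v 0"
  have u: "u \<in> per_space m" unfolding u_def by (rule E.mel_S)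
  have eu: "apply_c2b u = mode (freq per j) v 0" unfolding u_def by (rule E.ev_mel)
  have "c2b_comp A u = \<mu> *\<^sub>R u"
    by (rule c2b_eqI) (simp add: E.ev_am E.ev_scale eu mode_def linear_scale[OF A] v)
  then have T0: "E.T (alpha_pt m j \<mu>) u = 0" unfolding E.T_mode[OF eu] by (simp add: freq_sqr[OF m] period_def)
  have "u \<noteq> 0"
  proof
    assume "u = 0"
    then have "apply_c2b u 0 = 0" by (simp add: zero_c2b.rep_eq)
    then show False using v(1) by (simp add: eu mode_def)
  qed
  have "\<not> isomorphism_on (per_space m) (lin_op m A (alpha_pt m j \<mu>))"
  proof
    assume "isomorphism_on (per_space m) (lin_op m A (alpha_pt m j \<mu>))"
    then obtain R where "homeomorphism (per_space m) (per_space m) (lin_op m A (alpha_pt m j \<mu>)) R"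
      by (auto simp: isomorphism_on_def)
    then have R: "R (lin_op m A (alpha_pt m j \<mu>) x) = x" if "x \<in> per_space m" for x
      using that by (simp add: homeomorphism_def)
    have "0 \<in> (per_space m :: (real ^ 'k) c2b set)" by (rule subspace_0[OF E.subspace_S])
    from R[OF this] R[OF u] show False
      using \<open>u \<noteq> 0\<close> by (simp add: lin_op_eq u \<open>0 \<in> per_space m\<close> T0 linear_0[OF E.lin_T])
  qed
  then show ?thesis by (simp add: critical_points_def)
qed

lemma critical_imp_alpha:
  assumes "\<alpha> \<in> critical_points m A" obtains j \<mu> where "\<mu> \<in> real_spectrum A" "\<alpha> = alpha_pt m j \<mu>"
proof -
  have "\<exists>j. \<alpha> - (freq per j)\<^sup>2 \<in> real_spectrum A"
    using assms isomorphism_noncritical[of \<alpha>] by (auto simp: critical_points_def)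
  then obtain j where j: "\<alpha> - (freq per j)\<^sup>2 \<in> real_spectrum A" by blast
  then show thesis using that[of "\<alpha> - (freq per j)\<^sup>2" j] by (simp add: freq_sqr[OF m] period_def)
qed

lemma noncritical_inj:
  assumes "\<alpha> \<notin> critical_points m A" "x \<in> per_space m" "E.T \<alpha> x = 0" shows "x = 0"
proof (rule E.T_inj_noncritical[OF _ assms(2,3)])
  fix j
  have "alpha_pt m j (\<alpha> - (freq per j)\<^sup>2) = \<alpha>" by (simp add: freq_sqr[OF m] period_def)
  then show "\<alpha> - (freq per j)\<^sup>2 \<notin> real_spectrum A" using critical_alpha[of _ j] assms(1) by metis
qed

end

section \<open>The equivariant bifurcation invariant\<close>

text \<open>Shifts commute with every such convolution, reflections by the symmetry of the kernel;
  this makes the Fourier projections equivariant.\<close>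

lemma fun_act_conv:
  fixes h :: "real \<Rightarrow> 'v::euclidean_space"
  assumes k: "continuous_on {0..p} k" "\<And>r. r \<in> {0..p} \<Longrightarrow> k (p - r) = k r"
    and h: "continuous_on UNIV h" "\<And>t. h (t + p) = h t"
  shows "fun_act g (conv p k h) = conv p k (fun_act g h)"
proof
  fix t
  define c where "c = 2 * pi * real_of_int (fst (fst g))"
  define s where "s = real_of_int (snd g)"
  define e :: real where "e = (if snd (fst g) then - 1 else 1)"
  have ch: "continuous_on UNIV (\<lambda>t. h (e * (t + c)))"
    by (intro continuous_on_compose2[OF h(1)] continuous_intros) auto
  have "conv p k (\<lambda>t. h (e * (t + c))) t = conv p k h (e * (t + c))"
  proof (cases "snd (fst g)")
    case True
    have "conv p k (\<lambda>t. h (- (t + c))) t = conv p k (\<lambda>t. h (- t)) (t + c)"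
      by (rule conv_shift[of p k "\<lambda>t. h (- t)" c t])
    also have "\<dots> = conv p k h (- (t + c))" by (rule conv_reflect[OF k h])
    finally show ?thesis using True by (simp only: e_def if_True mult_minus1)
  next
    case False
    then show ?thesis using conv_shift[of p k h c t] by (simp add: e_def)
  qed
  moreover have "conv p k (fun_act g h) t = s *\<^sub>R conv p k (\<lambda>t. h (e * (t + c))) t"
    unfolding fun_act_def c_def[symmetric] s_def[symmetric] e_def[symmetric]
    by (rule conv_linear[OF k(1) ch bounded_linear.linear[OF bounded_linear_scaleR_right]])
  ultimately show "fun_act g (conv p k h) t = conv p k (fun_act g h) t"
    by (simp add: fun_act_def c_def[symmetric] s_def[symmetric] e_def[symmetric])
qed

lemma apply_sym_act: "apply_c2b (sym_act g u) = fun_act g (apply_c2b u)"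
  by (simp add: sym_act.rep_eq fun_act_def fun_eq_iff)

context linear_bvp
begin

lemma per_space_periodic: "u \<in> per_space m \<longleftrightarrow> periodic (2 * pi * real m) (apply_c2b u)"
  by (simp add: per_space_def periodic_def)

lemma sym_act_S: "u \<in> per_space m \<Longrightarrow> sym_act g u \<in> per_space m"
  unfolding per_space_periodic apply_sym_act by (rule fun_act_periodic)

lemma sym_act_mult:
  "u \<in> per_space m \<Longrightarrow> sym_act (x \<otimes>\<^bsub>sym_group m\<^esub> y) u = sym_act x (sym_act y u)"
  unfolding per_space_periodic by (rule c2b_eqI) (simp add: apply_sym_act fun_act_mult)

lemma sym_act_one: "sym_act \<one>\<^bsub>sym_group m\<^esub> u = u"
  by (rule c2b_eqI) (simp add: apply_sym_act fun_act_one)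

lemma sym_act_linear: "linear (sym_act g)"
  by (rule linearI; rule c2b_eqI)
    (simp_all add: apply_sym_act fun_act_def plus_c2b.rep_eq scaleR_c2b.rep_eq scaleR_add_right)

lemma sym_act_P:
  assumes "u \<in> per_space m" shows "sym_act g (E.P j u) = E.P j (sym_act g u)"
proof (rule c2b_eqI)
  fix t
  show "apply_c2b (sym_act g (E.P j u)) t = apply_c2b (E.P j (sym_act g u)) t"
    unfolding apply_sym_act E.P_def E.ev_cv[OF continuous_on_proj_kernel]
    by (subst fun_act_conv[OF continuous_on_proj_kernel proj_kernel_symmetric[OF per_pos] E.ev_cont E.S_per[OF assms]])
      (rule refl)
qed

lemma sym_act_am: "sym_act g (c2b_comp A u) = c2b_comp A (sym_act g u)"
  by (rule c2b_eqI) (simp add: apply_sym_act E.ev_am fun_act_def linear_scale[OF A])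

abbreviation "fixed K \<equiv> fixed_subspace sym_act (per_space m :: (real ^ 'k) c2b set) K"

lemma nice_fixed: "E.nice (fixed K)"
  unfolding E.nice_def
proof (intro conjI ballI allI)
  show "subspace (fixed K)"
    using E.subspace_S by (auto simp: fixed_subspace_def subspace_def linear_0[OF sym_act_linear]
        linear_add[OF sym_act_linear] linear_scale[OF sym_act_linear])
  show "fixed K \<subseteq> per_space m" by (auto simp: fixed_subspace_def)
  show "E.P j x \<in> fixed K" if "x \<in> fixed K" for x j
    using that by (auto simp: fixed_subspace_def sym_act_P E.P_S)
  show "c2b_comp A x \<in> fixed K" if "x \<in> fixed K" for x
    using that by (auto simp: fixed_subspace_def sym_act_am E.am_S)
qed

lemma sym_act_fixed_conj:
  assumes u: "u \<in> fixed K" and x: "x \<in> carrier (sym_group m)" and K: "K \<subseteq> carrier (sym_group m)"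
  shows "sym_act x u \<in> fixed (x <#\<^bsub>sym_group m\<^esub> K #>\<^bsub>sym_group m\<^esub> inv\<^bsub>sym_group m\<^esub> x)"
proof -
  let ?G = "sym_group m"
  interpret group ?G by (rule group_sym_group[OF m])
  have uS: "u \<in> per_space m" using u by (simp add: fixed_subspace_def)
  have "sym_act (x \<otimes>\<^bsub>?G\<^esub> h \<otimes>\<^bsub>?G\<^esub> inv\<^bsub>?G\<^esub> x) (sym_act x u) = sym_act x u" if h: "h \<in> K" for h
  proof -
    have hG: "h \<in> carrier ?G" using h K by blast
    have "sym_act (x \<otimes>\<^bsub>?G\<^esub> h \<otimes>\<^bsub>?G\<^esub> inv\<^bsub>?G\<^esub> x) (sym_act x u) = sym_act (x \<otimes>\<^bsub>?G\<^esub> h \<otimes>\<^bsub>?G\<^esub> inv\<^bsub>?G\<^esub> x \<otimes>\<^bsub>?G\<^esub> x) u"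
      by (rule sym_act_mult[OF uS, symmetric])
    also have "x \<otimes>\<^bsub>?G\<^esub> h \<otimes>\<^bsub>?G\<^esub> inv\<^bsub>?G\<^esub> x \<otimes>\<^bsub>?G\<^esub> x = x \<otimes>\<^bsub>?G\<^esub> h" using x hG by (simp add: m_assoc)
    also have "sym_act (x \<otimes>\<^bsub>?G\<^esub> h) u = sym_act x (sym_act h u)" by (rule sym_act_mult[OF uS])
    also have "sym_act h u = u" using u h by (simp add: fixed_subspace_def)
    finally show ?thesis .
  qed
  then show ?thesis using sym_act_S[OF uS] by (auto simp: fixed_subspace_def conj_eq_image)
qed

lemma leray_schauder_lin_op: "leray_schauder_degree (fixed K) (lin_op m A \<alpha>) = leray_schauder_degree (fixed K) (E.T \<alpha>)"
  by (rule leray_schauder_degree_cong) (simp add: lin_op_eq fixed_subspace_def)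

abbreviation "gdeg \<alpha> \<equiv> G_degree (sym_group m) sym_act (per_space m :: (real ^ 'k) c2b set) (lin_op m A \<alpha>)"

text \<open>Without critical points in between, the degree is constant on every fixed-point space,
  and the coefficients are computed from these degrees alone.\<close>

lemma gdeg_const:
  assumes "a \<le> b" and nc: "\<And>\<alpha>. \<alpha> \<in> {a..b} \<Longrightarrow> \<alpha> \<notin> critical_points m A"
  shows "gdeg a = gdeg b"
proof (rule G_degree_eqI)
  fix C
  have "leray_schauder_degree (fixed H) (lin_op m A a) = leray_schauder_degree (fixed H) (lin_op m A b)" for H
    unfolding leray_schauder_lin_op
    by (rule E.leray_schauder_T_const[OF nice_fixed assms(1)])
      (use nc noncritical_inj in \<open>auto simp: fixed_subspace_def\<close>)
  then show "burnside_coeff (sym_group m) (\<lambda>H. leray_schauder_degree (fixed H) (lin_op m A a)) (class_rep C) =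
    burnside_coeff (sym_group m) (\<lambda>H. leray_schauder_degree (fixed H) (lin_op m A b)) (class_rep C)"
    by (simp only:)
qed

text \<open>Modes fixed by \<open>H\<close> are multiples of a single profile; for j > 0 this is
  where the two copies of V shrink to one.\<close>

lemma fixed_cos_isotropy:
  assumes \<omega>: "\<omega> = freq per j" and g: "g \<in> carrier (sym_group m)"
    and H: "H = {x \<in> carrier (sym_group m). fun_act x (fun_act g (\<lambda>t. cos (\<omega> * t))) = fun_act g (\<lambda>t. cos (\<omega> * t))}"
  shows "E.P j ` fixed H = {x. \<exists>v. apply_c2b x = (\<lambda>t. fun_act g (\<lambda>t. cos (\<omega> * t)) t *\<^sub>R v)}"
proof -
  let ?w = "fun_act g (\<lambda>t. cos (\<omega> * t))"
  have \<omega>': "\<omega> = freq (2 * pi * real m) j" using \<omega> by (simp add: period_def)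
  have cm: "(\<lambda>t. cos (\<omega> * t)) = mode \<omega> 1 (0::real)" by (simp add: mode_def fun_eq_iff)
  obtain c e :: real where w: "?w = mode \<omega> c e" unfolding cm using fun_act_mode by blast
  show ?thesis
  proof (intro equalityI subsetI)
    fix x assume "x \<in> E.P j ` fixed H"
    then obtain u where u: "u \<in> fixed H" "x = E.P j u" by blast
    have uS: "u \<in> per_space m" using u(1) by (simp add: fixed_subspace_def)
    obtain a b where ab: "apply_c2b x = mode \<omega> a b" unfolding u(2) \<omega> using E.ev_P_mode[OF uS] .
    have "x \<in> fixed H" unfolding u(2) by (rule E.niceD(3)[OF nice_fixed u(1)])
    then have "fun_act y (mode \<omega> a b) = mode \<omega> a b" if "y \<in> H" for y
      unfolding ab[symmetric] apply_sym_act[symmetric] using that by (simp add: fixed_subspace_def)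
    then obtain v where "mode \<omega> a b = (\<lambda>t. ?w t *\<^sub>R v)"
      using fixed_mode_multiple[OF m \<omega>' g, of a b] unfolding H by blast
    then show "x \<in> {x. \<exists>v. apply_c2b x = (\<lambda>t. ?w t *\<^sub>R v)}" using ab by auto
  next
    fix x assume "x \<in> {x :: (real ^ 'k) c2b. \<exists>v. apply_c2b x = (\<lambda>t. ?w t *\<^sub>R v)}"
    then obtain v where v: "apply_c2b x = (\<lambda>t. ?w t *\<^sub>R v)" by blast
    have xm: "apply_c2b x = mode (freq per j) (c *\<^sub>R v) (e *\<^sub>R v)"
      unfolding v w unfolding \<omega> by (simp add: mode_def fun_eq_iff algebra_simps)
    have xS: "x \<in> per_space m" unfolding E.S_def by (simp add: xm mode_periodic[OF per_pos])
    have "sym_act y x = x" if "y \<in> H" for y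
      by (rule c2b_eqI) (use that in \<open>simp add: apply_sym_act v fun_act_scaleR H\<close>)
    then have "x \<in> fixed H" using xS by (simp add: fixed_subspace_def)
    moreover have "E.P j x = x" using E.P_mode[OF xm, of j] by simp
    ultimately show "x \<in> E.P j ` fixed H" by (metis image_eqI)
  qed
qed

text \<open>The coefficients at the class of the isotropy group of the cosine are compared. Its
  representative is an unknown conjugate \<open>H\<close>, the isotropy group of a transported
  cosine w. Where no critical mode is fixed the degree does not change, and by upward closure
  neither does the coefficient; all classes above (H) are of this kind, while at \<open>H\<close>
  the degree changes sign.\<close>

lemma gdeg_neq:
  assumes \<mu>\<^sub>0: "odd (alg_mult A \<mu>\<^sub>0)" and \<alpha>\<^sub>0: "\<alpha>\<^sub>0 = alpha_pt m j\<^sub>0 \<mu>\<^sub>0" and \<epsilon>: "\<epsilon> > 0"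
    and iso: "\<And>j \<mu>. \<mu> \<in> real_spectrum A \<Longrightarrow> (j, \<mu>) \<noteq> (j\<^sub>0, \<mu>\<^sub>0) \<Longrightarrow> \<bar>alpha_pt m j \<mu> - \<alpha>\<^sub>0\<bar> > \<epsilon>"
  shows "gdeg (\<alpha>\<^sub>0 - \<epsilon>) \<noteq> gdeg (\<alpha>\<^sub>0 + \<epsilon>)"
proof -
  let ?G = "sym_group m"
  interpret group ?G by (rule group_sym_group[OF m])
  note grp = group_sym_group[OF m] and fin = finite_sym_group[of m]
  define \<omega> where "\<omega> = freq per j\<^sub>0"
  have \<omega>': "\<omega> = freq (2 * pi * real m) j\<^sub>0" by (simp add: \<omega>_def period_def)
  let ?c = "\<lambda>t. cos (\<omega> * t)"
  have cper: "periodic (2 * pi * real m) ?c" unfolding \<omega>' by (rule freq_periodic[OF m])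
  define C where "C = conj_class ?G (cos_isotropy m \<omega>)"
  have sub0: "subgroup (cos_isotropy m \<omega>) ?G" unfolding cos_isotropy_def by (rule subgroup_isotropy[OF m cper])
  have C: "C \<in> conj_classes ?G" unfolding C_def conj_classes_def using sub0 by blast
  define H where "H = class_rep C"
  have HC: "H \<in> C" unfolding H_def by (rule class_rep_in[OF grp C])
  obtain g where g: "g \<in> carrier ?G" "H = g <#\<^bsub>?G\<^esub> cos_isotropy m \<omega> #>\<^bsub>?G\<^esub> inv\<^bsub>?G\<^esub> g"
    using HC unfolding C_def conj_class_def by blast
  define w where "w = fun_act g ?c"
  have Hw: "H = {x \<in> carrier ?G. fun_act x (fun_act g ?c) = fun_act g ?c}"
    unfolding g(2) cos_isotropy_def by (rule isotropy_conj[OF m cper g(1)])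
  have subH: "subgroup H ?G" unfolding Hw by (rule subgroup_isotropy[OF m fun_act_periodic[OF cper]])
  have CH: "C = conj_class ?G H" unfolding C_def using conj_class_eq[OF grp sub0] HC C_def by blast
  have Y: "E.P j\<^sub>0 ` fixed H = {x. \<exists>v. apply_c2b x = (\<lambda>t. w t *\<^sub>R v)}"
    unfolding w_def by (rule fixed_cos_isotropy[OF \<omega>_def g(1) Hw])
  have "?c = mode \<omega> 1 0" by (simp add: mode_def fun_eq_iff)
  then obtain c e :: real where wm: "w = mode (freq per j\<^sub>0) c e"
    unfolding w_def \<omega>_def[symmetric] using fun_act_mode[of g \<omega> 1 "0 :: real"] by auto
  have "\<bar>w (- (2 * pi * of_int (fst (fst g))))\<bar> = 1"
    unfolding w_def fun_act_cos(1)[OF g(1)] by (simp add: fun_act_cos(2)[OF g(1)])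
  then have w0: "w (- (2 * pi * of_int (fst (fst g)))) \<noteq> 0" by auto
  have iso': "\<bar>(freq per j)\<^sup>2 + \<mu> - \<alpha>\<^sub>0\<bar> > \<epsilon>" if "\<mu> \<in> real_spectrum A" "(j, \<mu>) \<noteq> (j\<^sub>0, \<mu>\<^sub>0)" for j \<mu>
    using iso[OF that] by (simp add: freq_sqr[OF m] period_def)
  have \<alpha>\<^sub>0': "\<alpha>\<^sub>0 = (freq per j\<^sub>0)\<^sup>2 + \<mu>\<^sub>0" by (simp add: \<alpha>\<^sub>0 freq_sqr[OF m] period_def)
  define a b where "a = \<alpha>\<^sub>0 - \<epsilon>" and "b = \<alpha>\<^sub>0 + \<epsilon>"
  have nc: "\<alpha> - (freq per j)\<^sup>2 \<notin> real_spectrum A" if "\<alpha> \<in> {a..b}" "j \<noteq> j\<^sub>0 \<or> \<alpha> \<noteq> \<alpha>\<^sub>0" for \<alpha> j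
  proof
    assume s: "\<alpha> - (freq per j)\<^sup>2 \<in> real_spectrum A"
    have "(j, \<alpha> - (freq per j)\<^sup>2) \<noteq> (j\<^sub>0, \<mu>\<^sub>0)" using that(2) \<alpha>\<^sub>0' by auto
    then have "\<epsilon> < \<bar>(freq per j)\<^sup>2 + (\<alpha> - (freq per j)\<^sup>2) - \<alpha>\<^sub>0\<bar>" by (rule iso'[OF s])
    then show False using that(1) by (auto simp: a_def b_def)
  qed
  define d d' where "d = (\<lambda>K. leray_schauder_degree (fixed K) (lin_op m A a))"
    and "d' = (\<lambda>K. leray_schauder_degree (fixed K) (lin_op m A b))"
  \<comment> \<open>the subgroups \<open>K\<close> for which the critical mode does not meet \<open>E\<^sup>K\<close>\<close>
  define U where "U = {K. K \<subseteq> carrier ?G \<and> (\<forall>u\<in>fixed K. E.P j\<^sub>0 u = u \<longrightarrow> u = 0)}"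
  \<comment> \<open>Without a critical mode the operator stays injective on the fixed-point space
    over the whole interval, at \<alpha>0 as well.\<close>
  have dU: "d K = d' K" if K: "K \<in> U" for K
    unfolding d_def d'_def leray_schauder_lin_op
  proof (rule E.leray_schauder_T_const[OF nice_fixed])
    show "a \<le> b" using \<epsilon> by (simp add: a_def b_def)
    fix \<alpha> x assume \<alpha>: "\<alpha> \<in> {a..b}" and x: "x \<in> fixed K" "E.T \<alpha> x = 0"
    have xS: "x \<in> per_space m" using x(1) by (simp add: fixed_subspace_def)
    have "E.P j\<^sub>0 (E.P j\<^sub>0 x) = E.P j\<^sub>0 x" using E.P_P[OF xS] by simp
    then have "E.P j\<^sub>0 x = 0" using K E.niceD(3)[OF nice_fixed x(1)] by (auto simp: U_def)
    then show "x = 0" using nc[OF \<alpha>] by (intro E.T_inj_except[OF _ xS x(2)]) auto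
  qed
  \<comment> \<open>Conjugation carries fixed-point spaces into each other, so membership does not
    depend on the representative chosen.\<close>
  have Uconj: "K' \<in> U" if K: "K \<in> U" and D: "D \<in> conj_classes ?G" "K \<in> D" "K' \<in> D" for K K' D
  proof -
    have sub: "K \<subseteq> carrier ?G" "K' \<subseteq> carrier ?G" using conj_classes_subset[OF grp D(1)] D(2,3) by blast+
    obtain x where x: "x \<in> carrier ?G" "K = x <#\<^bsub>?G\<^esub> K' #>\<^bsub>?G\<^esub> inv\<^bsub>?G\<^esub> x"
      using conj_classes_conj[OF grp D(1,3,2)] by blast
    have "u = 0" if u: "u \<in> fixed K'" "E.P j\<^sub>0 u = u" for u
    proof -
      have uS: "u \<in> per_space m" using u(1) by (simp add: fixed_subspace_def)
      have "sym_act x u \<in> fixed K" unfolding x(2) by (rule sym_act_fixed_conj[OF u(1) x(1) sub(2)])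
      moreover have "E.P j\<^sub>0 (sym_act x u) = sym_act x u" using sym_act_P[OF uS, of x j\<^sub>0] u(2) by simp
      ultimately have "sym_act x u = 0" using K by (auto simp: U_def)
      then have "sym_act (inv\<^bsub>?G\<^esub> x) (sym_act x u) = 0" by (simp add: linear_0[OF sym_act_linear])
      then show ?thesis using x(1) by (simp add: sym_act_one flip: sym_act_mult[OF uS])
    qed
    then show ?thesis using sub by (auto simp: U_def)
  qed
  have Uup: "class_rep D \<in> U" if K: "K \<in> U" and D: "D \<in> conj_classes ?G" "class_less ?G K D" for K D
  proof -
    obtain K' where K': "K' \<in> D" "K \<subseteq> K'" using D(2) by (auto simp: class_less_def)
    have "K' \<subseteq> carrier ?G" by (rule conj_classes_subset[OF grp D(1) K'(1)])
    moreover have "fixed K' \<subseteq> fixed K" using K'(2) by (auto simp: fixed_subspace_def)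
    ultimately have "K' \<in> U" using K by (auto simp: U_def)
    then show ?thesis using Uconj[OF _ D(1) K'(1) class_rep_in[OF grp D(1)]] by blast
  qed
  \<comment> \<open>A nonzero critical mode fixed by K \<supseteq> H has the form w v, so every
    element of K fixes w; then K = H, and the class is not strictly larger.\<close>
  have above: "class_rep D \<in> U" if D: "D \<in> conj_classes ?G" "class_less ?G H D" for D
  proof -
    obtain K where K: "K \<in> D" "H \<subseteq> K" and ne: "D \<noteq> conj_class ?G H" using D(2) by (auto simp: class_less_def)
    have KG: "K \<subseteq> carrier ?G" by (rule conj_classes_subset[OF grp D(1) K(1)])
    have "u = 0" if u: "u \<in> fixed K" "E.P j\<^sub>0 u = u" for u
    proof (rule ccontr)
      assume "u \<noteq> 0"
      have "u \<in> E.P j\<^sub>0 ` fixed H" using u K(2) by (force simp: fixed_subspace_def image_iff)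
      then obtain v where v: "apply_c2b u = (\<lambda>t. w t *\<^sub>R v)" unfolding Y by blast
      have "v \<noteq> 0"
      proof
        assume "v = 0"
        then have "u = 0" by (intro c2b_eqI) (simp add: v zero_c2b.rep_eq)
        then show False using \<open>u \<noteq> 0\<close> by simp
      qed
      have "x \<in> H" if x: "x \<in> K" for x
      proof -
        have "sym_act x u = u" using u(1) x by (simp add: fixed_subspace_def)
        then have "(\<lambda>t. fun_act x w t *\<^sub>R v) = (\<lambda>t. w t *\<^sub>R v)"
          unfolding fun_act_scaleR[symmetric] v[symmetric] apply_sym_act[symmetric] by simp
        then have "fun_act x w = w" using \<open>v \<noteq> 0\<close> by (simp add: fun_eq_iff)
        then show ?thesis using x KG unfolding Hw w_def by blast
      qed
      then have "K = H" using K(2) by blast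
      moreover obtain L where "subgroup L ?G" "D = conj_class ?G L" using D(1) by (auto simp: conj_classes_def)
      ultimately show False using ne K(1) conj_class_eq[OF grp] by metis
    qed
    then have "K \<in> U" using KG by (simp add: U_def)
    then show ?thesis using Uconj[OF _ D(1) K(1) class_rep_in[OF grp D(1)]] by blast
  qed
  \<comment> \<open>The degree of a linear isomorphism is 1 or -1, so a change of sign amounts to
    2.\<close>
  have "\<bar>d H - d' H\<bar> \<ge> 2"
  proof -
    obtain N where N: "\<And>N' \<alpha>. N' \<ge> N \<Longrightarrow> \<bar>\<alpha>\<bar> \<le> max \<bar>a\<bar> \<bar>b\<bar> \<Longrightarrow> E.tail N' \<alpha>"
      using E.tail_exists[of "max \<bar>a\<bar> \<bar>b\<bar>"] by blast
    define N' where "N' = max N j\<^sub>0"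
    have tail: "E.tail N' a" "E.tail N' b" by (rule N; simp add: N'_def)+
    have inj: "x = 0" if "x \<in> fixed H" "E.T \<alpha> x = 0" "\<alpha> \<in> {a, b}" for x \<alpha>
    proof (rule E.T_inj_noncritical[OF nc _ that(2)])
      show "\<alpha> \<in> {a..b}" using that(3) \<epsilon> by (auto simp: a_def b_def)
      show "j \<noteq> j\<^sub>0 \<or> \<alpha> \<noteq> \<alpha>\<^sub>0" for j using that(3) \<epsilon> by (auto simp: a_def b_def)
      show "x \<in> per_space m" using that(1) by (simp add: fixed_subspace_def)
    qed
    have "d H = brouwer_ball_degree (E.Q N' ` fixed H) (E.T a)"
      unfolding d_def leray_schauder_lin_op using inj by (intro E.leray_schauder_T[OF nice_fixed tail(1)]) auto
    moreover have "d' H = brouwer_ball_degree (E.Q N' ` fixed H) (E.T b)"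
      unfolding d'_def leray_schauder_lin_op using inj by (intro E.leray_schauder_T[OF nice_fixed tail(2)]) auto
    moreover note flip = E.T_flip_at_odd[OF nice_fixed Y wm w0 \<alpha>\<^sub>0' \<mu>\<^sub>0 \<epsilon> iso', of N', folded a_def b_def]
    have "brouwer_ball_degree (E.Q N' ` fixed H) (E.T a) = - brouwer_ball_degree (E.Q N' ` fixed H) (E.T b)"
      "\<bar>brouwer_ball_degree (E.Q N' ` fixed H) (E.T b)\<bar> = 1"
      by (rule flip; simp add: N'_def)+
    ultimately show ?thesis by simp
  qed
  moreover have "weyl_order ?G H = 1 \<or> weyl_order ?G H = 2"
    by (rule weyl_order_cos_isotropy[OF m \<omega>' g(1) Hw])
  ultimately have "burnside_coeff ?G d H \<noteq> burnside_coeff ?G d' H"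
    by (intro burnside_coeff_neqI[OF grp fin subH] burnside_coeff_eqI[OF grp fin Uup dU above])
  then have "Poly_Mapping.lookup (gdeg a) C \<noteq> Poly_Mapping.lookup (gdeg b) C"
    unfolding lookup_G_degree[OF fin C] H_def d_def d'_def .
  then show ?thesis unfolding a_def b_def by metis
qed

text \<open>Between the left ends of two admissible intervals there is no critical point, and
  likewise between the right ends, so the described value is unique; it is evaluated at distance
  \<epsilon> on either side.\<close>

lemma bif_invariant_neq_0:
  assumes \<mu>\<^sub>0: "\<mu>\<^sub>0 \<in> real_spectrum A" "odd (alg_mult A \<mu>\<^sub>0)"
    and distinct: "\<And>j j' \<mu> \<mu>'. \<mu> \<in> real_spectrum A \<Longrightarrow> \<mu>' \<in> real_spectrum A \<Longrightarrow> (j, \<mu>) \<noteq> (j', \<mu>')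
           \<Longrightarrow> alpha_pt m j \<mu> \<noteq> alpha_pt m j' \<mu>'"
  shows "bif_invariant m A (alpha_pt m j\<^sub>0 \<mu>\<^sub>0) \<noteq> 0"
proof -
  define \<alpha>\<^sub>0 where "\<alpha>\<^sub>0 = alpha_pt m j\<^sub>0 \<mu>\<^sub>0"
  obtain \<epsilon> where \<epsilon>: "\<epsilon> > 0" and
    iso: "\<And>j \<mu>. \<mu> \<in> real_spectrum A \<Longrightarrow> (j, \<mu>) \<noteq> (j\<^sub>0, \<mu>\<^sub>0) \<Longrightarrow> \<bar>alpha_pt m j \<mu> - \<alpha>\<^sub>0\<bar> > \<epsilon>"
    using isolated_alpha[OF m finite_real_spectrum[OF A], of 1 j\<^sub>0 \<mu>\<^sub>0] distinct \<mu>\<^sub>0(1) unfolding \<alpha>\<^sub>0_def by (metis zero_less_one)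
  define good where "good = (\<lambda>a b. a < \<alpha>\<^sub>0 \<and> \<alpha>\<^sub>0 < b \<and> {a..b} \<inter> critical_points m A = {\<alpha>\<^sub>0})"
  have left: "gdeg a = gdeg a'" if "good a b" "good a' b'" "a \<le> a'" for a b a' b'
  proof (rule gdeg_const[OF that(3)])
    fix \<alpha> assume \<alpha>: "\<alpha> \<in> {a..a'}"
    show "\<alpha> \<notin> critical_points m A"
    proof
      assume "\<alpha> \<in> critical_points m A"
      moreover have "\<alpha> \<in> {a..b}" using \<alpha> that(1,2) unfolding good_def by auto
      ultimately have "\<alpha> \<in> {a..b} \<inter> critical_points m A" by blast
      moreover have "{a..b} \<inter> critical_points m A = {\<alpha>\<^sub>0}" using that(1) by (simp add: good_def)
      ultimately have "\<alpha> = \<alpha>\<^sub>0" by (metis singletonD)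
      then show False using \<alpha> that by (simp add: good_def)
    qed
  qed
  have right: "gdeg b' = gdeg b" if "good a b" "good a' b'" "b' \<le> b" for a b a' b'
  proof (rule gdeg_const[OF that(3)])
    fix \<alpha> assume \<alpha>: "\<alpha> \<in> {b'..b}"
    show "\<alpha> \<notin> critical_points m A"
    proof
      assume "\<alpha> \<in> critical_points m A"
      moreover have "\<alpha> \<in> {a..b}" using \<alpha> that(1,2) unfolding good_def by auto
      ultimately have "\<alpha> \<in> {a..b} \<inter> critical_points m A" by blast
      moreover have "{a..b} \<inter> critical_points m A = {\<alpha>\<^sub>0}" using that(1) by (simp add: good_def)
      ultimately have "\<alpha> = \<alpha>\<^sub>0" by (metis singletonD)
      then show False using \<alpha> that by (simp add: good_def)
    qed
  qed
  have uniq: "gdeg a - gdeg b = gdeg a' - gdeg b'" if g: "good a b" "good a' b'" for a b a' b'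
  proof -
    have "gdeg a = gdeg a'" using left[OF g] left[OF g(2,1)] by (metis linear)
    moreover have "gdeg b = gdeg b'" using right[OF g] right[OF g(2,1)] by (metis linear)
    ultimately show ?thesis by simp
  qed
  have good: "good (\<alpha>\<^sub>0 - \<epsilon>) (\<alpha>\<^sub>0 + \<epsilon>)"
    unfolding good_def
  proof (intro conjI equalityI subsetI)
    fix \<alpha> assume \<alpha>: "\<alpha> \<in> {\<alpha>\<^sub>0 - \<epsilon>..\<alpha>\<^sub>0 + \<epsilon>} \<inter> critical_points m A"
    then obtain j \<mu> where j: "\<mu> \<in> real_spectrum A" "\<alpha> = alpha_pt m j \<mu>" using critical_imp_alpha by blast
    have "(j, \<mu>) = (j\<^sub>0, \<mu>\<^sub>0)"
    proof (rule ccontr)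
      assume "(j, \<mu>) \<noteq> (j\<^sub>0, \<mu>\<^sub>0)"
      then have "\<bar>alpha_pt m j \<mu> - \<alpha>\<^sub>0\<bar> > \<epsilon>" by (rule iso[OF j(1)])
      then show False using \<alpha> j(2) by auto
    qed
    then show "\<alpha> \<in> {\<alpha>\<^sub>0}" using j(2) by (simp add: \<alpha>\<^sub>0_def)
  next
    fix \<alpha> assume "\<alpha> \<in> {\<alpha>\<^sub>0}"
    then show "\<alpha> \<in> {\<alpha>\<^sub>0 - \<epsilon>..\<alpha>\<^sub>0 + \<epsilon>} \<inter> critical_points m A"
      using critical_alpha[OF \<mu>\<^sub>0(1)] \<epsilon> by (simp add: \<alpha>\<^sub>0_def)
  qed (use \<epsilon> in auto)
  have "bif_invariant m A \<alpha>\<^sub>0 = gdeg (\<alpha>\<^sub>0 - \<epsilon>) - gdeg (\<alpha>\<^sub>0 + \<epsilon>)"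
    unfolding bif_invariant_def
  proof (rule the_equality)
    show "\<exists>a b. a < \<alpha>\<^sub>0 \<and> \<alpha>\<^sub>0 < b \<and> {a..b} \<inter> critical_points m A = {\<alpha>\<^sub>0} \<and>
       gdeg (\<alpha>\<^sub>0 - \<epsilon>) - gdeg (\<alpha>\<^sub>0 + \<epsilon>) = gdeg a - gdeg b"
      using good unfolding good_def by blast
  next
    fix w assume "\<exists>a b. a < \<alpha>\<^sub>0 \<and> \<alpha>\<^sub>0 < b \<and> {a..b} \<inter> critical_points m A = {\<alpha>\<^sub>0} \<and> w = gdeg a - gdeg b"
    then obtain a b where "good a b" "w = gdeg a - gdeg b" unfolding good_def by blast
    then show "w = gdeg (\<alpha>\<^sub>0 - \<epsilon>) - gdeg (\<alpha>\<^sub>0 + \<epsilon>)" using uniq[OF _ good] by blast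
  qed
  moreover have "gdeg (\<alpha>\<^sub>0 - \<epsilon>) \<noteq> gdeg (\<alpha>\<^sub>0 + \<epsilon>)"
    by (rule gdeg_neq[OF \<mu>\<^sub>0(2) \<alpha>\<^sub>0_def \<epsilon> iso])
  ultimately show ?thesis by (simp add: \<alpha>\<^sub>0_def)
qed

end

section \<open>Bifurcation of even solutions\<close>

text \<open>The functions fixed by the reflection. Evenness of f in t lets the nonlinear term act on
  this space, in which every mode keeps only its cosines.\<close>

definition bc_even :: "real \<Rightarrow> (real \<Rightarrow>\<^sub>C 'v::real_normed_vector) set"
  where "bc_even p = {v \<in> bc_periodic p. \<forall>t. apply_bcontfun v (- t) = apply_bcontfun v t}"

definition nemytskii :: "(real \<Rightarrow> 'v \<Rightarrow> 'v) \<Rightarrow> (real \<Rightarrow>\<^sub>C 'v) \<Rightarrow> real \<Rightarrow>\<^sub>C 'v::real_normed_vector"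
  where "nemytskii f v = Bcontfun (\<lambda>t. f t (v t))"

lemma closed_bc_even: "closed (bc_even p :: (real \<Rightarrow>\<^sub>C 'v::real_normed_vector) set)"
proof -
  have cl: "closed {v :: real \<Rightarrow>\<^sub>C 'v. apply_bcontfun v s = apply_bcontfun v t}" for s t
  proof -
    have "continuous_on UNIV (\<lambda>v :: real \<Rightarrow>\<^sub>C 'v. apply_bcontfun v s)" for s
      by (rule lipschitz_on_continuous_on[of 1]) (auto intro!: lipschitz_onI dist_bounded)
    then show ?thesis by (intro closed_Collect_eq)
  qed
  have "bc_even p = (\<Inter>t. {v :: real \<Rightarrow>\<^sub>C 'v. apply_bcontfun v (t + p) = apply_bcontfun v t}) \<inter>
      (\<Inter>t. {v. apply_bcontfun v (- t) = apply_bcontfun v t})"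
    by (auto simp: bc_even_def bc_periodic_def)
  then show ?thesis using cl by (auto intro!: closed_Int closed_INT)
qed

context linear_bvp
begin

lemma nice_bc_even: "F.nice (bc_even per)"
  unfolding F.nice_def
proof (intro conjI ballI allI)
  show "subspace (bc_even per :: (real \<Rightarrow>\<^sub>C (real ^ 'k)) set)"
    by (auto simp: subspace_def bc_even_def bc_periodic_def)
  show "bc_even per \<subseteq> (bc_periodic per :: (real \<Rightarrow>\<^sub>C (real ^ 'k)) set)" by (auto simp: bc_even_def)
  show "F.P j v \<in> bc_even per" if "v \<in> bc_even per" for v j
  proof -
    have v: "v \<in> bc_periodic per" "apply_bcontfun v (- t) = apply_bcontfun v t" for t
      using that by (simp_all add: bc_even_def)
    have "apply_bcontfun (F.P j v) (- t) = apply_bcontfun (F.P j v) t" for t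
      unfolding F.P_def F.ev_cv[OF continuous_on_proj_kernel]
        conv_reflect[OF continuous_on_proj_kernel proj_kernel_symmetric[OF per_pos] F.ev_cont F.S_per[OF v(1)], symmetric]
        v(2) ..
    then show ?thesis using F.P_S[OF v(1)] by (simp add: bc_even_def)
  qed
  show "bc_comp A v \<in> bc_even per" if "v \<in> bc_even per" for v
    using that F.am_S[of v] by (simp add: bc_even_def F.ev_am)
qed

text \<open>An even mode has no sine part. This is the single-profile form on which the sign change
  of the degree rests, with the cosine as profile.\<close>

lemma P_bc_even:
  "F.P j ` bc_even per = {v. \<exists>c. apply_bcontfun v = (\<lambda>t. cos (freq per j * t) *\<^sub>R c)}"
proof (intro equalityI subsetI)
  fix v assume "v \<in> F.P j ` bc_even per"
  then obtain u where u: "u \<in> bc_even per" "v = F.P j u" by blast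
  have uS: "u \<in> bc_periodic per" using u(1) by (simp add: bc_even_def)
  obtain a b where ab: "apply_bcontfun v = mode (freq per j) a b" unfolding u(2) using F.ev_P_mode[OF uS] .
  have even: "apply_bcontfun v (- t) = apply_bcontfun v t" for t
    using F.niceD(3)[OF nice_bc_even u(1), of j] by (simp add: u(2) bc_even_def)
  have "apply_bcontfun v t = cos (freq per j * t) *\<^sub>R a" for t
  proof -
    have "- (sin (freq per j * t) *\<^sub>R b) = sin (freq per j * t) *\<^sub>R b"
      using even[of t] unfolding ab mode_def by simp
    then have "2 *\<^sub>R (sin (freq per j * t) *\<^sub>R b) = 0" unfolding scaleR_2 by (metis add.left_inverse)
    then have "sin (freq per j * t) *\<^sub>R b = 0" unfolding scaleR_eq_0_iff by linarith
    then show ?thesis by (simp add: ab mode_def)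
  qed
  then show "v \<in> {v. \<exists>c. apply_bcontfun v = (\<lambda>t. cos (freq per j * t) *\<^sub>R c)}" by blast
next
  fix v assume "v \<in> {v :: real \<Rightarrow>\<^sub>C (real ^ 'k). \<exists>c. apply_bcontfun v = (\<lambda>t. cos (freq per j * t) *\<^sub>R c)}"
  then obtain c where c: "apply_bcontfun v = (\<lambda>t. cos (freq per j * t) *\<^sub>R c)" by blast
  then have vm: "apply_bcontfun v = mode (freq per j) c 0" by (simp add: mode_def fun_eq_iff)
  have "v \<in> bc_periodic per" unfolding F.S_def by (simp add: vm mode_periodic[OF per_pos])
  then have "v \<in> bc_even per" by (simp add: bc_even_def c)
  moreover have "F.P j v = v" using F.P_mode[OF vm, of j] by simp
  ultimately show "v \<in> F.P j ` bc_even per" by (metis image_eqI)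
qed

section \<open>The superposition operator and the bifurcating solutions\<close>

lemma nemytskii_apply:
  fixes f :: "real \<Rightarrow> real ^ 'k \<Rightarrow> real ^ 'k"
  assumes f: "continuous_on UNIV (\<lambda>(t, x). f t x)" "\<And>t x. f (t + 2 * pi) x = f t x"
    and v: "v \<in> bc_periodic per"
  shows "apply_bcontfun (nemytskii f v) t = f t (v t)" "nemytskii f v \<in> bc_periodic per"
proof -
  have "f (t + per) x = f t x" for t x
    using periodic_int_shift[of "2 * pi" "\<lambda>t. f t x" t "int m"] f(2)
    by (simp add: periodic_def period_def mult.commute mult.left_commute)
  then have per: "f (t + per) (v (t + per)) = f t (v t)" for t using F.S_per[OF v] by simp
  have "continuous_on UNIV ((\<lambda>(t, x). f t x) \<circ> (\<lambda>t. (t, v t)))"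
    by (intro continuous_on_compose continuous_intros continuous_on_apply_bcontfun) (rule continuous_on_subset[OF f(1) subset_UNIV])
  then have "continuous_on UNIV (\<lambda>t. f t (v t))" by (simp add: o_def)
  then have "(\<lambda>t. f t (v t)) \<in> bcontfun" by (rule periodic_bcontfun[where f = "\<lambda>t. f t (v t)", OF per_pos per])
  then have e: "apply_bcontfun (nemytskii f v) t = f t (v t)" for t
    unfolding nemytskii_def by (simp add: Bcontfun_inverse)
  show "apply_bcontfun (nemytskii f v) t = f t (v t)" by (rule e)
  show "nemytskii f v \<in> bc_periodic per" by (simp add: bc_periodic_def e per)
qed

text \<open>\<open>f\<close> is uniformly continuous on [0, 2 pi] times a ball containing all values
  of functions within distance 1 of v; periodicity in t extends the estimate to all times.\<close>

lemma continuous_on_nemytskii: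
  fixes f :: "real \<Rightarrow> real ^ 'k \<Rightarrow> real ^ 'k"
  assumes f: "continuous_on UNIV (\<lambda>(t, x). f t x)" "\<And>t x. f (t + 2 * pi) x = f t x"
  shows "continuous_on (bc_periodic per) (nemytskii f)"
  unfolding continuous_on_iff
proof (intro ballI allI impI)
  fix v :: "real \<Rightarrow>\<^sub>C (real ^ 'k)" and e :: real assume v: "v \<in> bc_periodic per" and e: "e > 0"
  define R where "R = norm v + 1"
  define K where "K = {0..2 * pi} \<times> cball (0 :: real ^ 'k) R"
  have "uniformly_continuous_on K (\<lambda>(t, x). f t x)"
    unfolding K_def by (intro compact_uniformly_continuous compact_Times compact_cball continuous_on_subset[OF f(1)]) auto
  then obtain d where d: "d > 0" "\<And>z z'. z \<in> K \<Longrightarrow> z' \<in> K \<Longrightarrow> dist z' z < d \<Longrightarrow>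
      dist ((\<lambda>(t, x). f t x) z') ((\<lambda>(t, x). f t x) z) < e / 2"
    unfolding uniformly_continuous_on_def using e by (metis half_gt_zero)
  have f': "dist (f t x) (f t y) < e / 2" if "norm x \<le> R" "norm y \<le> R" "dist x y < d" for t x y
  proof -
    \<comment> \<open>The representative of t modulo 2 pi in [0, 2 pi].\<close>
    define s where "s = t - of_int \<lfloor>t / (2 * pi)\<rfloor> * (2 * pi)"
    have "0 \<le> t / (2 * pi) - of_int \<lfloor>t / (2 * pi)\<rfloor>" "t / (2 * pi) - of_int \<lfloor>t / (2 * pi)\<rfloor> \<le> 1" by linarith+
    then have "0 * (2 * pi) \<le> (t / (2 * pi) - of_int \<lfloor>t / (2 * pi)\<rfloor>) * (2 * pi)"
      "(t / (2 * pi) - of_int \<lfloor>t / (2 * pi)\<rfloor>) * (2 * pi) \<le> 1 * (2 * pi)" by (intro mult_right_mono; simp)+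
    then have s: "s \<in> {0..2 * pi}" by (simp add: s_def left_diff_distrib)
    have "f t z = f s z" for z
      using periodic_int_shift[of "2 * pi" "\<lambda>t. f t z" s "\<lfloor>t / (2 * pi)\<rfloor>"] f(2)
      by (simp add: periodic_def s_def)
    then show ?thesis using d(2)[of "(s, y)" "(s, x)"] s that by (simp add: K_def dist_Pair_Pair)
  qed
  show "\<exists>d>0. \<forall>v'\<in>bc_periodic per. dist v' v < d \<longrightarrow> dist (nemytskii f v') (nemytskii f v) < e"
  proof (intro exI[of _ "min d 1"] conjI ballI impI)
    fix v' :: "real \<Rightarrow>\<^sub>C (real ^ 'k)" assume v': "v' \<in> bc_periodic per" "dist v' v < min d 1"
    have "norm v' \<le> R" using v'(2) norm_triangle_sub[of v' v] by (simp add: R_def dist_norm)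
    then have n: "norm (v' t) \<le> R" "norm (v t) \<le> R" for t
      using norm_bounded[of v' t] norm_bounded[of v t] by (simp_all add: R_def)
    have "dist (v' t) (v t) < d" for t using dist_bounded[of v' t v] v'(2) by simp
    then have "dist (nemytskii f v' t) (nemytskii f v t) \<le> e / 2" for t
      using f'[OF n] by (simp add: nemytskii_apply(1)[OF f v] nemytskii_apply(1)[OF f v'(1)] less_imp_le)
    then have "dist (nemytskii f v') (nemytskii f v) \<le> e / 2" by (rule dist_bound)
    then show "dist (nemytskii f v') (nemytskii f v) < e" using e by simp
  qed (use d in simp)
qed

text \<open>The limit controls f at small nonzero x; at x = 0, where it says nothing, oddness gives
  f t 0 = 0.\<close>

lemma nemytskii_small:
  fixes f :: "real \<Rightarrow> real ^ 'k \<Rightarrow> real ^ 'k"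
  assumes f: "continuous_on UNIV (\<lambda>(t, x). f t x)" "\<And>t x. f (t + 2 * pi) x = f t x"
    and odd: "\<And>t x. f t (- x) = - f t x"
    and lim: "uniform_limit UNIV (\<lambda>x t. f t x /\<^sub>R norm x) (\<lambda>t. 0) (at 0)"
    and \<epsilon>: "\<epsilon> > 0"
  shows "\<exists>\<delta>>0. \<forall>v\<in>bc_periodic per. norm v \<le> \<delta> \<longrightarrow> norm (nemytskii f v) \<le> \<epsilon> * norm v"
proof -
  have "\<forall>\<^sub>F x in at 0. \<forall>t\<in>UNIV. dist (f t x /\<^sub>R norm x) 0 < \<epsilon>"
    using lim \<epsilon> unfolding uniform_limit_iff by blast
  then obtain d where d: "d > 0" "\<And>x t. x \<noteq> 0 \<Longrightarrow> norm x < d \<Longrightarrow> norm (f t x /\<^sub>R norm x) < \<epsilon>"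
    unfolding eventually_at by auto
  have f0: "f t 0 = 0" for t using odd[of t 0] by (simp add: eq_neg_iff_add_eq_0 flip: scaleR_2)
  have le: "norm (f t x) \<le> \<epsilon> * norm x" if "norm x < d" for t x
    using d(2)[OF _ that, of t] by (cases "x = 0") (auto simp: f0 field_simps)
  show ?thesis
  proof (intro exI[of _ "d / 2"] conjI ballI impI)
    fix v :: "real \<Rightarrow>\<^sub>C (real ^ 'k)" assume v: "v \<in> bc_periodic per" "norm v \<le> d / 2"
    have "norm (nemytskii f v t) \<le> \<epsilon> * norm v" for t
    proof -
      have n: "norm (v t) \<le> norm v" by (rule norm_bounded)
      then have "norm (f t (v t)) \<le> \<epsilon> * norm (v t)" using v(2) d(1) by (intro le) simp
      also have "\<dots> \<le> \<epsilon> * norm v" using n \<epsilon> by simp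
      finally show ?thesis by (simp add: nemytskii_apply(1)[OF f v(1)])
    qed
    then show "norm (nemytskii f v) \<le> \<epsilon> * norm v" by (rule norm_bound)
  qed (use d in simp)
qed

text \<open>An even continuous solution of the integral equation with small sup-norm is C^2 by
  regularity, with C^2 norm at most a constant times its sup-norm, so it lies in the prescribed
  neighbourhood.\<close>

lemma bifurcation_point_odd:
  fixes f :: "real \<Rightarrow> real ^ 'k \<Rightarrow> real ^ 'k"
  assumes f: "continuous_on UNIV (\<lambda>(t, x). f t x)" "\<And>t x. f (t + 2 * pi) x = f t x"
    and even: "\<And>t x. f (- t) x = f t x" and odd: "\<And>t x. f t (- x) = - f t x"
    and lim: "uniform_limit UNIV (\<lambda>x t. f t x /\<^sub>R norm x) (\<lambda>t. 0) (at 0)"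
    and \<mu>\<^sub>0: "\<mu>\<^sub>0 \<in> real_spectrum A" "odd (alg_mult A \<mu>\<^sub>0)"
    and distinct: "\<And>j j' \<mu> \<mu>'. \<mu> \<in> real_spectrum A \<Longrightarrow> \<mu>' \<in> real_spectrum A \<Longrightarrow> (j, \<mu>) \<noteq> (j', \<mu>')
           \<Longrightarrow> alpha_pt m j \<mu> \<noteq> alpha_pt m j' \<mu>'"
  shows "bifurcation_point m A f (alpha_pt m j\<^sub>0 \<mu>\<^sub>0)"
proof -
  define \<alpha>\<^sub>0 where "\<alpha>\<^sub>0 = alpha_pt m j\<^sub>0 \<mu>\<^sub>0"
  let ?X = "bc_even per :: (real \<Rightarrow>\<^sub>C (real ^ 'k)) set"
  note X = nice_bc_even
  have \<alpha>\<^sub>0': "\<alpha>\<^sub>0 = (freq per j\<^sub>0)\<^sup>2 + \<mu>\<^sub>0" by (simp add: \<alpha>\<^sub>0_def freq_sqr[OF m] period_def)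
  have "\<exists>\<alpha> u. (\<alpha>, u) \<in> U \<and> u \<noteq> 0 \<and> is_solution m A f \<alpha> u"
    if U: "open U" "(\<alpha>\<^sub>0, 0) \<in> U" for U :: "(real \<times> (real ^ 'k) c2b) set"
  proof -
    from open_prod_elim[OF U] obtain U1 U2 where U12: "open U1" "open U2" "(\<alpha>\<^sub>0, 0) \<in> U1 \<times> U2" "U1 \<times> U2 \<subseteq> U" .
    have U12_0: "\<alpha>\<^sub>0 \<in> U1" "0 \<in> U2" using U12(3) by simp_all
    from openE[OF U12(1) U12_0(1)] obtain e where e: "e > 0" "ball \<alpha>\<^sub>0 e \<subseteq> U1" .
    from openE[OF U12(2) U12_0(2)] obtain r where r: "r > 0" "ball 0 r \<subseteq> U2" .
    obtain \<epsilon> where \<epsilon>: "\<epsilon> > 0" "\<epsilon> < e" and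
      iso: "\<And>j \<mu>. \<mu> \<in> real_spectrum A \<Longrightarrow> (j, \<mu>) \<noteq> (j\<^sub>0, \<mu>\<^sub>0) \<Longrightarrow> \<bar>alpha_pt m j \<mu> - \<alpha>\<^sub>0\<bar> > \<epsilon>"
      using isolated_alpha[OF m finite_real_spectrum[OF A] e(1), of j\<^sub>0 \<mu>\<^sub>0] distinct \<mu>\<^sub>0(1) unfolding \<alpha>\<^sub>0_def by metis
    define a b where "a = \<alpha>\<^sub>0 - \<epsilon>" and "b = \<alpha>\<^sub>0 + \<epsilon>"
    have iso': "\<bar>(freq per j)\<^sup>2 + \<mu> - \<alpha>\<^sub>0\<bar> > \<epsilon>" if "\<mu> \<in> real_spectrum A" "(j, \<mu>) \<noteq> (j\<^sub>0, \<mu>\<^sub>0)" for j \<mu>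
      using iso[OF that] by (simp add: freq_sqr[OF m] period_def)
    have nc: "\<alpha> - (freq per j)\<^sup>2 \<notin> real_spectrum A" if "\<alpha> \<in> {a, b}" for \<alpha> j
    proof
      assume s: "\<alpha> - (freq per j)\<^sup>2 \<in> real_spectrum A"
      have "(j, \<alpha> - (freq per j)\<^sup>2) \<noteq> (j\<^sub>0, \<mu>\<^sub>0)" using that \<epsilon>(1) \<alpha>\<^sub>0' by (auto simp: a_def b_def)
      from iso'[OF s this] show False using that \<epsilon>(1) by (auto simp: a_def b_def)
    qed
    have inj: "x = 0" if "x \<in> ?X" "F.T \<alpha> x = 0" "\<alpha> \<in> {a, b}" for x \<alpha>
      by (rule F.T_inj_noncritical[OF nc[OF that(3)] F.niceD(5)[OF X that(1)] that(2)])
    obtain N where N: "\<And>N' \<alpha>. N' \<ge> N \<Longrightarrow> \<bar>\<alpha>\<bar> \<le> max \<bar>a\<bar> \<bar>b\<bar> \<Longrightarrow> F.tail N' \<alpha>"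
      using F.tail_exists[of "max \<bar>a\<bar> \<bar>b\<bar>"] by blast
    define N' where "N' = max N j\<^sub>0"
    have tail: "F.tail N' a" "F.tail N' b" by (rule N; simp add: N'_def)+
    have w: "(\<lambda>t. cos (freq per j\<^sub>0 * t)) = mode (freq per j\<^sub>0) (1::real) 0" "cos (freq per j\<^sub>0 * 0) \<noteq> 0"
      by (simp_all add: mode_def fun_eq_iff)
    note flip = F.T_flip_at_odd[OF X P_bc_even w \<alpha>\<^sub>0' \<mu>\<^sub>0(2) \<epsilon>(1) iso', of N', folded a_def b_def]
    have "brouwer_ball_degree (F.Q N' ` ?X) (F.T a) = - brouwer_ball_degree (F.Q N' ` ?X) (F.T b)"
      "\<bar>brouwer_ball_degree (F.Q N' ` ?X) (F.T b)\<bar> = 1"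
      by (rule flip; simp add: N'_def)+
    then have deg: "brouwer_ball_degree (F.Q N' ` ?X) (F.T a) \<noteq> brouwer_ball_degree (F.Q N' ` ?X) (F.T b)" by linarith
    note small = nemytskii_small[OF f odd lim]
    obtain \<delta>1 where \<delta>1: "\<delta>1 > 0" "\<And>v. v \<in> bc_periodic per \<Longrightarrow> norm v \<le> \<delta>1 \<Longrightarrow> norm (nemytskii f v) \<le> norm v"
      using small[of 1] by auto
    obtain C where C: "C > 0" "\<And>h. h \<in> bc_periodic per \<Longrightarrow>
        \<exists>u\<in>per_space m. apply_c2b u = conv per (green per) (apply_bcontfun h) \<and>
        (\<forall>t. c2_d2 u t = conv per (green per) (apply_bcontfun h) t + apply_bcontfun h t) \<and>
        norm (u :: (real ^ 'k) c2b) \<le> C * norm h"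
      using regularity by blast
    \<comment> \<open>The bracket bounds h = B v + f(t, v) by v: of the 2, one unit comes from the
      shift \<alpha> + 1 in \<open>B\<close> and one from the nonlinear term, at most norm v here.
      \<open>C\<close> is the regularity constant.\<close>
    define M where "M = C * (onorm A + max \<bar>a\<bar> \<bar>b\<bar> + 2)"
    have "onorm A \<ge> 0" using A by (intro onorm_pos_le linear_conv_bounded_linear[THEN iffD1])
    then have M: "M > 0" using C(1) by (auto simp: M_def)
    \<comment> \<open>The factor 2 in the denominator leaves the strict inequality norm u <
      r.\<close>
    define \<delta> where "\<delta> = min \<delta>1 (r / (2 * M))"
    have \<delta>: "\<delta> > 0" using \<delta>1 M r(1) by (simp add: \<delta>_def)
    have maps: "nemytskii f v \<in> ?X" if "v \<in> ?X" for v
    proof -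
      have "v \<in> bc_periodic per" "\<And>t. apply_bcontfun v (- t) = apply_bcontfun v t"
        using that by (simp_all add: bc_even_def)
      then show ?thesis by (simp add: bc_even_def nemytskii_apply[OF f] even)
    qed
    have cont: "continuous_on ?X (nemytskii f)"
      by (rule continuous_on_subset[OF continuous_on_nemytskii[OF f] F.niceD(2)[OF X]])
    have smallX: "\<exists>\<delta>>0. \<forall>v\<in>?X. norm v \<le> \<delta> \<longrightarrow> norm (nemytskii f v) \<le> \<epsilon> * norm v" if "\<epsilon> > 0" for \<epsilon>
      using small[OF that] F.niceD(5)[OF X] by blast
    have ab: "a \<le> b" using \<epsilon>(1) by (simp add: a_def b_def)
    obtain \<alpha> v where \<alpha>: "\<alpha> \<in> {a..b}" and v: "v \<in> ?X" "v \<noteq> 0" "norm v \<le> \<delta>" "F.T \<alpha> v = F.G (nemytskii f v)"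
      by (rule F.bifurcation_solutions[OF complete_bc_periodic X closed_bc_even ab maps cont smallX inj(1)[OF _ _ insertI1]
            inj(1)[OF _ _ insertI2[OF singletonI]] tail deg \<delta>])
    have vS: "v \<in> bc_periodic per" by (rule F.niceD(5)[OF X v(1)])
    define h where "h = F.B \<alpha> v + nemytskii f v"
    have hS: "h \<in> bc_periodic per"
      unfolding h_def by (intro subspace_add F.subspace_S F.B_S vS nemytskii_apply(2)[OF f])
    have "v = F.G (F.B \<alpha> v) + F.G (nemytskii f v)" using v(4) by (simp add: F.T_def algebra_simps)
    then have v_eq: "v = F.G h" unfolding h_def linear_add[OF F.lin_G] .
    have cv: "conv per (green per) (apply_bcontfun h) = apply_bcontfun v"
      by (subst v_eq) (simp only: F.G_def F.ev_cv[OF continuous_on_green(1)])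
    obtain u where u: "u \<in> per_space m" "apply_c2b u = apply_bcontfun v"
      "\<And>t. c2_d2 u t = apply_bcontfun v t + apply_bcontfun h t" "norm u \<le> C * norm h"
      using C(2)[OF hS] unfolding cv by blast
    have ht: "apply_bcontfun h t = A (v t) - (\<alpha> + 1) *\<^sub>R v t + f t (v t)" for t
      by (simp add: h_def F.ev_B nemytskii_apply(1)[OF f vS])
    \<comment> \<open>Here u'' = v + h, and the v cancels against the summand 1 in \<alpha> +
      1.\<close>
    have sol: "is_solution m A f \<alpha> u"
      using u(1) by (simp add: is_solution_def u(2,3) ht algebra_simps)
    have u0: "u \<noteq> 0"
    proof
      assume "u = 0"
      then have "apply_bcontfun v t = 0" for t by (simp add: u(2)[symmetric] zero_c2b.rep_eq)
      then have "v = 0" by (intro bcontfun_eqI) simp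
      then show False using v(2) by simp
    qed
    have "norm (F.B \<alpha> v) \<le> (onorm A + max \<bar>a\<bar> \<bar>b\<bar> + 1) * norm v"
      by (rule F.norm_B_le) (use \<alpha> in auto)
    moreover have "norm (nemytskii f v) \<le> norm v" using \<delta>1(2)[OF vS] v(3) by (simp add: \<delta>_def)
    ultimately have "norm h \<le> (onorm A + max \<bar>a\<bar> \<bar>b\<bar> + 2) * norm v"
      using norm_triangle_ineq[of "F.B \<alpha> v" "nemytskii f v"] by (simp add: h_def algebra_simps)
    then have "C * norm h \<le> M * norm v" using C(1) by (simp add: M_def mult.assoc)
    also have "\<dots> \<le> M * (r / (2 * M))" using v(3) M by (intro mult_left_mono) (auto simp: \<delta>_def)
    also have "\<dots> < r" using M r(1) by simp
    finally have "norm u < r" using u(4) by simp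
    then have "u \<in> U2" using r(2) by (simp add: subset_iff)
    moreover have "\<alpha> \<in> U1" using \<alpha> \<epsilon>(2) by (intro subsetD[OF e(2)]) (auto simp: a_def b_def dist_real_def)
    ultimately show ?thesis using U12(4) sol u0 by (meson SigmaI subsetD)
  qed
  then show ?thesis unfolding bifurcation_point_def \<alpha>\<^sub>0_def by blast
qed

end

theorem theorem3p1:
  fixes m :: nat and A :: "real ^ 'k \<Rightarrow> real ^ 'k"
    and f :: "real \<Rightarrow> real ^ 'k \<Rightarrow> real ^ 'k"
    and j\<^sub>0 :: nat and \<mu>\<^sub>0 :: real
  assumes "m \<ge> 3"
    and "linear A" and "bij A"
    and "continuous_on UNIV (\<lambda>(t, x). f t x)"
    and "\<And>t x. f (t + 2 * pi) x = f t x"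
    and "\<And>t x. f (- t) x = f t x"
    and "\<And>t x. f t (- x) = - f t x"
    and "uniform_limit UNIV (\<lambda>x t. f t x /\<^sub>R norm x) (\<lambda>t. 0) (at 0)"
    and "\<And>j j' \<mu> \<mu>'. \<mu> \<in> real_spectrum A \<Longrightarrow> \<mu>' \<in> real_spectrum A \<Longrightarrow> (j, \<mu>) \<noteq> (j', \<mu>')
           \<Longrightarrow> alpha_pt m j \<mu> \<noteq> alpha_pt m j' \<mu>'"
    and "\<mu>\<^sub>0 \<in> real_spectrum A" and "odd (alg_mult A \<mu>\<^sub>0)"
  shows "bif_invariant m A (alpha_pt m j\<^sub>0 \<mu>\<^sub>0) \<noteq> 0 \<and>
         bifurcation_point m A f (alpha_pt m j\<^sub>0 \<mu>\<^sub>0)"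
proof -
  interpret linear_bvp m A using assms(1,2) by (simp add: linear_bvp_def)
  show ?thesis
    using bif_invariant_neq_0[OF assms(10,11,9)] bifurcation_point_odd[OF assms(4-8,10,11,9)] by blast
qed

end
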